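(* Let $q\in\mathcal W^{2,\infty}([-1,1])$. Let $\eta_1=\frac{m_1}{m_2}\bar\eta$ and assume $n\gtrsim \|\mathbb K f^*\|_{L^2(\nu)}^{-2}\iota^{2\ell+2\alpha_\sigma+1}$, $m_1\gtrsim \|\mathbb K f^*\|_{L^2(\nu)}^{-2}\iota$, $m_2\gtrsim \|\mathbb K f^*\|_{L^2(\nu)}^{-2}\iota^{2\alpha_\sigma+1}$. Then there exist a choice $\bar\eta=\Theta(\iota^{-\chi}\|\mathbb K f^*\|_{L^2(\nu)}^{-1})$, a number of steps $T=\mathrm{poly}(d,n,m_1,m_2,\|q\|_{2,\infty})$, and choices of $\lambda,\eta_2$ such that with high probability the output $\hat\theta$ of the layer-wise training algorithm satisfies $$\mathbb E_{x\sim\nu}\big[(f(x;\hat\theta)-f^*(x))^2\big]\lesssim \|q\|_{1,\infty}^2\|\mathbb K f^*\|_{L^2}^{-2}\Big(\frac{\iota^{2\ell+2\alpha_\sigma+2\chi+1}}{n}+\frac{\iota^{2\alpha_\sigma+2\chi+1}}{m_2}+\frac{\iota}{m_1}\Big)+\big\|q\circ(\bar\eta\,\mathbb K f^* )-f^*\big\|_{L^2(\nu)}^2+\frac{\|q\|_{2,\infty}^2\iota}{m_1}+\sqrt{\frac{\|q\|_{2,\infty}^4\iota+\iota^{4\ell+1}}{n}}.$$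
   Context: Setting: $\mathcal X_d\subset\mathbb R^d$ is a covariate space with distribution $\nu$, and $f^*:\mathcal X_d\to\mathbb R$ is a target with $\mathbb E_{x\sim\nu}[f^*(x)^2]\le 1$. Two independent datasets $\mathcal D_1,\mathcal D_2$ each consist of $n$ i.i.d. samples from $\nu$. Assumptions: (i) $\mathbb E_\nu[x]=0$ and $\nu$ is $C_\gamma$-subGaussian, i.e. $\mathbb E[\exp(\lambda x\cdot v)]\le\exp(C_\gamma^2\lambda^2)$ for all unit $v$ and $\lambda\in\mathbb R$; (ii) $\mathbb E_\nu[|f^*(x)|^q]^{1/q}\le C_f q^\ell$ for all $q\ge1$; (iii) $\sigma_1(z)=\max(z,0)$ and $|\sigma_2(z)|\le C_\sigma(1+|z|)^{\alpha_\sigma}$; (iv) with $\tau$ the uniform measure on the unit sphere $\mathcal S^{d-1}(1)$, the kernel $K(x,x')=\mathbb E_{v\sim\tau}[\sigma_2(x\cdot v)\sigma_2(x'\cdot v)]$ and operator $(\mathbb K f)(x)=\mathbb E_{x'\sim\nu}[K(x,x')f(x')]$ satisfy $\|\mathbb K f^*\|_{L^q(\nu)}\le C_K q^\chi\|\mathbb K f^*\|_{L^2(\nu)}$ for all $1\le q\le d$. Network: $f(x;\theta)=\frac1{m_1}a^T\sigma_1(W\sigma_2(Vx)+b)$ with $\theta=(a,W,b,V)$, $a,b\in\mathbb R^{m_1}$, $W\in\mathbb R^{m_1\times m_2}$, $V\in\mathbb R^{m_2\times d}$. Initialization $\theta^{(0)}$: $a_i^{(0)}$ i.i.d. uniform on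 $\{\pm1\}$, $W^{(0)}=0$, $b_i^{(0)}$ i.i.d. $N(0,1)$, rows of $V^{(0)}$ i.i.d. $\sim\tau$. Losses $L_i(\theta)=\frac1n\sum_{x\in\mathcal D_i}(f(x;\theta)-f^*(x))^2$. Algorithm: $W^{(1)}=W^{(0)}-\eta_1\nabla_W L_1(\theta^{(0)})$, $a^{(1)}=a^{(0)}$; then for $t=2,\dots,T$, $a^{(t)}=a^{(t-1)}-\eta_2[\nabla_a L_2(\theta^{(t-1)})+\lambda a^{(t-1)}]$ with $\theta^{(t)}=(a^{(t)},W^{(1)},b^{(0)},V^{(0)})$; output $\hat\theta=\theta^{(T)}$. Sobolev norms: for twice continuously differentiable $q:[-1,1]\to\mathbb R$, $\|q\|_{k,\infty}=\max_{s\le k}\max_{x\in[-1,1]}|q^{(s)}(x)|$. Conventions: $\iota=C\log(dnm_1m_2)$ for a fixed sufficiently large constant $C$ (and $\iota\le C^{-1}d$); an event holds "with high probability" if it has probability at least $1-\mathrm{poly}(d,n,m_1,m_2)e^{-\iota}$ over initialization and data; $\lesssim,\Theta$ hide constants depending only on $C_\gamma,C_f,\ell,C_\sigma,\alpha_\sigma,C_K,\chi$, not on $d,n,m_1,m_2$. *)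

theory Defs
  imports "HOL-Probability.Probability"
begin

text \<open>Vectors in R^d are represented as functions nat => real, of which only the
  coordinates k < d matter; measures on R^d live on the product space PiM {..<d}.\<close>

type_synonym vec = "nat \<Rightarrow> real"

text \<open>Parameters theta = (a, W, b, V): a, b : index i < m1; W i j : i < m1, j < m2;
  V j : the j-th row of V (a vector in R^d), j < m2.\<close>
type_synonym params = "vec \<times> (nat \<Rightarrow> vec) \<times> vec \<times> (nat \<Rightarrow> vec)"

definition dotp :: "nat \<Rightarrow> vec \<Rightarrow> vec \<Rightarrow> real" where
  "dotp d u x = (\<Sum>k<d. u k * x k)"

definition Rd :: "nat \<Rightarrow> vec measure" where
  "Rd d = (\<Pi>\<^sub>M k\<in>{..<d}. borel)"

definition Rd_leb :: "nat \<Rightarrow> vec measure" where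
  "Rd_leb d = (\<Pi>\<^sub>M k\<in>{..<d}. lborel)"

definition unit_ball :: "nat \<Rightarrow> vec set" where
  "unit_ball d = {x \<in> space (Rd_leb d). dotp d x x \<le> 1}"

text \<open>Uniform (normalized surface) measure tau on the unit sphere S^{d-1}(1):
  radial projection of the uniform distribution on the unit ball (cone measure).\<close>
definition sphere_unif :: "nat \<Rightarrow> vec measure" where
  "sphere_unif d = distr (uniform_measure (Rd_leb d) (unit_ball d)) (Rd d)
      (\<lambda>x. \<lambda>k\<in>{..<d}. x k / sqrt (dotp d x x))"

definition std_normal :: "real measure" where
  "std_normal = density lborel std_normal_density"

definition rademacher :: "real measure" where
  "rademacher = measure_pmf (pmf_of_set {-1, 1})"

definition relu :: "real \<Rightarrow> real" where
  "relu z = max z 0"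

definition relu_deriv :: "real \<Rightarrow> real" where
  "relu_deriv z = (if z > 0 then 1 else 0)"

definition preact :: "nat \<Rightarrow> nat \<Rightarrow> (real \<Rightarrow> real) \<Rightarrow> params \<Rightarrow> nat \<Rightarrow> vec \<Rightarrow> real" where
  "preact d m2 \<sigma>2 \<theta> i x = (case \<theta> of (a, W, b, V) \<Rightarrow>
      (\<Sum>j<m2. W i j * \<sigma>2 (dotp d (V j) x)) + b i)"

definition net :: "nat \<Rightarrow> nat \<Rightarrow> nat \<Rightarrow> (real \<Rightarrow> real) \<Rightarrow> params \<Rightarrow> vec \<Rightarrow> real" where
  "net d m1 m2 \<sigma>2 \<theta> x = (case \<theta> of (a, W, b, V) \<Rightarrow>
      (1 / real m1) * (\<Sum>i<m1. a i * relu (preact d m2 \<sigma>2 \<theta> i x)))"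

definition emp_loss :: "nat \<Rightarrow> nat \<Rightarrow> nat \<Rightarrow> nat \<Rightarrow> (real \<Rightarrow> real) \<Rightarrow> (vec \<Rightarrow> real)
      \<Rightarrow> (nat \<Rightarrow> vec) \<Rightarrow> params \<Rightarrow> real" where
  "emp_loss d n m1 m2 \<sigma>2 fs X \<theta> = (1 / real n) * (\<Sum>k<n. (net d m1 m2 \<sigma>2 \<theta> (X k) - fs (X k))^2)"

text \<open>Partial derivative of emp_loss with respect to W i j (chain rule, relu'(0) = 0).\<close>
definition grad_W :: "nat \<Rightarrow> nat \<Rightarrow> nat \<Rightarrow> nat \<Rightarrow> (real \<Rightarrow> real) \<Rightarrow> (vec \<Rightarrow> real)
      \<Rightarrow> (nat \<Rightarrow> vec) \<Rightarrow> params \<Rightarrow> nat \<Rightarrow> nat \<Rightarrow> real" where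
  "grad_W d n m1 m2 \<sigma>2 fs X \<theta> i j = (case \<theta> of (a, W, b, V) \<Rightarrow>
     (1 / real n) * (\<Sum>k<n. 2 * (net d m1 m2 \<sigma>2 \<theta> (X k) - fs (X k)) * (1 / real m1) * a i
        * relu_deriv (preact d m2 \<sigma>2 \<theta> i (X k)) * \<sigma>2 (dotp d (V j) (X k))))"

definition grad_a :: "nat \<Rightarrow> nat \<Rightarrow> nat \<Rightarrow> nat \<Rightarrow> (real \<Rightarrow> real) \<Rightarrow> (vec \<Rightarrow> real)
      \<Rightarrow> (nat \<Rightarrow> vec) \<Rightarrow> params \<Rightarrow> nat \<Rightarrow> real" where
  "grad_a d n m1 m2 \<sigma>2 fs X \<theta> i =
     (1 / real n) * (\<Sum>k<n. 2 * (net d m1 m2 \<sigma>2 \<theta> (X k) - fs (X k)) * (1 / real m1)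
        * relu (preact d m2 \<sigma>2 \<theta> i (X k)))"

definition layerwise_train :: "nat \<Rightarrow> nat \<Rightarrow> nat \<Rightarrow> nat \<Rightarrow> (real \<Rightarrow> real) \<Rightarrow> (vec \<Rightarrow> real)
      \<Rightarrow> real \<Rightarrow> real \<Rightarrow> real \<Rightarrow> nat \<Rightarrow> vec \<Rightarrow> vec \<Rightarrow> (nat \<Rightarrow> vec)
      \<Rightarrow> (nat \<Rightarrow> vec) \<Rightarrow> (nat \<Rightarrow> vec) \<Rightarrow> params" where
  "layerwise_train d n m1 m2 \<sigma>2 fs \<eta>1 \<eta>2 lam T a0 b0 V0 X1 X2 =
     (let \<theta>0 = (a0, (\<lambda>i j. 0), b0, V0);
          W1 = (\<lambda>i j. 0 - \<eta>1 * grad_W d n m1 m2 \<sigma>2 fs X1 \<theta>0 i j);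
          step = (\<lambda>a. \<lambda>i. a i - \<eta>2 * (grad_a d n m1 m2 \<sigma>2 fs X2 (a, W1, b0, V0) i + lam * a i));
          aT = (step ^^ (T - 1)) a0
      in (aT, W1, b0, V0))"

text \<open>Joint law of the initialization (a(0), b(0), V(0)) and the datasets (D1, D2).\<close>
definition init_data_measure :: "nat \<Rightarrow> nat \<Rightarrow> nat \<Rightarrow> nat \<Rightarrow> vec measure
      \<Rightarrow> (vec \<times> vec \<times> (nat \<Rightarrow> vec) \<times> (nat \<Rightarrow> vec) \<times> (nat \<Rightarrow> vec)) measure" where
  "init_data_measure d n m1 m2 \<nu> =
     (\<Pi>\<^sub>M i\<in>{..<m1}. rademacher) \<Otimes>\<^sub>M ((\<Pi>\<^sub>M i\<in>{..<m1}. std_normal) \<Otimes>\<^sub>M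
     ((\<Pi>\<^sub>M j\<in>{..<m2}. sphere_unif d) \<Otimes>\<^sub>M ((\<Pi>\<^sub>M k\<in>{..<n}. \<nu>) \<Otimes>\<^sub>M (\<Pi>\<^sub>M k\<in>{..<n}. \<nu>))))"

definition kernel :: "nat \<Rightarrow> (real \<Rightarrow> real) \<Rightarrow> vec \<Rightarrow> vec \<Rightarrow> real" where
  "kernel d \<sigma>2 x x' = (\<integral>v. \<sigma>2 (dotp d x v) * \<sigma>2 (dotp d x' v) \<partial>sphere_unif d)"

definition Kop :: "nat \<Rightarrow> (real \<Rightarrow> real) \<Rightarrow> vec measure \<Rightarrow> (vec \<Rightarrow> real) \<Rightarrow> vec \<Rightarrow> real" where
  "Kop d \<sigma>2 \<nu> f x = (\<integral>x'. kernel d \<sigma>2 x x' * f x' \<partial>\<nu>)"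

definition Lnorm :: "vec measure \<Rightarrow> real \<Rightarrow> (vec \<Rightarrow> real) \<Rightarrow> real" where
  "Lnorm M p g = (\<integral>x. \<bar>g x\<bar> powr p \<partial>M) powr (1 / p)"

primrec dq :: "(real \<Rightarrow> real) \<Rightarrow> nat \<Rightarrow> real \<Rightarrow> real" where
  "dq q 0 = q"
| "dq q (Suc s) = (\<lambda>x. vector_derivative (dq q s) (at x within {-1..1}))"

definition C2_interval :: "(real \<Rightarrow> real) \<Rightarrow> bool" where
  "C2_interval q = ((\<forall>x\<in>{-1..1}.
       (q has_vector_derivative dq q 1 x) (at x within {-1..1}) \<and>
       (dq q 1 has_vector_derivative dq q 2 x) (at x within {-1..1}))
     \<and> continuous_on {-1..1} (dq q 2))"

definition sob_norm :: "(real \<Rightarrow> real) \<Rightarrow> nat \<Rightarrow> real" where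
  "sob_norm q k = Max ((\<lambda>s. SUP x\<in>{-1..1}. \<bar>dq q s x\<bar>) ` {0..k})"

definition centered_subgaussian :: "nat \<Rightarrow> vec measure \<Rightarrow> real \<Rightarrow> bool" where
  "centered_subgaussian d \<nu> C\<gamma> =
     ((\<forall>k<d. (\<integral>x. x k \<partial>\<nu>) = 0) \<and>
      (\<forall>v t. dotp d v v = 1 \<longrightarrow>
         (\<integral>\<^sup>+x. ennreal (exp (t * dotp d x v)) \<partial>\<nu>) \<le> ennreal (exp (C\<gamma>^2 * t^2))))"

definition moment_bound :: "vec measure \<Rightarrow> (vec \<Rightarrow> real) \<Rightarrow> real \<Rightarrow> real \<Rightarrow> bool" where
  "moment_bound \<nu> fs Cf ell = (\<forall>r\<ge>1.
     (\<integral>\<^sup>+x. ennreal (\<bar>fs x\<bar> powr r) \<partial>\<nu>) \<le> ennreal ((Cf * r powr ell) powr r))"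

definition iota :: "real \<Rightarrow> nat \<Rightarrow> nat \<Rightarrow> nat \<Rightarrow> nat \<Rightarrow> real" where
  "iota C d n m1 m2 = C * ln (real (d * n * m1 * m2))"

end

theory Submission
  imports Defs
begin

text \<open>After one gradient step from \<open>W = 0\<close>, the \<open>i\<close>-th preactivation is \<open>2 a\<^sub>i z(x) + b\<^sub>i\<close> if
  \<open>b\<^sub>i > 0\<close> and \<open>b\<^sub>i\<close> otherwise, where \<open>z = \<eta> (g - f\<^sub>0 s)\<close>: here \<open>g\<close> and \<open>s\<close> are the empirical versions
  of \<open>\<K> f\<^sup>*\<close> and \<open>\<K> 1\<close>, and \<open>f\<^sub>0 = O((\<iota>/m\<^sub>1)\<^sup>1\<^sup>/\<^sup>2)\<close> is the constant output of the initial network.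
  Truncation, Bernstein's inequality and Markov's inequality on the product space give \<open>g \<approx> \<K> f\<^sup>*\<close> outside
  a set of \<open>\<nu>\<close>-measure \<open>O(e\<^sup>-\<^sup>1\<^sup>2\<^sup>\<iota>)\<close>, which replaces a bound uniform in \<open>x\<close>. A second
  order Taylor expansion writes \<open>q(y)\<close> for \<open>y \<in> [-1,1]\<close> as the expectation of \<open>w(a,b) relu(2 a y + b)\<close> with
  \<open>w = O(\<parallel>q\<parallel>\<^sub>2)\<close> supported in \<open>0 < b \<le> 3\<close>, the values in \<open>(2,3]\<close> producing the affine part; sampling it
  gives output weights \<open>a\<^sup>*\<close> whose network approximates \<open>q(\<eta> \<K> f\<^sup>*)\<close>. Training the output layer is ridge
  regression, so gradient descent does as well as \<open>a\<^sup>*\<close> up to \<open>O(1/T)\<close>. Since the squared loss is quadratic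
  in \<open>a\<close>, entrywise concentration of its coefficients bounds the generalization gap by \<open>O((\<iota>/n)\<^sup>1\<^sup>/\<^sup>2)\<close>
  times the squared norm of \<open>a\<close>, which the ridge penalty absorbs.\<close>

section \<open>Concentration inequalities\<close>

text \<open>Discarding a set of inputs is affordable only if fourth moments pay for it, and this
  fixes the exponents. Tails start at \<open>exp (- 32 * \<iota>)\<close>; passing from one fixed
  input to most inputs leaves 16; comparing the truncated with the true kernel operator splits 16
  into 12 for the measure of bad inputs and 4 for the error on the others. On bad inputs the fourth
  moment may be as large as \<open>exp (6 * \<iota>)\<close> up to constants, and Young's inequality
  still returns order \<open>exp (- 2 * \<iota>) \<le> 1 / n\<close>. Union bounds cost factors
  \<open>exp \<iota>\<close>. The powers of \<open>\<iota>\<close> in the rate come from the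
  truncation levels: \<open>\<sigma>2\<close> is cut at \<open>B\<close> of order
  \<open>\<iota> powr (\<alpha> / 2)\<close>, the target at \<open>F\<close> of order
  \<open>\<iota> powr ell\<close>. The sampling error carries \<open>F * B\<^sup>2\<close>, the
  average over random directions only \<open>B\<^sup>2\<close>, so \<open>ell\<close> is absent from
  the condition on \<open>m2\<close>. Whatever multiplies the norm of the output weights must be
  free of \<open>\<iota>\<close> apart from the rate itself; therefore fourth moments bounded by
  powers of \<open>K\<close> are carried along besides the sup bounds.\<close>

lemma exp_le_quadratic:
  fixes y :: real
  assumes "\<bar>y\<bar> \<le> 1"
  shows "exp y \<le> 1 + y + y\<^sup>2"
proof (cases "y \<ge> 0")
  case True
  then show ?thesis using exp_bound[of y] assms by auto
next
  case False
  define t where "t = - y"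
  have t: "0 \<le> t" using False by (simp add: t_def)
  have e: "1 + t + t\<^sup>2 / 2 \<le> exp t" using exp_lower_Taylor_quadratic[OF t] .
  \<comment> \<open>With \<open>y = - t\<close> the claim says that \<open>1 - t + t^2\<close> times
    \<open>exp t\<close> is at least 1. Already with the quadratic Taylor lower bound in place of
    \<open>exp t\<close> this product is 1 plus nonnegative terms.\<close>
  have id: "(1 - t + t\<^sup>2) * (1 + t + t\<^sup>2 / 2) = 1 + t\<^sup>2/2 + t^3/2 + t^4/2"
    by (simp add: field_simps power2_eq_square power3_eq_cube power4_eq_xxxx)
  have pos: "0 \<le> 1 - t + t\<^sup>2"
    using zero_le_power2[of "t - 1/2"] by (simp add: power2_eq_square algebra_simps)
  have "1 \<le> (1 - t + t\<^sup>2) * (1 + t + t\<^sup>2 / 2)" unfolding id using t by simp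
  also have "\<dots> \<le> (1 - t + t\<^sup>2) * exp t" using e pos by (rule mult_left_mono)
  finally have "exp (- t) \<le> 1 - t + t\<^sup>2" by (simp add: exp_minus field_simps)
  then show ?thesis by (simp add: t_def)
qed

text \<open>For small \<open>x\<close> the linear terms of the two quadratic bounds cancel;
  otherwise both exponentials are below \<open>exp (x\<^sup>2)\<close> since
  \<open>\<bar>x\<bar> \<le> x\<^sup>2\<close>. The exponent is not sharp, but the form fits the
  hypothesis of \<open>chernoff_two_sided\<close>.\<close>

lemma cosh_le_exp_square: "(exp x + exp (- x)) / 2 \<le> exp (x\<^sup>2)" for x :: real
proof (cases "\<bar>x\<bar> \<le> 1")
  case True
  have "(exp x + exp (- x)) / 2 \<le> 1 + x\<^sup>2"
    using exp_le_quadratic[of x] exp_le_quadratic[of "-x"] True by simp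
  also have "\<dots> \<le> exp (x\<^sup>2)" using exp_ge_add_one_self[of "x\<^sup>2"] by simp
  finally show ?thesis .
next
  case False
  have "\<bar>x\<bar> * 1 \<le> \<bar>x\<bar> * \<bar>x\<bar>" using False by (intro mult_left_mono) auto
  then have "\<bar>x\<bar> \<le> x\<^sup>2" by (simp add: power2_eq_square)
  then have "exp x \<le> exp (x\<^sup>2)" "exp (- x) \<le> exp (x\<^sup>2)"
    by (intro iffD2[OF exp_le_cancel_iff]; linarith)+
  moreover have "(a + b) / 2 \<le> c" if "a \<le> c" "b \<le> c" for a b c :: real using that by simp
  ultimately show ?thesis by blast
qed

context prob_space
begin

text \<open>For \<open>2 * b * \<bar>s\<bar> \<le> 1\<close> the centred exponent lies in
  \<open>[-1, 1]\<close>, so \<open>exp_le_quadratic\<close> applies; its linear term integrates to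
  zero and only the second moment survives. The bound thus depends on \<open>v\<close> and not on
  the range \<open>b\<close>.\<close>

lemma mgf_bound:
  assumes [measurable]: "f \<in> borel_measurable M"
    and bd: "\<And>x. x \<in> space M \<Longrightarrow> \<bar>f x\<bar> \<le> b"
    and v: "expectation (\<lambda>x. (f x)\<^sup>2) \<le> v"
    and s: "2 * b * \<bar>s\<bar> \<le> 1"
  shows "(\<integral>\<^sup>+x. ennreal (exp (s * (f x - expectation f))) \<partial>M) \<le> ennreal (exp (s\<^sup>2 * v))"
proof -
  define m where "m = expectation f"
  have b0: "0 \<le> b" using bd not_empty by (meson abs_ge_zero ex_in_conv order_trans)
  have int: "integrable M f"
    by (rule integrable_const_bound[where B=b]) (use bd in auto)
  have int2: "integrable M (\<lambda>x. (f x)\<^sup>2)"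
    by (rule integrable_const_bound[where B="b\<^sup>2"])
       (use bd in \<open>auto simp: abs_le_square_iff[symmetric] intro!: AE_I2 order_trans[OF bd]\<close>)
  have mb: "\<bar>m\<bar> \<le> b"
  proof -
    have "\<bar>m\<bar> \<le> expectation (\<lambda>x. \<bar>f x\<bar>)" unfolding m_def by (rule integral_abs_bound)
    also have "\<dots> \<le> expectation (\<lambda>x. b)"
      by (rule integral_mono) (use int bd in auto)
    finally show ?thesis by (simp add: prob_space)
  qed
  have y1: "\<bar>s * (f x - m)\<bar> \<le> 1" if "x \<in> space M" for x
  proof -
    have "\<bar>f x - m\<bar> \<le> 2 * b" using bd[OF that] mb by linarith
    then have "\<bar>s * (f x - m)\<bar> \<le> \<bar>s\<bar> * (2 * b)" unfolding abs_mult by (intro mult_left_mono) auto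
    then show ?thesis using s by (simp add: mult.commute mult.left_commute)
  qed
  have intq: "integrable M (\<lambda>x. 1 + s * (f x - m) + (s * (f x - m))\<^sup>2)"
    using int int2 by (auto simp: power_mult_distrib power2_diff intro!: Bochner_Integration.integrable_add
      Bochner_Integration.integrable_diff integrable_mult_right)
  have "(\<integral>\<^sup>+x. ennreal (exp (s * (f x - m))) \<partial>M) \<le> (\<integral>\<^sup>+x. ennreal (1 + s * (f x - m) + (s * (f x - m))\<^sup>2) \<partial>M)"
    by (intro nn_integral_mono ennreal_leI exp_le_quadratic y1)
  also have "\<dots> = ennreal (expectation (\<lambda>x. 1 + s * (f x - m) + (s * (f x - m))\<^sup>2))"
  proof (rule nn_integral_eq_integral[OF intq])
    show "AE x in M. 0 \<le> 1 + s * (f x - m) + (s * (f x - m))\<^sup>2"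
      using y1 by (intro AE_I2) (meson exp_le_quadratic exp_ge_zero order_trans)
  qed
  also have "expectation (\<lambda>x. 1 + s * (f x - m) + (s * (f x - m))\<^sup>2) = 1 + s\<^sup>2 * (expectation (\<lambda>x. (f x)\<^sup>2) - m\<^sup>2)"
  proof -
    have "expectation (\<lambda>x. 1 + s * (f x - m) + (s * (f x - m))\<^sup>2)
       = expectation (\<lambda>x. (1 - s * m + s\<^sup>2 * m\<^sup>2) + (s - 2 * s\<^sup>2 * m) * f x + s\<^sup>2 * (f x)\<^sup>2)"
      by (rule Bochner_Integration.integral_cong) (auto simp: power2_eq_square algebra_simps)
    also have "\<dots> = (1 - s * m + s\<^sup>2 * m\<^sup>2) + (s - 2 * s\<^sup>2 * m) * m + s\<^sup>2 * expectation (\<lambda>x. (f x)\<^sup>2)"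
      using int int2 by (simp add: prob_space m_def)
    finally show ?thesis by (simp add: power2_eq_square algebra_simps)
  qed
  also have "\<dots> \<le> 1 + s\<^sup>2 * v"
    using v by (intro add_left_mono mult_left_mono) (auto intro: order_trans[rotated])
  also have "\<dots> \<le> exp (s\<^sup>2 * v)" using exp_ge_add_one_self[of "s\<^sup>2 * v"] by simp
  finally show ?thesis by (simp add: m_def ennreal_leI)
qed

text \<open>Chernoff's method with the single choice \<open>sqrt (L / V)\<close> and its negative:
  the threshold contributes \<open>- 2 * L\<close> to the exponent and the moment generating
  function \<open>L\<close>. The hypothesis is asked for only at these values because the Bernstein
  bound is available only for small \<open>s\<close>.\<close>

lemma chernoff_two_sided:
  assumes [measurable]: "S \<in> borel_measurable M" and V: "V > 0" and L: "L > 0"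
    and mgf: "\<And>s. s\<^sup>2 * V = L \<Longrightarrow> (\<integral>\<^sup>+x. ennreal (exp (s * S x)) \<partial>M) \<le> ennreal (exp (s\<^sup>2 * V))"
  shows "emeasure M {x \<in> space M. 2 * sqrt (V * L) < \<bar>S x\<bar>} \<le> ennreal (2 * exp (- L))"
proof -
  define s where "s = sqrt (L / V)"
  have s2: "s\<^sup>2 * V = L" using V L by (simp add: s_def)
  have s0: "s > 0" using V L by (simp add: s_def)
  have st: "s * (2 * sqrt (V * L)) = 2 * L"
    using V L by (simp add: s_def real_sqrt_mult real_sqrt_divide)
  have one: "emeasure M {x \<in> space M. 2 * sqrt (V * L) \<le> \<sigma> * S x} \<le> ennreal (exp (- L))" if "\<sigma> = 1 \<or> \<sigma> = -1" for \<sigma> :: real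
  proof -
    have "(\<sigma> * s)\<^sup>2 * V = L" using that s2 by auto
    from mgf[OF this] have m: "(\<integral>\<^sup>+x. ennreal (exp (\<sigma> * s * S x)) \<partial>M) \<le> ennreal (exp L)"
      using \<open>(\<sigma> * s)\<^sup>2 * V = L\<close> by simp
    have "{x \<in> space M. 2 * sqrt (V * L) \<le> \<sigma> * S x} \<subseteq> {x \<in> space M. 1 \<le> ennreal (exp (- 2 * L)) * ennreal (exp (\<sigma> * s * S x))}"
    proof safe
      fix x assume "2 * sqrt (V * L) \<le> \<sigma> * S x"
      then have "s * (2 * sqrt (V * L)) \<le> s * (\<sigma> * S x)" using s0 by (intro mult_left_mono) auto
      then have "0 \<le> - 2 * L + \<sigma> * s * S x" unfolding st by (simp add: ac_simps)
      then have "1 \<le> exp (- 2 * L) * exp (\<sigma> * s * S x)" by (simp flip: exp_add)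
      then show "1 \<le> ennreal (exp (- 2 * L)) * ennreal (exp (\<sigma> * s * S x))"
        by (simp flip: ennreal_mult'' ennreal_1 del: ennreal_1)
    qed
    then have "emeasure M {x \<in> space M. 2 * sqrt (V * L) \<le> \<sigma> * S x} \<le> emeasure M {x \<in> space M. 1 \<le> ennreal (exp (- 2 * L)) * ennreal (exp (\<sigma> * s * S x))}"
      by (intro emeasure_mono) auto
    also have "\<dots> \<le> ennreal (exp (- 2 * L)) * (\<integral>\<^sup>+x. ennreal (exp (\<sigma> * s * S x)) * indicator (space M) x \<partial>M)"
      by (intro nn_integral_Markov_inequality) auto
    also have "\<dots> = ennreal (exp (- 2 * L)) * (\<integral>\<^sup>+x. ennreal (exp (\<sigma> * s * S x)) \<partial>M)"
      by (intro arg_cong2[where f=times] nn_integral_cong) auto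
    also have "\<dots> \<le> ennreal (exp (- 2 * L)) * ennreal (exp L)"
      using m by (intro mult_left_mono) auto
    also have "\<dots> = ennreal (exp (- L))" by (simp flip: ennreal_mult'' exp_add)
    finally show ?thesis .
  qed
  have "emeasure M {x \<in> space M. 2 * sqrt (V * L) < \<bar>S x\<bar>}
     \<le> emeasure M ({x \<in> space M. 2 * sqrt (V * L) \<le> 1 * S x} \<union> {x \<in> space M. 2 * sqrt (V * L) \<le> (-1) * S x})"
    by (intro emeasure_mono) auto
  also have "\<dots> \<le> emeasure M {x \<in> space M. 2 * sqrt (V * L) \<le> 1 * S x} + emeasure M {x \<in> space M. 2 * sqrt (V * L) \<le> (-1) * S x}"
    by (intro emeasure_subadditive) auto
  also have "\<dots> \<le> ennreal (exp (- L)) + ennreal (exp (- L))" by (intro add_mono one) auto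
  also have "\<dots> = ennreal (2 * exp (- L))" by (simp flip: ennreal_plus)
  finally show ?thesis .
qed

end

lemma nn_integral_PiM_prod_iid:
  assumes "prob_space M" "finite I" "g \<in> borel_measurable M"
  shows "(\<integral>\<^sup>+x. (\<Prod>i\<in>I. g (x i)) \<partial>Pi\<^sub>M I (\<lambda>_. M)) = (\<integral>\<^sup>+x. g x \<partial>M) ^ card I"
proof -
  interpret product_sigma_finite "\<lambda>_. M"
    using assms(1) by (simp add: product_sigma_finite_def prob_space_imp_sigma_finite)
  show ?thesis using product_nn_integral_prod[of I "\<lambda>_. g"] assms by simp
qed

lemma ennreal_exp_sum: "finite I \<Longrightarrow> ennreal (exp (\<Sum>i\<in>I. f i)) = (\<Prod>i\<in>I. ennreal (exp (f i)))"
  by (simp add: exp_sum prod_ennreal)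

text \<open>\<open>bL\<close> says exactly that the Chernoff parameter
  \<open>sqrt (L / (n * v))\<close> stays in the range of \<open>mgf_bound\<close>. The deviation is
  then governed by the second moment alone, while \<open>b\<close> enters only through the sample
  size.\<close>

lemma bernstein_iid:
  assumes M: "prob_space M" and [measurable]: "f \<in> borel_measurable M"
    and bd: "\<And>x. x \<in> space M \<Longrightarrow> \<bar>f x\<bar> \<le> b"
    and v: "(\<integral>x. (f x)\<^sup>2 \<partial>M) \<le> v" and v0: "v > 0" and L: "L > 0" and n: "n > 0"
    and bL: "4 * b\<^sup>2 * L \<le> real n * v"
  shows "emeasure (Pi\<^sub>M {..<n} (\<lambda>_. M))
      {X \<in> space (Pi\<^sub>M {..<n} (\<lambda>_. M)). 2 * sqrt (v * L / n) < \<bar>(\<Sum>k<n. f (X k)) / n - (\<integral>x. f x \<partial>M)\<bar>}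
     \<le> ennreal (2 * exp (- L))"
proof -
  interpret M: prob_space M by fact
  let ?P = "Pi\<^sub>M {..<n} (\<lambda>_. M)" and ?m = "\<integral>x. f x \<partial>M"
  interpret P: prob_space ?P by (intro prob_space_PiM M)
  have b0: "0 \<le> b" using bd M.not_empty by (meson abs_ge_zero ex_in_conv order_trans)
  let ?S = "\<lambda>X. \<Sum>k<n. f (X k) - ?m"
  have S: "?S \<in> borel_measurable ?P" by measurable
  have "emeasure ?P {X \<in> space ?P. 2 * sqrt (n * v * L) < \<bar>?S X\<bar>} \<le> ennreal (2 * exp (- L))"
  proof (rule P.chernoff_two_sided[OF S])
    show "0 < real n * v" "L > 0" using n v0 L by auto
    fix s :: real assume s: "s\<^sup>2 * (real n * v) = L"
    have "(2 * b * \<bar>s\<bar>)\<^sup>2 * (n * v) = 4 * b\<^sup>2 * (s\<^sup>2 * (n * v))" by (simp add: power_mult_distrib)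
    also have "\<dots> \<le> 1 * (n * v)" using bL s by simp
    finally have "(2 * b * \<bar>s\<bar>)\<^sup>2 \<le> 1" using n v0 by (simp add: mult_le_cancel_right)
    then have s1: "2 * b * \<bar>s\<bar> \<le> 1" by (metis abs_le_square_iff abs_of_nonneg abs_one one_power2 abs_ge_self order_trans)
    have "(\<integral>\<^sup>+X. ennreal (exp (s * ?S X)) \<partial>?P) = (\<integral>\<^sup>+X. (\<Prod>k<n. ennreal (exp (s * (f (X k) - ?m)))) \<partial>?P)"
      by (simp add: sum_distrib_left ennreal_exp_sum)
    also have "\<dots> = (\<integral>\<^sup>+x. ennreal (exp (s * (f x - ?m))) \<partial>M) ^ n"
      using nn_integral_PiM_prod_iid[OF M, of "{..<n}" "\<lambda>x. ennreal (exp (s * (f x - ?m)))"] by simp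
    also have "\<dots> \<le> ennreal (exp (s\<^sup>2 * v)) ^ n"
      by (intro power_mono M.mgf_bound[where b=b] bd v s1) auto
    also have "\<dots> = ennreal (exp (s\<^sup>2 * (n * v)))"
      by (simp add: ennreal_power exp_of_nat_mult[symmetric] ac_simps)
    finally show "(\<integral>\<^sup>+X. ennreal (exp (s * ?S X)) \<partial>?P) \<le> ennreal (exp (s\<^sup>2 * (n * v)))" .
  qed
  moreover have "2 * sqrt (v * L / n) < \<bar>(\<Sum>k<n. f (X k)) / n - ?m\<bar> \<longleftrightarrow> 2 * sqrt (n * v * L) < \<bar>?S X\<bar>" for X
  proof -
    have "sqrt (n * v * L) = n * sqrt (v * L / n)"
      using n by (simp add: real_sqrt_mult real_sqrt_divide real_div_sqrt field_simps)
    moreover have "\<bar>?S X\<bar> = n * \<bar>(\<Sum>k<n. f (X k)) / n - ?m\<bar>"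
    proof -
      have "?S X = n * ((\<Sum>k<n. f (X k)) / n - ?m)" using n by (simp add: sum_subtractf field_simps)
      then show ?thesis by (simp add: abs_mult)
    qed
    ultimately show ?thesis using n by (simp add: mult.left_commute)
  qed
  ultimately show ?thesis by simp
qed

text \<open>Variant for samples whose two components live in separate product spaces, as signs and
  biases do in \<open>init_data_measure\<close>. The exponential moment is factorized by integrating
  over the second components first.\<close>

lemma bernstein_iid_pair:
  assumes M: "prob_space M" and N: "prob_space N"
    and [measurable]: "f \<in> borel_measurable (M \<Otimes>\<^sub>M N)"
    and bd: "\<And>x. x \<in> space (M \<Otimes>\<^sub>M N) \<Longrightarrow> \<bar>f x\<bar> \<le> b"
    and v: "(\<integral>x. (f x)\<^sup>2 \<partial>(M \<Otimes>\<^sub>M N)) \<le> v" and v0: "v > 0" and L: "L > 0" and n: "n > 0"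
    and bL: "4 * b\<^sup>2 * L \<le> real n * v"
  shows "emeasure (Pi\<^sub>M {..<n} (\<lambda>_. M) \<Otimes>\<^sub>M Pi\<^sub>M {..<n} (\<lambda>_. N))
      {X \<in> space (Pi\<^sub>M {..<n} (\<lambda>_. M) \<Otimes>\<^sub>M Pi\<^sub>M {..<n} (\<lambda>_. N)).
        2 * sqrt (v * L / n) < \<bar>(\<Sum>k<n. f (fst X k, snd X k)) / n - (\<integral>x. f x \<partial>(M \<Otimes>\<^sub>M N))\<bar>}
     \<le> ennreal (2 * exp (- L))"
proof -
  interpret M: prob_space M by fact
  interpret N: prob_space N by fact
  interpret MN: pair_prob_space M N ..
  let ?PM = "Pi\<^sub>M {..<n} (\<lambda>_. M)" and ?PN = "Pi\<^sub>M {..<n} (\<lambda>_. N)" and ?m = "\<integral>x. f x \<partial>(M \<Otimes>\<^sub>M N)"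
  interpret PM: prob_space ?PM by (intro prob_space_PiM M)
  interpret PN: prob_space ?PN by (intro prob_space_PiM N)
  interpret P: pair_prob_space ?PM ?PN ..
  have b0: "0 \<le> b" using bd MN.not_empty by (meson abs_ge_zero ex_in_conv order_trans)
  let ?S = "\<lambda>X. \<Sum>k<n. f (fst X k, snd X k) - ?m"
  have [measurable]: "(\<lambda>X. f (fst X k, snd X k)) \<in> borel_measurable (?PM \<Otimes>\<^sub>M ?PN)" if "k < n" for k
  proof -
    have "(\<lambda>X. fst X k) \<in> measurable (?PM \<Otimes>\<^sub>M ?PN) M" "(\<lambda>X. snd X k) \<in> measurable (?PM \<Otimes>\<^sub>M ?PN) N"
      using that by (auto intro: measurable_compose[OF measurable_fst measurable_component_singleton]
        measurable_compose[OF measurable_snd measurable_component_singleton])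
    then show ?thesis by measurable
  qed
  have S: "?S \<in> borel_measurable (?PM \<Otimes>\<^sub>M ?PN)" by measurable
  have "emeasure (?PM \<Otimes>\<^sub>M ?PN) {X \<in> space (?PM \<Otimes>\<^sub>M ?PN). 2 * sqrt (n * v * L) < \<bar>?S X\<bar>} \<le> ennreal (2 * exp (- L))"
  proof (rule P.chernoff_two_sided[OF S])
    show "0 < real n * v" "L > 0" using n v0 L by auto
    fix s :: real assume s: "s\<^sup>2 * (real n * v) = L"
    have "(2 * b * \<bar>s\<bar>)\<^sup>2 * (n * v) = 4 * b\<^sup>2 * (s\<^sup>2 * (n * v))" by (simp add: power_mult_distrib)
    also have "\<dots> \<le> 1 * (n * v)" using bL s by simp
    finally have "(2 * b * \<bar>s\<bar>)\<^sup>2 \<le> 1" using n v0 by (simp add: mult_le_cancel_right)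
    then have s1: "2 * b * \<bar>s\<bar> \<le> 1" by (metis abs_le_square_iff abs_of_nonneg abs_one one_power2 abs_ge_self order_trans)
    let ?g = "\<lambda>x. ennreal (exp (s * (f x - ?m)))"
    have "(\<integral>\<^sup>+X. ennreal (exp (s * ?S X)) \<partial>(?PM \<Otimes>\<^sub>M ?PN)) = (\<integral>\<^sup>+X. (\<Prod>k<n. ?g (fst X k, snd X k)) \<partial>(?PM \<Otimes>\<^sub>M ?PN))"
      by (simp add: sum_distrib_left ennreal_exp_sum)
    also have "\<dots> = (\<integral>\<^sup>+x. \<integral>\<^sup>+y. (\<Prod>k<n. ?g (x k, y k)) \<partial>?PN \<partial>?PM)"
      by (subst PN.nn_integral_fst[symmetric]) auto
    also have "\<dots> = (\<integral>\<^sup>+x. (\<Prod>k<n. \<integral>\<^sup>+y. ?g (x k, y) \<partial>N) \<partial>?PM)"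
    proof (rule nn_integral_cong)
      fix x assume x: "x \<in> space ?PM"
      interpret product_sigma_finite "\<lambda>_. N" ..
      have [measurable]: "x k \<in> space M" if "k < n" for k using x that by (auto simp: space_PiM)
      show "(\<integral>\<^sup>+y. (\<Prod>k<n. ?g (x k, y k)) \<partial>?PN) = (\<Prod>k<n. \<integral>\<^sup>+y. ?g (x k, y) \<partial>N)"
        by (rule product_nn_integral_prod[of "{..<n}" "\<lambda>k y. ?g (x k, y)"]) auto
    qed
    also have "\<dots> = (\<integral>\<^sup>+x. \<integral>\<^sup>+y. ?g (x, y) \<partial>N \<partial>M) ^ n"
      using nn_integral_PiM_prod_iid[OF M, of "{..<n}" "\<lambda>x. \<integral>\<^sup>+y. ?g (x, y) \<partial>N"] by simp
    also have "(\<integral>\<^sup>+x. \<integral>\<^sup>+y. ?g (x, y) \<partial>N \<partial>M) = (\<integral>\<^sup>+x. ?g x \<partial>(M \<Otimes>\<^sub>M N))"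
      by (rule N.nn_integral_fst) auto
    also have "\<dots> ^ n \<le> ennreal (exp (s\<^sup>2 * v)) ^ n"
      by (intro power_mono MN.mgf_bound[where b=b] bd v s1) auto
    also have "\<dots> = ennreal (exp (s\<^sup>2 * (n * v)))"
      by (simp add: ennreal_power exp_of_nat_mult[symmetric] ac_simps)
    finally show "(\<integral>\<^sup>+X. ennreal (exp (s * ?S X)) \<partial>(?PM \<Otimes>\<^sub>M ?PN)) \<le> ennreal (exp (s\<^sup>2 * (n * v)))" .
  qed
  moreover have "2 * sqrt (v * L / n) < \<bar>(\<Sum>k<n. f (fst X k, snd X k)) / n - ?m\<bar> \<longleftrightarrow> 2 * sqrt (n * v * L) < \<bar>?S X\<bar>" for X
  proof -
    have "sqrt (n * v * L) = n * sqrt (v * L / n)"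
      using n by (simp add: real_sqrt_mult real_sqrt_divide real_div_sqrt field_simps)
    moreover have "\<bar>?S X\<bar> = n * \<bar>(\<Sum>k<n. f (fst X k, snd X k)) / n - ?m\<bar>"
    proof -
      have "?S X = n * ((\<Sum>k<n. f (fst X k, snd X k)) / n - ?m)" using n by (simp add: sum_subtractf field_simps)
      then show ?thesis by (simp add: abs_mult)
    qed
    ultimately show ?thesis using n by (simp add: mult.left_commute)
  qed
  ultimately show ?thesis by simp
qed

section \<open>Gradient descent for ridge regression and the trained network\<close>

lemma sum_sq_expand:
  fixes a b :: "nat \<Rightarrow> real"
  shows "(\<Sum>i\<in>I. (a i + b i)\<^sup>2) = (\<Sum>i\<in>I. (a i)\<^sup>2) + 2 * (\<Sum>i\<in>I. a i * b i) + (\<Sum>i\<in>I. (b i)\<^sup>2)"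
  by (simp add: power2_sum sum.distrib sum_distrib_left algebra_simps)

definition ridge_res :: "(nat \<Rightarrow> nat \<Rightarrow> real) \<Rightarrow> (nat \<Rightarrow> real) \<Rightarrow> nat \<Rightarrow> (nat \<Rightarrow> real) \<Rightarrow> nat \<Rightarrow> real" where
  "ridge_res \<Phi> y m a k = (\<Sum>i<m. a i * \<Phi> k i) - y k"

text \<open>The penalty carries \<open>lam / 2\<close> so that its gradient is the term
  \<open>lam * a i\<close> of the algorithm.\<close>

definition ridge_obj :: "(nat \<Rightarrow> nat \<Rightarrow> real) \<Rightarrow> (nat \<Rightarrow> real) \<Rightarrow> nat \<Rightarrow> nat \<Rightarrow> real \<Rightarrow> (nat \<Rightarrow> real) \<Rightarrow> real" where
  "ridge_obj \<Phi> y n m lam a = (\<Sum>k<n. (ridge_res \<Phi> y m a k)\<^sup>2) / n + lam / 2 * (\<Sum>i<m. (a i)\<^sup>2)"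

definition ridge_grad :: "(nat \<Rightarrow> nat \<Rightarrow> real) \<Rightarrow> (nat \<Rightarrow> real) \<Rightarrow> nat \<Rightarrow> nat \<Rightarrow> real \<Rightarrow> (nat \<Rightarrow> real) \<Rightarrow> nat \<Rightarrow> real" where
  "ridge_grad \<Phi> y n m lam a i = (\<Sum>k<n. 2 * ridge_res \<Phi> y m a k * \<Phi> k i) / n + lam * a i"

definition ridge_step :: "(nat \<Rightarrow> nat \<Rightarrow> real) \<Rightarrow> (nat \<Rightarrow> real) \<Rightarrow> nat \<Rightarrow> nat \<Rightarrow> real \<Rightarrow> real \<Rightarrow> (nat \<Rightarrow> real) \<Rightarrow> nat \<Rightarrow> real" where
  "ridge_step \<Phi> y n m lam \<eta> a = (\<lambda>i. a i - \<eta> * ridge_grad \<Phi> y n m lam a i)"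

text \<open>\<open>B\<close> bounds the squared norms of the feature vectors, so
  \<open>2 * B + lam\<close> bounds the Hessian of the objective and \<open>\<eta>B\<close> is the
  usual step size condition for gradient descent.\<close>

locale ridge =
  fixes \<Phi> :: "nat \<Rightarrow> nat \<Rightarrow> real" and y :: "nat \<Rightarrow> real" and n m :: nat and lam B \<eta> :: real
  assumes lam: "lam \<ge> 0" and n: "n > 0" and \<eta>: "\<eta> > 0"
    and B: "\<And>k. k < n \<Longrightarrow> (\<Sum>i<m. (\<Phi> k i)\<^sup>2) \<le> B"
    and \<eta>B: "\<eta> * (2 * B + lam) \<le> 1"
begin

abbreviation "res \<equiv> ridge_res \<Phi> y m"
abbreviation "obj \<equiv> ridge_obj \<Phi> y n m lam"
abbreviation "grad \<equiv> ridge_grad \<Phi> y n m lam"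
abbreviation "gd_step \<equiv> ridge_step \<Phi> y n m lam \<eta>"

definition hess :: "(nat \<Rightarrow> real) \<Rightarrow> real" where
  "hess u = (\<Sum>k<n. (\<Sum>i<m. u i * \<Phi> k i)\<^sup>2) / n + lam / 2 * (\<Sum>i<m. (u i)\<^sup>2)"

text \<open>Exact Taylor expansion of a quadratic function. The lower bound for \<open>hess\<close>
  will express convexity, its upper bound smoothness.\<close>

lemma obj_expand: "obj (\<lambda>i. a i + u i) = obj a + (\<Sum>i<m. grad a i * u i) + hess u"
proof -
  have r: "res (\<lambda>i. a i + u i) k = res a k + (\<Sum>i<m. u i * \<Phi> k i)" for k
    by (simp add: ridge_res_def algebra_simps sum.distrib)
  have g: "(\<Sum>i<m. grad a i * u i) = 2 * (\<Sum>k<n. res a k * (\<Sum>i<m. u i * \<Phi> k i)) / n + lam * (\<Sum>i<m. a i * u i)"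
  proof -
    have "(\<Sum>i<m. grad a i * u i) = (\<Sum>i<m. \<Sum>k<n. 2 * res a k * \<Phi> k i * u i / n) + lam * (\<Sum>i<m. a i * u i)"
      by (simp add: ridge_grad_def algebra_simps sum.distrib sum_distrib_left sum_divide_distrib)
    also have "(\<Sum>i<m. \<Sum>k<n. 2 * res a k * \<Phi> k i * u i / n) = (\<Sum>k<n. \<Sum>i<m. 2 * res a k * \<Phi> k i * u i / n)"
      by (rule sum.swap)
    also have "\<dots> = 2 * (\<Sum>k<n. res a k * (\<Sum>i<m. u i * \<Phi> k i)) / n"
      by (simp add: sum_distrib_left sum_divide_distrib ac_simps)
    finally show ?thesis .
  qed
  show ?thesis
    unfolding ridge_obj_def r g hess_def sum_sq_expand by (simp add: add_divide_distrib algebra_simps)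
qed

lemma hess_bounds: "0 \<le> hess u" "hess u \<le> (B + lam / 2) * (\<Sum>i<m. (u i)\<^sup>2)"
proof -
  show "0 \<le> hess u" using lam by (simp add: hess_def sum_nonneg)
  have "(\<Sum>k<n. (\<Sum>i<m. u i * \<Phi> k i)\<^sup>2) \<le> (\<Sum>k<n. B * (\<Sum>i<m. (u i)\<^sup>2))"
  proof (rule sum_mono)
    fix k assume k: "k \<in> {..<n}"
    have "(\<Sum>i<m. u i * \<Phi> k i)\<^sup>2 \<le> (\<Sum>i<m. (u i)\<^sup>2) * (\<Sum>i<m. (\<Phi> k i)\<^sup>2)"
      by (rule Cauchy_Schwarz_ineq_sum)
    also have "\<dots> \<le> (\<Sum>i<m. (u i)\<^sup>2) * B" using B k by (intro mult_left_mono) (auto intro: sum_nonneg)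
    finally show "(\<Sum>i<m. u i * \<Phi> k i)\<^sup>2 \<le> B * (\<Sum>i<m. (u i)\<^sup>2)" by (simp add: mult.commute)
  qed
  then show "hess u \<le> (B + lam / 2) * (\<Sum>i<m. (u i)\<^sup>2)"
    using n by (simp add: hess_def field_simps)
qed

lemma gd_descent: "obj (gd_step a) \<le> obj a - \<eta> / 2 * (\<Sum>i<m. (grad a i)\<^sup>2)"
proof -
  let ?G = "\<Sum>i<m. (grad a i)\<^sup>2"
  have G0: "0 \<le> ?G" by (simp add: sum_nonneg)
  have "obj (gd_step a) = obj a + (\<Sum>i<m. grad a i * (- \<eta> * grad a i)) + hess (\<lambda>i. - \<eta> * grad a i)"
    using obj_expand[of a "\<lambda>i. - \<eta> * grad a i"] by (simp add: ridge_step_def)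
  also have "(\<Sum>i<m. grad a i * (- \<eta> * grad a i)) = - \<eta> * ?G"
    by (simp add: sum_distrib_left power2_eq_square ac_simps sum_negf)
  also have "hess (\<lambda>i. - \<eta> * grad a i) \<le> (B + lam / 2) * (\<eta>\<^sup>2 * ?G)"
    using hess_bounds(2)[of "\<lambda>i. - \<eta> * grad a i"] by (simp add: power_mult_distrib sum_distrib_left)
  also have "(B + lam / 2) * (\<eta>\<^sup>2 * ?G) = (\<eta> * (2 * B + lam)) * (\<eta> / 2 * ?G)"
    by (simp add: power2_eq_square field_simps)
  also have "\<dots> \<le> 1 * (\<eta> / 2 * ?G)" using \<eta>B \<eta> G0 by (intro mult_right_mono) auto
  finally show ?thesis by simp
qed

text \<open>Expanding the square produces \<open>\<eta>\<^sup>2\<close> times the squared gradient.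
  Convexity bounds the mixed term, and the decrease from \<open>gd_descent\<close> cancels the
  squared gradient, so the loss of distance to \<open>b\<close> pays for the excess objective at the
  new iterate.\<close>

lemma gd_distance:
  "(\<Sum>i<m. (gd_step a i - b i)\<^sup>2) \<le> (\<Sum>i<m. (a i - b i)\<^sup>2) - 2 * \<eta> * (obj (gd_step a) - obj b)"
proof -
  let ?G = "\<Sum>i<m. (grad a i)\<^sup>2"
  have "(\<Sum>i<m. (gd_step a i - b i)\<^sup>2) = (\<Sum>i<m. ((a i - b i) + (- \<eta> * grad a i))\<^sup>2)"
    by (simp add: ridge_step_def algebra_simps)
  also have "\<dots> = (\<Sum>i<m. (a i - b i)\<^sup>2) + 2 * \<eta> * (\<Sum>i<m. grad a i * (b i - a i)) + \<eta>\<^sup>2 * ?G"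
    unfolding sum_sq_expand by (simp add: power_mult_distrib sum_distrib_left sum_negf algebra_simps sum_subtractf)
  also have "obj b = obj a + (\<Sum>i<m. grad a i * (b i - a i)) + hess (\<lambda>i. b i - a i)"
    using obj_expand[of a "\<lambda>i. b i - a i"] by simp
  then have "(\<Sum>i<m. grad a i * (b i - a i)) \<le> obj b - obj a" using hess_bounds(1)[of "\<lambda>i. b i - a i"] by simp
  then have "2 * \<eta> * (\<Sum>i<m. grad a i * (b i - a i)) \<le> 2 * \<eta> * (obj b - obj a)"
    using \<eta> by (intro mult_left_mono) auto
  moreover have "2 * \<eta> * obj (gd_step a) \<le> 2 * \<eta> * (obj a - \<eta> / 2 * ?G)"
    using gd_descent[of a] \<eta> by (intro mult_left_mono) auto
  then have "2 * \<eta> * obj (gd_step a) \<le> 2 * \<eta> * obj a - \<eta>\<^sup>2 * ?G"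
    by (simp add: power2_eq_square algebra_simps)
  ultimately show ?thesis by (simp add: algebra_simps)
qed

text \<open>Telescoped \<open>gd_distance\<close>. The objective decreases along the iteration, so
  each earlier value may be replaced by the last one; this gives a rate for the last iterate and not
  only for an average.\<close>

lemma gd_rate_aux:
  "2 * \<eta> * t * (obj ((gd_step ^^ t) a) - obj b) \<le> (\<Sum>i<m. (a i - b i)\<^sup>2) - (\<Sum>i<m. ((gd_step ^^ t) a i - b i)\<^sup>2)"
proof (induction t)
  case (Suc t)
  let ?a = "(gd_step ^^ t) a"
  have "obj (gd_step ?a) \<le> obj ?a" using gd_descent[of ?a] \<eta> by (smt (verit) divide_nonneg_nonneg mult_nonneg_nonneg sum_nonneg zero_le_power2)
  then have "2 * \<eta> * t * (obj (gd_step ?a) - obj b) \<le> 2 * \<eta> * t * (obj ?a - obj b)"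
    using \<eta> by (intro mult_left_mono) auto
  with Suc gd_distance[of ?a b] show ?case by (simp add: algebra_simps)
qed simp

lemma gd_rate:
  assumes "t > 0"
  shows "obj ((gd_step ^^ t) a) \<le> obj b + (\<Sum>i<m. (a i - b i)\<^sup>2) / (2 * \<eta> * t)"
proof -
  have "2 * \<eta> * t * (obj ((gd_step ^^ t) a) - obj b) \<le> (\<Sum>i<m. (a i - b i)\<^sup>2)"
    using gd_rate_aux[of t a b] by (smt (verit) sum_nonneg zero_le_power2)
  then have "obj ((gd_step ^^ t) a) - obj b \<le> (\<Sum>i<m. (a i - b i)\<^sup>2) / (2 * \<eta> * t)"
    using assms \<eta> by (simp add: pos_le_divide_eq mult.commute)
  then show ?thesis by simp
qed

end

text \<open>For \<open>y = fs\<close> this is the function called \<open>g\<close> in the overview,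
  for constant \<open>y\<close> it is \<open>s\<close>. The sum over samples stands inside because
  it is, up to scaling, the weight that the first step gives to hidden unit
  \<open>j\<close>.\<close>

definition feat :: "nat \<Rightarrow> nat \<Rightarrow> nat \<Rightarrow> (real \<Rightarrow> real) \<Rightarrow> (vec \<Rightarrow> real) \<Rightarrow> (nat \<Rightarrow> vec) \<Rightarrow> (nat \<Rightarrow> vec) \<Rightarrow> vec \<Rightarrow> real" where
  "feat d n m2 s y V X x =
     (\<Sum>j<m2. s (dotp d (V j) x) * ((\<Sum>k<n. y (X k) * s (dotp d (V j) (X k))) / n)) / m2"

definition bias_out :: "nat \<Rightarrow> vec \<Rightarrow> vec \<Rightarrow> real" where
  "bias_out m1 a b = (\<Sum>i<m1. a i * relu (b i)) / m1"

definition psi :: "real \<Rightarrow> real \<Rightarrow> real \<Rightarrow> real" where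
  "psi a b z = relu (2 * a * relu_deriv b * z + b)"

definition zval :: "nat \<Rightarrow> nat \<Rightarrow> nat \<Rightarrow> nat \<Rightarrow> (real \<Rightarrow> real) \<Rightarrow> (vec \<Rightarrow> real) \<Rightarrow> real
    \<Rightarrow> vec \<Rightarrow> vec \<Rightarrow> (nat \<Rightarrow> vec) \<Rightarrow> (nat \<Rightarrow> vec) \<Rightarrow> vec \<Rightarrow> real" where
  "zval d n m1 m2 s y \<eta> a b V X x =
     \<eta> * (feat d n m2 s y V X x - bias_out m1 a b * feat d n m2 s (\<lambda>_. 1) V X x)"

text \<open>At \<open>W = 0\<close> the network is the constant \<open>bias_out\<close> and the
  preactivation is \<open>b i\<close> at every input. Hence \<open>relu_deriv (b i)\<close> leaves
  the sum over samples and the gradient is a product of a factor in \<open>i\<close> and a factor in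
  \<open>j\<close>. The step size \<open>m1 / m2 * \<eta>\<close> cancels the \<open>1 / m1\<close>
  of the network and supplies the average over hidden units.\<close>

lemma preact_after_first_step:
  assumes "n > 0" "m1 > 0" "m2 > 0"
    and W1_def: "W1 = (\<lambda>i j. 0 - (real m1 / real m2 * \<eta>) * grad_W d n m1 m2 s fs X (a, (\<lambda>i j. 0), b, V) i j)"
  shows "relu (preact d m2 s (c, W1, b, V) i x) = psi (a i) (b i) (zval d n m1 m2 s fs \<eta> a b V X x)"
proof -
  let ?f0 = "bias_out m1 a b"
  have net0: "net d m1 m2 s (a, (\<lambda>i j. 0), b, V) y = ?f0" for y
    by (simp add: net_def preact_def bias_out_def)
  have W: "W1 i j = 2 * a i * relu_deriv (b i) * \<eta> / m2 * ((\<Sum>k<n. (fs (X k) - ?f0) * s (dotp d (V j) (X k))) / n)" for j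
  proof -
    have "(\<Sum>k<n. 2 * (?f0 - fs (X k)) * (1 / real m1) * a i * relu_deriv (b i) * s (dotp d (V j) (X k)))
       = - (2 * a i * relu_deriv (b i) / m1) * (\<Sum>k<n. (fs (X k) - ?f0) * s (dotp d (V j) (X k)))"
      unfolding sum_distrib_left using assms(2) by (intro sum.cong) (auto simp: field_simps)
    then show ?thesis
      unfolding W1_def grad_W_def using assms(1-3) by (simp add: net0 preact_def)
  qed
  have S: "(\<Sum>k<n. (fs (X k) - ?f0) * s (dotp d (V j) (X k))) / n
      = (\<Sum>k<n. fs (X k) * s (dotp d (V j) (X k))) / n - ?f0 * ((\<Sum>k<n. 1 * s (dotp d (V j) (X k))) / n)" for j
    by (simp add: left_diff_distrib sum_subtractf sum_distrib_left diff_divide_distrib)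
  have "(\<Sum>j<m2. W1 i j * s (dotp d (V j) x)) = 2 * a i * relu_deriv (b i) * zval d n m1 m2 s fs \<eta> a b V X x"
    unfolding W S zval_def feat_def
    by (simp add: sum_distrib_left sum_divide_distrib sum_subtractf[symmetric] algebra_simps diff_divide_distrib)
  then show ?thesis by (simp add: preact_def psi_def)
qed

text \<open>After the first step the hidden layer is frozen, so the updates of \<open>a\<close> are
  ridge regression on fixed features. There are \<open>T - 1\<close> of them because the update of
  \<open>W\<close> counts as the first iterate.\<close>

lemma layerwise_train_eq:
  assumes "n > 0" "m1 > 0" "m2 > 0"
    and \<Phi>_def: "\<Phi> = (\<lambda>k i. psi (a i) (b i) (zval d n m1 m2 s fs \<eta> a b V X1 (X2 k)) / m1)"
  shows "net d m1 m2 s (layerwise_train d n m1 m2 s fs (real m1 / real m2 * \<eta>) \<eta>2 lam T a b V X1 X2) x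
    = (\<Sum>i<m1. ((ridge_step \<Phi> (\<lambda>k. fs (X2 k)) n m1 lam \<eta>2 ^^ (T - 1)) a) i
          * psi (a i) (b i) (zval d n m1 m2 s fs \<eta> a b V X1 x)) / m1"
proof -
  define W1 where "W1 = (\<lambda>i j. 0 - (real m1 / real m2 * \<eta>) * grad_W d n m1 m2 s fs X1 (a, (\<lambda>i j. 0), b, V) i j)"
  note pre = preact_after_first_step[OF assms(1-3) W1_def]
  have net: "net d m1 m2 s (c, W1, b, V) y = (\<Sum>i<m1. c i * psi (a i) (b i) (zval d n m1 m2 s fs \<eta> a b V X1 y)) / m1" for c y
    by (simp add: net_def pre)
  have g: "grad_a d n m1 m2 s fs X2 (c, W1, b, V) i + lam * c i
     = ridge_grad \<Phi> (\<lambda>k. fs (X2 k)) n m1 lam c i" for c i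
  proof -
    have "ridge_res \<Phi> (\<lambda>k. fs (X2 k)) m1 c k = net d m1 m2 s (c, W1, b, V) (X2 k) - fs (X2 k)" for k
      unfolding ridge_res_def net \<Phi>_def by (simp add: sum_divide_distrib)
    then show ?thesis unfolding ridge_grad_def grad_a_def pre by (simp add: \<Phi>_def)
  qed
  have "(\<lambda>c i. c i - \<eta>2 * (grad_a d n m1 m2 s fs X2 (c, W1, b, V) i + lam * c i))
    = ridge_step \<Phi> (\<lambda>k. fs (X2 k)) n m1 lam \<eta>2"
    unfolding g by (simp add: ridge_step_def fun_eq_iff)
  then have "layerwise_train d n m1 m2 s fs (real m1 / real m2 * \<eta>) \<eta>2 lam T a b V X1 X2
    = ((ridge_step \<Phi> (\<lambda>k. fs (X2 k)) n m1 lam \<eta>2 ^^ (T - 1)) a, W1, b, V)"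
    unfolding layerwise_train_def Let_def W1_def by simp
  then show ?thesis by (simp add: net)
qed

section \<open>The random initialization\<close>

lemma dotp_commute: "dotp d u v = dotp d v u"
  by (simp add: dotp_def mult.commute)

lemma measurable_dotp [measurable (raw)]:
  assumes "f \<in> measurable M (Rd d)" "g \<in> measurable M (Rd d)"
  shows "(\<lambda>x. dotp d (f x) (g x)) \<in> borel_measurable M"
proof -
  have "(\<lambda>x. h x k) \<in> borel_measurable M" if "h \<in> measurable M (Rd d)" "k < d" for h k
    using measurable_compose[OF that(1)[unfolded Rd_def] measurable_component_singleton] that(2) by simp
  with assms show ?thesis unfolding dotp_def by (auto intro!: borel_measurable_sum borel_measurable_times)
qed

section \<open>The uniform measure on the sphere\<close>

lemma sets_Rd_leb: "sets (Rd_leb d) = sets (Rd d)"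
  unfolding Rd_leb_def Rd_def by (intro sets_PiM_cong) auto

lemma unit_ball_sets: "unit_ball d \<in> sets (Rd_leb d)"
proof -
  have [measurable]: "(\<lambda>x. dotp d x x) \<in> borel_measurable (Rd_leb d)"
    using sets_Rd_leb by (intro measurable_dotp measurable_ident_sets) auto
  show ?thesis unfolding unit_ball_def by measurable
qed

lemma emeasure_Rd_leb_box:
  assumes "\<And>k. k < d \<Longrightarrow> A k \<in> sets borel"
  shows "emeasure (Rd_leb d) (PiE {..<d} A) = (\<Prod>k<d. emeasure lborel (A k))"
proof -
  interpret product_sigma_finite "\<lambda>_::nat. lborel :: real measure" ..
  show ?thesis unfolding Rd_leb_def using assms by (intro emeasure_PiM) auto
qed

text \<open>The ball lies between the cubes of half-width \<open>1 / d\<close> and \<open>1\<close>.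
  Positive finite measure is what makes the normalized measure on it a probability measure.\<close>

lemma unit_ball_emeasure:
  assumes "d > 0"
  shows "emeasure (Rd_leb d) (unit_ball d) \<noteq> 0" "emeasure (Rd_leb d) (unit_ball d) \<noteq> \<infinity>"
proof -
  have boxsets: "PiE {..<d} (\<lambda>_. {-c..c}) \<in> sets (Rd_leb d)" for c :: real
    unfolding Rd_leb_def by (intro sets_PiM_I_finite) auto
  have sp: "space (Rd_leb d) = PiE {..<d} (\<lambda>_. UNIV)" by (simp add: Rd_leb_def space_PiM)
  have "PiE {..<d} (\<lambda>_. {-(1/real d)..1/d}) \<subseteq> unit_ball d"
  proof
    fix x assume x: "x \<in> PiE {..<d} (\<lambda>_. {-(1/real d)..1/d})"
    have "dotp d x x \<le> (\<Sum>k<d. (1/d) * (1/d))"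
      unfolding dotp_def
    proof (rule sum_mono)
      fix k assume "k \<in> {..<d}"
      then have "\<bar>x k\<bar> \<le> 1/d" using x by (auto simp: PiE_def Pi_def abs_le_iff)
      then have "\<bar>x k\<bar> * \<bar>x k\<bar> \<le> (1/d) * (1/d)" by (intro mult_mono) auto
      then show "x k * x k \<le> (1/d) * (1/d)" by simp
    qed
    also have "\<dots> \<le> 1" using assms by (simp add: field_simps)
    finally show "x \<in> unit_ball d" using x by (auto simp: unit_ball_def sp)
  qed
  then have "emeasure (Rd_leb d) (PiE {..<d} (\<lambda>_. {-(1/real d)..1/d})) \<le> emeasure (Rd_leb d) (unit_ball d)"
    by (intro emeasure_mono unit_ball_sets)
  moreover have "emeasure (Rd_leb d) (PiE {..<d} (\<lambda>_. {-(1/real d)..1/d})) > 0"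
  proof -
    have "emeasure (Rd_leb d) (PiE {..<d} (\<lambda>_. {-(1/real d)..1/d})) = ennreal ((2 / d) ^ d)"
      by (subst emeasure_Rd_leb_box) (auto simp: ennreal_power)
    then show ?thesis using assms by (simp add: zero_less_power)
  qed
  ultimately show "emeasure (Rd_leb d) (unit_ball d) \<noteq> 0" by auto
  have "unit_ball d \<subseteq> PiE {..<d} (\<lambda>_. {-1..1})"
  proof
    fix x assume x: "x \<in> unit_ball d"
    have "\<bar>x k\<bar> \<le> 1" if "k < d" for k
    proof -
      have "x k * x k \<le> dotp d x x" unfolding dotp_def using that by (intro member_le_sum) auto
      also have "\<dots> \<le> 1" using x by (simp add: unit_ball_def)
      finally show ?thesis using abs_square_le_1[of "x k"] by (simp add: power2_eq_square)
    qed
    then show "x \<in> PiE {..<d} (\<lambda>_. {-1..1})" using x by (auto simp: unit_ball_def sp PiE_def Pi_def abs_le_iff minus_le_iff)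
  qed
  then have "emeasure (Rd_leb d) (unit_ball d) \<le> emeasure (Rd_leb d) (PiE {..<d} (\<lambda>_. {-1..1::real}))"
    by (intro emeasure_mono boxsets)
  also have "\<dots> < \<infinity>" by (subst emeasure_Rd_leb_box) (auto simp: power_less_top_ennreal)
  finally show "emeasure (Rd_leb d) (unit_ball d) \<noteq> \<infinity>" by auto
qed

lemma measurable_normalize:
  "(\<lambda>x. \<lambda>k\<in>{..<d}. x k / sqrt (dotp d x x)) \<in> measurable (Rd_leb d) (Rd d)"
proof -
  have m: "(\<lambda>x. dotp d x x) \<in> borel_measurable (Rd_leb d)"
    using sets_Rd_leb by (intro measurable_dotp measurable_ident_sets) auto
  have "(\<lambda>x. x k) \<in> borel_measurable (Rd_leb d)" if "k < d" for k
    using measurable_component_singleton[of k "{..<d}" "\<lambda>_. lborel"] that by (simp add: Rd_leb_def)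
  with m show ?thesis unfolding Rd_def
    by (intro measurable_restrict borel_measurable_divide borel_measurable_sqrt) auto
qed

lemma sets_sphere_unif [measurable_cong]: "sets (sphere_unif d) = sets (Rd d)"
  by (simp add: sphere_unif_def)

lemma prob_space_sphere_unif:
  assumes "d > 0"
  shows "prob_space (sphere_unif d)"
proof -
  interpret U: prob_space "uniform_measure (Rd_leb d) (unit_ball d)"
    using unit_ball_emeasure[OF assms] by (intro prob_space_uniform_measure) auto
  show ?thesis unfolding sphere_unif_def
    using measurable_normalize[of d] by (intro U.prob_space_distr) (simp add: measurable_cong_sets[OF sets_uniform_measure refl])
qed

text \<open>Normalization fails only at the origin, which lies in a coordinate hyperplane, a null
  set because \<open>d > 0\<close>.\<close>

lemma AE_sphere_unif_unit:
  assumes "d > 0"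
  shows "AE v in sphere_unif d. dotp d v v = 1"
proof -
  let ?Z = "PiE {..<d} (\<lambda>k. if k = 0 then {0::real} else UNIV)"
  have Z: "?Z \<in> sets (Rd_leb d)"
    unfolding Rd_leb_def by (intro sets_PiM_I_finite) auto
  have "emeasure (Rd_leb d) ?Z = (\<Prod>k<d. emeasure lborel (if k = 0 then {0::real} else UNIV))"
    by (intro emeasure_Rd_leb_box) auto
  also have "\<dots> = 0" using assms by (intro prod_zero) auto
  finally have "AE x in Rd_leb d. x \<notin> ?Z" using Z by (intro AE_not_in) (auto simp: null_sets_def)
  then have nz: "AE x in Rd_leb d. dotp d x x \<noteq> 0"
  proof (rule AE_mp, intro AE_I2 impI)
    fix x assume x: "x \<in> space (Rd_leb d)" "x \<notin> ?Z"
    then have "x 0 \<noteq> 0" by (auto simp: Rd_leb_def space_PiM PiE_def Pi_def split: if_splits)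
    moreover have "x 0 * x 0 \<le> dotp d x x" unfolding dotp_def using assms by (intro member_le_sum) auto
    ultimately show "dotp d x x \<noteq> 0" by (smt (verit) mult_eq_0_iff zero_le_square)
  qed
  have *: "dotp d (\<lambda>k\<in>{..<d}. x k / sqrt (dotp d x x)) (\<lambda>k\<in>{..<d}. x k / sqrt (dotp d x x)) = 1"
    if "dotp d x x \<noteq> 0" for x
  proof -
    have "dotp d x x \<ge> 0" by (simp add: dotp_def sum_nonneg)
    then have "dotp d (\<lambda>k\<in>{..<d}. x k / sqrt (dotp d x x)) (\<lambda>k\<in>{..<d}. x k / sqrt (dotp d x x)) = (\<Sum>k<d. x k * x k / dotp d x x)"
      unfolding dotp_def[of d "restrict _ _"] by (intro sum.cong) auto
    also have "\<dots> = 1" using that by (simp flip: sum_divide_distrib add: dotp_def)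
    finally show ?thesis .
  qed
  have m: "(\<lambda>x. \<lambda>k\<in>{..<d}. x k / sqrt (dotp d x x)) \<in> measurable (uniform_measure (Rd_leb d) (unit_ball d)) (Rd d)"
    using measurable_normalize by (simp add: measurable_cong_sets[OF sets_uniform_measure refl])
  have "{v \<in> space (Rd d). dotp d v v = 1} \<in> sets (Rd d)" by measurable
  moreover have "AE x in uniform_measure (Rd_leb d) (unit_ball d). dotp d x x \<noteq> 0"
    using nz by (intro AE_uniform_measureI[OF unit_ball_sets]) auto
  ultimately show ?thesis unfolding sphere_unif_def
    by (subst AE_distr_iff[OF m]) (auto elim!: eventually_mono intro: *)
qed

section \<open>The laws of signs and biases\<close>

lemma sets_rademacher [simp]: "sets rademacher = UNIV" and space_rademacher [simp]: "space rademacher = UNIV"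
  by (auto simp: rademacher_def)

lemma prob_space_rademacher: "prob_space rademacher"
  unfolding rademacher_def by (rule measure_pmf.prob_space_axioms)

lemma measurable_rademacher [simp]: "f \<in> measurable rademacher N \<longleftrightarrow> f \<in> UNIV \<rightarrow> space N"
  by (simp add: rademacher_def)

lemma nn_integral_rademacher: "(\<integral>\<^sup>+a. f a \<partial>rademacher) = (f (-1) + f 1) / 2"
  unfolding rademacher_def by (subst nn_integral_pmf_of_set) (auto simp: field_simps)

lemma integral_rademacher: "(\<integral>a. f a \<partial>rademacher) = (f (-1) + f 1 :: real) / 2"
  unfolding rademacher_def by (subst integral_pmf_of_set) auto

lemma AE_rademacher: "AE a in rademacher. a = 1 \<or> a = -1"
  unfolding rademacher_def by (subst AE_measure_pmf_iff) auto

lemma sets_std_normal [measurable_cong, simp]: "sets std_normal = sets borel" and space_std_normal [simp]: "space std_normal = UNIV"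
  by (auto simp: std_normal_def)

lemma prob_space_std_normal: "prob_space std_normal"
  unfolding std_normal_def by (rule prob_space_normal_density) simp

text \<open>Multiplying the standard density by \<open>exp (b\<^sup>2 / 4)\<close> gives
  \<open>sqrt 2\<close> times the normal density of variance 2.\<close>

lemma std_normal_exp_square: "(\<integral>\<^sup>+b. ennreal (exp (b\<^sup>2 / 4)) \<partial>std_normal) = ennreal (sqrt 2)"
proof -
  have "(\<integral>\<^sup>+b. ennreal (exp (b\<^sup>2 / 4)) \<partial>std_normal) = (\<integral>\<^sup>+b. ennreal (std_normal_density b) * ennreal (exp (b\<^sup>2 / 4)) \<partial>lborel)"
    unfolding std_normal_def by (subst nn_integral_density) auto
  also have "\<dots> = (\<integral>\<^sup>+b. ennreal (sqrt 2) * ennreal (normal_density 0 (sqrt 2) b) \<partial>lborel)"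
  proof (rule nn_integral_cong)
    fix b :: real
    have "std_normal_density b * exp (b\<^sup>2 / 4) = sqrt 2 * normal_density 0 (sqrt 2) b"
      by (simp add: normal_density_def real_sqrt_mult field_simps flip: exp_add)
    then show "ennreal (std_normal_density b) * ennreal (exp (b\<^sup>2 / 4)) = ennreal (sqrt 2) * ennreal (normal_density 0 (sqrt 2) b)"
      by (simp flip: ennreal_mult'')
  qed
  also have "\<dots> = ennreal (sqrt 2) * emeasure (density lborel (normal_density 0 (sqrt 2))) UNIV"
    by (simp add: nn_integral_cmult emeasure_density)
  also have "\<dots> = ennreal (sqrt 2)"
    using prob_space.emeasure_space_1[OF prob_space_normal_density[of "sqrt 2" 0]] by simp
  finally show ?thesis .
qed

text \<open>This lemma and the next stand in for conditioning: a probability bound that holds for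
  every frozen value of one factor passes to the product.\<close>

lemma emeasure_pair_le:
  assumes M: "prob_space M" and N: "prob_space N" and A: "A \<in> sets (M \<Otimes>\<^sub>M N)"
    and le: "\<And>x. x \<in> space M \<Longrightarrow> emeasure N {y \<in> space N. (x, y) \<in> A} \<le> e"
  shows "emeasure (M \<Otimes>\<^sub>M N) A \<le> e"
proof -
  interpret M: prob_space M by fact
  interpret N: prob_space N by fact
  have "emeasure (M \<Otimes>\<^sub>M N) A = (\<integral>\<^sup>+x. emeasure N (Pair x -` A) \<partial>M)"
    by (rule N.emeasure_pair_measure_alt[OF A])
  also have "\<dots> \<le> (\<integral>\<^sup>+x. e \<partial>M)"
  proof (rule nn_integral_mono)
    fix x assume x: "x \<in> space M"
    have "Pair x -` A = {y \<in> space N. (x, y) \<in> A}" using sets.sets_into_space[OF A] by (auto simp: space_pair_measure)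
    then show "emeasure N (Pair x -` A) \<le> e" using le[OF x] by simp
  qed
  also have "\<dots> = e" by (simp add: M.emeasure_space_1)
  finally show ?thesis .
qed

lemma emeasure_pair_le2:
  assumes M: "prob_space M" and N: "prob_space N" and A: "A \<in> sets (M \<Otimes>\<^sub>M N)"
    and le: "\<And>y. y \<in> space N \<Longrightarrow> emeasure M {x \<in> space M. (x, y) \<in> A} \<le> e"
  shows "emeasure (M \<Otimes>\<^sub>M N) A \<le> e"
proof -
  interpret M: prob_space M by fact
  interpret N: prob_space N by fact
  interpret pair_sigma_finite M N ..
  have "emeasure (M \<Otimes>\<^sub>M N) A = (\<integral>\<^sup>+y. emeasure M ((\<lambda>x. (x, y)) -` A) \<partial>N)"
    by (rule emeasure_pair_measure_alt2[OF A])
  also have "\<dots> \<le> (\<integral>\<^sup>+y. e \<partial>N)"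
  proof (rule nn_integral_mono)
    fix y assume y: "y \<in> space N"
    have "(\<lambda>x. (x, y)) -` A = {x \<in> space M. (x, y) \<in> A}" using sets.sets_into_space[OF A] by (auto simp: space_pair_measure)
    then show "emeasure M ((\<lambda>x. (x, y)) -` A) \<le> e" using le[OF y] by simp
  qed
  also have "\<dots> = e" by (simp add: N.emeasure_space_1)
  finally show ?thesis .
qed

lemma emeasure_union_bound:
  assumes "finite I" "\<And>i. i \<in> I \<Longrightarrow> {x \<in> space M. P i x} \<in> sets M"
    and "\<And>i. i \<in> I \<Longrightarrow> emeasure M {x \<in> space M. P i x} \<le> ennreal c" "0 \<le> c"
  shows "emeasure M {x \<in> space M. \<exists>i\<in>I. P i x} \<le> ennreal (real (card I) * c)"
proof -
  have "{x \<in> space M. \<exists>i\<in>I. P i x} = (\<Union>i\<in>I. {x \<in> space M. P i x})" by auto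
  then have "emeasure M {x \<in> space M. \<exists>i\<in>I. P i x} \<le> (\<Sum>i\<in>I. emeasure M {x \<in> space M. P i x})"
    using emeasure_subadditive_finite[OF assms(1), of "\<lambda>i. {x \<in> space M. P i x}" M] assms(2) by auto
  also have "\<dots> \<le> (\<Sum>i\<in>I. ennreal c)" by (intro sum_mono assms(3))
  also have "\<dots> = ennreal (real (card I) * c)" using assms(4) by (simp add: ennreal_mult'' ennreal_of_nat_eq_real_of_nat)
  finally show ?thesis .
qed

lemma emeasure_Un_le:
  assumes "{x \<in> space M. P x} \<in> sets M" "{x \<in> space M. Q x} \<in> sets M"
    "emeasure M {x \<in> space M. P x} \<le> ennreal a" "emeasure M {x \<in> space M. Q x} \<le> ennreal b" "0 \<le> a" "0 \<le> b"
  shows "emeasure M {x \<in> space M. P x \<or> Q x} \<le> ennreal (a + b)"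
proof -
  have "{x \<in> space M. P x \<or> Q x} = {x \<in> space M. P x} \<union> {x \<in> space M. Q x}" by auto
  then have "emeasure M {x \<in> space M. P x \<or> Q x} \<le> emeasure M {x \<in> space M. P x} + emeasure M {x \<in> space M. Q x}"
    using emeasure_subadditive[OF assms(1,2)] by simp
  also have "\<dots> \<le> ennreal a + ennreal b" using assms by (intro add_mono)
  finally show ?thesis using assms by simp
qed

text \<open>Young's inequality \<open>u \<le> (s u\<^sup>2 + 1/s) / 2\<close> on the event \<open>A\<close>, used in place of Cauchy--Schwarz.\<close>

lemma nn_integral_on_rare_event:
  assumes [measurable]: "u \<in> borel_measurable M" and A: "A \<in> sets M" and s: "s > 0" and C: "0 \<le> C" "0 \<le> p"
    and u: "(\<integral>\<^sup>+x. ennreal ((u x)\<^sup>2) \<partial>M) \<le> ennreal C" and p: "emeasure M A \<le> ennreal p"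
  shows "(\<integral>\<^sup>+x. ennreal \<bar>u x\<bar> * indicator A x \<partial>M) \<le> ennreal ((s * C + p / s) / 2)"
proof -
  have y: "\<bar>r\<bar> \<le> s / 2 * r\<^sup>2 + 1 / (2 * s)" for r :: real
  proof -
    have "0 \<le> (s * \<bar>r\<bar> - 1)\<^sup>2" by simp
    then have "2 * (s * \<bar>r\<bar>) \<le> s * (s * r\<^sup>2) + 1"
      by (simp add: power2_diff power_mult_distrib) (simp add: power2_eq_square mult.assoc)
    then show ?thesis using s by (simp add: field_simps power2_eq_square)
  qed
  have "(\<integral>\<^sup>+x. ennreal \<bar>u x\<bar> * indicator A x \<partial>M) \<le> (\<integral>\<^sup>+x. ennreal (s / 2) * ennreal ((u x)\<^sup>2) + ennreal (1 / (2 * s)) * indicator A x \<partial>M)"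
  proof (rule nn_integral_mono)
    fix x
    show "ennreal \<bar>u x\<bar> * indicator A x \<le> ennreal (s / 2) * ennreal ((u x)\<^sup>2) + ennreal (1 / (2 * s)) * indicator A x"
      using y[of "u x"] s by (auto simp: indicator_def simp flip: ennreal_mult'' ennreal_plus intro!: ennreal_leI)
  qed
  also have "\<dots> = ennreal (s / 2) * (\<integral>\<^sup>+x. ennreal ((u x)\<^sup>2) \<partial>M) + ennreal (1 / (2 * s)) * emeasure M A"
    using A by (subst nn_integral_add) (auto simp: nn_integral_cmult)
  also have "\<dots> \<le> ennreal (s / 2) * ennreal C + ennreal (1 / (2 * s)) * ennreal p"
    using u p by (intro add_mono mult_left_mono) auto
  also have "\<dots> = ennreal ((s * C + p / s) / 2)"
    using s C by (simp flip: ennreal_mult'' ennreal_plus add: field_simps)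
  finally show ?thesis .
qed

section \<open>Concentration of the learned feature\<close>

lemma nn_integral_abs_bound:
  fixes f :: "'a \<Rightarrow> real"
  assumes "f \<in> borel_measurable M" "(\<integral>\<^sup>+x. ennreal \<bar>f x\<bar> \<partial>M) \<le> ennreal C" "0 \<le> C"
  shows "integrable M f" "\<bar>\<integral>x. f x \<partial>M\<bar> \<le> C"
proof -
  show i: "integrable M f"
    using assms by (intro integrableI_bounded) (auto intro: le_less_trans)
  have "ennreal (norm (\<integral>x. f x \<partial>M)) \<le> (\<integral>\<^sup>+x. ennreal (norm (f x)) \<partial>M)"
    by (rule integral_norm_bound_ennreal[OF i])
  also have "\<dots> \<le> ennreal C" using assms by simp
  finally show "\<bar>\<integral>x. f x \<partial>M\<bar> \<le> C" using assms by simp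
qed

lemma nn_integral_le_affine:
  assumes "prob_space M" "g \<in> borel_measurable M" "(\<integral>\<^sup>+x. ennreal (g x) \<partial>M) \<le> ennreal C" "0 \<le> C" "0 \<le> a" "0 \<le> c"
    "\<And>x. x \<in> space M \<Longrightarrow> 0 \<le> g x" "\<And>x. x \<in> space M \<Longrightarrow> f x \<le> a + c * g x"
  shows "(\<integral>\<^sup>+x. ennreal (f x) \<partial>M) \<le> ennreal (a + c * C)"
proof -
  interpret prob_space M by fact
  note assms(2)[measurable]
  have "(\<integral>\<^sup>+x. ennreal (f x) \<partial>M) \<le> (\<integral>\<^sup>+x. ennreal a + ennreal c * ennreal (g x) \<partial>M)"
    using assms by (intro nn_integral_mono) (auto simp flip: ennreal_mult'' ennreal_plus intro!: ennreal_leI)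
  also have "\<dots> = ennreal a + ennreal c * (\<integral>\<^sup>+x. ennreal (g x) \<partial>M)"
    by (subst nn_integral_add) (auto simp: nn_integral_cmult emeasure_space_1)
  also have "\<dots> \<le> ennreal a + ennreal c * ennreal C" using assms by (intro add_mono mult_left_mono) auto
  also have "\<dots> = ennreal (a + c * C)" using assms by (simp flip: ennreal_mult'' ennreal_plus)
  finally show ?thesis .
qed

lemma nn_integral_add_le:
  assumes [measurable]: "f \<in> borel_measurable M" "g \<in> borel_measurable M"
    and "(\<integral>\<^sup>+x. ennreal (f x) \<partial>M) \<le> ennreal C" "(\<integral>\<^sup>+x. ennreal (g x) \<partial>M) \<le> ennreal D"
    "0 \<le> C" "0 \<le> D" "0 \<le> a" "0 \<le> b" and nn: "\<And>x. x \<in> space M \<Longrightarrow> 0 \<le> f x" "\<And>x. x \<in> space M \<Longrightarrow> 0 \<le> g x"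
    and le: "\<And>x. x \<in> space M \<Longrightarrow> h x \<le> a * f x + b * g x"
  shows "(\<integral>\<^sup>+x. ennreal (h x) \<partial>M) \<le> ennreal (a * C + b * D)"
proof -
  have "(\<integral>\<^sup>+x. ennreal (h x) \<partial>M) \<le> (\<integral>\<^sup>+x. ennreal a * ennreal (f x) + ennreal b * ennreal (g x) \<partial>M)"
    using assms by (intro nn_integral_mono) (auto simp flip: ennreal_mult'' ennreal_plus intro!: ennreal_leI)
  also have "\<dots> = ennreal a * (\<integral>\<^sup>+x. ennreal (f x) \<partial>M) + ennreal b * (\<integral>\<^sup>+x. ennreal (g x) \<partial>M)"
    by (subst nn_integral_add) (auto simp: nn_integral_cmult)
  also have "\<dots> \<le> ennreal a * ennreal C + ennreal b * ennreal D" using assms by (intro add_mono mult_left_mono) auto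
  also have "\<dots> = ennreal (a * C + b * D)" using assms by (simp flip: ennreal_mult'' ennreal_plus)
  finally show ?thesis .
qed

lemma mult_le_half_squares: "a * b \<le> (a\<^sup>2 + b\<^sup>2) / 2" for a b :: real
  using zero_le_power2[of "a - b"] by (simp add: power2_diff)

lemma abs_mult_le_half_squares: "\<bar>a * b\<bar> \<le> (a\<^sup>2 + b\<^sup>2) / 2" for a b :: real
  using mult_le_half_squares[of "\<bar>a\<bar>" "\<bar>b\<bar>"] by (simp add: abs_mult)

lemma exp_m32: "exp (- 32 * x) = exp (- 16 * x) * exp (- 16 * x)" for x :: real
  by (simp flip: exp_add)

text \<open>Everything that the later arguments use about the data. \<open>R\<close>,
  \<open>B\<close> and \<open>F\<close> are truncation levels for the projections, for
  \<open>\<sigma>2\<close> and for the target; they will grow with \<open>\<iota>\<close>, whereas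
  the moment bound \<open>K\<close> will not. \<open>Kf_tail\<close> and \<open>eta_eps\<close>
  spend one half each, so that the learned feature stays in \<open>[-1, 1]\<close>;
  \<open>eta_m1\<close> bounds the effect of the initial output; \<open>size\<close> turns counts in
  union bounds into \<open>exp \<iota>\<close>. \<open>eta_exp\<close> is crude and serves the
  inputs on which nothing better is known.\<close>

locale net_setup =
  fixes d n m1 m2 :: nat and \<nu> :: "vec measure" and fs :: "vec \<Rightarrow> real" and \<sigma>2 :: "real \<Rightarrow> real"
    and \<eta> \<iota> K R B F :: real
  assumes pos: "0 < d" "0 < n" "0 < m1" "0 < m2"
    and prob_nu: "prob_space \<nu>" and sets_nu [measurable_cong]: "sets \<nu> = sets (Rd d)"
    and fs_meas [measurable]: "fs \<in> borel_measurable (Rd d)"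
    and s2_meas [measurable]: "\<sigma>2 \<in> borel_measurable borel"
    and ge1: "1 \<le> K" "1 \<le> \<iota>" "1 \<le> B" "1 \<le> F"
    and s2_B: "\<And>z. \<bar>z\<bar> \<le> R \<Longrightarrow> \<bar>\<sigma>2 z\<bar> \<le> B"
    and s2_loc: "\<And>r. \<exists>b. \<forall>z. \<bar>z\<bar> \<le> r \<longrightarrow> \<bar>\<sigma>2 z\<bar> \<le> b"
    and s2_mom: "\<And>v. dotp d v v = 1 \<Longrightarrow> (\<integral>\<^sup>+x. ennreal ((\<sigma>2 (dotp d v x))^4) \<partial>\<nu>) \<le> ennreal K"
    and s2_tail: "\<And>v. dotp d v v = 1 \<Longrightarrow> emeasure \<nu> {x \<in> space \<nu>. R < \<bar>dotp d v x\<bar>} \<le> ennreal (exp (- 32 * \<iota>))"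
    and fs_4: "(\<integral>\<^sup>+x. ennreal ((fs x)^4) \<partial>\<nu>) \<le> ennreal K"
    and fs_2: "(\<integral>\<^sup>+x. ennreal ((fs x)^2) \<partial>\<nu>) \<le> 1"
    and fs_tail: "emeasure \<nu> {x \<in> space \<nu>. F < \<bar>fs x\<bar>} \<le> ennreal (exp (- 32 * \<iota>))"
    and Kf_tail: "emeasure \<nu> {x \<in> space \<nu>. 1 / 2 < \<bar>\<eta> * Kop d \<sigma>2 \<nu> fs x\<bar>} \<le> ennreal (exp (- 32 * \<iota>))"
    and n_large: "128 * K * F\<^sup>2 * B^4 * \<iota> \<le> real n"
    and m2_large: "128 * B^4 * \<iota> \<le> real m2"
    and m1_large: "128 * \<iota> \<le> real m1"
    and size: "real n * real m1 * real m2 \<le> exp \<iota>"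
    and eta0: "0 \<le> \<eta>" and eta_exp: "\<eta> \<le> exp \<iota>"
    and eta_eps: "\<eta> * (15 * K * (F * B\<^sup>2 * sqrt (\<iota> / n) + B\<^sup>2 * sqrt (\<iota> / m2))) \<le> 1 / 2"
    and eta_m1: "\<eta> * (12 * sqrt (\<iota> / m1)) \<le> 1"
begin

sublocale nu: prob_space \<nu> by (rule prob_nu)

abbreviation "\<tau> \<equiv> sphere_unif d"
abbreviation "MV \<equiv> Pi\<^sub>M {..<m2} (\<lambda>_. \<tau>)"
abbreviation "MX \<equiv> Pi\<^sub>M {..<n} (\<lambda>_. \<nu>)"
abbreviation "Kf \<equiv> Kop d \<sigma>2 \<nu> fs"

sublocale tau: prob_space \<tau> by (rule prob_space_sphere_unif) (rule pos)
sublocale MV: prob_space MV by (intro prob_space_PiM tau.prob_space_axioms)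
sublocale MX: prob_space MX by (intro prob_space_PiM nu.prob_space_axioms)
sublocale TN: pair_prob_space \<tau> \<nu> ..

lemma AE_tau_unit: "AE v in \<tau>. dotp d v v = 1"
  using AE_sphere_unif_unit pos by simp

lemma space_nu: "space \<nu> = space (Rd d)" using sets_eq_imp_space_eq[OF sets_nu] .
lemma space_tau: "space \<tau> = space (Rd d)" by (intro sets_eq_imp_space_eq sets_sphere_unif)

lemma size_le: "real n \<le> exp \<iota>" "real m1 \<le> exp \<iota>" "real m2 \<le> exp \<iota>"
proof -
  have *: "1 \<le> real n" "1 \<le> real m1" "1 \<le> real m2" using pos by auto
  have "real n * 1 * 1 \<le> real n * real m1 * real m2" "1 * real m1 * 1 \<le> real n * real m1 * real m2"
    "1 * 1 * real m2 \<le> real n * real m1 * real m2" using * by (intro mult_mono; simp)+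
  with size show "real n \<le> exp \<iota>" "real m1 \<le> exp \<iota>" "real m2 \<le> exp \<iota>" by auto
qed

lemma F2B4: "F\<^sup>2 * B^4 \<le> real n" "F\<^sup>2 * B^4 * \<iota> \<le> real n"
proof -
  have "1 * (F\<^sup>2 * B^4 * \<iota>) \<le> (128 * K) * (F\<^sup>2 * B^4 * \<iota>)" using ge1 by (intro mult_right_mono) auto
  also have "\<dots> \<le> n" using n_large by (simp add: ac_simps)
  finally show *: "F\<^sup>2 * B^4 * \<iota> \<le> real n" by simp
  have "F\<^sup>2 * B^4 * 1 \<le> F\<^sup>2 * B^4 * \<iota>" using ge1 by (intro mult_left_mono) auto
  with * show "F\<^sup>2 * B^4 \<le> real n" by simp
qed

text \<open>Cut off to zero and not clipped: \<open>sR\<close> and \<open>fF\<close> agree with the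
  originals off a rare event and are dominated by them in absolute value everywhere, so that moment
  bounds carry over.\<close>

definition sR :: "real \<Rightarrow> real" where "sR z = (if \<bar>z\<bar> \<le> R then \<sigma>2 z else 0)"
definition fF :: "vec \<Rightarrow> real" where "fF x = (if \<bar>fs x\<bar> \<le> F then fs x else 0)"

lemma sR_meas [measurable]: "sR \<in> borel_measurable borel" unfolding sR_def[abs_def] by measurable
lemma fF_meas [measurable]: "fF \<in> borel_measurable (Rd d)" unfolding fF_def[abs_def] by measurable
lemma sR_le: "\<bar>sR z\<bar> \<le> B" "\<bar>sR z\<bar> \<le> \<bar>\<sigma>2 z\<bar>" using s2_B ge1 by (auto simp: sR_def)
lemma fF_le: "\<bar>fF x\<bar> \<le> F" "\<bar>fF x\<bar> \<le> \<bar>fs x\<bar>" using ge1 by (auto simp: fF_def)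

lemma fs2': "(\<integral>\<^sup>+x. ennreal ((fs x)\<^sup>2) \<partial>\<nu>) \<le> ennreal 1" using fs_2 by simp

lemma s2_sq:
  assumes "dotp d v v = 1" "v \<in> space (Rd d)"
  shows "(\<integral>\<^sup>+x. ennreal ((\<sigma>2 (dotp d v x))\<^sup>2) \<partial>\<nu>) \<le> ennreal K"
proof -
  note assms(2)[measurable]
  have "(\<integral>\<^sup>+x. ennreal ((\<sigma>2 (dotp d v x))\<^sup>2) \<partial>\<nu>) \<le> ennreal (1/2 + 1/2 * K)"
  proof (rule nn_integral_le_affine[OF prob_nu _ s2_mom[OF assms(1)]])
    show "(\<sigma>2 (dotp d v x))\<^sup>2 \<le> 1/2 + 1/2 * (\<sigma>2 (dotp d v x))^4" for x
      using mult_le_half_squares[of 1 "(\<sigma>2 (dotp d v x))\<^sup>2"] by simp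
  qed (use ge1 in auto)
  also have "\<dots> \<le> ennreal K" using ge1 by (intro ennreal_leI) auto
  finally show ?thesis .
qed

lemma fs_s2_abs:
  assumes "dotp d v v = 1" "v \<in> space (Rd d)"
  shows "(\<integral>\<^sup>+x. ennreal \<bar>fs x * \<sigma>2 (dotp d v x)\<bar> \<partial>\<nu>) \<le> ennreal K"
proof -
  note assms(2)[measurable]
  have "(\<integral>\<^sup>+x. ennreal \<bar>fs x * \<sigma>2 (dotp d v x)\<bar> \<partial>\<nu>) \<le> ennreal (1/2 * 1 + 1/2 * K)"
  proof (rule nn_integral_add_le[OF _ _ fs2' s2_sq[OF assms]])
    show "\<bar>fs x * \<sigma>2 (dotp d v x)\<bar> \<le> 1/2 * (fs x)\<^sup>2 + 1/2 * (\<sigma>2 (dotp d v x))\<^sup>2" for x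
      using abs_mult_le_half_squares[of "fs x" "\<sigma>2 (dotp d v x)"] by (simp add: add_divide_distrib)
  qed (use ge1 in auto)
  also have "\<dots> \<le> ennreal K" using ge1 by (intro ennreal_leI) auto
  finally show ?thesis .
qed

lemma fs_s2_sq:
  assumes "dotp d v v = 1" "v \<in> space (Rd d)"
  shows "(\<integral>\<^sup>+x. ennreal ((fs x * \<sigma>2 (dotp d v x))\<^sup>2) \<partial>\<nu>) \<le> ennreal K"
proof -
  note assms(2)[measurable]
  have "(\<integral>\<^sup>+x. ennreal ((fs x * \<sigma>2 (dotp d v x))\<^sup>2) \<partial>\<nu>) \<le> ennreal (1/2 * K + 1/2 * K)"
  proof (rule nn_integral_add_le[OF _ _ fs_4 s2_mom[OF assms(1)]])
    show "(fs x * \<sigma>2 (dotp d v x))\<^sup>2 \<le> 1/2 * (fs x)^4 + 1/2 * (\<sigma>2 (dotp d v x))^4" for x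
      using mult_le_half_squares[of "(fs x)\<^sup>2" "(\<sigma>2 (dotp d v x))\<^sup>2"] by (simp add: power_mult_distrib add_divide_distrib)
  qed (use ge1 in auto)
  then show ?thesis by simp
qed

definition h :: "vec \<Rightarrow> real" where "h v = (\<integral>x. fs x * \<sigma>2 (dotp d v x) \<partial>\<nu>)"
definition hR :: "vec \<Rightarrow> real" where "hR v = (\<integral>x. fF x * sR (dotp d v x) \<partial>\<nu>)"

lemma h_meas [measurable]: "h \<in> borel_measurable (Rd d)"
  unfolding h_def[abs_def] by measurable

lemma hR_meas [measurable]: "hR \<in> borel_measurable (Rd d)"
  unfolding hR_def[abs_def] by measurable

lemma h_bound:
  assumes "dotp d v v = 1" "v \<in> space (Rd d)"
  shows "integrable \<nu> (\<lambda>x. fs x * \<sigma>2 (dotp d v x))" "\<bar>h v\<bar> \<le> K"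
proof -
  note assms(2)[measurable]
  show "integrable \<nu> (\<lambda>x. fs x * \<sigma>2 (dotp d v x))" "\<bar>h v\<bar> \<le> K"
    unfolding h_def using fs_s2_abs[OF assms] ge1 by (auto intro!: nn_integral_abs_bound)
qed

text \<open>The bound is \<open>B\<close> and not \<open>F * B\<close> because the second moment of
  the target is used in place of its truncation level. This keeps \<open>F\<close>, and with it
  \<open>ell\<close>, out of the requirement on \<open>m2\<close>.\<close>

lemma hR_bound:
  assumes "v \<in> space (Rd d)"
  shows "integrable \<nu> (\<lambda>x. fF x * sR (dotp d v x))" "\<bar>hR v\<bar> \<le> B"
proof -
  note assms(1)[measurable]
  have "(\<integral>\<^sup>+x. ennreal \<bar>fF x * sR (dotp d v x)\<bar> \<partial>\<nu>) \<le> ennreal (B / 2 + B / 2 * 1)"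
  proof (rule nn_integral_le_affine[OF prob_nu _ fs2'])
    fix x
    have "\<bar>fF x * sR (dotp d v x)\<bar> \<le> \<bar>fs x\<bar> * B"
      unfolding abs_mult using fF_le sR_le ge1 by (intro mult_mono) auto
    also have "\<dots> \<le> ((1 + (fs x)\<^sup>2) / 2) * B"
      using mult_le_half_squares[of 1 "\<bar>fs x\<bar>"] ge1 by (intro mult_right_mono) auto
    finally show "\<bar>fF x * sR (dotp d v x)\<bar> \<le> B / 2 + B / 2 * (fs x)\<^sup>2" by (simp add: field_simps)
  qed (use ge1 in auto)
  then have "(\<integral>\<^sup>+x. ennreal \<bar>fF x * sR (dotp d v x)\<bar> \<partial>\<nu>) \<le> ennreal B" by simp
  then show "integrable \<nu> (\<lambda>x. fF x * sR (dotp d v x))" "\<bar>hR v\<bar> \<le> B"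
    unfolding hR_def using ge1 by (auto intro!: nn_integral_abs_bound)
qed

text \<open>The two integrands differ only where a truncation is active. Young's inequality with
  parameter \<open>exp (- 16 * \<iota>)\<close> balances the second moment against a probability of
  order \<open>exp (- 32 * \<iota>)\<close>.\<close>

lemma h_diff:
  assumes v: "dotp d v v = 1" "v \<in> space (Rd d)"
  shows "\<bar>hR v - h v\<bar> \<le> 2 * K * exp (- 16 * \<iota>)"
proof -
  note v(2)[measurable]
  let ?A = "{x \<in> space \<nu>. F < \<bar>fs x\<bar> \<or> R < \<bar>dotp d v x\<bar>}"
  let ?f = "\<lambda>x. fF x * sR (dotp d v x) - fs x * \<sigma>2 (dotp d v x)"
  have A: "emeasure \<nu> ?A \<le> ennreal (exp (- 32 * \<iota>) + exp (- 32 * \<iota>))"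
    by (rule emeasure_Un_le) (use fs_tail s2_tail[OF v(1)] in auto)
  have "(\<integral>\<^sup>+x. ennreal \<bar>?f x\<bar> \<partial>\<nu>) \<le> (\<integral>\<^sup>+x. ennreal \<bar>fs x * \<sigma>2 (dotp d v x)\<bar> * indicator ?A x \<partial>\<nu>)"
    by (intro nn_integral_mono) (auto simp: fF_def sR_def split: split_indicator)
  also have "\<dots> \<le> ennreal ((exp (- 16 * \<iota>) * K + (exp (- 32 * \<iota>) + exp (- 32 * \<iota>)) / exp (- 16 * \<iota>)) / 2)"
    by (rule nn_integral_on_rare_event[OF _ _ _ _ _ fs_s2_sq[OF v] A]) (use ge1 in auto)
  also have "(exp (- 32 * \<iota>) + exp (- 32 * \<iota>)) / exp (- 16 * \<iota>) = 2 * exp (- 16 * \<iota>)"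
    unfolding exp_m32 by (simp add: field_simps)
  also have "(exp (- 16 * \<iota>) * K + 2 * exp (- 16 * \<iota>)) / 2 = exp (- 16 * \<iota>) * (K / 2 + 1)" by (simp add: field_simps)
  also have "\<dots> \<le> exp (- 16 * \<iota>) * (2 * K)" using ge1 by (intro mult_left_mono) auto
  finally have "(\<integral>\<^sup>+x. ennreal \<bar>?f x\<bar> \<partial>\<nu>) \<le> ennreal (2 * K * exp (- 16 * \<iota>))" by (simp add: ennreal_leI mult.commute)
  then have "\<bar>\<integral>x. ?f x \<partial>\<nu>\<bar> \<le> 2 * K * exp (- 16 * \<iota>)"
    by (rule nn_integral_abs_bound(2)[rotated]) (use ge1 in auto)
  then show ?thesis unfolding h_def hR_def
    using h_bound(1)[OF v] hR_bound(1)[OF v(2)] by simp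
qed

end

text \<open>\<open>bernstein_iid\<close> with the trivial variance \<open>b\<^sup>2\<close> and with
  \<open>32 * L\<close> for \<open>L\<close>. The constant 12 is \<open>2 * sqrt 32\<close> rounded
  up; the small failure probability is meant to survive Markov's inequality and union
  bounds.\<close>

lemma hoeffding_iid:
  assumes M: "prob_space M" and [measurable]: "f \<in> borel_measurable M"
    and bd: "\<And>x. x \<in> space M \<Longrightarrow> \<bar>f x\<bar> \<le> b" and b: "b > 0" and L: "0 < L" and n: "128 * L \<le> real n"
  shows "emeasure (Pi\<^sub>M {..<n} (\<lambda>_. M))
      {X \<in> space (Pi\<^sub>M {..<n} (\<lambda>_. M)). 12 * b * sqrt (L / n) < \<bar>(\<Sum>k<n. f (X k)) / n - (\<integral>x. f x \<partial>M)\<bar>}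
     \<le> ennreal (2 * exp (- 32 * L))"
proof -
  interpret M: prob_space M by fact
  let ?P = "Pi\<^sub>M {..<n} (\<lambda>_. M)"
  have n0: "n > 0" using n L by (intro gr0I) auto
  have sq: "(f x)\<^sup>2 \<le> b\<^sup>2" if "x \<in> space M" for x
    using bd[OF that] b by (simp add: abs_le_square_iff[symmetric])
  have "(\<integral>x. (f x)\<^sup>2 \<partial>M) \<le> b\<^sup>2"
    by (rule M.integral_le_const)
       (use sq in \<open>auto intro!: M.integrable_const_bound[where B="b\<^sup>2"]\<close>)
  then have main: "emeasure ?P {X \<in> space ?P. 2 * sqrt (b\<^sup>2 * (32 * L) / n) < \<bar>(\<Sum>k<n. f (X k)) / n - (\<integral>x. f x \<partial>M)\<bar>}
      \<le> ennreal (2 * exp (- (32 * L)))"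
    using b L n by (intro bernstein_iid[OF M, of f b "b\<^sup>2" "32 * L" n] bd n0) (auto simp: mult.commute mult.left_commute)
  have "2 * sqrt (b\<^sup>2 * (32 * L) / n) \<le> 12 * b * sqrt (L / n)"
  proof -
    have "sqrt 32 \<le> 6" by (intro real_le_lsqrt) auto
    have "2 * sqrt (b\<^sup>2 * (32 * L) / n) = 2 * b * sqrt 32 * sqrt (L / n)"
      using b by (simp add: real_sqrt_mult real_sqrt_divide)
    also have "\<dots> \<le> 2 * b * 6 * sqrt (L / n)"
      using \<open>sqrt 32 \<le> 6\<close> b L by (intro mult_right_mono mult_left_mono) auto
    finally show ?thesis by simp
  qed
  then have "{X \<in> space ?P. 12 * b * sqrt (L / n) < \<bar>(\<Sum>k<n. f (X k)) / n - (\<integral>x. f x \<partial>M)\<bar>}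
      \<subseteq> {X \<in> space ?P. 2 * sqrt (b\<^sup>2 * (32 * L) / n) < \<bar>(\<Sum>k<n. f (X k)) / n - (\<integral>x. f x \<partial>M)\<bar>}"
    by auto
  then have "emeasure ?P {X \<in> space ?P. 12 * b * sqrt (L / n) < \<bar>(\<Sum>k<n. f (X k)) / n - (\<integral>x. f x \<partial>M)\<bar>}
      \<le> emeasure ?P {X \<in> space ?P. 2 * sqrt (b\<^sup>2 * (32 * L) / n) < \<bar>(\<Sum>k<n. f (X k)) / n - (\<integral>x. f x \<partial>M)\<bar>}"
    by (intro emeasure_mono) auto
  also note main
  finally show ?thesis by simp
qed

text \<open>An exchange of quantifiers: a bound at each fixed \<open>y\<close> becomes, outside an
  event of probability \<open>c / e\<close>, a bound at all \<open>y\<close> but a set of measure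
  \<open>e\<close>. It is Markov's inequality for the measure of the bad slice, whose mean Fubini's
  theorem computes.\<close>

lemma fubini_markov:
  assumes M: "prob_space M" and N: "prob_space N" and A: "A \<in> sets (M \<Otimes>\<^sub>M N)" and e: "e > 0" and c: "0 \<le> c"
    and le: "\<And>y. y \<in> space N \<Longrightarrow> emeasure M {x \<in> space M. (x, y) \<in> A} \<le> ennreal c"
  shows "{x \<in> space M. ennreal e < emeasure N {y \<in> space N. (x, y) \<in> A}} \<in> sets M"
    and "emeasure M {x \<in> space M. ennreal e < emeasure N {y \<in> space N. (x, y) \<in> A}} \<le> ennreal (c / e)"
proof -
  interpret M: prob_space M by fact
  interpret N: prob_space N by fact
  have eq: "Pair x -` A = {y \<in> space N. (x, y) \<in> A}" for x
    using sets.sets_into_space[OF A] by (auto simp: space_pair_measure)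
  have [measurable]: "(\<lambda>x. emeasure N {y \<in> space N. (x, y) \<in> A}) \<in> borel_measurable M"
    using N.measurable_emeasure_Pair[OF A] by (simp add: eq)
  show "{x \<in> space M. ennreal e < emeasure N {y \<in> space N. (x, y) \<in> A}} \<in> sets M" by measurable
  have "{x \<in> space M. ennreal e < emeasure N {y \<in> space N. (x, y) \<in> A}}
     \<subseteq> {x \<in> space M. 1 \<le> ennreal (1 / e) * emeasure N {y \<in> space N. (x, y) \<in> A}}"
  proof safe
    fix x assume "ennreal e < emeasure N {y \<in> space N. (x, y) \<in> A}"
    then have "ennreal (1 / e) * ennreal e \<le> ennreal (1 / e) * emeasure N {y \<in> space N. (x, y) \<in> A}"
      by (intro mult_left_mono) auto
    then show "1 \<le> ennreal (1 / e) * emeasure N {y \<in> space N. (x, y) \<in> A}"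
      using e by (simp flip: ennreal_mult'')
  qed
  then have "emeasure M {x \<in> space M. ennreal e < emeasure N {y \<in> space N. (x, y) \<in> A}}
     \<le> emeasure M {x \<in> space M. 1 \<le> ennreal (1 / e) * emeasure N {y \<in> space N. (x, y) \<in> A}}"
    by (intro emeasure_mono) auto
  also have "\<dots> \<le> ennreal (1 / e) * (\<integral>\<^sup>+x. emeasure N {y \<in> space N. (x, y) \<in> A} * indicator (space M) x \<partial>M)"
    by (intro nn_integral_Markov_inequality) auto
  also have "(\<integral>\<^sup>+x. emeasure N {y \<in> space N. (x, y) \<in> A} * indicator (space M) x \<partial>M) = emeasure (M \<Otimes>\<^sub>M N) A"
    by (subst N.emeasure_pair_measure_alt[OF A]) (auto simp: eq intro!: nn_integral_cong)
  also have "\<dots> \<le> ennreal c" by (rule emeasure_pair_le2[OF M N A le])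
  finally show "emeasure M {x \<in> space M. ennreal e < emeasure N {y \<in> space N. (x, y) \<in> A}} \<le> ennreal (c / e)"
    using e c by (simp add: mult_left_mono flip: ennreal_mult'')
qed

context net_setup
begin

text \<open>The kernel operator with activations and target truncated: the centre around which the
  truncated empirical feature concentrates.\<close>

definition KR :: "vec \<Rightarrow> real" where "KR x = (\<integral>v. sR (dotp d v x) * hR v \<partial>\<tau>)"

text \<open>The mass of the activation beyond the truncation radius at one input. Its smallness is
  the condition on \<open>x\<close> that brings \<open>KR x\<close> close to
  \<open>Kf x\<close>.\<close>

definition U :: "vec \<Rightarrow> ennreal" where
  "U x = (\<integral>\<^sup>+v. ennreal \<bar>\<sigma>2 (dotp d v x)\<bar> * indicator {v. R < \<bar>dotp d v x\<bar>} v \<partial>\<tau>)"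

lemma KR_meas [measurable]: "KR \<in> borel_measurable (Rd d)"
  unfolding KR_def[abs_def] by measurable

text \<open>Against a unit vector the projection of \<open>x\<close> is at most the sum of its
  absolute coordinates, and \<open>\<sigma>2\<close> is bounded on bounded sets. Thus the integrals
  over directions exist at every input, not only almost everywhere.\<close>

lemma Kf_integrand_bound:
  assumes x: "x \<in> space (Rd d)"
  obtains b where "0 \<le> b" "\<And>v. dotp d v v = 1 \<Longrightarrow> \<bar>\<sigma>2 (dotp d v x)\<bar> \<le> b"
proof -
  define r where "r = (\<Sum>k<d. \<bar>x k\<bar>)"
  from s2_loc[of r] obtain b where b: "\<And>z. \<bar>z\<bar> \<le> r \<Longrightarrow> \<bar>\<sigma>2 z\<bar> \<le> b" by auto
  have "\<bar>dotp d v x\<bar> \<le> r" if v: "dotp d v v = 1" for v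
  proof -
    have v1: "\<bar>v k\<bar> \<le> 1" if "k < d" for k
    proof -
      have "v k * v k \<le> dotp d v v" unfolding dotp_def using that by (intro member_le_sum) auto
      then show ?thesis using v abs_square_le_1[of "v k"] by (simp add: power2_eq_square)
    qed
    have "\<bar>dotp d v x\<bar> \<le> (\<Sum>k<d. \<bar>v k * x k\<bar>)" unfolding dotp_def by (rule sum_abs)
    also have "\<dots> \<le> r" unfolding r_def
    proof (rule sum_mono)
      fix k assume "k \<in> {..<d}"
      then show "\<bar>v k * x k\<bar> \<le> \<bar>x k\<bar>" using mult_right_mono[OF v1[of k], of "\<bar>x k\<bar>"] by (simp add: abs_mult)
    qed
    finally show ?thesis .
  qed
  with b have "dotp d v v = 1 \<Longrightarrow> \<bar>\<sigma>2 (dotp d v x)\<bar> \<le> max 0 b" for v by (meson max.coboundedI2)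
  then show thesis by (intro that[of "max 0 b"]) auto
qed

text \<open>Fubini's theorem: integrating over the second input first shows \<open>Kf x\<close> as
  an average over directions, weighted by the correlation \<open>h v\<close> of the target with
  direction \<open>v\<close>. The hidden units sample this average.\<close>

lemma Kf_eq:
  assumes x: "x \<in> space (Rd d)"
  shows "Kf x = (\<integral>v. \<sigma>2 (dotp d v x) * h v \<partial>\<tau>)" "integrable \<tau> (\<lambda>v. \<sigma>2 (dotp d v x) * h v)"
proof -
  note x[measurable]
  obtain b where b: "0 \<le> b" "\<And>v. dotp d v v = 1 \<Longrightarrow> \<bar>\<sigma>2 (dotp d v x)\<bar> \<le> b"
    using Kf_integrand_bound[OF x] by blast
  let ?f = "\<lambda>v x'. \<sigma>2 (dotp d x v) * \<sigma>2 (dotp d x' v) * fs x'"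
  have f_eq: "?f v x' = \<sigma>2 (dotp d v x) * (fs x' * \<sigma>2 (dotp d v x'))" for v x'
    by (simp add: dotp_commute ac_simps)
  have meas: "case_prod ?f \<in> borel_measurable (\<tau> \<Otimes>\<^sub>M \<nu>)" by measurable
  have "(\<integral>\<^sup>+p. ennreal \<bar>case_prod ?f p\<bar> \<partial>(\<tau> \<Otimes>\<^sub>M \<nu>)) = (\<integral>\<^sup>+v. \<integral>\<^sup>+x'. ennreal \<bar>?f v x'\<bar> \<partial>\<nu> \<partial>\<tau>)"
    using meas by (subst nu.nn_integral_fst[symmetric]) auto
  also have "\<dots> \<le> (\<integral>\<^sup>+v. ennreal (b * K) \<partial>\<tau>)"
  proof (rule nn_integral_mono_AE, use AE_tau_unit AE_space in eventually_elim)
    fix v assume v: "dotp d v v = 1" "v \<in> space \<tau>"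
    then have v': "v \<in> space (Rd d)" by (simp add: space_tau)
    note v'[measurable]
    have "(\<integral>\<^sup>+x'. ennreal \<bar>?f v x'\<bar> \<partial>\<nu>) \<le> (\<integral>\<^sup>+x'. ennreal b * ennreal \<bar>fs x' * \<sigma>2 (dotp d v x')\<bar> \<partial>\<nu>)"
    proof (rule nn_integral_mono)
      fix x'
      show "ennreal \<bar>?f v x'\<bar> \<le> ennreal b * ennreal \<bar>fs x' * \<sigma>2 (dotp d v x')\<bar>"
        unfolding f_eq using b(1) mult_right_mono[OF b(2)[OF v(1)], of "\<bar>fs x' * \<sigma>2 (dotp d v x')\<bar>"]
        by (simp add: abs_mult ennreal_leI flip: ennreal_mult'')
    qed
    also have "\<dots> = ennreal b * (\<integral>\<^sup>+x'. ennreal \<bar>fs x' * \<sigma>2 (dotp d v x')\<bar> \<partial>\<nu>)"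
      by (rule nn_integral_cmult) measurable
    also have "\<dots> \<le> ennreal b * ennreal K" using fs_s2_abs[OF v(1) v'] by (intro mult_left_mono) auto
    also have "\<dots> = ennreal (b * K)" using b(1) ge1 by (simp flip: ennreal_mult'')
    finally show "(\<integral>\<^sup>+x'. ennreal \<bar>?f v x'\<bar> \<partial>\<nu>) \<le> ennreal (b * K)" .
  qed
  also have "\<dots> = ennreal (b * K)" by (simp add: tau.emeasure_space_1)
  finally have int: "integrable (\<tau> \<Otimes>\<^sub>M \<nu>) (case_prod ?f)"
    using meas by (intro nn_integral_abs_bound(1)[of _ _ "b * K"]) (use b ge1 in auto)
  have inner: "(\<integral>x'. ?f v x' \<partial>\<nu>) = \<sigma>2 (dotp d v x) * h v" for v
    unfolding f_eq h_def by simp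
  have "Kf x = (\<integral>x'. (\<integral>v. ?f v x' \<partial>\<tau>) \<partial>\<nu>)"
    by (simp add: Kop_def kernel_def)
  also have "\<dots> = (\<integral>v. (\<integral>x'. ?f v x' \<partial>\<nu>) \<partial>\<tau>)"
    by (rule TN.Fubini_integral[OF int])
  also have "\<dots> = (\<integral>v. \<sigma>2 (dotp d v x) * h v \<partial>\<tau>)" by (simp only: inner)
  finally show "Kf x = (\<integral>v. \<sigma>2 (dotp d v x) * h v \<partial>\<tau>)" by simp
  show "integrable \<tau> (\<lambda>v. \<sigma>2 (dotp d v x) * h v)"
    using TN.integrable_fst'[OF int] by (simp add: inner del: integrable_mult_right_iff)
qed

lemma Kf_meas [measurable]: "Kf \<in> borel_measurable (Rd d)"
proof -
  have "(\<lambda>x. \<integral>v. \<sigma>2 (dotp d v x) * h v \<partial>\<tau>) \<in> borel_measurable (Rd d)" by measurable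
  then show ?thesis by (rule measurable_cong[THEN iffD1, rotated]) (simp add: Kf_eq)
qed

lemma U_meas [measurable]: "U \<in> borel_measurable (Rd d)"
  unfolding U_def[abs_def] by measurable

lemma U_int: "(\<integral>\<^sup>+x. U x \<partial>\<nu>) \<le> ennreal (K * exp (- 16 * \<iota>))"
proof -
  have "(\<integral>\<^sup>+x. U x \<partial>\<nu>) = (\<integral>\<^sup>+v. \<integral>\<^sup>+x. ennreal \<bar>\<sigma>2 (dotp d v x)\<bar> * indicator {v. R < \<bar>dotp d v x\<bar>} v \<partial>\<nu> \<partial>\<tau>)"
    unfolding U_def by (rule TN.Fubini') measurable
  also have "\<dots> \<le> (\<integral>\<^sup>+v. ennreal (K * exp (- 16 * \<iota>)) \<partial>\<tau>)"
  proof (rule nn_integral_mono_AE, use AE_tau_unit AE_space in eventually_elim)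
    fix v assume v: "dotp d v v = 1" "v \<in> space \<tau>"
    then have v': "v \<in> space (Rd d)" by (simp add: space_tau)
    note v'[measurable]
    let ?A = "{x \<in> space \<nu>. R < \<bar>dotp d v x\<bar>}"
    have "(\<integral>\<^sup>+x. ennreal \<bar>\<sigma>2 (dotp d v x)\<bar> * indicator {v. R < \<bar>dotp d v x\<bar>} v \<partial>\<nu>)
      = (\<integral>\<^sup>+x. ennreal \<bar>\<sigma>2 (dotp d v x)\<bar> * indicator ?A x \<partial>\<nu>)"
      by (intro nn_integral_cong) (auto split: split_indicator)
    also have "\<dots> \<le> ennreal ((exp (- 16 * \<iota>) * K + exp (- 32 * \<iota>) / exp (- 16 * \<iota>)) / 2)"
      by (rule nn_integral_on_rare_event[OF _ _ _ _ _ s2_sq[OF v(1) v'] s2_tail[OF v(1)]]) (use ge1 in auto)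
    also have "exp (- 32 * \<iota>) / exp (- 16 * \<iota>) = exp (- 16 * \<iota>)" unfolding exp_m32 by simp
    also have "(exp (- 16 * \<iota>) * K + exp (- 16 * \<iota>)) / 2 = exp (- 16 * \<iota>) * ((K + 1) / 2)" by (simp add: field_simps)
    also have "\<dots> \<le> exp (- 16 * \<iota>) * K" using ge1 by (intro mult_left_mono) auto
    finally show "(\<integral>\<^sup>+x. ennreal \<bar>\<sigma>2 (dotp d v x)\<bar> * indicator {v. R < \<bar>dotp d v x\<bar>} v \<partial>\<nu>) \<le> ennreal (K * exp (- 16 * \<iota>))"
      by (simp add: ennreal_leI mult.commute)
  qed
  also have "\<dots> = ennreal (K * exp (- 16 * \<iota>))" by (simp add: tau.emeasure_space_1)
  finally show ?thesis .
qed

text \<open>Markov's inequality splits the exponent 16 of \<open>U_int\<close> into 12 for the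
  measure of exceptional inputs and 4 for the size of \<open>U\<close> at the others.\<close>

lemma U_tail: "emeasure \<nu> {x \<in> space \<nu>. ennreal (exp (- 4 * \<iota>)) < U x} \<le> ennreal (K * exp (- 12 * \<iota>))"
proof -
  have "{x \<in> space \<nu>. ennreal (exp (- 4 * \<iota>)) < U x} \<subseteq> {x \<in> space \<nu>. 1 \<le> ennreal (exp (4 * \<iota>)) * U x}"
  proof safe
    fix x assume "ennreal (exp (- 4 * \<iota>)) < U x"
    then have "ennreal (exp (4 * \<iota>)) * ennreal (exp (- 4 * \<iota>)) \<le> ennreal (exp (4 * \<iota>)) * U x"
      by (intro mult_left_mono) auto
    then show "1 \<le> ennreal (exp (4 * \<iota>)) * U x" by (simp flip: ennreal_mult'' exp_add)
  qed
  then have "emeasure \<nu> {x \<in> space \<nu>. ennreal (exp (- 4 * \<iota>)) < U x} \<le> emeasure \<nu> {x \<in> space \<nu>. 1 \<le> ennreal (exp (4 * \<iota>)) * U x}"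
    by (intro emeasure_mono) measurable
  also have "\<dots> \<le> ennreal (exp (4 * \<iota>)) * (\<integral>\<^sup>+x. U x * indicator (space \<nu>) x \<partial>\<nu>)"
    by (intro nn_integral_Markov_inequality) auto
  also have "(\<integral>\<^sup>+x. U x * indicator (space \<nu>) x \<partial>\<nu>) = (\<integral>\<^sup>+x. U x \<partial>\<nu>)" by (intro nn_integral_cong) auto
  also have "ennreal (exp (4 * \<iota>)) * (\<integral>\<^sup>+x. U x \<partial>\<nu>) \<le> ennreal (exp (4 * \<iota>)) * ennreal (K * exp (- 16 * \<iota>))"
    by (intro mult_left_mono U_int) auto
  also have "\<dots> = ennreal (K * exp (- 12 * \<iota>))"
    using ge1 by (simp add: mult.left_commute flip: ennreal_mult'' exp_add)
  finally show ?thesis .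
qed

lemma KR_diff:
  assumes x: "x \<in> space \<nu>" and Ux: "U x \<le> ennreal (exp (- 4 * \<iota>))"
  shows "\<bar>KR x - Kf x\<bar> \<le> 3 * K * exp (- 4 * \<iota>)"
proof -
  have x': "x \<in> space (Rd d)" using x space_nu by simp
  note x'[measurable]
  have iR: "integrable \<tau> (\<lambda>v. sR (dotp d v x) * hR v)"
  proof (rule tau.integrable_const_bound[where B="B * B"])
    show "AE v in \<tau>. norm (sR (dotp d v x) * hR v) \<le> B * B"
      using AE_space by eventually_elim (use sR_le hR_bound ge1 in \<open>auto simp: abs_mult space_tau intro!: mult_mono\<close>)
  qed measurable
  let ?f = "\<lambda>v. sR (dotp d v x) * hR v - \<sigma>2 (dotp d v x) * h v"
  let ?c = "B * (2 * K * exp (- 16 * \<iota>))"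
  have "(\<integral>\<^sup>+v. ennreal \<bar>?f v\<bar> \<partial>\<tau>)
    \<le> (\<integral>\<^sup>+v. ennreal ?c + ennreal K * (ennreal \<bar>\<sigma>2 (dotp d v x)\<bar> * indicator {v. R < \<bar>dotp d v x\<bar>} v) \<partial>\<tau>)"
  proof (rule nn_integral_mono_AE, use AE_tau_unit AE_space in eventually_elim)
    fix v assume v: "dotp d v v = 1" "v \<in> space \<tau>"
    then have v': "v \<in> space (Rd d)" by (simp add: space_tau)
    \<comment> \<open>One factor is exchanged at a time: the first difference is small uniformly in
      \<open>v\<close> by \<open>h_diff\<close>, the second integrates to a multiple of
      \<open>U x\<close>.\<close>
    have "?f v = sR (dotp d v x) * (hR v - h v) + (sR (dotp d v x) - \<sigma>2 (dotp d v x)) * h v" by (simp add: algebra_simps)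
    then have "\<bar>?f v\<bar> \<le> \<bar>sR (dotp d v x)\<bar> * \<bar>hR v - h v\<bar> + \<bar>sR (dotp d v x) - \<sigma>2 (dotp d v x)\<bar> * \<bar>h v\<bar>"
      using abs_triangle_ineq by (simp flip: abs_mult)
    also have "\<dots> \<le> ?c + \<bar>sR (dotp d v x) - \<sigma>2 (dotp d v x)\<bar> * K"
      using sR_le(1) h_diff[OF v(1) v'] h_bound(2)[OF v(1) v'] ge1 by (intro add_mono mult_mono) auto
    finally have "ennreal \<bar>?f v\<bar> \<le> ennreal ?c + ennreal K * ennreal \<bar>sR (dotp d v x) - \<sigma>2 (dotp d v x)\<bar>"
      using ge1 by (simp add: ennreal_leI mult.commute flip: ennreal_mult'' ennreal_plus)
    also have "ennreal \<bar>sR (dotp d v x) - \<sigma>2 (dotp d v x)\<bar> = ennreal \<bar>\<sigma>2 (dotp d v x)\<bar> * indicator {v. R < \<bar>dotp d v x\<bar>} v"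
      by (auto simp: sR_def split: split_indicator)
    finally show "ennreal \<bar>?f v\<bar> \<le> ennreal ?c + ennreal K * (ennreal \<bar>\<sigma>2 (dotp d v x)\<bar> * indicator {v. R < \<bar>dotp d v x\<bar>} v)" .
  qed
  also have "\<dots> = ennreal ?c + ennreal K * U x"
    unfolding U_def by (subst nn_integral_add) (auto simp: nn_integral_cmult tau.emeasure_space_1)
  also have "\<dots> \<le> ennreal ?c + ennreal K * ennreal (exp (- 4 * \<iota>))"
    using Ux by (intro add_left_mono mult_left_mono) auto
  also have "\<dots> = ennreal (?c + K * exp (- 4 * \<iota>))" using ge1 by (simp flip: ennreal_mult'' ennreal_plus)
  also have "?c + K * exp (- 4 * \<iota>) \<le> 3 * K * exp (- 4 * \<iota>)"
  proof -
    \<comment> \<open>The level \<open>B\<close> is swallowed by the sample size: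
      \<open>B \<le> F\<^sup>2 * B^4 \<le> n \<le> exp \<iota>\<close>.\<close>
    have "B * 1 \<le> B * (B^3 * F\<^sup>2)" using ge1 one_le_power[of B 3] one_le_power[of F 2] by (intro mult_left_mono) (auto intro: mult_ge1_I)
    also have "\<dots> = F\<^sup>2 * B^4" by (simp add: power_numeral_reduce)
    also have "\<dots> \<le> exp \<iota>" using F2B4 size_le by linarith
    finally have "B * exp (- 16 * \<iota>) \<le> exp \<iota> * exp (- 16 * \<iota>)" by (intro mult_right_mono) auto
    also have "\<dots> \<le> exp (- 4 * \<iota>)" using ge1 by (simp flip: exp_add)
    finally have "2 * K * (B * exp (- 16 * \<iota>)) \<le> 2 * K * exp (- 4 * \<iota>)" using ge1 by (intro mult_left_mono) auto
    then show ?thesis by (simp add: algebra_simps)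
  qed
  finally have "(\<integral>\<^sup>+v. ennreal \<bar>?f v\<bar> \<partial>\<tau>) \<le> ennreal (3 * K * exp (- 4 * \<iota>))" by (simp add: ennreal_leI)
  then have "\<bar>\<integral>v. ?f v \<partial>\<tau>\<bar> \<le> 3 * K * exp (- 4 * \<iota>)"
    by (rule nn_integral_abs_bound(2)[rotated]) (use ge1 in auto)
  then show ?thesis using iR Kf_eq[OF x'] by (simp add: KR_def)
qed

end

lemma emeasure_PiM_component:
  assumes "prob_space M" "i \<in> I" "{x \<in> space M. Q x} \<in> sets M"
  shows "{X \<in> space (Pi\<^sub>M I (\<lambda>_. M)). Q (X i)} \<in> sets (Pi\<^sub>M I (\<lambda>_. M))"
    "emeasure (Pi\<^sub>M I (\<lambda>_. M)) {X \<in> space (Pi\<^sub>M I (\<lambda>_. M)). Q (X i)} = emeasure M {x \<in> space M. Q x}"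
proof -
  let ?P = "Pi\<^sub>M I (\<lambda>_. M)"
  have m: "(\<lambda>X. X i) \<in> measurable ?P M" using assms(2) by (rule measurable_component_singleton)
  have eq: "(\<lambda>X. X i) -` {x \<in> space M. Q x} \<inter> space ?P = {X \<in> space ?P. Q (X i)}"
    using measurable_space[OF m] by auto
  show "{X \<in> space ?P. Q (X i)} \<in> sets ?P" using measurable_sets[OF m assms(3)] unfolding eq .
  have "emeasure M {x \<in> space M. Q x} = emeasure (distr ?P M (\<lambda>X. X i)) {x \<in> space M. Q x}"
    using assms by (subst distr_PiM_component) auto
  also have "\<dots> = emeasure ?P {X \<in> space ?P. Q (X i)}"
    by (subst emeasure_distr[OF m assms(3)]) (simp only: eq)
  finally show "emeasure ?P {X \<in> space ?P. Q (X i)} = emeasure M {x \<in> space M. Q x}" by simp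
qed

lemma power4_mean_le:
  fixes u :: "nat \<Rightarrow> real"
  assumes "m > 0"
  shows "((\<Sum>j<m. u j) / m)^4 \<le> (\<Sum>j<m. (u j)^4) / m"
proof -
  have sq: "((\<Sum>j<m. w j) / m)\<^sup>2 \<le> (\<Sum>j<m. (w j)\<^sup>2) / m" for w :: "nat \<Rightarrow> real"
  proof -
    have "(\<Sum>j<m. w j * 1)\<^sup>2 \<le> (\<Sum>j<m. (w j)\<^sup>2) * (\<Sum>j<m. 1\<^sup>2)" by (rule Cauchy_Schwarz_ineq_sum)
    then have "(\<Sum>j<m. w j)\<^sup>2 \<le> (\<Sum>j<m. (w j)\<^sup>2) * m" by simp
    then show ?thesis using assms by (simp add: power_divide field_simps power2_eq_square)
  qed
  have "((\<Sum>j<m. u j) / m)^4 = (((\<Sum>j<m. u j) / m)\<^sup>2)\<^sup>2" by simp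
  also have "\<dots> \<le> ((\<Sum>j<m. (u j)\<^sup>2) / m)\<^sup>2" by (intro power_mono sq) simp
  also have "\<dots> \<le> (\<Sum>j<m. ((u j)\<^sup>2)\<^sup>2) / m" by (rule sq)
  finally show ?thesis by simp
qed

lemma measurable_feat:
  assumes V: "f \<in> measurable N (Pi\<^sub>M {..<m2} (\<lambda>_. P))" and X: "g \<in> measurable N (Pi\<^sub>M {..<n} (\<lambda>_. Q))" and x: "e \<in> measurable N (Rd d)"
    and P: "sets P = sets (Rd d)" and Q: "sets Q = sets (Rd d)"
    and s: "s \<in> borel_measurable borel" and y: "y \<in> borel_measurable (Rd d)"
  shows "(\<lambda>\<omega>. feat d n m2 s y (f \<omega>) (g \<omega>) (e \<omega>)) \<in> borel_measurable N"
proof -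
  have Vj: "(\<lambda>\<omega>. f \<omega> j) \<in> measurable N (Rd d)" if "j \<in> {..<m2}" for j
    using measurable_compose[OF V measurable_component_singleton[OF that]] measurable_cong_sets[OF refl P] by blast
  have Xk: "(\<lambda>\<omega>. g \<omega> k) \<in> measurable N (Rd d)" if "k \<in> {..<n}" for k
    using measurable_compose[OF X measurable_component_singleton[OF that]] measurable_cong_sets[OF refl Q] by blast
  show ?thesis unfolding feat_def
    by (intro borel_measurable_divide borel_measurable_sum borel_measurable_times borel_measurable_const
        measurable_compose[OF _ s] measurable_compose[OF _ y] measurable_dotp Vj Xk x)
qed

context net_setup
begin

lemma V_comp: "f \<in> measurable N MV \<Longrightarrow> j < m2 \<Longrightarrow> (\<lambda>\<omega>. f \<omega> j) \<in> measurable N (Rd d)"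
  using measurable_compose[OF _ measurable_component_singleton, of f N "{..<m2}" "\<lambda>_. \<tau>" j]
    measurable_cong_sets[OF refl sets_sphere_unif] by blast

lemma X_comp: "f \<in> measurable N MX \<Longrightarrow> k < n \<Longrightarrow> (\<lambda>\<omega>. f \<omega> k) \<in> measurable N (Rd d)"
  using measurable_compose[OF _ measurable_component_singleton, of f N "{..<n}" "\<lambda>_. \<nu>" k]
    measurable_cong_sets[OF refl sets_nu] by blast

lemma V_space: "V \<in> space MV \<Longrightarrow> j < m2 \<Longrightarrow> V j \<in> space (Rd d)"
  using space_tau by (auto simp: space_PiM)

lemma X_space: "X \<in> space MX \<Longrightarrow> k < n \<Longrightarrow> X k \<in> space (Rd d)" "X \<in> space MX \<Longrightarrow> k < n \<Longrightarrow> X k \<in> space \<nu>"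
  using space_nu by (auto simp: space_PiM)

lemma feat_meas [measurable (raw)]:
  assumes "f \<in> measurable N MV" "g \<in> measurable N MX" "e \<in> measurable N (Rd d)"
    and "s \<in> borel_measurable borel" "y \<in> borel_measurable (Rd d)"
  shows "(\<lambda>\<omega>. feat d n m2 s y (f \<omega>) (g \<omega>) (e \<omega>)) \<in> borel_measurable N"
  by (rule measurable_feat[OF assms(1-3) sets_sphere_unif sets_nu assms(4,5)])

definition gR :: "(nat \<Rightarrow> vec) \<Rightarrow> (nat \<Rightarrow> vec) \<Rightarrow> vec \<Rightarrow> real" where
  "gR V X x = feat d n m2 sR fF V X x"

text \<open>The expectation of \<open>gR V X x\<close> over the samples for frozen directions. It
  separates the sampling error from the error made by finitely many hidden units;
  \<open>tdev\<close> adds the two deviations.\<close>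

definition mid :: "(nat \<Rightarrow> vec) \<Rightarrow> vec \<Rightarrow> real" where
  "mid V x = (\<Sum>j<m2. sR (dotp d (V j) x) * hR (V j)) / m2"

definition tdev :: real where
  "tdev = 12 * (F * (B * B)) * sqrt (\<iota> / n) + 12 * (B * B) * sqrt (\<iota> / m2)"

lemma gR_meas [measurable (raw)]:
  assumes [measurable]: "f \<in> measurable N MV" "g \<in> measurable N MX" "e \<in> measurable N (Rd d)"
  shows "(\<lambda>\<omega>. gR (f \<omega>) (g \<omega>) (e \<omega>)) \<in> borel_measurable N"
  unfolding gR_def by measurable

lemma mid_meas [measurable (raw)]:
  assumes "f \<in> measurable N MV" and e [measurable]: "e \<in> measurable N (Rd d)"
  shows "(\<lambda>\<omega>. mid (f \<omega>) (e \<omega>)) \<in> borel_measurable N"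
proof -
  have [measurable]: "(\<lambda>\<omega>. f \<omega> j) \<in> measurable N (Rd d)" if "j \<in> {..<m2}" for j
    using V_comp assms that by auto
  show ?thesis unfolding mid_def by measurable
qed

lemma n128: "128 * \<iota> \<le> real n" "128 * \<iota> \<le> real m2"
proof -
  have B4: "1 \<le> B^4" using ge1 by simp
  have KF: "1 \<le> K * (F\<^sup>2 * B^4)" using ge1 B4 one_le_power[of F 2] by (intro mult_ge1_I) auto
  have "128 * \<iota> * 1 \<le> 128 * \<iota> * (K * (F\<^sup>2 * B^4))" using KF ge1 by (intro mult_left_mono) auto
  then show "128 * \<iota> \<le> real n" using n_large by (simp add: ac_simps)
  have "128 * \<iota> * 1 \<le> 128 * \<iota> * B^4" using B4 ge1 by (intro mult_left_mono) auto
  then show "128 * \<iota> \<le> real m2" using m2_large by (simp add: ac_simps)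
qed

text \<open>Once the two sums are exchanged, \<open>gR\<close> is for frozen directions an empirical
  mean over samples of a function bounded by \<open>F * B\<^sup>2\<close>.\<close>

lemma gR_conc:
  assumes V: "V \<in> space MV" and x: "x \<in> space (Rd d)"
  shows "emeasure MX {X \<in> space MX. 12 * (F * (B * B)) * sqrt (\<iota> / n) < \<bar>gR V X x - mid V x\<bar>} \<le> ennreal (2 * exp (- 32 * \<iota>))"
proof -
  note x[measurable]
  have Vj [measurable]: "V j \<in> space (Rd d)" if "j \<in> {..<m2}" for j using V_space[OF V] that by auto
  let ?f = "\<lambda>x'. fF x' * ((\<Sum>j<m2. sR (dotp d (V j) x) * sR (dotp d (V j) x')) / m2)"
  have gR: "gR V X x = (\<Sum>k<n. ?f (X k)) / n" for X
  proof -
    have "gR V X x = (\<Sum>j<m2. \<Sum>k<n. fF (X k) * sR (dotp d (V j) x) * sR (dotp d (V j) (X k)) / n / m2)"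
      unfolding gR_def feat_def by (simp add: sum_distrib_left sum_divide_distrib ac_simps)
    also have "\<dots> = (\<Sum>k<n. \<Sum>j<m2. fF (X k) * sR (dotp d (V j) x) * sR (dotp d (V j) (X k)) / n / m2)"
      by (rule sum.swap)
    also have "\<dots> = (\<Sum>k<n. ?f (X k)) / n"
      by (simp add: sum_distrib_left sum_divide_distrib ac_simps)
    finally show ?thesis .
  qed
  have i: "(\<integral>x'. ?f x' \<partial>\<nu>) = mid V x"
  proof -
    have "(\<integral>x'. ?f x' \<partial>\<nu>) = (\<integral>x'. (\<Sum>j<m2. sR (dotp d (V j) x) * (fF x' * sR (dotp d (V j) x'))) / m2 \<partial>\<nu>)"
      by (simp add: sum_distrib_left sum_divide_distrib ac_simps)
    also have "\<dots> = (\<Sum>j<m2. (\<integral>x'. sR (dotp d (V j) x) * (fF x' * sR (dotp d (V j) x')) \<partial>\<nu>)) / m2"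
      using hR_bound(1)[OF Vj] by (subst integral_divide_zero, subst Bochner_Integration.integral_sum) auto
    also have "\<dots> = mid V x" unfolding mid_def hR_def by simp
    finally show ?thesis .
  qed
  have bd: "\<bar>?f x'\<bar> \<le> F * (B * B)" for x'
  proof -
    have "\<bar>\<Sum>j<m2. sR (dotp d (V j) x) * sR (dotp d (V j) x')\<bar> \<le> (\<Sum>j<m2. B * B)"
      using sR_le(1) ge1 by (intro order_trans[OF sum_abs] sum_mono) (auto simp: abs_mult intro!: mult_mono)
    then have "\<bar>(\<Sum>j<m2. sR (dotp d (V j) x) * sR (dotp d (V j) x')) / m2\<bar> \<le> B * B"
      using pos by (simp add: field_simps)
    then show ?thesis unfolding abs_mult using fF_le(1) ge1 by (intro mult_mono) auto
  qed
  have "emeasure MX {X \<in> space MX. 12 * (F * (B * B)) * sqrt (\<iota> / n) < \<bar>(\<Sum>k<n. ?f (X k)) / n - (\<integral>x. ?f x \<partial>\<nu>)\<bar>} \<le> ennreal (2 * exp (- 32 * \<iota>))"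
    by (rule hoeffding_iid[OF prob_nu _ bd]) (use ge1 n128 in auto)
  then show ?thesis by (simp only: gR i)
qed

lemma mid_conc:
  assumes x: "x \<in> space (Rd d)"
  shows "emeasure MV {V \<in> space MV. 12 * (B * B) * sqrt (\<iota> / m2) < \<bar>mid V x - KR x\<bar>} \<le> ennreal (2 * exp (- 32 * \<iota>))"
proof -
  note x[measurable]
  have "emeasure MV {V \<in> space MV. 12 * (B * B) * sqrt (\<iota> / m2) < \<bar>(\<Sum>j<m2. sR (dotp d (V j) x) * hR (V j)) / m2 - (\<integral>v. sR (dotp d v x) * hR v \<partial>\<tau>)\<bar>}
     \<le> ennreal (2 * exp (- 32 * \<iota>))"
  proof (rule hoeffding_iid[OF tau.prob_space_axioms])
    show "\<bar>sR (dotp d v x) * hR v\<bar> \<le> B * B" if "v \<in> space \<tau>" for v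
      using that sR_le(1) hR_bound(2)[of v] ge1 by (auto simp: abs_mult space_tau intro!: mult_mono)
  qed (use ge1 n128 in auto)
  then show ?thesis by (simp only: mid_def KR_def)
qed

definition far :: "(nat \<Rightarrow> vec) \<Rightarrow> (nat \<Rightarrow> vec) \<Rightarrow> vec \<Rightarrow> bool" where
  "far V X x \<longleftrightarrow> tdev < \<bar>gR V X x - KR x\<bar>"

lemma far_prob:
  shows "{p \<in> space (MV \<Otimes>\<^sub>M MX). ennreal (exp (- 16 * \<iota>)) < emeasure \<nu> {x \<in> space \<nu>. far (fst p) (snd p) x}} \<in> sets (MV \<Otimes>\<^sub>M MX)"
    and "emeasure (MV \<Otimes>\<^sub>M MX) {p \<in> space (MV \<Otimes>\<^sub>M MX). ennreal (exp (- 16 * \<iota>)) < emeasure \<nu> {x \<in> space \<nu>. far (fst p) (snd p) x}} \<le> ennreal (4 * exp (- 16 * \<iota>))"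
proof -
  interpret VX: pair_prob_space MV MX ..
  let ?A = "{q \<in> space ((MV \<Otimes>\<^sub>M MX) \<Otimes>\<^sub>M \<nu>). far (fst (fst q)) (snd (fst q)) (snd q)}"
  have A: "?A \<in> sets ((MV \<Otimes>\<^sub>M MX) \<Otimes>\<^sub>M \<nu>)" unfolding far_def by measurable
  have le: "emeasure (MV \<Otimes>\<^sub>M MX) {p \<in> space (MV \<Otimes>\<^sub>M MX). (p, x) \<in> ?A} \<le> ennreal (4 * exp (- 32 * \<iota>))" if x: "x \<in> space \<nu>" for x
  proof -
    have x' [measurable]: "x \<in> space (Rd d)" using x space_nu by simp
    let ?P = "\<lambda>p. 12 * (F * (B * B)) * sqrt (\<iota> / n) < \<bar>gR (fst p) (snd p) x - mid (fst p) x\<bar>"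
    let ?Q = "\<lambda>p. 12 * (B * B) * sqrt (\<iota> / m2) < \<bar>mid (fst p) x - KR x\<bar>"
    have P: "emeasure (MV \<Otimes>\<^sub>M MX) {p \<in> space (MV \<Otimes>\<^sub>M MX). ?P p} \<le> ennreal (2 * exp (- 32 * \<iota>))"
    proof (rule emeasure_pair_le[OF MV.prob_space_axioms MX.prob_space_axioms])
      show "emeasure MX {X \<in> space MX. (V, X) \<in> {p \<in> space (MV \<Otimes>\<^sub>M MX). ?P p}} \<le> ennreal (2 * exp (- 32 * \<iota>))" if "V \<in> space MV" for V
        using gR_conc[OF that x'] that by (simp add: space_pair_measure cong: conj_cong)
    qed measurable
    have Q: "emeasure (MV \<Otimes>\<^sub>M MX) {p \<in> space (MV \<Otimes>\<^sub>M MX). ?Q p} \<le> ennreal (2 * exp (- 32 * \<iota>))"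
    proof (rule emeasure_pair_le2[OF MV.prob_space_axioms MX.prob_space_axioms])
      show "emeasure MV {V \<in> space MV. (V, X) \<in> {p \<in> space (MV \<Otimes>\<^sub>M MX). ?Q p}} \<le> ennreal (2 * exp (- 32 * \<iota>))" if "X \<in> space MX" for X
        using mid_conc[OF x'] that by (simp add: space_pair_measure cong: conj_cong)
    qed measurable
    have "{p \<in> space (MV \<Otimes>\<^sub>M MX). (p, x) \<in> ?A} \<subseteq> {p \<in> space (MV \<Otimes>\<^sub>M MX). ?P p \<or> ?Q p}"
      by (auto simp: far_def tdev_def)
    then have "emeasure (MV \<Otimes>\<^sub>M MX) {p \<in> space (MV \<Otimes>\<^sub>M MX). (p, x) \<in> ?A} \<le> emeasure (MV \<Otimes>\<^sub>M MX) {p \<in> space (MV \<Otimes>\<^sub>M MX). ?P p \<or> ?Q p}"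
      by (intro emeasure_mono) measurable
    also have "\<dots> \<le> ennreal (2 * exp (- 32 * \<iota>) + 2 * exp (- 32 * \<iota>))"
      by (rule emeasure_Un_le[OF _ _ P Q]) (auto, measurable)
    finally show ?thesis by simp
  qed
  have slice: "{x \<in> space \<nu>. (p, x) \<in> ?A} = {x \<in> space \<nu>. far (fst p) (snd p) x}" if "p \<in> space (MV \<Otimes>\<^sub>M MX)" for p
    using that by (auto simp: space_pair_measure)
  have eq: "{p \<in> space (MV \<Otimes>\<^sub>M MX). ennreal (exp (- 16 * \<iota>)) < emeasure \<nu> {x \<in> space \<nu>. (p, x) \<in> ?A}}
     = {p \<in> space (MV \<Otimes>\<^sub>M MX). ennreal (exp (- 16 * \<iota>)) < emeasure \<nu> {x \<in> space \<nu>. far (fst p) (snd p) x}}"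
    using slice by auto
  note fm = fubini_markov[OF VX.prob_space_axioms prob_nu A exp_gt_zero[of "- 16 * \<iota>"] _ le]
  show "{p \<in> space (MV \<Otimes>\<^sub>M MX). ennreal (exp (- 16 * \<iota>)) < emeasure \<nu> {x \<in> space \<nu>. far (fst p) (snd p) x}} \<in> sets (MV \<Otimes>\<^sub>M MX)"
    using fm(1) unfolding eq by simp
  have "4 * exp (- 32 * \<iota>) / exp (- 16 * \<iota>) = 4 * exp (- 16 * \<iota>)" unfolding exp_m32 by simp
  with fm(2) show "emeasure (MV \<Otimes>\<^sub>M MX) {p \<in> space (MV \<Otimes>\<^sub>M MX). ennreal (exp (- 16 * \<iota>)) < emeasure \<nu> {x \<in> space \<nu>. far (fst p) (snd p) x}} \<le> ennreal (4 * exp (- 16 * \<iota>))"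
    unfolding eq by simp
qed

definition unitV :: "(nat \<Rightarrow> vec) \<Rightarrow> bool" where
  "unitV V \<longleftrightarrow> (\<forall>j\<in>{..<m2}. dotp d (V j) (V j) = 1)"

text \<open>The bound \<open>2 * K\<close> on the empirical means is the delicate clause: the
  trivial bound \<open>B\<close> would let powers of \<open>\<iota>\<close> into the fourth moment
  of the feature with \<open>y = 1\<close>, and from there into the factor of the weight norm in the
  generalization gap.\<close>

definition good :: "(nat \<Rightarrow> vec) \<Rightarrow> (nat \<Rightarrow> vec) \<Rightarrow> bool" where
  "good V X \<longleftrightarrow> unitV V \<and> (\<forall>k\<in>{..<n}. \<bar>fs (X k)\<bar> \<le> F) \<and> (\<forall>k\<in>{..<n}. \<forall>j\<in>{..<m2}. \<bar>dotp d (V j) (X k)\<bar> \<le> R)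
     \<and> (\<forall>j\<in>{..<m2}. \<bar>(\<Sum>k<n. sR (dotp d (V j) (X k))) / n\<bar> \<le> 2 * K)
     \<and> emeasure \<nu> {x \<in> space \<nu>. far V X x} \<le> ennreal (exp (- 16 * \<iota>))"

text \<open>Bernstein's inequality with variance \<open>K\<close>: the deviation is at most 1 and
  the mean at most \<open>(1 + K) / 2\<close> in absolute value, and these add up to at most
  \<open>2 * K\<close> because \<open>K \<ge> 1\<close>.\<close>

lemma mean_sR_conc:
  assumes v: "v \<in> space (Rd d)" "dotp d v v = 1"
  shows "emeasure MX {X \<in> space MX. 2 * K < \<bar>(\<Sum>k<n. sR (dotp d v (X k))) / n\<bar>} \<le> ennreal (2 * exp (- 32 * \<iota>))"
proof -
  note v(1)[measurable]
  let ?f = "\<lambda>x. sR (dotp d v x)"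
  have int2: "(\<integral>\<^sup>+x. ennreal \<bar>(?f x)\<^sup>2\<bar> \<partial>\<nu>) \<le> ennreal K"
  proof -
    have "(\<integral>\<^sup>+x. ennreal \<bar>(?f x)\<^sup>2\<bar> \<partial>\<nu>) \<le> (\<integral>\<^sup>+x. ennreal ((\<sigma>2 (dotp d v x))\<^sup>2) \<partial>\<nu>)"
      using sR_le(2) by (intro nn_integral_mono ennreal_leI) (simp add: abs_le_square_iff[symmetric])
    also have "\<dots> \<le> ennreal K" by (rule s2_sq[OF v(2,1)])
    finally show ?thesis .
  qed
  then have v2: "\<bar>\<integral>x. (?f x)\<^sup>2 \<partial>\<nu>\<bar> \<le> K" by (rule nn_integral_abs_bound(2)[rotated]) (use ge1 in auto)
  have "(\<integral>\<^sup>+x. ennreal \<bar>?f x\<bar> \<partial>\<nu>) \<le> ennreal (1/2 + 1/2 * K)"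
  proof (rule nn_integral_le_affine[OF prob_nu _ int2])
    show "\<bar>?f x\<bar> \<le> 1/2 + 1/2 * \<bar>(?f x)\<^sup>2\<bar>" for x using mult_le_half_squares[of 1 "\<bar>?f x\<bar>"] by simp
  qed (use ge1 in auto)
  then have m: "\<bar>\<integral>x. ?f x \<partial>\<nu>\<bar> \<le> 1/2 + 1/2 * K" by (rule nn_integral_abs_bound(2)[rotated]) (use ge1 in auto)
  have F2: "1 \<le> F\<^sup>2 * B\<^sup>2" using ge1 one_le_power[of F 2] one_le_power[of B 2] by (intro mult_ge1_I) auto
  have c: "4 * B\<^sup>2 * (32 * \<iota>) \<le> real n * K"
  proof -
    have "(128 * B\<^sup>2 * \<iota>) * 1 \<le> (128 * B\<^sup>2 * \<iota>) * (K * (F\<^sup>2 * B\<^sup>2))"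
      using ge1 F2 by (intro mult_left_mono mult_ge1_I) auto
    also have "\<dots> = 128 * K * F\<^sup>2 * B^4 * \<iota>" by (simp add: power2_eq_square power4_eq_xxxx)
    also have "\<dots> \<le> real n * 1" using n_large by simp
    also have "\<dots> \<le> real n * K" using ge1 by (intro mult_left_mono) auto
    finally show ?thesis by simp
  qed
  have t: "2 * sqrt (K * (32 * \<iota>) / n) \<le> 1"
  proof -
    have "128 * K * \<iota> * 1 \<le> 128 * K * \<iota> * (F\<^sup>2 * B\<^sup>2 * B\<^sup>2)"
      using ge1 F2 one_le_power[of B 2] by (intro mult_left_mono mult_ge1_I[of _ "B\<^sup>2"]) auto
    also have "\<dots> \<le> n" using n_large by (simp add: power2_eq_square power4_eq_xxxx ac_simps)
    finally have "K * (32 * \<iota>) / n \<le> 1 / 4" using pos by (simp add: field_simps)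
    then have "sqrt (K * (32 * \<iota>) / n) \<le> sqrt ((1/2)\<^sup>2)" by (intro real_sqrt_le_mono) (simp add: power2_eq_square)
    then show ?thesis by simp
  qed
  have "emeasure MX {X \<in> space MX. 2 * K < \<bar>(\<Sum>k<n. ?f (X k)) / n\<bar>}
    \<le> emeasure MX {X \<in> space MX. 2 * sqrt (K * (32 * \<iota>) / n) < \<bar>(\<Sum>k<n. ?f (X k)) / n - (\<integral>x. ?f x \<partial>\<nu>)\<bar>}"
  proof (rule emeasure_mono)
    show "{X \<in> space MX. 2 * K < \<bar>(\<Sum>k<n. ?f (X k)) / n\<bar>} \<subseteq> {X \<in> space MX. 2 * sqrt (K * (32 * \<iota>) / n) < \<bar>(\<Sum>k<n. ?f (X k)) / n - (\<integral>x. ?f x \<partial>\<nu>)\<bar>}"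
      using m t ge1(1) by auto
    have [measurable]: "(\<lambda>X. X k) \<in> measurable MX (Rd d)" if "k \<in> {..<n}" for k using X_comp[of "\<lambda>X. X"] that by auto
    show "{X \<in> space MX. 2 * sqrt (K * (32 * \<iota>) / n) < \<bar>(\<Sum>k<n. ?f (X k)) / n - (\<integral>x. ?f x \<partial>\<nu>)\<bar>} \<in> sets MX" by measurable
  qed
  also have "\<dots> \<le> ennreal (2 * exp (- (32 * \<iota>)))"
    by (rule bernstein_iid[OF prob_nu _ sR_le(1) _ _ _ _ c]) (use v2 ge1 pos in auto)
  finally show ?thesis by simp
qed

end

context net_setup
begin

lemma nm2_le: "real (n * m2) \<le> exp \<iota>"
proof -
  have "real n * 1 * real m2 \<le> real n * real m1 * real m2" using pos by (intro mult_mono) auto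
  with size show ?thesis by simp
qed

lemma good_prob:
  shows "{p \<in> space (MV \<Otimes>\<^sub>M MX). \<not> good (fst p) (snd p)} \<in> sets (MV \<Otimes>\<^sub>M MX)"
    and "emeasure (MV \<Otimes>\<^sub>M MX) {p \<in> space (MV \<Otimes>\<^sub>M MX). \<not> good (fst p) (snd p)} \<le> ennreal (8 * exp (- \<iota>))"
proof -
  let ?M = "MV \<Otimes>\<^sub>M MX"
  have [measurable]: "(\<lambda>p. fst p j) \<in> measurable ?M (Rd d)" if "j \<in> {..<m2}" for j using V_comp[of fst ?M j] that by auto
  have [measurable]: "(\<lambda>p. snd p k) \<in> measurable ?M (Rd d)" if "k \<in> {..<n}" for k using X_comp[of snd ?M k] that by auto
  define P1 where "P1 = (\<lambda>p::(nat \<Rightarrow> vec) \<times> (nat \<Rightarrow> vec). \<not> unitV (fst p))"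
  define P2 where "P2 = (\<lambda>p::(nat \<Rightarrow> vec) \<times> (nat \<Rightarrow> vec). \<exists>k\<in>{..<n}. F < \<bar>fs (snd p k)\<bar>)"
  \<comment> \<open>\<open>P3\<close> and \<open>P4\<close> include \<open>unitV\<close>, so that
    the tail bounds for unit directions apply on every slice; the remaining directions form the null
    event \<open>P1\<close>.\<close>
  define P3 where "P3 = (\<lambda>p::(nat \<Rightarrow> vec) \<times> (nat \<Rightarrow> vec). unitV (fst p) \<and> (\<exists>k\<in>{..<n}. \<exists>j\<in>{..<m2}. R < \<bar>dotp d (fst p j) (snd p k)\<bar>))"
  define P4 where "P4 = (\<lambda>p::(nat \<Rightarrow> vec) \<times> (nat \<Rightarrow> vec). unitV (fst p) \<and> (\<exists>j\<in>{..<m2}. 2 * K < \<bar>(\<Sum>k<n. sR (dotp d (fst p j) (snd p k))) / n\<bar>))"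
  define P5 where "P5 = (\<lambda>p. ennreal (exp (- 16 * \<iota>)) < emeasure \<nu> {x \<in> space \<nu>. far (fst p) (snd p) x})"
  have m1[measurable]: "{p \<in> space ?M. P1 p} \<in> sets ?M" unfolding P1_def unitV_def by measurable
  have m2[measurable]: "{p \<in> space ?M. P2 p} \<in> sets ?M" unfolding P2_def by measurable
  have m3[measurable]: "{p \<in> space ?M. P3 p} \<in> sets ?M" unfolding P3_def unitV_def by measurable
  have m4[measurable]: "{p \<in> space ?M. P4 p} \<in> sets ?M" unfolding P4_def unitV_def by measurable
  have m5[measurable]: "{p \<in> space ?M. P5 p} \<in> sets ?M" unfolding P5_def by (rule far_prob)
  have eq: "{p \<in> space ?M. \<not> good (fst p) (snd p)} = {p \<in> space ?M. P1 p \<or> (P2 p \<or> (P3 p \<or> (P4 p \<or> P5 p)))}"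
    unfolding good_def P1_def P2_def P3_def P4_def P5_def by (auto simp: not_le not_less)
  have sub: "{p \<in> space ?M. P1 p \<or> (P2 p \<or> (P3 p \<or> (P4 p \<or> P5 p)))} \<in> sets ?M" by measurable
  show "{p \<in> space ?M. \<not> good (fst p) (snd p)} \<in> sets ?M" unfolding eq by (rule sub)
  let ?e = "exp (- 32 * \<iota>)"
  have e1: "emeasure ?M {p \<in> space ?M. P1 p} \<le> ennreal 0"
  proof (rule emeasure_pair_le2[OF MV.prob_space_axioms MX.prob_space_axioms m1])
    fix X assume X: "X \<in> space MX"
    have "AE V in MV. \<forall>j\<in>{..<m2}. dotp d (V j) (V j) = 1"
      by (rule AE_finite_allI) (auto intro!: AE_PiM_component AE_tau_unit tau.prob_space_axioms)
    then have "AE V in MV. V \<notin> {V \<in> space MV. (V, X) \<in> {p \<in> space ?M. P1 p}}"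
      by eventually_elim (auto simp: P1_def unitV_def)
    then show "emeasure MV {V \<in> space MV. (V, X) \<in> {p \<in> space ?M. P1 p}} \<le> ennreal 0"
      by (subst emeasure_eq_0_AE) auto
  qed
  have fsm: "{x \<in> space \<nu>. F < \<bar>fs x\<bar>} \<in> sets \<nu>" by measurable
  have e2: "emeasure ?M {p \<in> space ?M. P2 p} \<le> ennreal (n * ?e)"
  proof (rule emeasure_pair_le[OF MV.prob_space_axioms MX.prob_space_axioms m2])
    fix V assume V: "V \<in> space MV"
    have "emeasure MX {X \<in> space MX. \<exists>k\<in>{..<n}. F < \<bar>fs (X k)\<bar>} \<le> ennreal (real (card {..<n}) * ?e)"
      using emeasure_PiM_component[OF prob_nu _ fsm, of _ "{..<n}"] fs_tail by (intro emeasure_union_bound) auto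
    then show "emeasure MX {X \<in> space MX. (V, X) \<in> {p \<in> space ?M. P2 p}} \<le> ennreal (n * ?e)"
      using V by (simp add: P2_def space_pair_measure cong: conj_cong)
  qed
  have e3: "emeasure ?M {p \<in> space ?M. P3 p} \<le> ennreal (n * (m2 * ?e))"
  proof (rule emeasure_pair_le[OF MV.prob_space_axioms MX.prob_space_axioms m3])
    fix V assume V: "V \<in> space MV"
    show "emeasure MX {X \<in> space MX. (V, X) \<in> {p \<in> space ?M. P3 p}} \<le> ennreal (n * (m2 * ?e))"
    proof (cases "unitV V")
      case True
      have Vj [measurable]: "V j \<in> space (Rd d)" if "j \<in> {..<m2}" for j using V_space[OF V] that by auto
      have m: "{x \<in> space \<nu>. \<exists>j\<in>{..<m2}. R < \<bar>dotp d (V j) x\<bar>} \<in> sets \<nu>" by measurable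
      have "emeasure \<nu> {x \<in> space \<nu>. \<exists>j\<in>{..<m2}. R < \<bar>dotp d (V j) x\<bar>} \<le> ennreal (real (card {..<m2}) * ?e)"
        using True s2_tail by (intro emeasure_union_bound) (auto simp: unitV_def)
      then have "emeasure MX {X \<in> space MX. \<exists>k\<in>{..<n}. (\<exists>j\<in>{..<m2}. R < \<bar>dotp d (V j) (X k)\<bar>)} \<le> ennreal (real (card {..<n}) * (m2 * ?e))"
        using emeasure_PiM_component[OF prob_nu _ m, of _ "{..<n}"] by (intro emeasure_union_bound) auto
      then show ?thesis using V by (simp add: P3_def space_pair_measure True cong: conj_cong)
    qed (simp add: P3_def)
  qed
  have e4: "emeasure ?M {p \<in> space ?M. P4 p} \<le> ennreal (m2 * (2 * ?e))"
  proof (rule emeasure_pair_le[OF MV.prob_space_axioms MX.prob_space_axioms m4])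
    fix V assume V: "V \<in> space MV"
    show "emeasure MX {X \<in> space MX. (V, X) \<in> {p \<in> space ?M. P4 p}} \<le> ennreal (m2 * (2 * ?e))"
    proof (cases "unitV V")
      case True
      have Vj [measurable]: "V j \<in> space (Rd d)" if "j \<in> {..<m2}" for j using V_space[OF V] that by auto
      have [measurable]: "(\<lambda>X. X k) \<in> measurable MX (Rd d)" if "k \<in> {..<n}" for k using X_comp[of "\<lambda>X. X"] that by auto
      have "emeasure MX {X \<in> space MX. \<exists>j\<in>{..<m2}. 2 * K < \<bar>(\<Sum>k<n. sR (dotp d (V j) (X k))) / n\<bar>} \<le> ennreal (real (card {..<m2}) * (2 * ?e))"
      proof (rule emeasure_union_bound)
        fix j assume j: "j \<in> {..<m2}"
        note Vj[OF j, measurable]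
        show "{X \<in> space MX. 2 * K < \<bar>(\<Sum>k<n. sR (dotp d (V j) (X k))) / n\<bar>} \<in> sets MX" by measurable
        show "emeasure MX {X \<in> space MX. 2 * K < \<bar>(\<Sum>k<n. sR (dotp d (V j) (X k))) / n\<bar>} \<le> ennreal (2 * ?e)"
          using True j by (intro mean_sR_conc Vj) (auto simp: unitV_def)
      qed auto
      then show ?thesis using V by (simp add: P4_def space_pair_measure True cong: conj_cong)
    qed (simp add: P4_def)
  qed
  have e5: "emeasure ?M {p \<in> space ?M. P5 p} \<le> ennreal (4 * exp (- 16 * \<iota>))" unfolding P5_def by (rule far_prob)
  have "emeasure ?M {p \<in> space ?M. P1 p \<or> (P2 p \<or> (P3 p \<or> (P4 p \<or> P5 p)))} \<le> ennreal (0 + (n * ?e + (n * (m2 * ?e) + (m2 * (2 * ?e) + 4 * exp (- 16 * \<iota>)))))"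
    by (intro emeasure_Un_le e1 e2 e3 e4 e5 m1 m2 m3 m4 m5) (auto, measurable)
  also have "\<dots> \<le> ennreal (8 * exp (- \<iota>))"
  proof (rule ennreal_leI)
    have E: "exp \<iota> * ?e \<le> exp (- \<iota>)" using ge1 by (simp flip: exp_add)
    have "n * ?e \<le> exp \<iota> * ?e" "m2 * ?e \<le> exp \<iota> * ?e" "real (n * m2) * ?e \<le> exp \<iota> * ?e"
      using size_le nm2_le by (intro mult_right_mono; simp)+
    moreover have "exp (- 16 * \<iota>) \<le> exp (- \<iota>)" using ge1 by simp
    ultimately have "n * ?e + (real (n * m2) * ?e + (2 * (m2 * ?e) + 4 * exp (- 16 * \<iota>))) \<le> 8 * exp (- \<iota>)"
      using E by linarith
    then show "0 + (n * ?e + (n * (m2 * ?e) + (m2 * (2 * ?e) + 4 * exp (- 16 * \<iota>)))) \<le> 8 * exp (- \<iota>)"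
      by (simp add: ac_simps)
  qed
  finally show "emeasure ?M {p \<in> space ?M. \<not> good (fst p) (snd p)} \<le> ennreal (8 * exp (- \<iota>))" unfolding eq .
qed

text \<open>The inputs at which no truncation is active and the feature is accurate. Fine estimates
  are made on \<open>G\<close>, and its complement is paid for by crude moments.\<close>

definition G :: "(nat \<Rightarrow> vec) \<Rightarrow> (nat \<Rightarrow> vec) \<Rightarrow> vec set" where
  "G V X = {x \<in> space (Rd d). (\<forall>j\<in>{..<m2}. \<bar>dotp d (V j) x\<bar> \<le> R) \<and> \<bar>fs x\<bar> \<le> F \<and> \<bar>\<eta> * Kf x\<bar> \<le> 1 / 2
     \<and> \<not> far V X x \<and> U x \<le> ennreal (exp (- 4 * \<iota>))}"

lemma G_meas: "f \<in> measurable N MV \<Longrightarrow> g \<in> measurable N MX \<Longrightarrow> e \<in> measurable N (Rd d)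
  \<Longrightarrow> {\<omega> \<in> space N. e \<omega> \<in> G (f \<omega>) (g \<omega>)} \<in> sets N"
proof -
  assume [measurable]: "f \<in> measurable N MV" "g \<in> measurable N MX" "e \<in> measurable N (Rd d)"
  have [measurable]: "(\<lambda>\<omega>. f \<omega> j) \<in> measurable N (Rd d)" if "j \<in> {..<m2}" for j using V_comp[of f N j] that by auto
  have "{\<omega> \<in> space N. e \<omega> \<in> G (f \<omega>) (g \<omega>)} = {\<omega> \<in> space N. (\<forall>j\<in>{..<m2}. \<bar>dotp d (f \<omega> j) (e \<omega>)\<bar> \<le> R) \<and> \<bar>fs (e \<omega>)\<bar> \<le> F
     \<and> \<bar>\<eta> * Kf (e \<omega>)\<bar> \<le> 1 / 2 \<and> \<not> far (f \<omega>) (g \<omega>) (e \<omega>) \<and> U (e \<omega>) \<le> ennreal (exp (- 4 * \<iota>))}"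
    using measurable_space[of e N "Rd d"] by (auto simp: G_def)
  also have "\<dots> \<in> sets N" unfolding far_def by measurable
  finally show ?thesis .
qed

lemma G_sets:
  assumes "V \<in> space MV" "X \<in> space MX"
  shows "G V X \<in> sets (Rd d)" "G V X \<in> sets \<nu>"
proof -
  have "G V X = {x \<in> space (Rd d). x \<in> G V X}" by (auto simp: G_def)
  also have "\<dots> \<in> sets (Rd d)" using assms by (intro G_meas) auto
  finally show "G V X \<in> sets (Rd d)" .
  then show "G V X \<in> sets \<nu>" by (simp add: sets_nu)
qed

text \<open>The weakest exponent is the 12 of \<open>U_tail\<close>; the union over hidden units
  only costs a factor \<open>exp \<iota>\<close> against
  \<open>exp (- 32 * \<iota>)\<close>.\<close>

lemma G_compl:
  assumes V: "V \<in> space MV" and X: "X \<in> space MX" and good: "good V X"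
  shows "emeasure \<nu> (space \<nu> - G V X) \<le> ennreal (6 * K * exp (- 12 * \<iota>))"
proof -
  have Vj [measurable]: "V j \<in> space (Rd d)" if "j \<in> {..<m2}" for j using V_space[OF V] that by auto
  note V[measurable] X[measurable]
  let ?e = "exp (- 32 * \<iota>)"
  define Q1 where "Q1 = (\<lambda>x. \<exists>j\<in>{..<m2}. R < \<bar>dotp d (V j) x\<bar>)"
  define Q2 where "Q2 = (\<lambda>x. F < \<bar>fs x\<bar>)"
  define Q3 where "Q3 = (\<lambda>x. 1/2 < \<bar>\<eta> * Kf x\<bar>)"
  define Q4 where "Q4 = far V X"
  define Q5 where "Q5 = (\<lambda>x. ennreal (exp (- 4 * \<iota>)) < U x)"
  have m [measurable]: "{x \<in> space \<nu>. Q1 x} \<in> sets \<nu>" "{x \<in> space \<nu>. Q2 x} \<in> sets \<nu>" "{x \<in> space \<nu>. Q3 x} \<in> sets \<nu>"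
    "{x \<in> space \<nu>. Q4 x} \<in> sets \<nu>" "{x \<in> space \<nu>. Q5 x} \<in> sets \<nu>"
    unfolding Q1_def Q2_def Q3_def Q4_def Q5_def far_def by measurable
  have eq: "space \<nu> - G V X = {x \<in> space \<nu>. Q1 x \<or> (Q2 x \<or> (Q3 x \<or> (Q4 x \<or> Q5 x)))}"
    unfolding G_def Q1_def Q2_def Q3_def Q4_def Q5_def using space_nu by (auto simp flip: not_le)
  have q1: "emeasure \<nu> {x \<in> space \<nu>. Q1 x} \<le> ennreal (real (card {..<m2}) * ?e)" unfolding Q1_def
    using good s2_tail by (intro emeasure_union_bound) (auto simp: good_def unitV_def)
  have q2: "emeasure \<nu> {x \<in> space \<nu>. Q2 x} \<le> ennreal ?e" unfolding Q2_def by (rule fs_tail)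
  have q3: "emeasure \<nu> {x \<in> space \<nu>. Q3 x} \<le> ennreal ?e" unfolding Q3_def by (rule Kf_tail)
  have q4: "emeasure \<nu> {x \<in> space \<nu>. Q4 x} \<le> ennreal (exp (- 16 * \<iota>))" unfolding Q4_def using good by (simp add: good_def)
  have q5: "emeasure \<nu> {x \<in> space \<nu>. Q5 x} \<le> ennreal (K * exp (- 12 * \<iota>))" unfolding Q5_def by (rule U_tail)
  have "emeasure \<nu> (space \<nu> - G V X) \<le> ennreal (real (card {..<m2}) * ?e + (?e + (?e + (exp (- 16 * \<iota>) + K * exp (- 12 * \<iota>)))))"
    unfolding eq using ge1(1) by (intro emeasure_Un_le q1 q2 q3 q4 q5 m) (auto, measurable)
  also have "\<dots> \<le> ennreal (6 * K * exp (- 12 * \<iota>))"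
  proof (rule ennreal_leI)
    have "m2 * ?e \<le> exp \<iota> * ?e" using size_le by (intro mult_right_mono) auto
    moreover have "exp \<iota> * ?e \<le> exp (- 12 * \<iota>)" using ge1 by (simp flip: exp_add)
    moreover have "?e \<le> exp (- 12 * \<iota>)" "exp (- 16 * \<iota>) \<le> exp (- 12 * \<iota>)" using ge1 by auto
    moreover have "1 * exp (- 12 * \<iota>) \<le> K * exp (- 12 * \<iota>)" using ge1 by (intro mult_right_mono) auto
    moreover have "0 \<le> K * exp (- 12 * \<iota>)" using ge1 by simp
    moreover have "real (card {..<m2}) = m2" by simp
    ultimately show "real (card {..<m2}) * ?e + (?e + (?e + (exp (- 16 * \<iota>) + K * exp (- 12 * \<iota>)))) \<le> 6 * K * exp (- 12 * \<iota>)"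
      by (simp only: mult.assoc)
  qed
  finally show ?thesis .
qed

definition eps :: real where
  "eps = 15 * K * (F * B\<^sup>2 * sqrt (\<iota> / n) + B\<^sup>2 * sqrt (\<iota> / m2))"

lemma inv_sqrt_n: "exp (- \<iota>) \<le> 1 / n" "1 / n \<le> sqrt (1 / n)" "sqrt (1 / n) \<le> sqrt (\<iota> / n)"
proof -
  show "exp (- \<iota>) \<le> 1 / n" using size_le(1) pos by (simp add: exp_minus field_simps)
  have "(1 / real n)\<^sup>2 \<le> 1 / n" using pos by (simp add: power2_eq_square field_simps)
  then show "1 / n \<le> sqrt (1 / n)" by (rule real_le_rsqrt)
  show "sqrt (1 / n) \<le> sqrt (\<iota> / n)" using ge1 pos by (auto intro!: divide_right_mono)
qed

lemma eps_ge: "tdev + 3 * K * exp (- 4 * \<iota>) \<le> eps"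
proof -
  let ?a = "F * B\<^sup>2 * sqrt (\<iota> / n)" and ?b = "B\<^sup>2 * sqrt (\<iota> / m2)"
  have ab: "0 \<le> ?a" "0 \<le> ?b" using ge1 by auto
  have "exp (- 4 * \<iota>) \<le> exp (- \<iota>)" using ge1 by simp
  also have "\<dots> \<le> 1 * sqrt (\<iota> / n)" using inv_sqrt_n by linarith
  also have "\<dots> \<le> F * B\<^sup>2 * sqrt (\<iota> / n)" using ge1 one_le_power[of B 2] by (intro mult_right_mono mult_ge1_I) auto
  finally have "3 * K * exp (- 4 * \<iota>) \<le> 3 * K * ?a" using ge1 by (intro mult_left_mono) auto
  moreover have "tdev = 12 * (?a + ?b)" by (simp add: tdev_def power2_eq_square)
  moreover have "1 * (12 * (?a + ?b)) \<le> K * (12 * (?a + ?b))" using ab ge1 by (intro mult_right_mono) auto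
  moreover have "0 \<le> K * ?b" using ab ge1 by auto
  ultimately show ?thesis by (simp add: eps_def algebra_simps)
qed

lemma feat_trunc:
  assumes good: "good V X" and x: "\<forall>j\<in>{..<m2}. \<bar>dotp d (V j) x\<bar> \<le> R"
  shows "feat d n m2 \<sigma>2 fs V X x = gR V X x" "feat d n m2 \<sigma>2 (\<lambda>_. 1) V X x = feat d n m2 sR (\<lambda>_. 1) V X x"
proof -
  have *: "sR (dotp d (V j) x) = \<sigma>2 (dotp d (V j) x)" "sR (dotp d (V j) (X k)) = \<sigma>2 (dotp d (V j) (X k))" "fF (X k) = fs (X k)"
    if "j < m2" "k < n" for j k using good x that by (auto simp: good_def sR_def fF_def)
  show "feat d n m2 \<sigma>2 fs V X x = gR V X x" "feat d n m2 \<sigma>2 (\<lambda>_. 1) V X x = feat d n m2 sR (\<lambda>_. 1) V X x"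
    unfolding gR_def feat_def using pos * by (auto intro!: sum.cong arg_cong2[where f="(/)"] arg_cong2[where f=times])
qed

lemma G_facts:
  assumes good: "good V X" and x: "x \<in> G V X"
  shows "\<bar>feat d n m2 \<sigma>2 fs V X x - Kf x\<bar> \<le> eps" "\<bar>\<eta> * feat d n m2 \<sigma>2 fs V X x\<bar> \<le> 1"
    "\<bar>feat d n m2 \<sigma>2 (\<lambda>_. 1) V X x\<bar> \<le> 2 * K * B" "\<bar>fs x\<bar> \<le> F" "\<bar>\<eta> * Kf x\<bar> \<le> 1 / 2"
proof -
  have tr: "\<forall>j\<in>{..<m2}. \<bar>dotp d (V j) x\<bar> \<le> R" using x by (simp add: G_def)
  show "\<bar>fs x\<bar> \<le> F" and k: "\<bar>\<eta> * Kf x\<bar> \<le> 1 / 2" using x by (simp_all add: G_def)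
  have "\<bar>KR x - Kf x\<bar> \<le> 3 * K * exp (- 4 * \<iota>)" using x by (intro KR_diff) (auto simp: G_def space_nu)
  moreover have "\<bar>gR V X x - KR x\<bar> \<le> tdev" using x by (simp add: G_def far_def not_less)
  ultimately show e: "\<bar>feat d n m2 \<sigma>2 fs V X x - Kf x\<bar> \<le> eps" unfolding feat_trunc[OF good tr] using eps_ge by linarith
  have "\<bar>\<eta> * feat d n m2 \<sigma>2 fs V X x - \<eta> * Kf x\<bar> = \<eta> * \<bar>feat d n m2 \<sigma>2 fs V X x - Kf x\<bar>"
    using eta0 by (simp add: abs_mult flip: right_diff_distrib)
  also have "\<dots> \<le> \<eta> * eps" using e eta0 by (intro mult_left_mono)
  also have "\<dots> \<le> 1 / 2" using eta_eps by (simp add: eps_def)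
  finally show "\<bar>\<eta> * feat d n m2 \<sigma>2 fs V X x\<bar> \<le> 1" using k by linarith
  have "\<bar>\<Sum>j<m2. sR (dotp d (V j) x) * ((\<Sum>k<n. 1 * sR (dotp d (V j) (X k))) / n)\<bar> \<le> (\<Sum>j<m2. B * (2 * K))"
  proof (intro order_trans[OF sum_abs] sum_mono)
    fix j assume "j \<in> {..<m2}"
    then have "\<bar>(\<Sum>k<n. 1 * sR (dotp d (V j) (X k))) / n\<bar> \<le> 2 * K" using good by (simp add: good_def)
    then show "\<bar>sR (dotp d (V j) x) * ((\<Sum>k<n. 1 * sR (dotp d (V j) (X k))) / n)\<bar> \<le> B * (2 * K)"
      using sR_le(1)[of "dotp d (V j) x"] ge1 by (subst abs_mult) (intro mult_mono, auto)
  qed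
  then have "\<bar>feat d n m2 sR (\<lambda>_. 1) V X x\<bar> \<le> (\<Sum>j<m2. B * (2 * K)) / m2"
    unfolding feat_def abs_divide using pos by (simp add: pos_divide_le_eq ac_simps)
  then show "\<bar>feat d n m2 \<sigma>2 (\<lambda>_. 1) V X x\<bar> \<le> 2 * K * B" unfolding feat_trunc[OF good tr] using pos by (simp add: ac_simps)
qed

text \<open>The estimate covers inputs outside \<open>G\<close> as well: the feature averages
  \<open>\<sigma>2\<close> over the directions with weights of size at most \<open>c\<close>, and
  convexity of the fourth power reduces it to the moment along a single direction.\<close>

lemma feat_moment4:
  assumes V: "V \<in> space MV" "unitV V" and c: "0 \<le> c"
    and w: "\<And>j. j < m2 \<Longrightarrow> \<bar>(\<Sum>k<n. y (X k) * \<sigma>2 (dotp d (V j) (X k))) / n\<bar> \<le> c"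
  shows "(\<integral>\<^sup>+x. ennreal ((feat d n m2 \<sigma>2 y V X x)^4) \<partial>\<nu>) \<le> ennreal (c^4 * K)"
proof -
  have Vj [measurable]: "V j \<in> space (Rd d)" if "j \<in> {..<m2}" for j using V_space[OF V(1)] that by auto
  let ?w = "\<lambda>j. (\<Sum>k<n. y (X k) * \<sigma>2 (dotp d (V j) (X k))) / n"
  have pw: "(feat d n m2 \<sigma>2 y V X x)^4 \<le> (\<Sum>j<m2. (c^4 / m2) * (\<sigma>2 (dotp d (V j) x))^4)" for x
  proof -
    have "(feat d n m2 \<sigma>2 y V X x)^4 \<le> (\<Sum>j<m2. (\<sigma>2 (dotp d (V j) x) * ?w j)^4) / m2"
      unfolding feat_def by (rule power4_mean_le) (rule pos)
    also have "\<dots> \<le> (\<Sum>j<m2. (\<sigma>2 (dotp d (V j) x))^4 * c^4) / m2"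
    proof (intro divide_right_mono sum_mono)
      fix j assume "j \<in> {..<m2}"
      then have "\<bar>?w j\<bar>^4 \<le> c^4" using w by (intro power_mono) auto
      then have "(?w j)^4 \<le> c^4" by (simp only: power_even_abs_numeral even_numeral)
      then show "(\<sigma>2 (dotp d (V j) x) * ?w j)^4 \<le> (\<sigma>2 (dotp d (V j) x))^4 * c^4"
        unfolding power_mult_distrib by (intro mult_left_mono) auto
    qed simp
    finally show ?thesis by (simp add: sum_divide_distrib mult.commute)
  qed
  have "(\<integral>\<^sup>+x. ennreal ((feat d n m2 \<sigma>2 y V X x)^4) \<partial>\<nu>) \<le> (\<integral>\<^sup>+x. (\<Sum>j<m2. ennreal (c^4 / m2) * ennreal ((\<sigma>2 (dotp d (V j) x))^4)) \<partial>\<nu>)"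
  proof (rule nn_integral_mono)
    fix x
    have "ennreal ((feat d n m2 \<sigma>2 y V X x)^4) \<le> ennreal (\<Sum>j<m2. (c^4 / m2) * (\<sigma>2 (dotp d (V j) x))^4)" by (intro ennreal_leI pw)
    also have "\<dots> = (\<Sum>j<m2. ennreal (c^4 / m2) * ennreal ((\<sigma>2 (dotp d (V j) x))^4))"
    proof -
      have "ennreal (c^4 / m2) * ennreal ((\<sigma>2 (dotp d (V j) x))^4) = ennreal ((c^4 / m2) * (\<sigma>2 (dotp d (V j) x))^4)" for j
        using c by (intro ennreal_mult[symmetric]) auto
      then show ?thesis using c by (simp only:) (intro sum_ennreal[symmetric], auto)
    qed
    finally show "ennreal ((feat d n m2 \<sigma>2 y V X x)^4) \<le> (\<Sum>j<m2. ennreal (c^4 / m2) * ennreal ((\<sigma>2 (dotp d (V j) x))^4))" .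
  qed
  also have "\<dots> = (\<Sum>j<m2. ennreal (c^4 / m2) * (\<integral>\<^sup>+x. ennreal ((\<sigma>2 (dotp d (V j) x))^4) \<partial>\<nu>))"
    by (subst nn_integral_sum) (auto simp: nn_integral_cmult)
  also have "\<dots> \<le> (\<Sum>j<m2. ennreal (c^4 / m2) * ennreal K)"
    using V(2) by (intro sum_mono mult_left_mono s2_mom) (auto simp: unitV_def)
  also have "\<dots> = ennreal (c^4 * K)"
    using c ge1 pos by (simp add: ennreal_of_nat_eq_real_of_nat flip: ennreal_mult'')
  finally show ?thesis .
qed

text \<open>The constants differ in nature. For \<open>y = 1\<close> the bound is a power of
  \<open>K\<close> alone, by the fourth clause of \<open>good\<close>; for the target the crude
  weight \<open>F * B\<close> is acceptable because that bound serves only inputs outside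
  \<open>G\<close>.\<close>

lemma feat_moments:
  assumes V: "V \<in> space MV" and X: "X \<in> space MX" and good: "good V X"
  shows "(\<integral>\<^sup>+x. ennreal ((feat d n m2 \<sigma>2 (\<lambda>_. 1) V X x)^4) \<partial>\<nu>) \<le> ennreal (16 * K^5)"
    and "(\<integral>\<^sup>+x. ennreal ((feat d n m2 \<sigma>2 fs V X x)^4) \<partial>\<nu>) \<le> ennreal ((F * B)^4 * K)"
proof -
  have *: "sR (dotp d (V j) (X k)) = \<sigma>2 (dotp d (V j) (X k))" "\<bar>\<sigma>2 (dotp d (V j) (X k))\<bar> \<le> B" "\<bar>fs (X k)\<bar> \<le> F"
    if "j < m2" "k < n" for j k using good that s2_B by (auto simp: good_def sR_def)
  have u: "unitV V" using good by (simp add: good_def)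
  have "(\<integral>\<^sup>+x. ennreal ((feat d n m2 \<sigma>2 (\<lambda>_. 1) V X x)^4) \<partial>\<nu>) \<le> ennreal ((2 * K)^4 * K)"
  proof (rule feat_moment4[OF V u])
    fix j assume j: "j < m2"
    have "(\<Sum>k<n. 1 * \<sigma>2 (dotp d (V j) (X k))) = (\<Sum>k<n. sR (dotp d (V j) (X k)))" using * j by simp
    then show "\<bar>(\<Sum>k<n. 1 * \<sigma>2 (dotp d (V j) (X k))) / n\<bar> \<le> 2 * K" using good j by (simp add: good_def)
  qed (use ge1 in auto)
  then show "(\<integral>\<^sup>+x. ennreal ((feat d n m2 \<sigma>2 (\<lambda>_. 1) V X x)^4) \<partial>\<nu>) \<le> ennreal (16 * K^5)"
    by (simp add: power_mult_distrib power_numeral_reduce ac_simps)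
  show "(\<integral>\<^sup>+x. ennreal ((feat d n m2 \<sigma>2 fs V X x)^4) \<partial>\<nu>) \<le> ennreal ((F * B)^4 * K)"
  proof (rule feat_moment4[OF V u])
    fix j assume j: "j < m2"
    have "\<bar>\<Sum>k<n. fs (X k) * \<sigma>2 (dotp d (V j) (X k))\<bar> \<le> (\<Sum>k<n. F * B)"
      using * j ge1 by (intro order_trans[OF sum_abs] sum_mono) (auto simp: abs_mult intro!: mult_mono)
    then show "\<bar>(\<Sum>k<n. fs (X k) * \<sigma>2 (dotp d (V j) (X k))) / n\<bar> \<le> F * B" using pos by (simp add: field_simps)
  qed (use ge1 in auto)
qed

end

section \<open>Tail bounds for signs and biases\<close>

lemma hoeffding_iid_pair:
  assumes M: "prob_space M" and N: "prob_space N" and [measurable]: "f \<in> borel_measurable (M \<Otimes>\<^sub>M N)"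
    and bd: "\<And>x. x \<in> space (M \<Otimes>\<^sub>M N) \<Longrightarrow> \<bar>f x\<bar> \<le> b" and b: "b > 0" and L: "0 < L" and n: "128 * L \<le> real n"
  shows "emeasure (Pi\<^sub>M {..<n} (\<lambda>_. M) \<Otimes>\<^sub>M Pi\<^sub>M {..<n} (\<lambda>_. N))
      {X \<in> space (Pi\<^sub>M {..<n} (\<lambda>_. M) \<Otimes>\<^sub>M Pi\<^sub>M {..<n} (\<lambda>_. N)).
         12 * b * sqrt (L / n) < \<bar>(\<Sum>k<n. f (fst X k, snd X k)) / n - (\<integral>x. f x \<partial>(M \<Otimes>\<^sub>M N))\<bar>}
     \<le> ennreal (2 * exp (- 32 * L))"
proof -
  interpret M: prob_space M by fact
  interpret N: prob_space N by fact
  interpret MN: pair_prob_space M N ..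
  let ?P = "Pi\<^sub>M {..<n} (\<lambda>_. M) \<Otimes>\<^sub>M Pi\<^sub>M {..<n} (\<lambda>_. N)"
  let ?D = "\<lambda>X. \<bar>(\<Sum>k<n. f (fst X k, snd X k)) / n - (\<integral>x. f x \<partial>(M \<Otimes>\<^sub>M N))\<bar>"
  have n0: "n > 0" using n L by (intro gr0I) auto
  have sq: "(f x)\<^sup>2 \<le> b\<^sup>2" if "x \<in> space (M \<Otimes>\<^sub>M N)" for x
    using bd[OF that] b by (simp add: abs_le_square_iff[symmetric])
  have "(\<integral>x. (f x)\<^sup>2 \<partial>(M \<Otimes>\<^sub>M N)) \<le> b\<^sup>2"
    by (rule MN.integral_le_const)
       (use sq in \<open>auto intro!: MN.integrable_const_bound[where B="b\<^sup>2"]\<close>)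
  then have main: "emeasure ?P {X \<in> space ?P. 2 * sqrt (b\<^sup>2 * (32 * L) / n) < ?D X} \<le> ennreal (2 * exp (- (32 * L)))"
    using b L n by (intro bernstein_iid_pair[OF M N, of f b "b\<^sup>2" "32 * L" n] bd n0) (auto simp: mult.commute mult.left_commute)
  have t: "2 * sqrt (b\<^sup>2 * (32 * L) / n) \<le> 12 * b * sqrt (L / n)"
  proof -
    have "sqrt 32 \<le> 6" by (intro real_le_lsqrt) auto
    have "2 * sqrt (b\<^sup>2 * (32 * L) / n) = 2 * b * sqrt 32 * sqrt (L / n)"
      using b by (simp add: real_sqrt_mult real_sqrt_divide)
    also have "\<dots> \<le> 2 * b * 6 * sqrt (L / n)"
      using \<open>sqrt 32 \<le> 6\<close> b L by (intro mult_right_mono mult_left_mono) auto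
    finally show ?thesis by simp
  qed
  have "(\<lambda>X. f (fst X k, snd X k)) \<in> borel_measurable ?P" if "k \<in> {..<n}" for k
  proof -
    have "(\<lambda>X. fst X k) \<in> measurable ?P M" "(\<lambda>X. snd X k) \<in> measurable ?P N"
      using that by (auto intro: measurable_compose[OF measurable_fst measurable_component_singleton]
        measurable_compose[OF measurable_snd measurable_component_singleton])
    then show ?thesis by measurable
  qed
  then have [measurable]: "?D \<in> borel_measurable ?P"
    by (intro borel_measurable_abs borel_measurable_diff borel_measurable_divide borel_measurable_sum) auto
  have "{X \<in> space ?P. 2 * sqrt (b\<^sup>2 * (32 * L) / n) < ?D X} \<in> sets ?P" by measurable
  then have "emeasure ?P {X \<in> space ?P. 12 * b * sqrt (L / n) < ?D X} \<le> emeasure ?P {X \<in> space ?P. 2 * sqrt (b\<^sup>2 * (32 * L) / n) < ?D X}"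
    using t by (intro emeasure_mono) auto
  also note main
  finally show ?thesis by simp
qed

text \<open>Exponential Markov inequality with parameter \<open>1 / 4\<close>: the threshold
  contributes \<open>2 * m\<close> to the exponent, and the moment is
  \<open>sqrt 2 ^ m \<le> exp m\<close>.\<close>

lemma normal_norm_tail:
  assumes "m > 0"
  shows "emeasure (Pi\<^sub>M {..<m} (\<lambda>_. std_normal)) {b \<in> space (Pi\<^sub>M {..<m} (\<lambda>_. std_normal)). 8 * real m < (\<Sum>i<m. (b i)\<^sup>2)}
     \<le> ennreal (exp (- real m))"
proof -
  let ?P = "Pi\<^sub>M {..<m} (\<lambda>_. std_normal)"
  have [measurable]: "(\<lambda>b. b i) \<in> borel_measurable ?P" if "i \<in> {..<m}" for i
    using measurable_component_singleton[OF that, of "\<lambda>_. std_normal"] measurable_cong_sets[OF refl sets_std_normal] by blast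
  have u: "(\<lambda>b. ennreal (exp ((\<Sum>i<m. (b i)\<^sup>2) / 4))) \<in> borel_measurable ?P" by measurable
  have "(\<integral>\<^sup>+b. ennreal (exp ((\<Sum>i<m. (b i)\<^sup>2) / 4)) \<partial>?P) = (\<integral>\<^sup>+b. (\<Prod>i<m. ennreal (exp ((b i)\<^sup>2 / 4))) \<partial>?P)"
    by (simp add: sum_divide_distrib ennreal_exp_sum)
  also have "\<dots> = (\<integral>\<^sup>+b. ennreal (exp (b\<^sup>2 / 4)) \<partial>std_normal) ^ m"
  proof -
    have "(\<lambda>b::real. ennreal (exp (b\<^sup>2 / 4))) \<in> borel_measurable borel" by simp
    then have "(\<lambda>b. ennreal (exp (b\<^sup>2 / 4))) \<in> borel_measurable std_normal"
      using measurable_cong_sets[OF sets_std_normal refl] by blast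
    from nn_integral_PiM_prod_iid[OF prob_space_std_normal _ this, of "{..<m}"] show ?thesis by simp
  qed
  also have "\<dots> = ennreal (sqrt 2 ^ m)" by (simp add: std_normal_exp_square ennreal_power)
  also have "\<dots> \<le> ennreal (exp (real m))"
  proof (rule ennreal_leI)
    have "sqrt 2 \<le> (2::real)" by (intro real_le_lsqrt) auto
    then have "sqrt 2 \<le> exp 1" using exp_ge_add_one_self[of 1] by linarith
    then have "sqrt 2 ^ m \<le> exp 1 ^ m" by (intro power_mono) auto
    then show "sqrt 2 ^ m \<le> exp (real m)" by (simp add: exp_of_nat_mult[symmetric])
  qed
  finally have I: "(\<integral>\<^sup>+b. ennreal (exp ((\<Sum>i<m. (b i)\<^sup>2) / 4)) \<partial>?P) \<le> ennreal (exp (real m))" .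
  have "emeasure ?P {b \<in> space ?P. 8 * real m < (\<Sum>i<m. (b i)\<^sup>2)}
    \<le> emeasure ?P {b \<in> space ?P. 1 \<le> ennreal (exp (- 2 * real m)) * ennreal (exp ((\<Sum>i<m. (b i)\<^sup>2) / 4))}"
  proof (rule emeasure_mono)
    show "{b \<in> space ?P. 8 * real m < (\<Sum>i<m. (b i)\<^sup>2)} \<subseteq> {b \<in> space ?P. 1 \<le> ennreal (exp (- 2 * real m)) * ennreal (exp ((\<Sum>i<m. (b i)\<^sup>2) / 4))}"
    proof safe
      fix b :: "nat \<Rightarrow> real" assume "8 * real m < (\<Sum>i<m. (b i)\<^sup>2)"
      then have "0 \<le> - 2 * real m + (\<Sum>i<m. (b i)\<^sup>2) / 4" by simp
      then have "1 \<le> exp (- 2 * real m) * exp ((\<Sum>i<m. (b i)\<^sup>2) / 4)" by (simp flip: exp_add)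
      then show "1 \<le> ennreal (exp (- 2 * real m)) * ennreal (exp ((\<Sum>i<m. (b i)\<^sup>2) / 4))"
        by (simp flip: ennreal_mult'' ennreal_1 del: ennreal_1)
    qed
    show "{b \<in> space ?P. 1 \<le> ennreal (exp (- 2 * real m)) * ennreal (exp ((\<Sum>i<m. (b i)\<^sup>2) / 4))} \<in> sets ?P" by measurable
  qed
  also have "\<dots> \<le> ennreal (exp (- 2 * real m)) * (\<integral>\<^sup>+b. ennreal (exp ((\<Sum>i<m. (b i)\<^sup>2) / 4)) * indicator (space ?P) b \<partial>?P)"
    by (intro nn_integral_Markov_inequality) (auto intro!: borel_measurable_times_ennreal u)
  also have "(\<integral>\<^sup>+b. ennreal (exp ((\<Sum>i<m. (b i)\<^sup>2) / 4)) * indicator (space ?P) b \<partial>?P) = (\<integral>\<^sup>+b. ennreal (exp ((\<Sum>i<m. (b i)\<^sup>2) / 4)) \<partial>?P)"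
    by (intro nn_integral_cong) auto
  also have "ennreal (exp (- 2 * real m)) * \<dots> \<le> ennreal (exp (- 2 * real m)) * ennreal (exp (real m))"
    using I by (intro mult_left_mono) auto
  also have "\<dots> = ennreal (exp (- real m))" by (simp flip: ennreal_mult'' exp_add)
  finally show ?thesis .
qed

lemma prod_mono_ennreal:
  fixes f g :: "'i \<Rightarrow> ennreal"
  assumes "\<And>i. i \<in> I \<Longrightarrow> f i \<le> g i"
  shows "(\<Prod>i\<in>I. f i) \<le> (\<Prod>i\<in>I. g i)"
  using assms by (induction I rule: infinite_finite_induct) (auto intro!: mult_mono)

lemma rademacher_sum_tail:
  fixes r :: "nat \<Rightarrow> real"
  assumes r: "(\<Sum>i<m. (r i)\<^sup>2) \<le> V" and V: "V > 0" and L: "L > 0"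
  shows "emeasure (Pi\<^sub>M {..<m} (\<lambda>_. rademacher)) {a \<in> space (Pi\<^sub>M {..<m} (\<lambda>_. rademacher)). 2 * sqrt (V * L) < \<bar>\<Sum>i<m. a i * r i\<bar>}
     \<le> ennreal (2 * exp (- L))"
proof -
  let ?P = "Pi\<^sub>M {..<m} (\<lambda>_. rademacher)"
  interpret P: prob_space ?P by (intro prob_space_PiM prob_space_rademacher)
  interpret product_sigma_finite "\<lambda>_. rademacher"
    by (simp add: product_sigma_finite_def prob_space_rademacher prob_space_imp_sigma_finite)
  have "(\<lambda>a. a i) \<in> borel_measurable ?P" if "i \<in> {..<m}" for i
  proof -
    have "(\<lambda>x. x) \<in> measurable rademacher borel" by (simp add: measurable_rademacher)
    from measurable_compose[OF measurable_component_singleton[OF that] this] show ?thesis by simp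
  qed
  then have S: "(\<lambda>a. \<Sum>i<m. a i * r i) \<in> borel_measurable ?P"
    by (intro borel_measurable_sum borel_measurable_times) auto
  show ?thesis
  proof (rule P.chernoff_two_sided[OF S V L])
    fix s :: real
    have "(\<integral>\<^sup>+a. ennreal (exp (s * (\<Sum>i<m. a i * r i))) \<partial>?P) = (\<integral>\<^sup>+a. (\<Prod>i<m. ennreal (exp (s * (a i * r i)))) \<partial>?P)"
      by (simp add: sum_distrib_left ennreal_exp_sum)
    also have "\<dots> = (\<Prod>i<m. \<integral>\<^sup>+a. ennreal (exp (s * (a * r i))) \<partial>rademacher)"
      by (rule product_nn_integral_prod[of "{..<m}" "\<lambda>i a. ennreal (exp (s * (a * r i)))"]) auto
    also have "\<dots> \<le> (\<Prod>i<m. ennreal (exp (s\<^sup>2 * (r i)\<^sup>2)))"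
    proof (rule prod_mono_ennreal)
      fix i
      have "(\<integral>\<^sup>+a. ennreal (exp (s * (a * r i))) \<partial>rademacher) = (ennreal (exp (s * ((-1) * r i))) + ennreal (exp (s * (1 * r i)))) / 2"
        by (rule nn_integral_rademacher)
      also have "\<dots> = ennreal ((exp (s * r i) + exp (- (s * r i))) / 2)"
        by (simp add: add.commute flip: ennreal_plus divide_ennreal[of _ 2, simplified])
      also have "\<dots> \<le> ennreal (exp ((s * r i)\<^sup>2))" by (intro ennreal_leI cosh_le_exp_square)
      finally show "(\<integral>\<^sup>+a. ennreal (exp (s * (a * r i))) \<partial>rademacher) \<le> ennreal (exp (s\<^sup>2 * (r i)\<^sup>2))"
        by (simp add: power_mult_distrib)
    qed
    also have "\<dots> = ennreal (exp (s\<^sup>2 * (\<Sum>i<m. (r i)\<^sup>2)))" by (simp add: sum_distrib_left ennreal_exp_sum)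
    also have "\<dots> \<le> ennreal (exp (s\<^sup>2 * V))" using r by (intro ennreal_leI) (simp add: mult_left_mono)
    finally show "(\<integral>\<^sup>+a. ennreal (exp (s * (\<Sum>i<m. a i * r i))) \<partial>?P) \<le> ennreal (exp (s\<^sup>2 * V))" .
  qed
qed

lemma AE_PiM_rademacher: "AE a in Pi\<^sub>M {..<m::nat} (\<lambda>_. rademacher). \<forall>i\<in>{..<m}. a i = 1 \<or> a i = -1"
  by (rule AE_finite_allI) (auto intro!: AE_PiM_component AE_rademacher prob_space_rademacher)

section \<open>Representing a smooth function by random biased ReLUs\<close>

lemma relu_lipschitz: "\<bar>relu x - relu y\<bar> \<le> \<bar>x - y\<bar>"
  by (auto simp: relu_def)

lemma relu_meas [measurable]: "relu \<in> borel_measurable borel"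
  unfolding relu_def[abs_def] by measurable

text \<open>Importance weighting: dividing a weight by the density turns a Gaussian average over the
  bias into a Lebesgue integral.\<close>

lemma integral_std_normal_set:
  fixes g :: "real \<Rightarrow> real"
  assumes A: "A \<in> sets borel" and int: "set_integrable lborel A g"
  shows "(\<integral>b. indicator A b * g b / std_normal_density b \<partial>std_normal) = integral A g"
proof -
  have gm: "(\<lambda>b. indicator A b * g b) \<in> borel_measurable lborel"
    using int by (auto simp: set_integrable_def dest: borel_measurable_integrable)
  have "(\<integral>b. indicator A b * g b / std_normal_density b \<partial>std_normal)
     = (\<integral>b. std_normal_density b *\<^sub>R (indicator A b * g b / std_normal_density b) \<partial>lborel)"
    unfolding std_normal_def using gm by (intro integral_density) auto
  also have "\<dots> = (\<integral>b. indicator A b *\<^sub>R g b \<partial>lborel)"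
  proof (rule Bochner_Integration.integral_cong[OF refl])
    fix b :: real
    have "std_normal_density b > 0" by (simp add: normal_density_pos)
    then show "std_normal_density b *\<^sub>R (indicator A b * g b / std_normal_density b) = indicator A b *\<^sub>R g b" by simp
  qed
  also have "\<dots> = integral A g"
    using set_borel_integral_eq_integral(2)[OF int] by (simp add: set_lebesgue_integral_def)
  finally show ?thesis .
qed

text \<open>Projection onto \<open>[-1, 0]\<close>, the interval swept by the kink
  \<open>- b / 2\<close> as \<open>b\<close> runs through \<open>[0, 2]\<close>.\<close>

definition clamp01 :: "real \<Rightarrow> real" where "clamp01 z = min (max z (-1)) 0"

text \<open>Integration by parts; the ReLU vanishes below \<open>- 2 * z\<close>, so the integral
  effectively starts at the clamped point \<open>b0\<close>. For \<open>z\<close> in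
  \<open>[-1, 0]\<close> the value is 4 times the first order Taylor remainder of \<open>f\<close>
  at \<open>-1\<close>; it is continued linearly to the right and by zero to the left.\<close>

lemma kink_integral:
  fixes f f1 f2 :: "real \<Rightarrow> real"
  assumes f: "\<And>x. x \<in> {-1..1} \<Longrightarrow> (f has_real_derivative f1 x) (at x within {-1..1})"
    and f1: "\<And>x. x \<in> {-1..1} \<Longrightarrow> (f1 has_real_derivative f2 x) (at x within {-1..1})"
  shows "((\<lambda>b. f2 (- b / 2) * relu (2 * z + b)) has_integral
     4 * (f1 (clamp01 z) * (z - clamp01 z) + f (clamp01 z) - f (-1) - f1 (-1) * (z + 1))) {0..2}"
proof -
  define b0 where "b0 = - 2 * clamp01 z"
  have b0: "0 \<le> b0" "b0 \<le> 2" by (auto simp: b0_def clamp01_def)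
  let ?P = "\<lambda>b. - 4 * (f1 (- b / 2) * (z + b / 2) + f (- b / 2))"
  have img: "(\<lambda>b::real. - b / 2) ` {0..2} \<subseteq> {-1..1}" by auto
  have dP: "(?P has_real_derivative f2 (- b / 2) * (2 * z + b)) (at b within {b0..2})" if b: "b \<in> {b0..2}" for b
  proof -
    have b': "- b / 2 \<in> {-1..1}" using b b0 by auto
    have g: "((\<lambda>b::real. - b / 2) has_real_derivative - 1 / 2) (at b within {b0..2})"
      by (auto intro!: derivative_eq_intros)
    have sub: "(\<lambda>b::real. - b / 2) ` {b0..2} \<subseteq> {-1..1}" using b0 by auto
    have c1: "((\<lambda>b. f1 (- b / 2)) has_real_derivative f2 (- b / 2) * (- 1 / 2)) (at b within {b0..2})"
      using DERIV_image_chain[OF has_field_derivative_subset[OF f1[OF b'] sub] g] by (simp add: o_def)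
    have c0: "((\<lambda>b. f (- b / 2)) has_real_derivative f1 (- b / 2) * (- 1 / 2)) (at b within {b0..2})"
      using DERIV_image_chain[OF has_field_derivative_subset[OF f[OF b'] sub] g] by (simp add: o_def)
    show ?thesis
      by (rule derivative_eq_intros c0 c1 refl | simp add: field_simps)+
  qed
  have i2: "((\<lambda>b. f2 (- b / 2) * relu (2 * z + b)) has_integral (?P 2 - ?P b0)) {b0..2}"
  proof (cases "z < -1")
    case True
    then have "b0 = 2" by (simp add: b0_def clamp01_def)
    then show ?thesis by (simp add: has_integral_refl)
  next
    case False
    have A: "((\<lambda>b. f2 (- b / 2) * (2 * z + b)) has_integral (?P 2 - ?P b0)) {b0..2}"
      using dP b0 by (intro fundamental_theorem_of_calculus) (auto simp: has_real_derivative_iff_has_vector_derivative)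
    have "2 * z + b = relu (2 * z + b)" if "b \<in> {b0..2}" for b
      using that False by (auto simp: b0_def clamp01_def relu_def min_def max_def split: if_splits)
    then show ?thesis by (intro has_integral_eq[OF _ A]) metis
  qed
  have i1: "((\<lambda>b. f2 (- b / 2) * relu (2 * z + b)) has_integral 0) {0..b0}"
  proof (cases "z > 0")
    case True
    then have "b0 = 0" by (simp add: b0_def clamp01_def)
    then show ?thesis by (simp add: has_integral_refl)
  next
    case False
    then show ?thesis
      by (intro has_integral_is_0) (auto simp: b0_def clamp01_def relu_def min_def max_def split: if_splits)
  qed
  have "((\<lambda>b. f2 (- b / 2) * relu (2 * z + b)) has_integral (0 + (?P 2 - ?P b0))) {0..2}"
    using b0 i1 i2 by (intro has_integral_combine[of 0 b0 2]) auto
  moreover have "- b0 / 2 = clamp01 z" "b0 / 2 = - clamp01 z" by (auto simp: b0_def)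
  ultimately show ?thesis by (simp add: algebra_simps)
qed

lemma kink_expectation:
  fixes f f1 f2 :: "real \<Rightarrow> real"
  assumes f: "\<And>x. x \<in> {-1..1} \<Longrightarrow> (f has_real_derivative f1 x) (at x within {-1..1})"
    and f1: "\<And>x. x \<in> {-1..1} \<Longrightarrow> (f1 has_real_derivative f2 x) (at x within {-1..1})"
    and f2: "continuous_on {-1..1} f2"
  shows "(\<integral>b. indicator {0<..<2} b * (f2 (- b / 2) * relu (2 * z + b)) / std_normal_density b \<partial>std_normal)
    = 4 * (f1 (clamp01 z) * (z - clamp01 z) + f (clamp01 z) - f (-1) - f1 (-1) * (z + 1))"
proof -
  let ?g = "\<lambda>b. f2 (- b / 2) * relu (2 * z + b)"
  have "continuous_on {0..2} (\<lambda>b::real. f2 (- b / 2))"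
    by (rule continuous_on_compose2[OF f2]) (auto intro!: continuous_intros)
  then have "continuous_on {0..2} ?g" unfolding relu_def by (intro continuous_intros)
  then have "set_integrable lborel {0..2} ?g" by (rule borel_integrable_atLeastAtMost')
  then have "set_integrable lborel {0<..<2} ?g" by (rule set_integrable_subset) auto
  then have "(\<integral>b. indicator {0<..<2} b * ?g b / std_normal_density b \<partial>std_normal) = integral {0<..<2} ?g"
    by (intro integral_std_normal_set) auto
  also have "\<dots> = integral {0..2} ?g" using integral_open_interval_real[of 0 2 ?g] by simp
  also have "\<dots> = 4 * (f1 (clamp01 z) * (z - clamp01 z) + f (clamp01 z) - f (-1) - f1 (-1) * (z + 1))"
    using kink_integral[OF f f1] by (intro integral_unique) auto
  finally show ?thesis .
qed

text \<open>For \<open>\<bar>z\<bar> \<le> 1\<close> all neurons with bias in \<open>[2, 3]\<close>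
  are active, so they act linearly and supply the affine correction of the representation.\<close>

definition lin_part :: "real \<Rightarrow> real" where
  "lin_part z = (\<integral>b. indicator {2..3} b * relu (2 * z + b) / std_normal_density b \<partial>std_normal)"

lemma lin_part_integral: "lin_part z = integral {2..3} (\<lambda>b. relu (2 * z + b))" and
  lin_part_integrable: "(\<lambda>b. relu (2 * z + b)) integrable_on {2..3}"
proof -
  have c: "continuous_on {2..3} (\<lambda>b. relu (2 * z + b))" unfolding relu_def by (intro continuous_intros)
  show "lin_part z = integral {2..3} (\<lambda>b. relu (2 * z + b))"
    unfolding lin_part_def by (intro integral_std_normal_set borel_integrable_atLeastAtMost' c) auto
  show "(\<lambda>b. relu (2 * z + b)) integrable_on {2..3}" using c by (rule integrable_continuous_real)
qed

lemma lin_part_eq: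
  assumes "\<bar>z\<bar> \<le> 1"
  shows "lin_part z = 2 * z + 5 / 2"
proof -
  have "((\<lambda>b. relu (2 * z + b)) has_integral ((2 * z * 3 + 3\<^sup>2 / 2) - (2 * z * 2 + 2\<^sup>2 / 2))) {2..3}"
  proof (rule has_integral_eq[rotated])
    show "((\<lambda>b. 2 * z + b) has_integral ((2 * z * 3 + 3\<^sup>2 / 2) - (2 * z * 2 + 2\<^sup>2 / 2))) {2..3}"
      by (rule fundamental_theorem_of_calculus[where f="\<lambda>b. 2 * z * b + b\<^sup>2 / 2"])
         (auto simp flip: has_real_derivative_iff_has_vector_derivative intro!: derivative_eq_intros)
  qed (use assms in \<open>auto simp: relu_def\<close>)
  then show ?thesis unfolding lin_part_integral by (subst integral_unique) (auto simp: field_simps)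
qed

lemma lin_part_lipschitz: "\<bar>lin_part z - lin_part y\<bar> \<le> 2 * \<bar>z - y\<bar>"
proof -
  have "\<bar>lin_part z - lin_part y\<bar> = norm (integral {2..3} (\<lambda>b. relu (2 * z + b) - relu (2 * y + b)))"
    unfolding lin_part_integral using lin_part_integrable by (simp add: Henstock_Kurzweil_Integration.integral_diff)
  also have "\<dots> \<le> integral {2..3::real} (\<lambda>b. 2 * \<bar>z - y\<bar>)"
  proof (rule integral_norm_bound_integral)
    show "norm (relu (2 * z + b) - relu (2 * y + b)) \<le> 2 * \<bar>z - y\<bar>" for b
      using relu_lipschitz[of "2 * z + b" "2 * y + b"] by (simp add: abs_if split: if_splits)
  qed (auto intro!: integrable_diff lin_part_integrable)
  finally show ?thesis by simp
qed

lemma sob_norm_bounds: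
  assumes q: "C2_interval q" and x: "x \<in> {-1..1}"
  shows "\<bar>q x\<bar> \<le> sob_norm q 1" "\<bar>dq q 1 x\<bar> \<le> sob_norm q 1" "\<bar>dq q 2 x\<bar> \<le> sob_norm q 2" "sob_norm q 1 \<le> sob_norm q 2"
proof -
  have d0: "\<And>x. x \<in> {-1..1} \<Longrightarrow> (q has_vector_derivative dq q 1 x) (at x within {-1..1})"
    and d1: "\<And>x. x \<in> {-1..1} \<Longrightarrow> (dq q 1 has_vector_derivative dq q 2 x) (at x within {-1..1})"
    and c2: "continuous_on {-1..1} (dq q 2)"
    using q by (auto simp: C2_interval_def)
  have c: "continuous_on {-1..1} (dq q s)" if "s \<le> 2" for s
  proof -
    consider "s = 0" | "s = 1" | "s = 2" using \<open>s \<le> 2\<close> by linarith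
    then show ?thesis
      using c2 has_vector_derivative_continuous[OF d0] has_vector_derivative_continuous[OF d1]
      by cases (auto simp: continuous_on_eq_continuous_within)
  qed
  have b: "bdd_above ((\<lambda>x. \<bar>dq q s x\<bar>) ` {-1..1})" if "s \<le> 2" for s
    using c[OF that] by (intro bounded_imp_bdd_above compact_imp_bounded compact_continuous_image continuous_on_rabs) auto
  have up: "\<bar>dq q s x\<bar> \<le> sob_norm q k" if "s \<le> k" "k \<le> 2" for s k
  proof -
    have "\<bar>dq q s x\<bar> \<le> (SUP x\<in>{-1..1}. \<bar>dq q s x\<bar>)" using b[of s] x that by (intro cSUP_upper) auto
    also have "\<dots> \<le> sob_norm q k" unfolding sob_norm_def using that by (intro Max_ge) auto
    finally show ?thesis .
  qed
  show "\<bar>q x\<bar> \<le> sob_norm q 1" using up[of 0 1] by simp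
  show "\<bar>dq q 1 x\<bar> \<le> sob_norm q 1" "\<bar>dq q 2 x\<bar> \<le> sob_norm q 2" using up[of 1 1] up[of 2 2] by auto
  show "sob_norm q 1 \<le> sob_norm q 2" unfolding sob_norm_def by (intro Max_mono) auto
qed

text \<open>The weights are divided by the Gaussian density, which on \<open>[0, 3]\<close> is
  smallest at 3; the 8 leaves room for every numerator that occurs.\<close>

definition Wb :: real where "Wb = 8 / std_normal_density 3"

lemma Wb_pos: "Wb \<ge> 1"
proof -
  have "std_normal_density 3 \<le> 1"
  proof -
    have "1 / sqrt (2 * pi) \<le> 1" using pi_gt3 by simp
    moreover have "exp (- 3\<^sup>2 / 2) \<le> (1::real)" by simp
    ultimately show ?thesis unfolding std_normal_density_def by (intro mult_le_one) auto
  qed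
  moreover have "std_normal_density 3 > 0" by (simp add: normal_density_pos)
  ultimately show ?thesis by (simp add: Wb_def field_simps)
qed

lemma density_ge: "0 \<le> b \<Longrightarrow> b \<le> 3 \<Longrightarrow> std_normal_density 3 \<le> std_normal_density b"
  unfolding std_normal_density_def using power_mono[of b 3 2] by (intro mult_left_mono) auto

lemma density_div_bound:
  assumes "0 \<le> b" "b \<le> 3" "\<bar>c\<bar> \<le> 8 * S"
  shows "\<bar>c / std_normal_density b\<bar> \<le> S * Wb"
proof -
  have p: "std_normal_density 3 > 0" by (simp add: normal_density_pos)
  then have "std_normal_density b > 0" using density_ge[OF assms(1,2)] by linarith
  then have "\<bar>c / std_normal_density b\<bar> = \<bar>c\<bar> / std_normal_density b" by (simp add: abs_divide)
  also have "\<dots> \<le> 8 * S / std_normal_density 3" using p assms density_ge[OF assms(1,2)] by (intro frac_le) auto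
  finally show ?thesis by (simp add: Wb_def mult.commute)
qed

lemma std_normal_integrable:
  assumes [measurable]: "g \<in> borel_measurable borel" and c: "\<And>b. \<bar>g b\<bar> \<le> c" and s: "\<And>b::real. g b \<noteq> 0 \<Longrightarrow> 0 < b \<and> b \<le> 3"
  shows "integrable std_normal (\<lambda>b. g b * relu (z + b))"
proof -
  interpret prob_space std_normal by (rule prob_space_std_normal)
  show ?thesis
  proof (rule integrable_const_bound[where B="c * (\<bar>z\<bar> + 3)"])
    have "\<bar>g b * relu (z + b)\<bar> \<le> c * (\<bar>z\<bar> + 3)" for b
    proof (cases "g b = 0")
      case False
      then have "\<bar>relu (z + b)\<bar> \<le> \<bar>z\<bar> + 3" using s[of b] by (auto simp: relu_def)
      then show ?thesis unfolding abs_mult using c[of b] by (intro mult_mono) auto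
    next
      case True
      then show ?thesis using c[of b] by simp
    qed
    then show "AE b in std_normal. norm (g b * relu (z + b)) \<le> c * (\<bar>z\<bar> + 3)" by simp
  qed measurable
qed

text \<open>Kinks with \<open>a = 1\<close> cover \<open>[-1, 0]\<close>, their mirror images with
  \<open>a = -1\<close> cover \<open>[0, 1]\<close>. On \<open>[-1, 1]\<close> the two remainders
  add up to \<open>q\<close> plus one and the same affine function, which the biases in
  \<open>[2, 3]\<close> cancel. The weights involve second derivatives and scale with
  \<open>sob_norm q 2\<close>, but the represented function has slopes controlled by first
  derivatives, even outside the interval. This is why the feature error is later multiplied by
  \<open>sob_norm q 1\<close> only.\<close>

lemma representation:
  assumes q: "C2_interval q"
  obtains u v :: "real \<Rightarrow> real" where
    "u \<in> borel_measurable borel" "v \<in> borel_measurable borel"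
    "\<And>b. \<bar>u b\<bar> \<le> Wb" "\<And>b. \<bar>v b\<bar> \<le> Wb"
    "\<And>b. u b \<noteq> 0 \<Longrightarrow> 0 < b \<and> b \<le> 3" "\<And>b. v b \<noteq> 0 \<Longrightarrow> 0 < b \<and> b \<le> 3"
    "\<And>y. y \<in> {-1..1} \<Longrightarrow> sob_norm q 2 * (((\<integral>b. u b * relu (2 * y + b) \<partial>std_normal) + (\<integral>b. v b * relu (- 2 * y + b) \<partial>std_normal)) / 2) = q y"
    "\<And>y z. y \<in> {-1..1} \<Longrightarrow>
      \<bar>sob_norm q 2 * (((\<integral>b. u b * relu (2 * z + b) \<partial>std_normal) + (\<integral>b. v b * relu (- 2 * z + b) \<partial>std_normal)) / 2) - q y\<bar>
      \<le> 11 * sob_norm q 1 * \<bar>z - y\<bar>"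
proof -
  define q1 q2 S1 S2 where "q1 = dq q 1" "q2 = dq q 2" "S1 = sob_norm q 1" "S2 = sob_norm q 2"
  note defs = q1_q2_S1_S2_def
  have d0: "\<And>x. x \<in> {-1..1} \<Longrightarrow> (q has_real_derivative q1 x) (at x within {-1..1})"
    and d1: "\<And>x. x \<in> {-1..1} \<Longrightarrow> (q1 has_real_derivative q2 x) (at x within {-1..1})"
    and c2: "continuous_on {-1..1} q2"
    using q by (auto simp: C2_interval_def defs has_real_derivative_iff_has_vector_derivative)
  have neg: "(uminus has_real_derivative -1) (at x within {-1..1})" for x :: real
    by (auto intro!: derivative_eq_intros)
  have img: "uminus ` {-1..1::real} = {-1..1}" by (auto simp: image_iff intro: bexI[of _ "- _"])
  have d0': "((\<lambda>x. q (- x)) has_real_derivative - q1 (- x)) (at x within {-1..1})" if "x \<in> {-1..1}" for x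
    using DERIV_image_chain[of q "q1 (- x)" uminus x "{-1..1}" "-1"] d0[of "- x"] neg[of x] that img by (simp add: o_def)
  have d1': "((\<lambda>x. - q1 (- x)) has_real_derivative q2 (- x)) (at x within {-1..1})" if "x \<in> {-1..1}" for x
    using DERIV_image_chain[of q1 "q2 (- x)" uminus x "{-1..1}" "-1"] d1[of "- x"] neg[of x] that img
    by (auto simp: o_def intro!: derivative_eq_intros)
  have c2': "continuous_on {-1..1} (\<lambda>x. q2 (- x))"
    by (rule continuous_on_compose2[OF c2]) (auto intro!: continuous_intros)
  have b: "\<bar>q x\<bar> \<le> S1" "\<bar>q1 x\<bar> \<le> S1" "\<bar>q2 x\<bar> \<le> S2" "S1 \<le> S2" if "x \<in> {-1..1}" for x
    using sob_norm_bounds[OF q that] by (auto simp: defs)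
  have S: "0 \<le> S1" "S1 \<le> S2" using b[of 0] by auto
  \<comment> \<open>The affine excess of the two remainders has constant
    \<open>q 0 - q (-1) - q1 (-1) - q 1 + q1 1\<close> and slope
    \<open>q1 0 - q1 (-1) - q1 1\<close>. The two linear parts contribute
    \<open>5/2 * p + 2 * r * y\<close>, which determines \<open>p\<close> and
    \<open>r\<close>.\<close>
  define p where "p = - (2/5) * (q 0 - q (-1) - q1 (-1) - q 1 + q1 1)"
  define r where "r = - (1/2) * (q1 0 - q1 (-1) - q1 1)"
  have pb: "\<bar>p\<bar> \<le> 2 * S1" using b(1)[of 0] b(1)[of "-1"] b(1)[of 1] b(2)[of "-1"] b(2)[of 1] by (simp add: p_def)
  have rb: "\<bar>r\<bar> \<le> 3/2 * S1" using b(2)[of 0] b(2)[of "-1"] b(2)[of 1] by (simp add: r_def)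
  let ?\<phi> = std_normal_density
  define u0 where "u0 = (\<lambda>b. (indicator {0<..<2} b * (q2 (- b / 2)) / 2 + (p + r) * indicator {2..3} b) / ?\<phi> b)"
  define v0 where "v0 = (\<lambda>b. (indicator {0<..<2} b * (q2 (b / 2)) / 2 + (p - r) * indicator {2..3} b) / ?\<phi> b)"
  have mm: "(\<lambda>b. indicator {0<..<2} b * q2 (- b / 2)) \<in> borel_measurable borel" "(\<lambda>b. indicator {0<..<2} b * q2 (b / 2)) \<in> borel_measurable borel"
  proof -
    have "continuous_on {0<..<2} (\<lambda>b::real. q2 (- b / 2))" "continuous_on {0<..<2} (\<lambda>b::real. q2 (b / 2))"
      by (rule continuous_on_compose2[OF c2]; auto intro!: continuous_intros)+
    then show "(\<lambda>b. indicator {0<..<2} b * q2 (- b / 2)) \<in> borel_measurable borel" "(\<lambda>b. indicator {0<..<2} b * q2 (b / 2)) \<in> borel_measurable borel"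
      using borel_measurable_continuous_on_indicator[of "{0<..<2::real}"] by fastforce+
  qed
  note mm[measurable]
  have m: "u0 \<in> borel_measurable borel" "v0 \<in> borel_measurable borel" unfolding u0_def v0_def by measurable
  have supp: "u0 b \<noteq> 0 \<Longrightarrow> 0 < b \<and> b \<le> 3" "v0 b \<noteq> 0 \<Longrightarrow> 0 < b \<and> b \<le> 3" for b
    by (auto simp: u0_def v0_def split: split_indicator_asm)
  have bd: "\<bar>u0 b\<bar> \<le> S2 * Wb" "\<bar>v0 b\<bar> \<le> S2 * Wb" for b
  proof -
    have z: "0 \<le> S2 * Wb" using S Wb_pos by auto
    have "\<bar>indicator {0<..<2} b * (q2 (- b / 2)) / 2 + (p + r) * indicator {2..3} b\<bar> \<le> 8 * S2"
      using S pb rb b(3)[of "- b / 2"] by (auto split: split_indicator)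
    then have "0 \<le> b \<Longrightarrow> b \<le> 3 \<Longrightarrow> \<bar>u0 b\<bar> \<le> S2 * Wb" unfolding u0_def by (intro density_div_bound)
    then show "\<bar>u0 b\<bar> \<le> S2 * Wb" using supp(1)[of b] z by (cases "u0 b = 0") auto
    have "\<bar>indicator {0<..<2} b * (q2 (b / 2)) / 2 + (p - r) * indicator {2..3} b\<bar> \<le> 8 * S2"
      using S pb rb b(3)[of "b / 2"] by (auto split: split_indicator)
    then have "0 \<le> b \<Longrightarrow> b \<le> 3 \<Longrightarrow> \<bar>v0 b\<bar> \<le> S2 * Wb" unfolding v0_def by (intro density_div_bound)
    then show "\<bar>v0 b\<bar> \<le> S2 * Wb" using supp(2)[of b] z by (cases "v0 b = 0") auto
  qed
  define u where "u = (\<lambda>b. u0 b / S2)"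
  define v where "v = (\<lambda>b. v0 b / S2)"
  \<comment> \<open>If \<open>S2 = 0\<close>, the bound \<open>bd\<close> forces \<open>u0\<close>
    and \<open>v0\<close> to vanish, so the division by zero is harmless.\<close>
  have u0: "S2 * u b = u0 b" and v0: "S2 * v b = v0 b" for b
    using bd[of b] by (auto simp: u_def v_def)
  have div_le: "\<bar>x / S2\<bar> \<le> Wb" if "\<bar>x\<bar> \<le> S2 * Wb" for x
  proof (cases "S2 = 0")
    case False
    then have "S2 > 0" using S by auto
    then show ?thesis using that by (simp add: abs_divide pos_divide_le_eq mult.commute)
  qed (use Wb_pos in simp)
  have ub: "\<bar>u b\<bar> \<le> Wb" and vb: "\<bar>v b\<bar> \<le> Wb" for b
    unfolding u_def v_def by (rule div_le[OF bd(1)], rule div_le[OF bd(2)])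
  define c0 where "c0 = clamp01"
  define J where "J = (\<lambda>z. q1 (c0 z) * (z - c0 z) + q (c0 z) - q (-1) - q1 (-1) * (z + 1))"
  define J' where "J' = (\<lambda>z. - q1 (- c0 (- z)) * (- z - c0 (- z)) + q (- c0 (- z)) - q 1 + q1 1 * (- z + 1))"
  have kb: "integrable std_normal (\<lambda>b. indicator {0<..<2} b * (f (- b / 2) * relu (2 * z + b)) / ?\<phi> b)"
    if f: "continuous_on {-1..1} f" "\<And>x. x \<in> {-1..1} \<Longrightarrow> \<bar>f x\<bar> \<le> S2" for f z
  proof -
    have "continuous_on {0<..<2} (\<lambda>b::real. f (- b / 2))"
      by (rule continuous_on_compose2[OF f(1)]) (auto intro!: continuous_intros)
    then have [measurable]: "(\<lambda>b. indicator {0<..<2} b * f (- b / 2)) \<in> borel_measurable borel"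
      using borel_measurable_continuous_on_indicator[of "{0<..<2::real}"] by fastforce
    have "integrable std_normal (\<lambda>b. (indicator {0<..<2} b * f (- b / 2) / ?\<phi> b) * relu (2 * z + b))"
    proof (rule std_normal_integrable)
      show "(\<lambda>b. indicator {0<..<2} b * f (- b / 2) / ?\<phi> b) \<in> borel_measurable borel" by measurable
      show "\<bar>indicator {0<..<2} b * f (- b / 2) / ?\<phi> b\<bar> \<le> S2 * Wb" for b
      proof (cases "b \<in> {0<..<2}")
        case True
        then show ?thesis using f(2)[of "- b / 2"] S by (intro density_div_bound) auto
      qed (use S Wb_pos in auto)
    qed (auto split: split_indicator_asm)
    then show ?thesis by (simp add: ac_simps)
  qed
  have lb: "integrable std_normal (\<lambda>b. indicator {2..3} b * relu (2 * z + b) / ?\<phi> b)" for z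
  proof -
    have "integrable std_normal (\<lambda>b. (indicator {2..3} b / ?\<phi> b) * relu (2 * z + b))"
    proof (rule std_normal_integrable)
      show "\<bar>indicator {2..3} b / ?\<phi> b\<bar> \<le> 1 * Wb" for b :: real
      proof (cases "b \<in> {2..3}")
        case True
        then show ?thesis by (intro density_div_bound) auto
      qed (use Wb_pos in auto)
    qed (auto split: split_indicator_asm)
    then show ?thesis by (simp add: ac_simps)
  qed
  have alg: "(A * B / 2 + C * D) / E * T = (1/2) * (A * (B * T) / E) + C * (D * T / E)" for A B C D E T :: real
    by (cases "E = 0") (auto simp: field_simps)
  have Iu: "(\<integral>b. u0 b * relu (2 * z + b) \<partial>std_normal) = 2 * J z + (p + r) * lin_part z" for z
  proof -
    have "(\<integral>b. u0 b * relu (2 * z + b) \<partial>std_normal)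
      = (\<integral>b. (1/2) * (indicator {0<..<2} b * (q2 (- b / 2) * relu (2 * z + b)) / ?\<phi> b) + (p + r) * (indicator {2..3} b * relu (2 * z + b) / ?\<phi> b) \<partial>std_normal)"
      unfolding u0_def alg by simp
    also have "\<dots> = (1/2) * (\<integral>b. indicator {0<..<2} b * (q2 (- b / 2) * relu (2 * z + b)) / ?\<phi> b \<partial>std_normal) + (p + r) * lin_part z"
      unfolding lin_part_def using kb[OF c2 b(3), of z] lb[of z]
      by (subst Bochner_Integration.integral_add) (auto simp del: times_divide_eq_right times_divide_eq_left)
    also have "\<dots> = 2 * J z + (p + r) * lin_part z"
      using kink_expectation[OF d0 d1 c2, of z] by (simp add: J_def c0_def)
    finally show ?thesis .
  qed
  have Iv: "(\<integral>b. v0 b * relu (- 2 * z + b) \<partial>std_normal) = 2 * J' z + (p - r) * lin_part (- z)" for z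
  proof -
    have "(\<integral>b. v0 b * relu (- 2 * z + b) \<partial>std_normal)
      = (\<integral>b. (1/2) * (indicator {0<..<2} b * (q2 (- (- b / 2)) * relu (2 * (- z) + b)) / ?\<phi> b) + (p - r) * (indicator {2..3} b * relu (2 * (- z) + b) / ?\<phi> b) \<partial>std_normal)"
      unfolding v0_def alg by simp
    also have "\<dots> = (1/2) * (\<integral>b. indicator {0<..<2} b * (q2 (- (- b / 2)) * relu (2 * (- z) + b)) / ?\<phi> b \<partial>std_normal) + (p - r) * lin_part (- z)"
      unfolding lin_part_def using kb[OF c2', of "- z"] b(3) lb[of "- z"]
      by (subst Bochner_Integration.integral_add) (auto simp del: times_divide_eq_right times_divide_eq_left)
    also have "\<dots> = 2 * J' z + (p - r) * lin_part (- z)"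
      using kink_expectation[OF d0' d1' c2', of "- z"] by (simp add: J'_def c0_def)
    finally show ?thesis .
  qed
  define Gq where "Gq = (\<lambda>z. S2 * (((\<integral>b. u b * relu (2 * z + b) \<partial>std_normal) + (\<integral>b. v b * relu (- 2 * z + b) \<partial>std_normal)) / 2))"
  have Gq: "Gq z = J z + J' z + (p + r) / 2 * lin_part z + (p - r) / 2 * lin_part (- z)" for z
  proof -
    have "S2 * (\<integral>b. u b * relu (2 * z + b) \<partial>std_normal) = (\<integral>b. u0 b * relu (2 * z + b) \<partial>std_normal)"
      "S2 * (\<integral>b. v b * relu (- 2 * z + b) \<partial>std_normal) = (\<integral>b. v0 b * relu (- 2 * z + b) \<partial>std_normal)"
      by (simp_all flip: u0 v0 add: mult.assoc)
    then show ?thesis unfolding Gq_def using Iu[of z] Iv[of z] by (simp add: field_simps)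
  qed
  have Geq: "Gq y = q y" if "y \<in> {-1..1}" for y
  proof -
    have l: "lin_part y = 2 * y + 5 / 2" "lin_part (- y) = - 2 * y + 5 / 2" using that by (auto simp: lin_part_eq abs_le_iff)
    show ?thesis
    proof (cases "y \<ge> 0")
      case True
      then have c: "c0 y = 0" "c0 (- y) = - y" using that by (auto simp: c0_def clamp01_def)
      show ?thesis unfolding Gq J_def J'_def l c p_def r_def by (simp add: field_simps)
    next
      case False
      then have c: "c0 y = y" "c0 (- y) = 0" using that by (auto simp: c0_def clamp01_def)
      show ?thesis unfolding Gq J_def J'_def l c p_def r_def by (simp add: field_simps)
    qed
  qed
  have qlip: "\<bar>q x - q y\<bar> \<le> S1 * \<bar>x - y\<bar>" if "x \<in> {-1..1}" "y \<in> {-1..1}" for x y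
    using field_differentiable_bound[of "{-1..1}" q q1 S1 x y] d0 b(2) that by auto
  \<comment> \<open>Outside the interval all clamps are constant, so the kink parts are affine with
    slope at most \<open>2 * S1\<close>; \<open>lin_part\<close> is no longer affine there, but it
    stays Lipschitz with constant 2 and adds at most \<open>7 * S1\<close>.\<close>
  have edge: "\<bar>Gq z - Gq e\<bar> \<le> 9 * S1 * \<bar>z - e\<bar>" if e: "(e = 1 \<and> 1 \<le> z) \<or> (e = -1 \<and> z \<le> -1)" for z e
  proof -
    have JJ: "\<bar>(J z + J' z) - (J e + J' e)\<bar> \<le> 2 * S1 * \<bar>z - e\<bar>"
    proof (cases "e = 1")
      case True
      then have c: "c0 z = 0" "c0 (- z) = -1" "c0 e = 0" "c0 (- e) = -1" and z: "1 \<le> z" using e by (auto simp: c0_def clamp01_def)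
      have "(J z + J' z) - (J e + J' e) = (q1 0 - q1 (-1)) * (z - e)" unfolding J_def J'_def c by (simp add: algebra_simps)
      moreover have "\<bar>q1 0 - q1 (-1)\<bar> \<le> 2 * S1" using b(2)[of 0] b(2)[of "-1"] by simp
      ultimately show ?thesis by (simp add: abs_mult mult_right_mono)
    next
      case False
      then have c: "c0 z = -1" "c0 (- z) = 0" "c0 e = -1" "c0 (- e) = 0" and z: "z \<le> -1" using e by (auto simp: c0_def clamp01_def)
      have "(J z + J' z) - (J e + J' e) = (q1 0 - q1 1) * (z - e)" unfolding J_def J'_def c by (simp add: algebra_simps)
      moreover have "\<bar>q1 0 - q1 1\<bar> \<le> 2 * S1" using b(2)[of 0] b(2)[of 1] by simp
      ultimately show ?thesis by (simp add: abs_mult mult_right_mono)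
    qed
    have pr: "\<bar>(p + r) / 2\<bar> \<le> 7/4 * S1" "\<bar>(p - r) / 2\<bar> \<le> 7/4 * S1"
      using abs_triangle_ineq[of p r] abs_triangle_ineq4[of p r] pb rb by (simp_all add: abs_divide)
    have l1: "\<bar>(p + r) / 2 * (lin_part z - lin_part e)\<bar> \<le> (7/4 * S1) * (2 * \<bar>z - e\<bar>)"
      using mult_mono[OF pr(1) lin_part_lipschitz[of z e]] S by (simp add: abs_mult)
    have l2: "\<bar>(p - r) / 2 * (lin_part (- z) - lin_part (- e))\<bar> \<le> (7/4 * S1) * (2 * \<bar>z - e\<bar>)"
      using mult_mono[OF pr(2) lin_part_lipschitz[of "- z" "- e"]] S by (simp add: abs_mult abs_minus_commute)
    have "Gq z - Gq e = ((J z + J' z) - (J e + J' e)) + (p + r) / 2 * (lin_part z - lin_part e) + (p - r) / 2 * (lin_part (- z) - lin_part (- e))"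
      unfolding Gq by (simp add: algebra_simps add_divide_distrib diff_divide_distrib)
    then have "\<bar>Gq z - Gq e\<bar> \<le> 2 * S1 * \<bar>z - e\<bar> + (7/4 * S1) * (2 * \<bar>z - e\<bar>) + (7/4 * S1) * (2 * \<bar>z - e\<bar>)"
      using JJ l1 l2 by linarith
    then show ?thesis by (simp add: algebra_simps)
  qed
  have Glip: "\<bar>Gq z - q y\<bar> \<le> 11 * S1 * \<bar>z - y\<bar>" if y: "y \<in> {-1..1}" for y z
  proof -
    define e where "e = max (min z 1) (-1)"
    have e: "e \<in> {-1..1}" by (auto simp: e_def)
    have 1: "\<bar>Gq z - Gq e\<bar> \<le> 9 * S1 * \<bar>z - e\<bar>"
    proof (cases "z \<in> {-1..1}")
      case True
      then have "e = z" by (auto simp: e_def)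
      then show ?thesis by simp
    next
      case False
      then show ?thesis by (intro edge) (auto simp: e_def)
    qed
    have d: "\<bar>z - e\<bar> \<le> \<bar>z - y\<bar>" "\<bar>e - y\<bar> \<le> \<bar>z - y\<bar>" using y by (auto simp: e_def min_def max_def)
    have "\<bar>Gq z - q y\<bar> \<le> \<bar>Gq z - Gq e\<bar> + \<bar>q e - q y\<bar>" using Geq[OF e] by simp
    also have "\<dots> \<le> 9 * S1 * \<bar>z - y\<bar> + S1 * \<bar>z - y\<bar>"
      using order_trans[OF 1 mult_left_mono[OF d(1)]] order_trans[OF qlip[OF e y] mult_left_mono[OF d(2)]] S by (intro add_mono) auto
    also have "\<dots> \<le> 11 * S1 * \<bar>z - y\<bar>" using S by (simp add: algebra_simps)
    finally show ?thesis .
  qed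
  show thesis
  proof (rule that[of u v])
    show "u \<in> borel_measurable borel" "v \<in> borel_measurable borel" unfolding u_def v_def using m by auto
    show "u b \<noteq> 0 \<Longrightarrow> 0 < b \<and> b \<le> 3" "v b \<noteq> 0 \<Longrightarrow> 0 < b \<and> b \<le> 3" for b
      using supp[of b] by (auto simp: u_def v_def)
  qed (use ub vb Geq Glip in \<open>auto simp: Gq_def defs\<close>)
qed

section \<open>The second layer at initialization\<close>

definition wt :: "(real \<Rightarrow> real) \<Rightarrow> (real \<Rightarrow> real) \<Rightarrow> real \<Rightarrow> real \<Rightarrow> real" where
  "wt u v a b = (if a = 1 then u b else if a = -1 then v b else 0)"

text \<open>The factor \<open>relu_deriv\<close> of \<open>psi\<close> is absent because the weights
  vanish for \<open>b \<le> 0\<close>; where they do not, both expressions agree.\<close>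

definition frep :: "(real \<Rightarrow> real) \<Rightarrow> (real \<Rightarrow> real) \<Rightarrow> real \<Rightarrow> real \<times> real \<Rightarrow> real" where
  "frep u v z p = wt u v (fst p) (snd p) * relu (2 * fst p * z + snd p)"

locale weights =
  fixes u v :: "real \<Rightarrow> real"
  assumes u_meas [measurable]: "u \<in> borel_measurable borel" and v_meas [measurable]: "v \<in> borel_measurable borel"
    and u_bd: "\<And>b. \<bar>u b\<bar> \<le> Wb" and v_bd: "\<And>b. \<bar>v b\<bar> \<le> Wb"
    and u_supp: "\<And>b. u b \<noteq> 0 \<Longrightarrow> 0 < b \<and> b \<le> 3" and v_supp: "\<And>b. v b \<noteq> 0 \<Longrightarrow> 0 < b \<and> b \<le> 3"
begin

abbreviation "RN \<equiv> rademacher \<Otimes>\<^sub>M std_normal"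

sublocale rad: prob_space rademacher by (rule prob_space_rademacher)
sublocale nor: prob_space std_normal by (rule prob_space_std_normal)
sublocale RN: pair_prob_space rademacher std_normal ..

lemma wt_bd: "\<bar>wt u v a b\<bar> \<le> Wb" using u_bd v_bd Wb_pos by (auto simp: wt_def)
lemma wt_supp: "wt u v a b \<noteq> 0 \<Longrightarrow> (a = 1 \<or> a = -1) \<and> 0 < b \<and> b \<le> 3"
  using u_supp v_supp by (auto simp: wt_def split: if_splits)

lemma frep_meas [measurable]: "frep u v z \<in> borel_measurable RN"
proof -
  have "(\<lambda>x::real. x) \<in> measurable rademacher borel" by simp
  from measurable_compose[OF measurable_fst[of rademacher std_normal] this] have [measurable]: "fst \<in> borel_measurable RN" by simp
  have [measurable]: "snd \<in> borel_measurable RN" by measurable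
  show ?thesis unfolding frep_def[abs_def] wt_def by measurable
qed

lemma frep_lipschitz: "\<bar>frep u v z p - frep u v y p\<bar> \<le> 2 * Wb * \<bar>z - y\<bar>"
proof (cases "wt u v (fst p) (snd p) = 0")
  case False
  note s = wt_supp[OF False]
  have "\<bar>relu (2 * fst p * z + snd p) - relu (2 * fst p * y + snd p)\<bar> \<le> 2 * \<bar>z - y\<bar>"
  proof -
    have "\<bar>2 * fst p * z + snd p - (2 * fst p * y + snd p)\<bar> = 2 * \<bar>z - y\<bar>" using s by (auto simp: abs_if)
    then show ?thesis using relu_lipschitz[of "2 * fst p * z + snd p" "2 * fst p * y + snd p"] by simp
  qed
  then have "\<bar>wt u v (fst p) (snd p)\<bar> * \<bar>relu (2 * fst p * z + snd p) - relu (2 * fst p * y + snd p)\<bar> \<le> Wb * (2 * \<bar>z - y\<bar>)"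
    using wt_bd Wb_pos by (intro mult_mono) auto
  then show ?thesis by (simp add: frep_def flip: abs_mult right_diff_distrib)
qed (use Wb_pos in \<open>simp add: frep_def\<close>)

lemma frep_bd: "\<bar>frep u v z p\<bar> \<le> Wb * (2 * \<bar>z\<bar> + 3)"
proof (cases "wt u v (fst p) (snd p) = 0")
  case False
  have "\<bar>relu (2 * fst p * z + snd p)\<bar> \<le> 2 * \<bar>z\<bar> + 3" using wt_supp[OF False] by (auto simp: relu_def)
  then show ?thesis unfolding frep_def abs_mult using wt_bd Wb_pos by (intro mult_mono) auto
qed (use Wb_pos in \<open>simp add: frep_def\<close>)

lemma frep_integrable: "integrable RN (frep u v z)"
  by (rule RN.integrable_const_bound[where B="Wb * (2 * \<bar>z\<bar> + 3)"]) (use frep_bd in auto)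

text \<open>For \<open>\<bar>z\<bar> \<ge> 2\<close> the term \<open>2 * z\<close> dominates every
  bias that carries a weight, as these are at most 3, so each neuron is off or linear. This extends
  bounds from a compact interval to the whole line.\<close>

lemma frep_affine:
  "2 \<le> z \<Longrightarrow> frep u v z p = frep u v 2 p + (z - 2) * (frep u v 3 p - frep u v 2 p)"
  "z \<le> -2 \<Longrightarrow> frep u v z p = frep u v (-2) p + (- z - 2) * (frep u v (-3) p - frep u v (-2) p)"
  by (cases "wt u v (fst p) (snd p) = 0"; use wt_supp[of "fst p" "snd p"] in \<open>auto simp: frep_def relu_def max_def algebra_simps\<close>)+

lemma frep_expectation:
  "(\<integral>p. frep u v z p \<partial>RN) = ((\<integral>b. u b * relu (2 * z + b) \<partial>std_normal) + (\<integral>b. v b * relu (- 2 * z + b) \<partial>std_normal)) / 2"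
proof -
  have "(\<integral>p. frep u v z p \<partial>RN) = (\<integral>a. (\<integral>b. frep u v z (a, b) \<partial>std_normal) \<partial>rademacher)"
    by (rule RN.integral_fst'[OF frep_integrable, symmetric])
  then show ?thesis unfolding integral_rademacher by (simp add: frep_def wt_def add.commute)
qed

definition err :: "nat \<Rightarrow> real \<Rightarrow> vec \<Rightarrow> vec \<Rightarrow> real" where
  "err m z a b = (\<Sum>i<m. frep u v z (a i, b i)) / m - (\<integral>p. frep u v z p \<partial>RN)"

lemma err_lipschitz: 
  assumes "m > 0"
  shows "\<bar>err m z a b - err m y a b\<bar> \<le> 4 * Wb * \<bar>z - y\<bar>"
proof -
  have 1: "\<bar>(\<Sum>i<m. frep u v z (a i, b i)) / m - (\<Sum>i<m. frep u v y (a i, b i)) / m\<bar> \<le> 2 * Wb * \<bar>z - y\<bar>"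
  proof -
    have "\<bar>\<Sum>i<m. frep u v z (a i, b i) - frep u v y (a i, b i)\<bar> \<le> (\<Sum>i<m. 2 * Wb * \<bar>z - y\<bar>)"
      by (intro order_trans[OF sum_abs] sum_mono frep_lipschitz)
    then have "\<bar>\<Sum>i<m. frep u v z (a i, b i) - frep u v y (a i, b i)\<bar> / m \<le> 2 * Wb * \<bar>z - y\<bar>"
      using assms by (simp add: pos_divide_le_eq mult.commute)
    then show ?thesis using assms by (simp add: sum_subtractf flip: diff_divide_distrib)
  qed
  have 2: "\<bar>(\<integral>p. frep u v z p \<partial>RN) - (\<integral>p. frep u v y p \<partial>RN)\<bar> \<le> 2 * Wb * \<bar>z - y\<bar>"
  proof -
    have "\<bar>(\<integral>p. frep u v z p \<partial>RN) - (\<integral>p. frep u v y p \<partial>RN)\<bar> = \<bar>\<integral>p. frep u v z p - frep u v y p \<partial>RN\<bar>"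
      using frep_integrable by simp
    also have "\<dots> \<le> (\<integral>p. \<bar>frep u v z p - frep u v y p\<bar> \<partial>RN)" by (rule integral_abs_bound)
    also have "\<dots> \<le> 2 * Wb * \<bar>z - y\<bar>"
      using frep_lipschitz frep_integrable by (intro RN.integral_le_const integrable_abs Bochner_Integration.integrable_diff) auto
    finally show ?thesis .
  qed
  show ?thesis using 1 2 unfolding err_def by (simp add: abs_le_iff)
qed

lemma err_affine:
  "2 \<le> z \<Longrightarrow> err m z a b = err m 2 a b + (z - 2) * (err m 3 a b - err m 2 a b)"
  "z \<le> -2 \<Longrightarrow> err m z a b = err m (-2) a b + (- z - 2) * (err m (-3) a b - err m (-2) a b)"
proof -
  have *: "err m z a b = err m e a b + c * (err m e' a b - err m e a b)"
    if "\<And>p. frep u v z p = frep u v e p + c * (frep u v e' p - frep u v e p)" for z e e' c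
  proof -
    have "(\<integral>p. frep u v z p \<partial>RN) = (\<integral>p. frep u v e p \<partial>RN) + c * ((\<integral>p. frep u v e' p \<partial>RN) - (\<integral>p. frep u v e p \<partial>RN))"
      unfolding that using frep_integrable by simp
    moreover have "(\<Sum>i<m. frep u v z (a i, b i)) / m = (\<Sum>i<m. frep u v e (a i, b i)) / m
        + c * ((\<Sum>i<m. frep u v e' (a i, b i)) / m - (\<Sum>i<m. frep u v e (a i, b i)) / m)"
      unfolding that by (simp add: sum.distrib sum_subtractf sum_distrib_left[symmetric] add_divide_distrib diff_divide_distrib right_diff_distrib)
    ultimately show ?thesis unfolding err_def by (simp add: algebra_simps)
  qed
  show "2 \<le> z \<Longrightarrow> err m z a b = err m 2 a b + (z - 2) * (err m 3 a b - err m 2 a b)"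
    by (rule *) (rule frep_affine)
  show "z \<le> -2 \<Longrightarrow> err m z a b = err m (-2) a b + (- z - 2) * (err m (-3) a b - err m (-2) a b)"
    by (rule *) (rule frep_affine)
qed

text \<open>Uniformity in \<open>z\<close> matters since the argument inserted later,
  \<open>zz\<close>, depends on the same signs and biases through \<open>bias_out\<close>. Between
  grid points at distance \<open>6 / m\<close> the Lipschitz constant \<open>4 * Wb\<close> adds
  \<open>24 * Wb / m\<close>, whence \<open>132 = 108 + 24\<close>; outside \<open>[-3, 3]\<close>
  the error is extrapolated from its values at 2 and 3 or their negatives.\<close>

lemma err_uniform:
  assumes m: "m > 0" and \<delta>: "0 \<le> \<delta>" "1 / real m \<le> \<delta>"
    and grid: "\<And>g. g \<le> m \<Longrightarrow> \<bar>err m (-3 + 6 * real g / m) a b\<bar> \<le> 108 * Wb * \<delta>"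
  shows "\<bar>err m z a b\<bar> \<le> 132 * Wb * \<delta> * (1 + 2 * \<bar>z\<bar>)"
proof -
  have in3: "\<bar>err m z a b\<bar> \<le> 132 * Wb * \<delta>" if z: "\<bar>z\<bar> \<le> 3" for z
  proof -
    define g where "g = nat \<lfloor>(z + 3) * m / 6\<rfloor>"
    have nn: "0 \<le> (z + 3) * m / 6" using z by auto
    have "(z + 3) * m / 6 \<le> m" using z mult_right_mono[of "z + 3" 6 "real m"] by (simp add: abs_le_iff)
    then have gm: "g \<le> m" unfolding g_def by (simp add: floor_le_iff nat_le_iff)
    have g1: "real g \<le> (z + 3) * m / 6" "(z + 3) * m / 6 < real g + 1"
      using nn of_int_floor_le[of "(z + 3) * m / 6"] real_of_int_floor_add_one_gt[of "(z + 3) * m / 6"]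
      unfolding g_def by (simp_all only: of_nat_nat zero_le_floor)
    have "\<bar>z - (-3 + 6 * real g / m)\<bar> \<le> 6 / m"
    proof -
      have "z - (-3 + 6 * real g / m) = ((z + 3) * m - 6 * real g) / m" using m by (simp add: field_simps)
      moreover have "\<bar>(z + 3) * m - 6 * real g\<bar> \<le> 6" using g1 by (simp add: abs_le_iff)
      ultimately show ?thesis using m by (simp add: abs_divide divide_right_mono)
    qed
    then have "4 * Wb * \<bar>z - (-3 + 6 * real g / m)\<bar> \<le> 4 * Wb * (6 / m)" using Wb_pos by (intro mult_left_mono) auto
    also have "\<dots> = 24 * Wb * (1 / m)" by simp
    also have "\<dots> \<le> 24 * Wb * \<delta>" using \<delta> Wb_pos by (intro mult_left_mono) auto
    finally show ?thesis
      using err_lipschitz[OF m, of z a b "-3 + 6 * real g / m"] grid[OF gm] by linarith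
  qed
  let ?D = "132 * Wb * \<delta>"
  have D: "0 \<le> ?D" using \<delta> Wb_pos by auto
  have out: "\<bar>e + c * (e' - e)\<bar> \<le> ?D + c * (2 * ?D)" if "\<bar>e\<bar> \<le> ?D" "\<bar>e'\<bar> \<le> ?D" "0 \<le> c" for e e' c
  proof -
    have "\<bar>c * (e' - e)\<bar> \<le> c * (2 * ?D)" unfolding abs_mult using that by (intro mult_mono) auto
    then show ?thesis using that by linarith
  qed
  consider "\<bar>z\<bar> \<le> 3" | "2 \<le> z" | "z \<le> -2" by linarith
  then show ?thesis
  proof cases
    case 1
    have "?D * 1 \<le> ?D * (1 + 2 * \<bar>z\<bar>)" using D by (intro mult_left_mono) auto
    then show ?thesis using in3[OF 1] by simp
  next
    case 2
    have "\<bar>err m z a b\<bar> \<le> ?D + (z - 2) * (2 * ?D)"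
      unfolding err_affine(1)[OF 2] using 2 by (intro out in3) auto
    also have "\<dots> = ?D * (1 + 2 * (z - 2))" by (simp add: algebra_simps)
    also have "\<dots> \<le> ?D * (1 + 2 * \<bar>z\<bar>)" using D 2 by (intro mult_left_mono) auto
    finally show ?thesis .
  next
    case 3
    have "\<bar>err m z a b\<bar> \<le> ?D + (- z - 2) * (2 * ?D)"
      unfolding err_affine(2)[OF 3] using 3 by (intro out in3) auto
    also have "\<dots> = ?D * (1 + 2 * (- z - 2))" by (simp add: algebra_simps)
    also have "\<dots> \<le> ?D * (1 + 2 * \<bar>z\<bar>)" using D 3 by (intro mult_left_mono) auto
    finally show ?thesis .
  qed
qed

end

locale net_weights = net_setup + weights
begin

abbreviation "MA \<equiv> Pi\<^sub>M {..<m1} (\<lambda>_. rademacher)"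
abbreviation "MB \<equiv> Pi\<^sub>M {..<m1} (\<lambda>_. std_normal)"

sublocale MA: prob_space MA by (intro prob_space_PiM prob_space_rademacher)
sublocale MB: prob_space MB by (intro prob_space_PiM prob_space_std_normal)

text \<open>The constant 108 is 12, from the Hoeffding bound, times the bound \<open>9 * Wb\<close>
  of \<open>frep\<close> for \<open>\<bar>z\<bar> \<le> 3\<close>.\<close>

definition good_ab :: "vec \<Rightarrow> vec \<Rightarrow> bool" where
  "good_ab a b \<longleftrightarrow> (\<forall>i\<in>{..<m1}. a i = 1 \<or> a i = -1) \<and> (\<Sum>i<m1. (b i)\<^sup>2) \<le> 8 * real m1
     \<and> \<bar>bias_out m1 a b\<bar> \<le> 12 * sqrt (\<iota> / m1)
     \<and> (\<forall>g\<in>{..m1}. \<bar>err m1 (-3 + 6 * real g / m1) a b\<bar> \<le> 108 * Wb * sqrt (\<iota> / m1))"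

lemma A_comp: "f \<in> measurable N MA \<Longrightarrow> i < m1 \<Longrightarrow> (\<lambda>\<omega>. f \<omega> i) \<in> borel_measurable N"
proof -
  assume f: "f \<in> measurable N MA" "i < m1"
  have "(\<lambda>x::real. x) \<in> measurable rademacher borel" by simp
  from measurable_compose[OF measurable_compose[OF f(1) measurable_component_singleton] this] f(2)
  show ?thesis by simp
qed

lemma B_comp: "f \<in> measurable N MB \<Longrightarrow> i < m1 \<Longrightarrow> (\<lambda>\<omega>. f \<omega> i) \<in> borel_measurable N"
  using measurable_compose[OF _ measurable_component_singleton, of f N "{..<m1}" "\<lambda>_. std_normal" i]
    measurable_cong_sets[OF refl sets_std_normal] by blast

lemma bias_meas [measurable (raw)]:
  assumes "f \<in> measurable N MA" "g \<in> measurable N MB"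
  shows "(\<lambda>\<omega>. bias_out m1 (f \<omega>) (g \<omega>)) \<in> borel_measurable N"
proof -
  have [measurable]: "(\<lambda>\<omega>. f \<omega> i) \<in> borel_measurable N" "(\<lambda>\<omega>. g \<omega> i) \<in> borel_measurable N" if "i \<in> {..<m1}" for i
    using A_comp[OF assms(1)] B_comp[OF assms(2)] that by auto
  show ?thesis unfolding bias_out_def by measurable
qed

lemma err_meas: "(\<lambda>p. err m1 z (fst p) (snd p)) \<in> borel_measurable (MA \<Otimes>\<^sub>M MB)"
proof -
  have "(\<lambda>p. frep u v z (fst p i, snd p i)) \<in> borel_measurable (MA \<Otimes>\<^sub>M MB)" if "i \<in> {..<m1}" for i
  proof -
    have "(\<lambda>p. fst p i) \<in> measurable (MA \<Otimes>\<^sub>M MB) rademacher" "(\<lambda>p. snd p i) \<in> measurable (MA \<Otimes>\<^sub>M MB) std_normal"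
      using that by (auto intro: measurable_compose[OF measurable_fst measurable_component_singleton]
        measurable_compose[OF measurable_snd measurable_component_singleton])
    then show ?thesis by measurable
  qed
  then show ?thesis unfolding err_def by (intro borel_measurable_diff borel_measurable_divide borel_measurable_sum) auto
qed

text \<open>With biases of controlled norm frozen only the signs are random, and their cancellation
  makes the initial output of order \<open>sqrt (\<iota> / m1)\<close> instead of order one.\<close>

lemma bias_tail:
  assumes b: "(\<Sum>i<m1. (b i)\<^sup>2) \<le> 8 * real m1"
  shows "emeasure MA {a \<in> space MA. 12 * sqrt (\<iota> / m1) < \<bar>bias_out m1 a b\<bar>} \<le> ennreal (2 * exp (- 4 * \<iota>))"
proof -
  have "(\<Sum>i<m1. (relu (b i))\<^sup>2) \<le> (\<Sum>i<m1. (b i)\<^sup>2)"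
    by (intro sum_mono) (auto simp: relu_def max_def)
  with b have r: "(\<Sum>i<m1. (relu (b i))\<^sup>2) \<le> 8 * real m1" by simp
  have t: "2 * sqrt (8 * real m1 * (4 * \<iota>)) \<le> 12 * sqrt (\<iota> / m1) * m1"
  proof -
    have "sqrt 32 \<le> 6" by (intro real_le_lsqrt) auto
    have "sqrt (8 * real m1 * (4 * \<iota>)) = sqrt 32 * sqrt (m1 * \<iota>)" by (simp flip: real_sqrt_mult)
    also have "\<dots> \<le> 6 * sqrt (m1 * \<iota>)" using \<open>sqrt 32 \<le> 6\<close> ge1 by (intro mult_right_mono) auto
    also have "sqrt (m1 * \<iota>) = sqrt (\<iota> / m1) * m1"
      using pos by (simp add: real_sqrt_mult real_sqrt_divide field_simps)
    finally show ?thesis by (simp only: mult.assoc)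
  qed
  have "emeasure MA {a \<in> space MA. 12 * sqrt (\<iota> / m1) < \<bar>bias_out m1 a b\<bar>}
     \<le> emeasure MA {a \<in> space MA. 2 * sqrt (8 * real m1 * (4 * \<iota>)) < \<bar>\<Sum>i<m1. a i * relu (b i)\<bar>}"
  proof (rule emeasure_mono)
    show "{a \<in> space MA. 12 * sqrt (\<iota> / m1) < \<bar>bias_out m1 a b\<bar>} \<subseteq> {a \<in> space MA. 2 * sqrt (8 * real m1 * (4 * \<iota>)) < \<bar>\<Sum>i<m1. a i * relu (b i)\<bar>}"
    proof safe
      fix a assume "12 * sqrt (\<iota> / m1) < \<bar>bias_out m1 a b\<bar>"
      then have "12 * sqrt (\<iota> / m1) * m1 < \<bar>\<Sum>i<m1. a i * relu (b i)\<bar>"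
        using pos by (simp add: bias_out_def abs_divide pos_less_divide_eq)
      with t show "2 * sqrt (8 * real m1 * (4 * \<iota>)) < \<bar>\<Sum>i<m1. a i * relu (b i)\<bar>" by (rule le_less_trans)
    qed
    have [measurable]: "(\<lambda>a. a i) \<in> borel_measurable MA" if "i \<in> {..<m1}" for i using A_comp[of "\<lambda>a. a"] that by auto
    show "{a \<in> space MA. 2 * sqrt (8 * real m1 * (4 * \<iota>)) < \<bar>\<Sum>i<m1. a i * relu (b i)\<bar>} \<in> sets MA" by measurable
  qed
  also have "\<dots> \<le> ennreal (2 * exp (- (4 * \<iota>)))" using pos ge1 by (intro rademacher_sum_tail r) auto
  finally show ?thesis by simp
qed

lemma inv_m1: "1 / real m1 \<le> sqrt (\<iota> / m1)"
proof -
  have "(1 / real m1)\<^sup>2 \<le> \<iota> / m1" using pos mult_mono[of 1 \<iota> 1 "real m1"] ge1(2) by (simp add: power2_eq_square field_simps)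
  then show ?thesis by (rule real_le_rsqrt)
qed

lemma good_ab_prob:
  shows "{p \<in> space (MA \<Otimes>\<^sub>M MB). \<not> good_ab (fst p) (snd p)} \<in> sets (MA \<Otimes>\<^sub>M MB)"
    and "emeasure (MA \<Otimes>\<^sub>M MB) {p \<in> space (MA \<Otimes>\<^sub>M MB). \<not> good_ab (fst p) (snd p)} \<le> ennreal (7 * exp (- \<iota>))"
proof -
  let ?M = "MA \<Otimes>\<^sub>M MB"
  have [measurable]: "(\<lambda>p. fst p i) \<in> borel_measurable ?M" if "i \<in> {..<m1}" for i using A_comp[of fst ?M i] that by auto
  have [measurable]: "(\<lambda>p. snd p i) \<in> borel_measurable ?M" if "i \<in> {..<m1}" for i using B_comp[of snd ?M i] that by auto
  note err_meas[measurable]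
  define P1 where "P1 = (\<lambda>p::vec \<times> vec. \<not> (\<forall>i\<in>{..<m1}. fst p i = 1 \<or> fst p i = -1))"
  define P2 where "P2 = (\<lambda>p::vec \<times> vec. 8 * real m1 < (\<Sum>i<m1. (snd p i)\<^sup>2))"
  define P3 where "P3 = (\<lambda>p::vec \<times> vec. (\<Sum>i<m1. (snd p i)\<^sup>2) \<le> 8 * real m1 \<and> 12 * sqrt (\<iota> / m1) < \<bar>bias_out m1 (fst p) (snd p)\<bar>)"
  define P4 where "P4 = (\<lambda>p::vec \<times> vec. \<exists>g\<in>{..m1}. 108 * Wb * sqrt (\<iota> / m1) < \<bar>err m1 (-3 + 6 * real g / m1) (fst p) (snd p)\<bar>)"
  have ms1: "{p \<in> space ?M. P1 p} \<in> sets ?M" unfolding P1_def by measurable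
  have ms2: "{p \<in> space ?M. P2 p} \<in> sets ?M" unfolding P2_def by measurable
  have ms3: "{p \<in> space ?M. P3 p} \<in> sets ?M" unfolding P3_def by measurable
  have ms4: "{p \<in> space ?M. P4 p} \<in> sets ?M" unfolding P4_def by measurable
  note ms1[measurable] ms2[measurable] ms3[measurable] ms4[measurable]
  have eq: "{p \<in> space ?M. \<not> good_ab (fst p) (snd p)} = {p \<in> space ?M. P1 p \<or> (P2 p \<or> (P3 p \<or> P4 p))}"
    unfolding good_ab_def P1_def P2_def P3_def P4_def by (auto simp flip: not_le)
  show "{p \<in> space ?M. \<not> good_ab (fst p) (snd p)} \<in> sets ?M" unfolding eq by measurable
  have e1: "emeasure ?M {p \<in> space ?M. P1 p} \<le> ennreal 0"
  proof (rule emeasure_pair_le2[OF MA.prob_space_axioms MB.prob_space_axioms ms1])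
    fix b
    have "AE a in MA. a \<notin> {a \<in> space MA. (a, b) \<in> {p \<in> space ?M. P1 p}}"
      using AE_PiM_rademacher[of m1] by eventually_elim (auto simp: P1_def)
    then show "emeasure MA {a \<in> space MA. (a, b) \<in> {p \<in> space ?M. P1 p}} \<le> ennreal 0"
      by (subst emeasure_eq_0_AE) auto
  qed
  have e2: "emeasure ?M {p \<in> space ?M. P2 p} \<le> ennreal (exp (- real m1))"
  proof (rule emeasure_pair_le[OF MA.prob_space_axioms MB.prob_space_axioms ms2])
    fix a assume "a \<in> space MA"
    then show "emeasure MB {b \<in> space MB. (a, b) \<in> {p \<in> space ?M. P2 p}} \<le> ennreal (exp (- real m1))"
      using normal_norm_tail[OF pos(3)] by (simp add: P2_def space_pair_measure cong: conj_cong)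
  qed
  have e3: "emeasure ?M {p \<in> space ?M. P3 p} \<le> ennreal (2 * exp (- 4 * \<iota>))"
  proof (rule emeasure_pair_le2[OF MA.prob_space_axioms MB.prob_space_axioms ms3])
    fix b assume b: "b \<in> space MB"
    show "emeasure MA {a \<in> space MA. (a, b) \<in> {p \<in> space ?M. P3 p}} \<le> ennreal (2 * exp (- 4 * \<iota>))"
    proof (cases "(\<Sum>i<m1. (b i)\<^sup>2) \<le> 8 * real m1")
      case True
      then show ?thesis using bias_tail[OF True] b by (simp add: P3_def space_pair_measure cong: conj_cong)
    qed (simp add: P3_def)
  qed
  have e4: "emeasure ?M {p \<in> space ?M. P4 p} \<le> ennreal (real (card {..m1}) * (2 * exp (- 32 * \<iota>)))"
    unfolding P4_def
  proof (rule emeasure_union_bound)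
    fix g assume g: "g \<in> {..m1}"
    let ?z = "-3 + 6 * real g / m1"
    have z: "\<bar>?z\<bar> \<le> 3" using g pos by (simp add: abs_le_iff field_simps)
    show "{p \<in> space ?M. 108 * Wb * sqrt (\<iota> / m1) < \<bar>err m1 ?z (fst p) (snd p)\<bar>} \<in> sets ?M" by measurable
    have bd: "\<bar>frep u v ?z p\<bar> \<le> 9 * Wb" for p
    proof -
      have "\<bar>frep u v ?z p\<bar> \<le> Wb * (2 * \<bar>?z\<bar> + 3)" by (rule frep_bd)
      also have "\<dots> \<le> Wb * 9" using z Wb_pos by (intro mult_left_mono) auto
      finally show ?thesis by simp
    qed
    show "emeasure ?M {p \<in> space ?M. 108 * Wb * sqrt (\<iota> / m1) < \<bar>err m1 ?z (fst p) (snd p)\<bar>} \<le> ennreal (2 * exp (- 32 * \<iota>))"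
      using hoeffding_iid_pair[OF prob_space_rademacher prob_space_std_normal frep_meas bd, of \<iota> m1] Wb_pos ge1 m1_large
      by (simp add: err_def)
  qed auto
  have "emeasure ?M {p \<in> space ?M. P1 p \<or> (P2 p \<or> (P3 p \<or> P4 p))}
     \<le> ennreal (0 + (exp (- real m1) + (2 * exp (- 4 * \<iota>) + real (card {..m1}) * (2 * exp (- 32 * \<iota>)))))"
    by (intro emeasure_Un_le e1 e2 e3 e4 ms1 ms2 ms3 ms4) (auto, measurable)
  also have "\<dots> \<le> ennreal (7 * exp (- \<iota>))"
  proof (rule ennreal_leI)
    have "\<iota> \<le> real m1" using m1_large ge1 by linarith
    then have "exp (- real m1) \<le> exp (- \<iota>)" by simp
    moreover have "exp (- 4 * \<iota>) \<le> exp (- \<iota>)" using ge1 by simp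
    moreover have "m1 * exp (- 32 * \<iota>) \<le> exp \<iota> * exp (- 32 * \<iota>)" using size_le by (intro mult_right_mono) auto
    moreover have "exp \<iota> * exp (- 32 * \<iota>) \<le> exp (- \<iota>)" using ge1 by (simp flip: exp_add)
    moreover have "exp (- 32 * \<iota>) \<le> exp (- \<iota>)" using ge1 by simp
    moreover have "real (card {..m1}) * (2 * exp (- 32 * \<iota>)) = 2 * (m1 * exp (- 32 * \<iota>)) + 2 * exp (- 32 * \<iota>)" by (simp add: algebra_simps)
    ultimately show "0 + (exp (- real m1) + (2 * exp (- 4 * \<iota>) + real (card {..m1}) * (2 * exp (- 32 * \<iota>)))) \<le> 7 * exp (- \<iota>)"
      by linarith
  qed
  finally show "emeasure ?M {p \<in> space ?M. \<not> good_ab (fst p) (snd p)} \<le> ennreal (7 * exp (- \<iota>))" unfolding eq .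
qed

lemma good_ab_err:
  assumes "good_ab a b"
  shows "\<bar>err m1 z a b\<bar> \<le> 132 * Wb * sqrt (\<iota> / m1) * (1 + 2 * \<bar>z\<bar>)"
  using assms pos inv_m1 ge1 by (intro err_uniform) (auto simp: good_ab_def)

end

section \<open>The second data set\<close>

lemma relu_deriv_meas [measurable]: "relu_deriv \<in> borel_measurable borel"
  unfolding relu_deriv_def[abs_def] by measurable

lemma psi_nonneg: "0 \<le> psi a b z" by (simp add: psi_def relu_def)

lemma psi_le:
  assumes "a = 1 \<or> a = -1"
  shows "psi a b z \<le> (1 + \<bar>b\<bar>) * (1 + 2 * \<bar>z\<bar>)"
proof -
  have "psi a b z \<le> 2 * \<bar>z\<bar> + \<bar>b\<bar>" using assms by (auto simp: psi_def relu_def relu_deriv_def)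
  also have "\<dots> \<le> (1 + \<bar>b\<bar>) * (1 + 2 * \<bar>z\<bar>)" by (simp add: algebra_simps)
  finally show ?thesis .
qed

lemma pow4_add_le: "(x + y)^4 \<le> 8 * (x^4 + y^4)" for x y :: real
proof -
  have "(x + y)\<^sup>2 \<le> 2 * (x\<^sup>2 + y\<^sup>2)" using mult_le_half_squares[of x y] by (simp add: power2_sum)
  then have "((x + y)\<^sup>2)\<^sup>2 \<le> (2 * (x\<^sup>2 + y\<^sup>2))\<^sup>2" by (intro power_mono) auto
  also have "\<dots> = 4 * (x\<^sup>2 + y\<^sup>2)\<^sup>2" by (simp only: power_mult_distrib) simp
  also have "\<dots> \<le> 4 * (2 * ((x\<^sup>2)\<^sup>2 + (y\<^sup>2)\<^sup>2))" using mult_le_half_squares[of "x\<^sup>2" "y\<^sup>2"] by (simp add: power2_sum)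
  finally show ?thesis by simp
qed

context net_weights
begin

definition zz :: "vec \<Rightarrow> vec \<Rightarrow> (nat \<Rightarrow> vec) \<Rightarrow> (nat \<Rightarrow> vec) \<Rightarrow> vec \<Rightarrow> real" where
  "zz a b V X x = zval d n m1 m2 \<sigma>2 fs \<eta> a b V X x"

text \<open>The coordinates in which the residual is a linear form; index \<open>m1\<close> carries
  the target. Division by \<open>1 + \<bar>b i\<bar>\<close> gives all neurons a common bound
  although the biases are unbounded, and restriction to \<open>G\<close> bounds the features
  themselves.\<close>

definition xf :: "vec \<Rightarrow> vec \<Rightarrow> (nat \<Rightarrow> vec) \<Rightarrow> (nat \<Rightarrow> vec) \<Rightarrow> nat \<Rightarrow> vec \<Rightarrow> real" where
  "xf a b V X i x = (if x \<in> G V X then (if i < m1 then psi (a i) (b i) (zz a b V X x) / (1 + \<bar>b i\<bar>) else fs x) else 0)"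

definition K2 :: real where "K2 = 3000 * K^5"

text \<open>Variance proxies for products of coordinates: only the square of the target sees the
  level \<open>F\<close>, every other pair has a bound free of \<open>\<iota>\<close>.\<close>

definition vv :: "nat \<Rightarrow> nat \<Rightarrow> real" where "vv i j = (if i = m1 \<and> j = m1 then F^4 else K2)"

lemma zz_meas [measurable (raw)]:
  assumes [measurable]: "f \<in> measurable N MA" "g \<in> measurable N MB" "vf \<in> measurable N MV" "l \<in> measurable N MX" "e \<in> measurable N (Rd d)"
  shows "(\<lambda>\<omega>. zz (f \<omega>) (g \<omega>) (vf \<omega>) (l \<omega>) (e \<omega>)) \<in> borel_measurable N"
  unfolding zz_def zval_def by measurable

lemma xf_meas:
  assumes fm: "f \<in> measurable N MA" "g \<in> measurable N MB" "vf \<in> measurable N MV" "l \<in> measurable N MX" "e \<in> measurable N (Rd d)"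
  shows "(\<lambda>\<omega>. xf (f \<omega>) (g \<omega>) (vf \<omega>) (l \<omega>) i (e \<omega>)) \<in> borel_measurable N"
proof -
  note fm[measurable]
  have G: "{\<omega> \<in> space N. e \<omega> \<in> G (vf \<omega>) (l \<omega>)} \<in> sets N" using fm by (intro G_meas)
  show ?thesis
  proof (cases "i < m1")
    case True
    have [measurable]: "(\<lambda>\<omega>. f \<omega> i) \<in> borel_measurable N" "(\<lambda>\<omega>. g \<omega> i) \<in> borel_measurable N"
      using A_comp[OF fm(1) True] B_comp[OF fm(2) True] by auto
    have "(\<lambda>\<omega>. psi (f \<omega> i) (g \<omega> i) (zz (f \<omega>) (g \<omega>) (vf \<omega>) (l \<omega>) (e \<omega>)) / (1 + \<bar>g \<omega> i\<bar>)) \<in> borel_measurable N"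
      unfolding psi_def by measurable
    then show ?thesis unfolding xf_def using True G by (simp add: measurable_If)
  next
    case False
    have "(\<lambda>\<omega>. fs (e \<omega>)) \<in> borel_measurable N" by measurable
    then show ?thesis unfolding xf_def using False G by (simp add: measurable_If)
  qed
qed

lemma xf_meas1 [measurable]:
  assumes "a \<in> space MA" "b \<in> space MB" "V \<in> space MV" "X \<in> space MX"
  shows "xf a b V X i \<in> borel_measurable \<nu>"
proof -
  have "(\<lambda>x. x) \<in> measurable \<nu> (Rd d)" by measurable
  then show ?thesis using assms by (intro xf_meas) auto
qed

lemma K_le_n: "K \<le> real n" "K * B\<^sup>2 \<le> real n"
proof -
  have 1: "1 \<le> F\<^sup>2 * (B\<^sup>2 * \<iota>)" using ge1 one_le_power[of F 2] one_le_power[of B 2] by (intro mult_ge1_I) auto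
  have "K * B\<^sup>2 * 1 \<le> K * B\<^sup>2 * (F\<^sup>2 * (B\<^sup>2 * \<iota>))" using ge1 1 by (intro mult_left_mono) auto
  also have "\<dots> = K * F\<^sup>2 * B^4 * \<iota>" by (simp add: power2_eq_square power4_eq_xxxx)
  also have "\<dots> \<le> 128 * (K * F\<^sup>2 * B^4 * \<iota>)" using ge1 by simp
  also have "\<dots> \<le> n" using n_large by simp
  finally show *: "K * B\<^sup>2 \<le> real n" by simp
  have "K * 1 \<le> K * B\<^sup>2" using ge1 one_le_power[of B 2] by (intro mult_left_mono) auto
  with * show "K \<le> real n" by simp
qed

lemma K5: "1 \<le> K^5" "K \<le> K^5"
proof -
  show "1 \<le> K^5" using ge1 by simp
  have "K^1 \<le> K^5" using ge1 by (intro power_increasing) auto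
  then show "K \<le> K^5" by simp
qed

text \<open>The first bound is for moments, since the feature with \<open>y = 1\<close> has a fourth
  moment free of \<open>\<iota>\<close>; the second is the sup bound that Bernstein's inequality and
  the step size condition ask for.\<close>

lemma zz_G:
  assumes g: "good V X" and ab: "good_ab a b" and x: "x \<in> G V X"
  shows "1 + 2 * \<bar>zz a b V X x\<bar> \<le> 3 + 2 * \<bar>feat d n m2 \<sigma>2 (\<lambda>_. 1) V X x\<bar>" "1 + 2 * \<bar>zz a b V X x\<bar> \<le> 7 * K * B"
proof -
  let ?s = "feat d n m2 \<sigma>2 (\<lambda>_. 1) V X x"
  have "\<bar>\<eta> * bias_out m1 a b\<bar> \<le> \<eta> * (12 * sqrt (\<iota> / m1))"
    using ab eta0 by (simp add: abs_mult good_ab_def mult_left_mono)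
  also have "\<dots> \<le> 1" by (rule eta_m1)
  finally have "\<bar>\<eta> * bias_out m1 a b\<bar> * \<bar>?s\<bar> \<le> 1 * \<bar>?s\<bar>" by (intro mult_right_mono) auto
  moreover have "zz a b V X x = \<eta> * feat d n m2 \<sigma>2 fs V X x - (\<eta> * bias_out m1 a b) * ?s"
    by (simp add: zz_def zval_def algebra_simps)
  ultimately show 1: "1 + 2 * \<bar>zz a b V X x\<bar> \<le> 3 + 2 * \<bar>?s\<bar>"
    using G_facts(2)[OF g x] abs_triangle_ineq4[of "\<eta> * feat d n m2 \<sigma>2 fs V X x" "(\<eta> * bias_out m1 a b) * ?s"]
    by (simp add: abs_mult[symmetric])
  have "1 \<le> K * B" using ge1 by (intro mult_ge1_I)
  then show "1 + 2 * \<bar>zz a b V X x\<bar> \<le> 7 * K * B" using 1 G_facts(3)[OF g x] by simp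
qed

lemma xf_le:
  assumes ab: "good_ab a b" and i: "i < m1"
  shows "\<bar>xf a b V X i x\<bar> \<le> 1 + 2 * \<bar>zz a b V X x\<bar>"
proof (cases "x \<in> G V X")
  case True
  have "a i = 1 \<or> a i = -1" using ab i by (auto simp: good_ab_def)
  then have "psi (a i) (b i) (zz a b V X x) / (1 + \<bar>b i\<bar>) \<le> 1 + 2 * \<bar>zz a b V X x\<bar>"
    using psi_le[of "a i" "b i" "zz a b V X x"] by (subst pos_divide_le_eq) (auto simp: mult.commute)
  then show ?thesis using True i psi_nonneg[of "a i" "b i"] by (simp add: xf_def abs_divide)
qed (simp add: xf_def)

context
  fixes a b V X
  assumes sp: "a \<in> space MA" "b \<in> space MB" "V \<in> space MV" "X \<in> space MX"
    and ab: "good_ab a b" and g: "good V X"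
begin

lemma zz_G_pow4: "(\<integral>\<^sup>+x. ennreal ((1 + 2 * \<bar>zz a b V X x\<bar>)^4 * indicator (G V X) x) \<partial>\<nu>) \<le> ennreal K2"
proof -
  note sp[measurable]
  have "(\<integral>\<^sup>+x. ennreal ((1 + 2 * \<bar>zz a b V X x\<bar>)^4 * indicator (G V X) x) \<partial>\<nu>) \<le> ennreal (648 + 128 * (16 * K^5))"
  proof (rule nn_integral_le_affine[OF prob_nu _ feat_moments(1)[OF sp(3,4) g]])
    fix x
    let ?s = "feat d n m2 \<sigma>2 (\<lambda>_. 1) V X x"
    show "(1 + 2 * \<bar>zz a b V X x\<bar>)^4 * indicator (G V X) x \<le> 648 + 128 * ?s^4"
    proof (cases "x \<in> G V X")
      case True
      have "(1 + 2 * \<bar>zz a b V X x\<bar>)^4 \<le> (3 + 2 * \<bar>?s\<bar>)^4" using zz_G(1)[OF g ab True] by (intro power_mono) auto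
      also have "\<dots> \<le> 8 * (3^4 + (2 * \<bar>?s\<bar>)^4)" by (rule pow4_add_le)
      also have "\<dots> = 648 + 128 * ?s^4" by (simp add: power_mult_distrib)
      finally show ?thesis using True by simp
    qed simp
  qed (use K5 ge1 in auto)
  also have "\<dots> \<le> ennreal K2" using K5 by (intro ennreal_leI) (simp add: K2_def)
  finally show ?thesis .
qed

lemma xf_pow4: "(\<integral>\<^sup>+x. ennreal ((xf a b V X i x)^4) \<partial>\<nu>) \<le> ennreal K2"
proof (cases "i < m1")
  case True
  have "(\<integral>\<^sup>+x. ennreal ((xf a b V X i x)^4) \<partial>\<nu>) \<le> (\<integral>\<^sup>+x. ennreal ((1 + 2 * \<bar>zz a b V X x\<bar>)^4 * indicator (G V X) x) \<partial>\<nu>)"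
  proof (intro nn_integral_mono ennreal_leI)
    fix x
    show "(xf a b V X i x)^4 \<le> (1 + 2 * \<bar>zz a b V X x\<bar>)^4 * indicator (G V X) x"
    proof (cases "x \<in> G V X")
      case True
      have "\<bar>xf a b V X i x\<bar>^4 \<le> (1 + 2 * \<bar>zz a b V X x\<bar>)^4" using xf_le[OF ab \<open>i < m1\<close>] by (intro power_mono) auto
      then show ?thesis using True by (simp add: power_even_abs_numeral)
    qed (simp add: xf_def)
  qed
  then show ?thesis using zz_G_pow4 by (rule order_trans)
next
  case False
  have "(\<integral>\<^sup>+x. ennreal ((xf a b V X i x)^4) \<partial>\<nu>) \<le> (\<integral>\<^sup>+x. ennreal ((fs x)^4) \<partial>\<nu>)"
    using False by (intro nn_integral_mono ennreal_leI) (auto simp: xf_def)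
  also have "\<dots> \<le> ennreal K" by (rule fs_4)
  also have "\<dots> \<le> ennreal K2" using K5 by (intro ennreal_leI) (simp add: K2_def)
  finally show ?thesis .
qed

lemma xf_bound: "\<bar>xf a b V X i x\<bar> \<le> (if i < m1 then 7 * K * B else F)"
proof (cases "x \<in> G V X")
  case True
  then show ?thesis using xf_le[OF ab, of i V X x] zz_G(2)[OF g ab True] G_facts(4)[OF g True] by (auto simp: xf_def[of _ _ _ _ m1] xf_def)
qed (use ge1 in \<open>auto simp: xf_def\<close>)

lemma xf_prod_conc:
  assumes ij: "i \<le> m1" "j \<le> m1"
  shows "emeasure MX {Y \<in> space MX. 2 * sqrt (vv i j * (4 * \<iota>) / n) < \<bar>(\<Sum>k<n. xf a b V X i (Y k) * xf a b V X j (Y k)) / n - (\<integral>x. xf a b V X i x * xf a b V X j x \<partial>\<nu>)\<bar>}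
    \<le> ennreal (2 * exp (- (4 * \<iota>)))"
proof -
  note sp[measurable]
  let ?f = "\<lambda>x. xf a b V X i x * xf a b V X j x"
  have F2: "1 \<le> F\<^sup>2" "1 \<le> F^4" and B4: "1 \<le> B^4" using ge1 by auto
  have KB: "1 \<le> K * B" using ge1 by (intro mult_ge1_I)
  have vpos: "0 < vv i j" using ge1 K5 by (auto simp: vv_def K2_def)
  \<comment> \<open>The range of a product may grow with \<open>\<iota>\<close>: it enters only the
    sample size condition of \<open>bernstein_iid\<close>, which \<open>n_large\<close> covers,
    whereas the deviation depends on \<open>vv\<close>.\<close>
  define bb where "bb = (if i = m1 \<and> j = m1 then F\<^sup>2 else 49 * (K * B)\<^sup>2 * F)"
  have bd: "\<bar>?f x\<bar> \<le> bb" for x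
  proof -
    consider "i = m1" "j = m1" | "i = m1" "j < m1" | "i < m1" "j = m1" | "i < m1" "j < m1" using ij by linarith
    then show ?thesis
    proof cases
      case 1
      then show ?thesis using xf_bound[of m1 x] mult_mono[of "\<bar>xf a b V X m1 x\<bar>" F "\<bar>xf a b V X m1 x\<bar>" F] ge1
        by (simp add: bb_def abs_mult power2_eq_square)
    next
      case 4
      have "\<bar>?f x\<bar> \<le> (7 * K * B) * (7 * K * B)" unfolding abs_mult using 4 xf_bound[of i x] xf_bound[of j x] ge1 by (intro mult_mono) auto
      also have "\<dots> = 49 * (K * B)\<^sup>2 * 1" by (simp add: power2_eq_square)
      also have "\<dots> \<le> 49 * (K * B)\<^sup>2 * F" using ge1 by (intro mult_left_mono) auto
      finally show ?thesis using 4 by (simp add: bb_def)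
    next
      case 2
      have "\<bar>?f x\<bar> \<le> F * (7 * K * B)" unfolding abs_mult using 2 xf_bound[of i x] xf_bound[of j x] ge1 by (intro mult_mono) auto
      also have "\<dots> = 7 * F * (K * B) * 1" by simp
      also have "\<dots> \<le> 7 * F * (K * B) * (7 * (K * B))" using ge1 KB by (intro mult_left_mono) auto
      finally show ?thesis using 2 by (simp add: bb_def power2_eq_square ac_simps)
    next
      case 3
      have "\<bar>?f x\<bar> \<le> (7 * K * B) * F" unfolding abs_mult using 3 xf_bound[of i x] xf_bound[of j x] ge1 KB by (intro mult_mono) auto
      also have "\<dots> = 7 * F * (K * B) * 1" by simp
      also have "\<dots> \<le> 7 * F * (K * B) * (7 * (K * B))" using ge1 KB by (intro mult_left_mono) auto
      finally show ?thesis using 3 by (simp add: bb_def power2_eq_square ac_simps)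
    qed
  qed
  have v: "(\<integral>x. (?f x)\<^sup>2 \<partial>\<nu>) \<le> vv i j"
  proof (cases "i = m1 \<and> j = m1")
    case True
    have sq: "(?f x)\<^sup>2 \<le> F^4" for x
    proof -
      have "\<bar>?f x\<bar>\<^sup>2 \<le> bb\<^sup>2" using bd by (intro power_mono) auto
      then show ?thesis using True by (simp add: bb_def)
    qed
    then have "(\<integral>x. (?f x)\<^sup>2 \<partial>\<nu>) \<le> F^4"
      by (intro nu.integral_le_const nu.integrable_const_bound[where B="F^4"]) auto
    then show ?thesis using True by (simp add: vv_def)
  next
    case False
    have "(\<integral>\<^sup>+x. ennreal \<bar>(?f x)\<^sup>2\<bar> \<partial>\<nu>) \<le> ennreal (1/2 * K2 + 1/2 * K2)"
    proof (rule nn_integral_add_le[OF _ _ xf_pow4[of i] xf_pow4[of j]])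
      show "\<bar>(?f x)\<^sup>2\<bar> \<le> 1/2 * (xf a b V X i x)^4 + 1/2 * (xf a b V X j x)^4" for x
        using mult_le_half_squares[of "(xf a b V X i x)\<^sup>2" "(xf a b V X j x)\<^sup>2"] by (simp add: power_mult_distrib add_divide_distrib)
    qed (use K5 ge1 in \<open>auto simp: K2_def\<close>)
    then have "\<bar>\<integral>x. (?f x)\<^sup>2 \<partial>\<nu>\<bar> \<le> K2"
      using K5 ge1 by (intro nn_integral_abs_bound(2)) (auto simp: K2_def)
    then show ?thesis using False by (auto simp: vv_def)
  qed
  have c: "4 * bb\<^sup>2 * (4 * \<iota>) \<le> real n * vv i j"
  proof (cases "i = m1 \<and> j = m1")
    case True
    have "16 * \<iota> * F^4 \<le> real n * F^4" using n128 ge1 F2 by (intro mult_right_mono) auto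
    then show ?thesis using True by (simp add: bb_def vv_def ac_simps)
  next
    case False
    have "4 * bb\<^sup>2 * (4 * \<iota>) = 38416 * K^4 * (F\<^sup>2 * B^4 * \<iota>)"
      using False by (auto simp: bb_def power_mult_distrib power2_eq_square power4_eq_xxxx)
    also have "\<dots> \<le> 384000 * K^4 * (F\<^sup>2 * B^4 * \<iota>)" using ge1 by (intro mult_right_mono) auto
    also have "\<dots> = 3000 * K^3 * (128 * K * F\<^sup>2 * B^4 * \<iota>)" by (simp add: power_numeral_reduce)
    also have "\<dots> \<le> 3000 * K^5 * n" using n_large ge1 by (intro mult_mono) (auto intro: power_increasing)
    finally show ?thesis using False by (auto simp: vv_def K2_def mult.commute)
  qed
  have "\<And>x. x \<in> space \<nu> \<Longrightarrow> \<bar>?f x\<bar> \<le> bb" using bd by blast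
  then show ?thesis
    by (rule bernstein_iid[OF prob_nu _ _ v vpos _ pos(2) c, rotated]) (use ge1 in auto)
qed

end

text \<open>Concentration of all entries of a second moment matrix of size \<open>m1 + 1\<close>.
  The event does not mention output weights, so its consequences hold for all of them at once, as
  they must because the trained weights depend on \<open>Y\<close>.\<close>

definition good2 :: "vec \<Rightarrow> vec \<Rightarrow> (nat \<Rightarrow> vec) \<Rightarrow> (nat \<Rightarrow> vec) \<Rightarrow> (nat \<Rightarrow> vec) \<Rightarrow> bool" where
  "good2 a b V X Y \<longleftrightarrow> (\<forall>k\<in>{..<n}. Y k \<in> G V X) \<and> (\<forall>i\<in>{..m1}. \<forall>j\<in>{..m1}.
      \<bar>(\<Sum>k<n. xf a b V X i (Y k) * xf a b V X j (Y k)) / n - (\<integral>x. xf a b V X i x * xf a b V X j x \<partial>\<nu>)\<bar> \<le> 2 * sqrt (vv i j * (4 * \<iota>) / n))"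

lemma good2_meas:
  assumes fm: "f \<in> measurable N MA" "g \<in> measurable N MB" "vf \<in> measurable N MV" "l \<in> measurable N MX" "e \<in> measurable N MX"
  shows "{\<omega> \<in> space N. good2 (f \<omega>) (g \<omega>) (vf \<omega>) (l \<omega>) (e \<omega>)} \<in> sets N"
proof -
  have ek: "(\<lambda>\<omega>. e \<omega> k) \<in> measurable N (Rd d)" if "k \<in> {..<n}" for k using X_comp[OF fm(5)] that by auto
  have 1: "{\<omega> \<in> space N. e \<omega> k \<in> G (vf \<omega>) (l \<omega>)} \<in> sets N" if "k \<in> {..<n}" for k
    by (rule G_meas[OF fm(3,4) ek[OF that]])
  have 2: "(\<lambda>\<omega>. xf (f \<omega>) (g \<omega>) (vf \<omega>) (l \<omega>) i (e \<omega> k)) \<in> borel_measurable N" if "k \<in> {..<n}" for i k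
    by (rule xf_meas[OF fm(1-4) ek[OF that]])
  have 3: "(\<lambda>\<omega>. \<integral>x. xf (f \<omega>) (g \<omega>) (vf \<omega>) (l \<omega>) i x * xf (f \<omega>) (g \<omega>) (vf \<omega>) (l \<omega>) j x \<partial>\<nu>) \<in> borel_measurable N" for i j
  proof -
    have s: "snd \<in> measurable (N \<Otimes>\<^sub>M \<nu>) (Rd d)" by measurable
    have "(\<lambda>p. xf (f (fst p)) (g (fst p)) (vf (fst p)) (l (fst p)) i (snd p)) \<in> borel_measurable (N \<Otimes>\<^sub>M \<nu>)" for i
      by (intro xf_meas measurable_compose[OF measurable_fst fm(1)] measurable_compose[OF measurable_fst fm(2)]
          measurable_compose[OF measurable_fst fm(3)] measurable_compose[OF measurable_fst fm(4)] s)
    then have "(\<lambda>p. xf (f (fst p)) (g (fst p)) (vf (fst p)) (l (fst p)) i (snd p) * xf (f (fst p)) (g (fst p)) (vf (fst p)) (l (fst p)) j (snd p)) \<in> borel_measurable (N \<Otimes>\<^sub>M \<nu>)"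
      by (intro borel_measurable_times)
    then show ?thesis by (intro nu.borel_measurable_lebesgue_integral) (simp add: case_prod_beta')
  qed
  have 4: "(\<lambda>\<omega>. \<bar>(\<Sum>k<n. xf (f \<omega>) (g \<omega>) (vf \<omega>) (l \<omega>) i (e \<omega> k) * xf (f \<omega>) (g \<omega>) (vf \<omega>) (l \<omega>) j (e \<omega> k)) / n
      - (\<integral>x. xf (f \<omega>) (g \<omega>) (vf \<omega>) (l \<omega>) i x * xf (f \<omega>) (g \<omega>) (vf \<omega>) (l \<omega>) j x \<partial>\<nu>)\<bar>) \<in> borel_measurable N" for i j
    by (intro borel_measurable_abs borel_measurable_diff borel_measurable_divide borel_measurable_sum borel_measurable_times 2 3) auto
  have 5: "{\<omega> \<in> space N. \<bar>(\<Sum>k<n. xf (f \<omega>) (g \<omega>) (vf \<omega>) (l \<omega>) i (e \<omega> k) * xf (f \<omega>) (g \<omega>) (vf \<omega>) (l \<omega>) j (e \<omega> k)) / n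
      - (\<integral>x. xf (f \<omega>) (g \<omega>) (vf \<omega>) (l \<omega>) i x * xf (f \<omega>) (g \<omega>) (vf \<omega>) (l \<omega>) j x \<partial>\<nu>)\<bar> \<le> c} \<in> sets N" for i j c
    using 4[of i j] by (rule borel_measurable_le) simp
  show ?thesis unfolding good2_def
    by (intro sets.sets_Collect_conj sets.sets_Collect_finite_All 1 5) auto
qed

lemma good2_prob:
  assumes sp: "a \<in> space MA" "b \<in> space MB" "V \<in> space MV" "X \<in> space MX" and ab: "good_ab a b" and g: "good V X"
  shows "emeasure MX {Y \<in> space MX. \<not> good2 a b V X Y} \<le> ennreal (14 * exp (- \<iota>))"
proof -
  let ?P = "\<lambda>Y. \<exists>k\<in>{..<n}. Y k \<notin> G V X"
  let ?D = "\<lambda>i j Y. 2 * sqrt (vv i j * (4 * \<iota>) / n) < \<bar>(\<Sum>k<n. xf a b V X i (Y k) * xf a b V X j (Y k)) / n - (\<integral>x. xf a b V X i x * xf a b V X j x \<partial>\<nu>)\<bar>"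
  have Gm: "{x \<in> space \<nu>. x \<notin> G V X} \<in> sets \<nu>"
    using G_sets(2)[OF sp(3,4)] by auto
  have Gc: "emeasure \<nu> {x \<in> space \<nu>. x \<notin> G V X} \<le> ennreal (6 * K * exp (- 12 * \<iota>))"
    using G_compl[OF sp(3,4) g] by (simp add: set_diff_eq)
  have Pm: "{Y \<in> space MX. Y k \<notin> G V X} \<in> sets MX" if "k \<in> {..<n}" for k
    using emeasure_PiM_component(1)[OF prob_nu that Gm] .
  have e1: "emeasure MX {Y \<in> space MX. ?P Y} \<le> ennreal (real (card {..<n}) * (6 * K * exp (- 12 * \<iota>)))"
  proof (rule emeasure_union_bound)
    show "emeasure MX {Y \<in> space MX. Y k \<notin> G V X} \<le> ennreal (6 * K * exp (- 12 * \<iota>))" if "k \<in> {..<n}" for k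
      using emeasure_PiM_component(2)[OF prob_nu that Gm] Gc by simp
  qed (use ge1 Pm in auto)
  have Dm: "{Y \<in> space MX. ?D i j Y} \<in> sets MX" for i j
  proof -
    have "(\<lambda>Y. xf a b V X i (Y k)) \<in> borel_measurable MX" if "k \<in> {..<n}" for i k
      using X_comp[of "\<lambda>Y. Y" MX k] that sp by (intro xf_meas) auto
    then have "(\<lambda>Y. \<bar>(\<Sum>k<n. xf a b V X i (Y k) * xf a b V X j (Y k)) / n - (\<integral>x. xf a b V X i x * xf a b V X j x \<partial>\<nu>)\<bar>) \<in> borel_measurable MX"
      by (intro borel_measurable_abs borel_measurable_diff borel_measurable_divide borel_measurable_sum borel_measurable_times) auto
    then show ?thesis by measurable
  qed
  have e2: "emeasure MX {Y \<in> space MX. \<exists>i\<in>{..m1}. (\<exists>j\<in>{..m1}. ?D i j Y)} \<le> ennreal (real (card {..m1}) * (real (card {..m1}) * (2 * exp (- (4 * \<iota>)))))"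
  proof (rule emeasure_union_bound)
    fix i assume i: "i \<in> {..m1}"
    show "{Y \<in> space MX. \<exists>j\<in>{..m1}. ?D i j Y} \<in> sets MX" by (intro sets.sets_Collect_finite_Ex Dm) auto
    show "emeasure MX {Y \<in> space MX. \<exists>j\<in>{..m1}. ?D i j Y} \<le> ennreal (real (card {..m1}) * (2 * exp (- (4 * \<iota>))))"
      using i xf_prod_conc[OF sp ab g] by (intro emeasure_union_bound Dm) auto
  qed auto
  have eq: "{Y \<in> space MX. \<not> good2 a b V X Y} = {Y \<in> space MX. ?P Y \<or> (\<exists>i\<in>{..m1}. (\<exists>j\<in>{..m1}. ?D i j Y))}"
    unfolding good2_def by (auto simp flip: not_le)
  have "emeasure MX {Y \<in> space MX. \<not> good2 a b V X Y} \<le> ennreal (real (card {..<n}) * (6 * K * exp (- 12 * \<iota>)) + real (card {..m1}) * (real (card {..m1}) * (2 * exp (- (4 * \<iota>)))))"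
    unfolding eq using ge1 e1 e2
    by (intro emeasure_Un_le sets.sets_Collect_finite_Ex Pm Dm) auto
  also have "\<dots> \<le> ennreal (14 * exp (- \<iota>))"
  proof (rule ennreal_leI)
    let ?e = "exp \<iota>"
    have e: "1 \<le> ?e" using ge1 by simp
    have "real n * K \<le> ?e * ?e" using size_le K_le_n ge1 by (intro mult_mono) linarith+
    then have "real n * K * (6 * exp (- 12 * \<iota>)) \<le> ?e * ?e * (6 * exp (- 12 * \<iota>))" by (intro mult_right_mono) auto
    also have "\<dots> = 6 * exp (- 10 * \<iota>)" by (simp flip: exp_add)
    also have "\<dots> \<le> 6 * exp (- \<iota>)" using ge1 by simp
    finally have A: "real n * K * (6 * exp (- 12 * \<iota>)) \<le> 6 * exp (- \<iota>)" .
    have "real (m1 + 1) = real m1 + 1" by simp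
    then have m: "real (m1 + 1) \<le> 2 * ?e" using size_le(2) e by linarith
    have "real (m1 + 1) * real (m1 + 1) \<le> (2 * ?e) * (2 * ?e)" using m by (intro mult_mono) auto
    then have "real (m1 + 1) * real (m1 + 1) * (2 * exp (- (4 * \<iota>))) \<le> (2 * ?e) * (2 * ?e) * (2 * exp (- (4 * \<iota>)))" by (intro mult_right_mono) auto
    also have "\<dots> = 8 * exp (- 2 * \<iota>)" by (simp flip: exp_add)
    also have "\<dots> \<le> 8 * exp (- \<iota>)" using ge1 by simp
    finally have Bq: "real (m1 + 1) * real (m1 + 1) * (2 * exp (- (4 * \<iota>))) \<le> 8 * exp (- \<iota>)" .
    have "real (card {..<n}) * (6 * K * exp (- 12 * \<iota>)) = real n * K * (6 * exp (- 12 * \<iota>))" by simp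
    moreover have "real (card {..m1}) * (real (card {..m1}) * (2 * exp (- (4 * \<iota>)))) = real (m1 + 1) * real (m1 + 1) * (2 * exp (- (4 * \<iota>)))" by simp
    ultimately show "real (card {..<n}) * (6 * K * exp (- 12 * \<iota>)) + real (card {..m1}) * (real (card {..m1}) * (2 * exp (- (4 * \<iota>)))) \<le> 14 * exp (- \<iota>)"
      using A Bq by linarith
  qed
  finally show ?thesis .
qed

end

lemma double_sum_split:
  fixes p e :: "'i \<Rightarrow> real"
  shows "(\<Sum>i\<in>I. \<Sum>j\<in>I. p i * p j * (A + C * (e i * e j))) = (\<Sum>i\<in>I. p i)\<^sup>2 * A + (\<Sum>i\<in>I. p i * e i)\<^sup>2 * C"
proof -
  have 1: "(\<Sum>i\<in>I. p i)\<^sup>2 * A = (\<Sum>i\<in>I. \<Sum>j\<in>I. p i * p j * A)"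
    by (simp only: power2_eq_square sum_product) (simp only: sum_distrib_right)
  have 2: "(\<Sum>i\<in>I. p i * e i)\<^sup>2 * C = (\<Sum>i\<in>I. \<Sum>j\<in>I. (p i * e i) * (p j * e j) * C)"
    by (simp only: power2_eq_square sum_product) (simp only: sum_distrib_right)
  have 3: "p i * p j * (A + C * (e i * e j)) = p i * p j * A + (p i * e i) * (p j * e j) * C" for i j
    by (simp add: algebra_simps)
  show ?thesis unfolding 1 2 3 sum.distrib by simp
qed

context net_weights
begin

section \<open>Generalization gap of the quadratic loss\<close>

definition K3 :: real where "K3 = 1000000 * K^5"
definition sn :: real where "sn = sqrt (\<iota> / n)"

lemma sn_facts: "0 \<le> sn" "1 / n \<le> sn" "sn \<le> 1"
proof -
  show "0 \<le> sn" "1 / n \<le> sn" unfolding sn_def using order_trans[OF inv_sqrt_n(2,3)] ge1 by auto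
  have "\<iota> / n \<le> 1" using n128 ge1 pos by (simp add: field_simps)
  then show "sn \<le> 1" unfolding sn_def by (simp add: real_sqrt_le_1_iff)
qed

lemma exp_le_inv_n: "exp (- 2 * \<iota>) \<le> 1 / n"
proof -
  have "exp (- 2 * \<iota>) \<le> exp (- \<iota>)" using ge1 by simp
  then show ?thesis using inv_sqrt_n(1) by linarith
qed

definition sqn :: "vec \<Rightarrow> real" where "sqn a = (\<Sum>i<m1. (a i)\<^sup>2) / m1"

lemma sqn_nonneg: "0 \<le> sqn a" by (simp add: sqn_def sum_nonneg)

definition net_out :: "vec \<Rightarrow> vec \<Rightarrow> vec \<Rightarrow> (nat \<Rightarrow> vec) \<Rightarrow> (nat \<Rightarrow> vec) \<Rightarrow> vec \<Rightarrow> real" where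
  "net_out c a b V X x = (\<Sum>i<m1. c i * psi (a i) (b i) (zz a b V X x)) / m1"

text \<open>The \<open>l1\<close> norm of the coefficients with respect to the normalized
  coordinates \<open>xf\<close>.\<close>

definition bbar :: "vec \<Rightarrow> vec \<Rightarrow> real" where "bbar c b = (\<Sum>i<m1. \<bar>c i\<bar> * (1 + \<bar>b i\<bar>)) / m1"

lemma beta_sum:
  assumes "good_ab a b"
  shows "(\<Sum>i<m1. (1 + \<bar>b i\<bar>)\<^sup>2) \<le> 18 * real m1"
proof -
  have "(\<Sum>i<m1. (1 + \<bar>b i\<bar>)\<^sup>2) \<le> (\<Sum>i<m1. 2 + 2 * (b i)\<^sup>2)"
  proof (rule sum_mono)
    fix i
    show "(1 + \<bar>b i\<bar>)\<^sup>2 \<le> 2 + 2 * (b i)\<^sup>2" using mult_le_half_squares[of 1 "\<bar>b i\<bar>"] by (simp add: power2_sum)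
  qed
  also have "\<dots> = 2 * real m1 + 2 * (\<Sum>i<m1. (b i)\<^sup>2)" by (simp add: sum.distrib sum_distrib_left)
  also have "\<dots> \<le> 18 * real m1" using assms by (simp add: good_ab_def)
  finally show ?thesis .
qed

lemma bbar_le:
  assumes ab: "good_ab a b"
  shows "0 \<le> bbar c b" "(bbar c b)\<^sup>2 \<le> 18 * sqn c"
proof -
  show "0 \<le> bbar c b" by (simp add: bbar_def sum_nonneg)
  have "(\<Sum>i<m1. \<bar>c i\<bar> * (1 + \<bar>b i\<bar>))\<^sup>2 \<le> (\<Sum>i<m1. \<bar>c i\<bar>\<^sup>2) * (\<Sum>i<m1. (1 + \<bar>b i\<bar>)\<^sup>2)"
    by (rule Cauchy_Schwarz_ineq_sum)
  also have "\<dots> \<le> (\<Sum>i<m1. \<bar>c i\<bar>\<^sup>2) * (18 * real m1)" using beta_sum[OF ab] by (intro mult_left_mono) (auto intro: sum_nonneg)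
  finally have "(\<Sum>i<m1. \<bar>c i\<bar> * (1 + \<bar>b i\<bar>))\<^sup>2 / (real m1)\<^sup>2 \<le> (\<Sum>i<m1. \<bar>c i\<bar>\<^sup>2) * (18 * real m1) / (real m1)\<^sup>2"
    by (intro divide_right_mono) auto
  also have "\<dots> = 18 * sqn c" using pos by (simp add: sqn_def power2_eq_square)
  finally show "(bbar c b)\<^sup>2 \<le> 18 * sqn c" by (simp add: bbar_def power_divide)
qed

lemma net_out_le:
  assumes ab: "good_ab a b"
  shows "(net_out c a b V X x)\<^sup>2 \<le> 18 * sqn c * (1 + 2 * \<bar>zz a b V X x\<bar>)\<^sup>2"
proof -
  let ?z = "1 + 2 * \<bar>zz a b V X x\<bar>"
  have "\<bar>\<Sum>i<m1. c i * psi (a i) (b i) (zz a b V X x)\<bar> \<le> (\<Sum>i<m1. \<bar>c i\<bar> * (1 + \<bar>b i\<bar>) * ?z)"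
  proof (intro order_trans[OF sum_abs] sum_mono)
    fix i assume "i \<in> {..<m1}"
    then have "a i = 1 \<or> a i = -1" using ab by (auto simp: good_ab_def)
    then have "\<bar>psi (a i) (b i) (zz a b V X x)\<bar> \<le> (1 + \<bar>b i\<bar>) * ?z" using psi_le psi_nonneg by simp
    then show "\<bar>c i * psi (a i) (b i) (zz a b V X x)\<bar> \<le> \<bar>c i\<bar> * (1 + \<bar>b i\<bar>) * ?z"
      by (simp add: abs_mult mult_left_mono mult.assoc)
  qed
  also have "\<dots> = (\<Sum>i<m1. \<bar>c i\<bar> * (1 + \<bar>b i\<bar>)) * ?z" by (rule sum_distrib_right[symmetric])
  also have "\<dots> = (bbar c b * ?z) * m1" using pos by (simp add: bbar_def)
  finally have "\<bar>net_out c a b V X x\<bar> \<le> bbar c b * ?z" using pos by (simp add: net_out_def abs_divide pos_divide_le_eq)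
  then have "\<bar>net_out c a b V X x\<bar>\<^sup>2 \<le> (bbar c b * ?z)\<^sup>2" by (intro power_mono) auto
  also have "\<dots> = (bbar c b)\<^sup>2 * ?z\<^sup>2" by (simp add: power_mult_distrib)
  also have "\<dots> \<le> 18 * sqn c * ?z\<^sup>2" using bbar_le(2)[OF ab, of c] by (intro mult_right_mono) auto
  finally show ?thesis by simp
qed

lemma net_out_meas: "a \<in> space MA \<Longrightarrow> b \<in> space MB \<Longrightarrow> V \<in> space MV \<Longrightarrow> X \<in> space MX \<Longrightarrow> net_out c a b V X \<in> borel_measurable \<nu>"
proof -
  assume sp[measurable]: "a \<in> space MA" "b \<in> space MB" "V \<in> space MV" "X \<in> space MX"
  show ?thesis unfolding net_out_def[abs_def] psi_def by measurable
qed

text \<open>Undoes the normalization in \<open>xf\<close>; the coefficient \<open>-1\<close> of the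
  target makes \<open>rG\<close> the residual on \<open>G\<close>.\<close>

definition cf :: "vec \<Rightarrow> vec \<Rightarrow> nat \<Rightarrow> real" where
  "cf c b i = (if i < m1 then c i * (1 + \<bar>b i\<bar>) / m1 else -1)"

definition rG :: "vec \<Rightarrow> vec \<Rightarrow> vec \<Rightarrow> (nat \<Rightarrow> vec) \<Rightarrow> (nat \<Rightarrow> vec) \<Rightarrow> vec \<Rightarrow> real" where
  "rG c a b V X x = (\<Sum>i\<le>m1. cf c b i * xf a b V X i x)"

lemma rG_eq: "rG c a b V X x = (if x \<in> G V X then net_out c a b V X x - fs x else 0)"
proof (cases "x \<in> G V X")
  case True
  have p: "1 + \<bar>b i\<bar> \<noteq> 0" for i using abs_ge_zero[of "b i"] by linarith
  have "rG c a b V X x = (\<Sum>i<m1. cf c b i * xf a b V X i x) + cf c b m1 * xf a b V X m1 x"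
    unfolding rG_def by (simp add: lessThan_Suc_atMost[symmetric])
  also have "(\<Sum>i<m1. cf c b i * xf a b V X i x) = net_out c a b V X x"
    unfolding net_out_def sum_divide_distrib using True p by (intro sum.cong) (auto simp: cf_def xf_def)
  finally show ?thesis using True by (simp add: cf_def xf_def)
qed (simp add: rG_def xf_def)

definition Qhat :: "vec \<Rightarrow> vec \<Rightarrow> vec \<Rightarrow> (nat \<Rightarrow> vec) \<Rightarrow> (nat \<Rightarrow> vec) \<Rightarrow> (nat \<Rightarrow> vec) \<Rightarrow> real" where
  "Qhat c a b V X Y = (\<Sum>k<n. (net_out c a b V X (Y k) - fs (Y k))\<^sup>2) / n"

definition QG :: "vec \<Rightarrow> vec \<Rightarrow> vec \<Rightarrow> (nat \<Rightarrow> vec) \<Rightarrow> (nat \<Rightarrow> vec) \<Rightarrow> real" where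
  "QG c a b V X = (\<integral>x. (rG c a b V X x)\<^sup>2 \<partial>\<nu>)"

text \<open>Written as a constant plus a term at the pair \<open>(m1, m1)\<close>, so that
  \<open>double_sum_split\<close> produces the squared \<open>l1\<close> norm of the coefficients
  for the first part and only the coefficient of the target for the second. In this way
  \<open>F\<^sup>2\<close> never multiplies the weights.\<close>

lemma dev_le:
  assumes "i \<le> m1" "j \<le> m1"
  shows "2 * sqrt (vv i j * (4 * \<iota>) / n) \<le> 4 * K2 * sn + 4 * F\<^sup>2 * sn * ((if i = m1 then 1 else 0) * (if j = m1 then 1 else 0))"
proof -
  have eq: "2 * sqrt (vv i j * (4 * \<iota>) / n) = 4 * sqrt (vv i j) * sn"
  proof -
    have "vv i j * (4 * \<iota>) / n = (2\<^sup>2 * vv i j) * (\<iota> / n)" by simp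
    then have "sqrt (vv i j * (4 * \<iota>) / n) = sqrt (2\<^sup>2) * sqrt (vv i j) * sn" by (simp only: real_sqrt_mult sn_def)
    then show ?thesis by simp
  qed
  show ?thesis
  proof (cases "i = m1 \<and> j = m1")
    case True
    have "sqrt (F^4) = F\<^sup>2" using real_sqrt_abs[of "F\<^sup>2"] by simp
    moreover have "0 \<le> K2 * sn" using sn_facts ge1 by (simp add: K2_def)
    ultimately show ?thesis unfolding eq using True by (simp add: vv_def)
  next
    case False
    have "1 \<le> K2" using K5 by (simp add: K2_def)
    then have "K2 \<le> K2\<^sup>2" by (simp add: power2_eq_square)
    then have "sqrt K2 \<le> K2" using \<open>1 \<le> K2\<close> by (intro real_le_lsqrt) auto
    then have "4 * sqrt K2 * sn \<le> 4 * K2 * sn" using sn_facts by (intro mult_right_mono) auto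
    then show ?thesis unfolding eq using False by (auto simp: vv_def)
  qed
qed

context
  fixes a b V X
  assumes sp: "a \<in> space MA" "b \<in> space MB" "V \<in> space MV" "X \<in> space MX"
    and ab: "good_ab a b" and g: "good V X"
begin

lemma xf_prod_integrable: "integrable \<nu> (\<lambda>x. xf a b V X i x * xf a b V X j x)"
proof -
  note sp[measurable]
  show ?thesis
  proof (rule nu.integrable_const_bound[where B="max (7 * K * B) F * max (7 * K * B) F"])
    have "\<bar>xf a b V X i x\<bar> \<le> max (7 * K * B) F" for i x using xf_bound[OF sp ab g, of i x] by (auto split: if_splits)
    then show "AE x in \<nu>. norm (xf a b V X i x * xf a b V X j x) \<le> max (7 * K * B) F * max (7 * K * B) F"
      using ge1 by (auto simp: abs_mult intro!: AE_I2 mult_mono)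
  qed measurable
qed

lemma rG_sq: "(rG c a b V X x)\<^sup>2 = (\<Sum>i\<le>m1. \<Sum>j\<le>m1. cf c b i * cf c b j * (xf a b V X i x * xf a b V X j x))"
  unfolding rG_def power2_eq_square sum_product by (intro sum.cong) (auto simp: ac_simps)

lemma rG_sq_integrable: "integrable \<nu> (\<lambda>x. (rG c a b V X x)\<^sup>2)"
  unfolding rG_sq by (intro Bochner_Integration.integrable_sum integrable_mult_right xf_prod_integrable)

lemma QG_eq: "QG c a b V X = (\<Sum>i\<le>m1. \<Sum>j\<le>m1. cf c b i * cf c b j * (\<integral>x. xf a b V X i x * xf a b V X j x \<partial>\<nu>))"
  unfolding QG_def rG_sq using xf_prod_integrable
  by (subst Bochner_Integration.integral_sum, fastforce, intro sum.cong refl)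
     (subst Bochner_Integration.integral_sum, auto)

lemma cf_abs_sum: "(\<Sum>i\<le>m1. \<bar>cf c b i\<bar>) = bbar c b + 1"
proof -
  have "(\<Sum>i\<le>m1. \<bar>cf c b i\<bar>) = (\<Sum>i<m1. \<bar>cf c b i\<bar>) + \<bar>cf c b m1\<bar>" by (simp add: lessThan_Suc_atMost[symmetric])
  also have "(\<Sum>i<m1. \<bar>cf c b i\<bar>) = bbar c b"
    unfolding bbar_def sum_divide_distrib by (intro sum.cong) (auto simp: cf_def abs_mult)
  finally show ?thesis by (simp add: cf_def)
qed

text \<open>Empirical and population loss on \<open>G\<close> are quadratic forms in the same
  coefficients, with matrices that are close entrywise by \<open>good2\<close>; the difference is at
  most the squared \<open>l1\<close> norm times the entrywise error.\<close>

lemma gap: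
  assumes g2: "good2 a b V X Y"
  shows "\<bar>Qhat c a b V X Y - QG c a b V X\<bar> \<le> 144 * K2 * sn * sqn c + 12 * K2 * F\<^sup>2 * sn"
proof -
  let ?m = "\<lambda>i j. (\<Sum>k<n. xf a b V X i (Y k) * xf a b V X j (Y k)) / n"
  let ?e = "\<lambda>i j. (\<integral>x. xf a b V X i x * xf a b V X j x \<partial>\<nu>)"
  let ?c = "cf c b" and ?d = "\<lambda>i. if i = m1 then 1 else 0 :: real"
  have YG: "Y k \<in> G V X" if "k < n" for k using g2 that by (auto simp: good2_def)
  have "Qhat c a b V X Y = (\<Sum>k<n. (rG c a b V X (Y k))\<^sup>2) / n"
    unfolding Qhat_def using YG by (simp add: rG_eq)
  also have "\<dots> = (\<Sum>i\<le>m1. \<Sum>j\<le>m1. ?c i * ?c j * ?m i j)"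
  proof -
    have "(\<Sum>k<n. (rG c a b V X (Y k))\<^sup>2) = (\<Sum>i\<le>m1. \<Sum>j\<le>m1. \<Sum>k<n. ?c i * ?c j * (xf a b V X i (Y k) * xf a b V X j (Y k)))"
    proof -
      have "(\<Sum>k<n. (rG c a b V X (Y k))\<^sup>2) = (\<Sum>i\<le>m1. \<Sum>k<n. \<Sum>j\<le>m1. ?c i * ?c j * (xf a b V X i (Y k) * xf a b V X j (Y k)))"
        unfolding rG_sq by (rule sum.swap)
      also have "\<dots> = (\<Sum>i\<le>m1. \<Sum>j\<le>m1. \<Sum>k<n. ?c i * ?c j * (xf a b V X i (Y k) * xf a b V X j (Y k)))"
        by (rule sum.cong[OF refl], rule sum.swap)
      finally show ?thesis .
    qed
    then show ?thesis by (simp add: sum_divide_distrib sum_distrib_left)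
  qed
  finally have D: "Qhat c a b V X Y - QG c a b V X = (\<Sum>i\<le>m1. \<Sum>j\<le>m1. ?c i * ?c j * (?m i j - ?e i j))"
    unfolding QG_eq by (simp add: sum_subtractf right_diff_distrib)
  have "\<bar>Qhat c a b V X Y - QG c a b V X\<bar> \<le> (\<Sum>i\<le>m1. \<Sum>j\<le>m1. \<bar>?c i\<bar> * \<bar>?c j\<bar> * (4 * K2 * sn + 4 * F\<^sup>2 * sn * (?d i * ?d j)))"
    unfolding D
  proof (intro order_trans[OF sum_abs] sum_mono)
      fix i j assume i: "i \<in> {..m1}" and j: "j \<in> {..m1}"
      have "\<bar>?m i j - ?e i j\<bar> \<le> 2 * sqrt (vv i j * (4 * \<iota>) / n)" using g2 i j by (simp add: good2_def)
      also have "\<dots> \<le> 4 * K2 * sn + 4 * F\<^sup>2 * sn * (?d i * ?d j)" using i j by (intro dev_le) auto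
      finally show "\<bar>?c i * ?c j * (?m i j - ?e i j)\<bar> \<le> \<bar>?c i\<bar> * \<bar>?c j\<bar> * (4 * K2 * sn + 4 * F\<^sup>2 * sn * (?d i * ?d j))"
        unfolding abs_mult by (intro mult_left_mono) auto
  qed
  also have "\<dots> = (\<Sum>i\<le>m1. \<bar>?c i\<bar>)\<^sup>2 * (4 * K2 * sn) + (\<Sum>i\<le>m1. \<bar>?c i\<bar> * ?d i)\<^sup>2 * (4 * F\<^sup>2 * sn)"
    by (rule double_sum_split)
  finally have T: "\<bar>Qhat c a b V X Y - QG c a b V X\<bar> \<le> (\<Sum>i\<le>m1. \<bar>?c i\<bar>)\<^sup>2 * (4 * K2 * sn) + (\<Sum>i\<le>m1. \<bar>?c i\<bar> * ?d i)\<^sup>2 * (4 * F\<^sup>2 * sn)" .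
  have d1: "(\<Sum>i\<le>m1. \<bar>?c i\<bar> * ?d i) = 1"
  proof -
    have "(\<Sum>i\<le>m1. \<bar>?c i\<bar> * ?d i) = (\<Sum>i\<le>m1. if i = m1 then \<bar>?c m1\<bar> else 0)" by (intro sum.cong) auto
    then show ?thesis by (simp add: cf_def)
  qed
  have "(bbar c b + 1)\<^sup>2 \<le> 2 * (bbar c b)\<^sup>2 + 2" using mult_le_half_squares[of "bbar c b" 1] by (simp add: power2_sum)
  then have c2: "(\<Sum>i\<le>m1. \<bar>?c i\<bar>)\<^sup>2 \<le> 36 * sqn c + 2" using bbar_le(2)[OF ab, of c] unfolding cf_abs_sum by linarith
  have "(\<Sum>i\<le>m1. \<bar>?c i\<bar>)\<^sup>2 * (4 * K2 * sn) \<le> (36 * sqn c + 2) * (4 * K2 * sn)"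
    using sn_facts ge1 c2 by (intro mult_right_mono) (auto simp: K2_def)
  with T have "\<bar>Qhat c a b V X Y - QG c a b V X\<bar> \<le> (36 * sqn c + 2) * (4 * K2 * sn) + 4 * F\<^sup>2 * sn"
    unfolding d1 by simp
  also have "\<dots> \<le> 144 * K2 * sn * sqn c + 12 * K2 * F\<^sup>2 * sn"
  proof -
    have k: "1 \<le> K2" "1 \<le> F\<^sup>2" using K5 ge1 by (auto simp: K2_def)
    have "K2 * 1 \<le> K2 * F\<^sup>2" "1 * F\<^sup>2 \<le> K2 * F\<^sup>2" using k by (intro mult_mono; simp)+
    then have "(8 * K2 + 4 * F\<^sup>2) * sn \<le> (12 * (K2 * F\<^sup>2)) * sn" using sn_facts by (intro mult_right_mono) auto
    then show ?thesis by (simp add: algebra_simps)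
  qed
  finally show ?thesis .
qed

text \<open>Integrated over all inputs, hence the crude factor: \<open>\<eta>^4\<close> costs
  \<open>exp (4 * \<iota>)\<close>, and \<open>(F * B)^4\<close>, being at most
  \<open>n\<^sup>2\<close>, costs \<open>exp (2 * \<iota>)\<close>.\<close>

lemma zz_moment: "(\<integral>\<^sup>+x. ennreal (((1 + 2 * \<bar>zz a b V X x\<bar>)\<^sup>2)\<^sup>2) \<partial>\<nu>) \<le> ennreal (18000 * K^5 * exp (6 * \<iota>))"
proof -
  note sp[measurable]
  let ?g = "feat d n m2 \<sigma>2 fs V X" and ?s = "feat d n m2 \<sigma>2 (\<lambda>_. 1) V X"
  have eb: "\<bar>\<eta> * bias_out m1 a b\<bar> \<le> 1"
    using ab eta0 eta_m1 by (simp add: abs_mult good_ab_def) (meson mult_left_mono order_trans)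
  have pw: "zz a b V X x ^ 4 \<le> 8 * exp (4 * \<iota>) * ?g x ^ 4 + 8 * ?s x ^ 4" for x
  proof -
    have "zz a b V X x = \<eta> * ?g x + (- (\<eta> * bias_out m1 a b)) * ?s x" by (simp add: zz_def zval_def algebra_simps)
    then have "zz a b V X x ^ 4 \<le> 8 * ((\<eta> * ?g x)^4 + ((- (\<eta> * bias_out m1 a b)) * ?s x)^4)" using pow4_add_le by metis
    also have "(\<eta> * ?g x)^4 \<le> exp (4 * \<iota>) * ?g x ^ 4"
    proof -
      have "\<eta>^4 \<le> exp \<iota> ^ 4" using eta0 eta_exp by (intro power_mono)
      then show ?thesis by (simp add: power_mult_distrib mult_right_mono flip: exp_of_nat_mult)
    qed
    also have "((- (\<eta> * bias_out m1 a b)) * ?s x)^4 \<le> 1 * ?s x ^ 4"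
    proof -
      have "\<bar>\<eta> * bias_out m1 a b\<bar>^4 \<le> 1" using eb by (intro power_le_one) auto
      then have "(- (\<eta> * bias_out m1 a b))^4 \<le> 1" by (simp add: power_even_abs_numeral)
      then show ?thesis unfolding power_mult_distrib by (intro mult_right_mono) auto
    qed
    finally show ?thesis by simp
  qed
  have gm: "(\<integral>\<^sup>+x. ennreal (?g x ^ 4) \<partial>\<nu>) \<le> ennreal (exp (2 * \<iota>) * K)"
  proof -
    have "(F * B)^4 \<le> (F\<^sup>2 * B^4)\<^sup>2"
    proof -
      have "B^4 * 1 \<le> B^4 * B^4" using ge1 by (intro mult_left_mono) auto
      then have "F^4 * B^4 \<le> F^4 * (B^4 * B^4)" by (intro mult_left_mono) auto
      then show ?thesis by (simp add: power_mult_distrib flip: power_add)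
    qed
    also have "\<dots> \<le> (exp \<iota>)\<^sup>2" using F2B4(1) size_le(1) by (intro power_mono) auto
    also have "\<dots> = exp (2 * \<iota>)" by (simp flip: exp_of_nat_mult)
    finally have "(F * B)^4 * K \<le> exp (2 * \<iota>) * K" using ge1 by (intro mult_right_mono) auto
    with feat_moments(2)[OF sp(3,4) g] show ?thesis by (meson ennreal_leI order_trans)
  qed
  have "(\<integral>\<^sup>+x. ennreal (8 + 128 * zz a b V X x ^ 4) \<partial>\<nu>) \<le> ennreal (8 + 128 * (8 * exp (4 * \<iota>) * (exp (2 * \<iota>) * K) + 8 * (16 * K^5)))"
  proof (rule nn_integral_le_affine[OF prob_nu])
    show "(\<integral>\<^sup>+x. ennreal (zz a b V X x ^ 4) \<partial>\<nu>) \<le> ennreal (8 * exp (4 * \<iota>) * (exp (2 * \<iota>) * K) + 8 * (16 * K^5))"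
      by (rule nn_integral_add_le[OF _ _ gm feat_moments(1)[OF sp(3,4) g]]) (use pw ge1 K5 in auto)
  qed (use ge1 K5 in auto)
  also have "8 + 128 * (8 * exp (4 * \<iota>) * (exp (2 * \<iota>) * K) + 8 * (16 * K^5)) \<le> 18000 * K^5 * exp (6 * \<iota>)"
  proof -
    have e: "exp (4 * \<iota>) * exp (2 * \<iota>) = exp (6 * \<iota>)" by (simp flip: exp_add)
    have "1 \<le> exp (6 * \<iota>)" using ge1 by simp
    then have i: "K^5 \<le> K^5 * exp (6 * \<iota>)" using K5 ge1 mult_left_mono[of 1 "exp (6 * \<iota>)" "K^5"] by simp
    have ii: "K * exp (6 * \<iota>) \<le> K^5 * exp (6 * \<iota>)" using K5 by (intro mult_right_mono) auto
    have e8: "8 * exp (4 * \<iota>) * (exp (2 * \<iota>) * K) = 8 * (K * exp (6 * \<iota>))" unfolding e[symmetric] by simp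
    have iii: "18000 * K^5 * exp (6 * \<iota>) = 18000 * (K^5 * exp (6 * \<iota>))" by (rule mult.assoc)
    have gen: "8 + 128 * (8 * u + 8 * (16 * w)) \<le> 18000 * t" if "w \<le> t" "u \<le> t" "1 \<le> w" for u w t :: real
    proof -
      have "8 + 128 * (8 * u + 8 * (16 * w)) \<le> 8 * t + 128 * (8 * t + 8 * (16 * t))"
        using that by (intro add_mono mult_left_mono) auto
      also have "\<dots> = 17416 * t" by simp
      also have "\<dots> \<le> 18000 * t" using that by (intro mult_right_mono) auto
      finally show ?thesis .
    qed
    show ?thesis unfolding e8 iii by (rule gen[OF i ii K5(1)])
  qed
  finally have fin: "(\<integral>\<^sup>+x. ennreal (8 + 128 * zz a b V X x ^ 4) \<partial>\<nu>) \<le> ennreal (18000 * K^5 * exp (6 * \<iota>))"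
    by (simp add: ennreal_leI)
  have "(\<integral>\<^sup>+x. ennreal (((1 + 2 * \<bar>zz a b V X x\<bar>)\<^sup>2)\<^sup>2) \<partial>\<nu>) \<le> (\<integral>\<^sup>+x. ennreal (8 + 128 * zz a b V X x ^ 4) \<partial>\<nu>)"
  proof (intro nn_integral_mono ennreal_leI)
    fix x
    have "(1 + 2 * \<bar>zz a b V X x\<bar>)^4 \<le> 8 * (1^4 + (2 * \<bar>zz a b V X x\<bar>)^4)" by (rule pow4_add_le)
    then show "((1 + 2 * \<bar>zz a b V X x\<bar>)\<^sup>2)\<^sup>2 \<le> 8 + 128 * zz a b V X x ^ 4" by (simp add: power_mult_distrib)
  qed
  then show ?thesis using fin by (rule order_trans)
qed

text \<open>For the network the Young parameter \<open>exp (- 8 * \<iota>)\<close> turns a moment of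
  order \<open>exp (6 * \<iota>)\<close> and a probability of order
  \<open>exp (- 12 * \<iota>)\<close> into order \<open>exp (- 2 * \<iota>)\<close>, which is below
  \<open>1 / n\<close> and so below \<open>sn\<close>. For the target, whose moment is bounded,
  \<open>exp (- 6 * \<iota>)\<close> balances both terms.\<close>

lemma tail:
  "(\<integral>\<^sup>+x. ennreal ((net_out c a b V X x - fs x)\<^sup>2) * indicator (space \<nu> - G V X) x \<partial>\<nu>) \<le> ennreal (360000 * K^5 * sn * sqn c + 8 * K * sn)"
proof -
  note sp[measurable]
  note net_out_meas[OF sp, measurable]
  let ?A = "space \<nu> - G V X"
  have A: "?A \<in> sets \<nu>" using G_sets(2)[OF sp(3,4)] by auto
  note Gc = G_compl[OF sp(3,4) g]
  have t1: "(\<integral>\<^sup>+x. ennreal \<bar>(1 + 2 * \<bar>zz a b V X x\<bar>)\<^sup>2\<bar> * indicator ?A x \<partial>\<nu>) \<le> ennreal (10000 * K^5 * sn)"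
  proof -
    have "(\<integral>\<^sup>+x. ennreal \<bar>(1 + 2 * \<bar>zz a b V X x\<bar>)\<^sup>2\<bar> * indicator ?A x \<partial>\<nu>)
       \<le> ennreal ((exp (- 8 * \<iota>) * (18000 * K^5 * exp (6 * \<iota>)) + 6 * K * exp (- 12 * \<iota>) / exp (- 8 * \<iota>)) / 2)"
      by (rule nn_integral_on_rare_event[OF _ A _ _ _ zz_moment Gc]) (use ge1 K5 in auto)
    also have "exp (- 8 * \<iota>) * (18000 * K^5 * exp (6 * \<iota>)) = 18000 * K^5 * exp (- 2 * \<iota>)"
      by (simp add: mult.left_commute flip: exp_add)
    also have "6 * K * exp (- 12 * \<iota>) / exp (- 8 * \<iota>) = 6 * K * exp (- 4 * \<iota>)"
      by (simp flip: exp_diff times_divide_eq_right)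
    also have "(18000 * K^5 * exp (- 2 * \<iota>) + 6 * K * exp (- 4 * \<iota>)) / 2 \<le> 10000 * K^5 * sn"
    proof -
      have "exp (- 4 * \<iota>) \<le> exp (- 2 * \<iota>)" using ge1 by simp
      then have "K * exp (- 4 * \<iota>) \<le> K^5 * exp (- 2 * \<iota>)" using K5 ge1 by (intro mult_mono) auto
      moreover have "K^5 * exp (- 2 * \<iota>) \<le> K^5 * sn" using exp_le_inv_n sn_facts K5 by (intro mult_left_mono) linarith+
      moreover have "0 \<le> K^5 * sn" using sn_facts ge1 by simp
      ultimately show ?thesis by simp
    qed
    finally show ?thesis by (simp add: ennreal_leI)
  qed
  have t2: "(\<integral>\<^sup>+x. ennreal \<bar>(fs x)\<^sup>2\<bar> * indicator ?A x \<partial>\<nu>) \<le> ennreal (4 * K * sn)"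
  proof -
    have f4: "(\<integral>\<^sup>+x. ennreal (((fs x)\<^sup>2)\<^sup>2) \<partial>\<nu>) \<le> ennreal K" using fs_4 by simp
    have "(\<integral>\<^sup>+x. ennreal \<bar>(fs x)\<^sup>2\<bar> * indicator ?A x \<partial>\<nu>) \<le> ennreal ((exp (- 6 * \<iota>) * K + 6 * K * exp (- 12 * \<iota>) / exp (- 6 * \<iota>)) / 2)"
      by (rule nn_integral_on_rare_event[OF _ A _ _ _ f4 Gc]) (use ge1 in auto)
    also have "6 * K * exp (- 12 * \<iota>) / exp (- 6 * \<iota>) = 6 * K * exp (- 6 * \<iota>)"
      by (simp flip: exp_diff times_divide_eq_right)
    also have "(exp (- 6 * \<iota>) * K + 6 * K * exp (- 6 * \<iota>)) / 2 \<le> 4 * K * sn"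
    proof -
      have "exp (- 6 * \<iota>) \<le> exp (- 2 * \<iota>)" using ge1 by simp
      then have "K * exp (- 6 * \<iota>) \<le> K * sn" using exp_le_inv_n sn_facts ge1 by (intro mult_left_mono) linarith+
      moreover have "0 \<le> K * sn" using sn_facts ge1 by simp
      ultimately show ?thesis by simp
    qed
    finally show ?thesis by (simp add: ennreal_leI)
  qed
  have "(\<integral>\<^sup>+x. ennreal ((net_out c a b V X x - fs x)\<^sup>2) * indicator ?A x \<partial>\<nu>)
    \<le> (\<integral>\<^sup>+x. ennreal (36 * sqn c) * (ennreal \<bar>(1 + 2 * \<bar>zz a b V X x\<bar>)\<^sup>2\<bar> * indicator ?A x) + ennreal 2 * (ennreal \<bar>(fs x)\<^sup>2\<bar> * indicator ?A x) \<partial>\<nu>)"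
  proof (rule nn_integral_mono)
    fix x
    have "(net_out c a b V X x - fs x)\<^sup>2 \<le> 2 * (net_out c a b V X x)\<^sup>2 + 2 * (fs x)\<^sup>2"
      using abs_mult_le_half_squares[of "net_out c a b V X x" "fs x"] by (simp add: power2_diff abs_le_iff)
    also have "\<dots> \<le> 36 * sqn c * (1 + 2 * \<bar>zz a b V X x\<bar>)\<^sup>2 + 2 * (fs x)\<^sup>2" using net_out_le[OF ab, of c V X x] by simp
    finally have pw: "(net_out c a b V X x - fs x)\<^sup>2 \<le> 36 * sqn c * (1 + 2 * \<bar>zz a b V X x\<bar>)\<^sup>2 + 2 * (fs x)\<^sup>2" .
    have "ennreal ((net_out c a b V X x - fs x)\<^sup>2) \<le> ennreal (36 * sqn c) * ennreal \<bar>(1 + 2 * \<bar>zz a b V X x\<bar>)\<^sup>2\<bar> + ennreal 2 * ennreal \<bar>(fs x)\<^sup>2\<bar>"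
    proof -
      have "ennreal (36 * sqn c * (1 + 2 * \<bar>zz a b V X x\<bar>)\<^sup>2 + 2 * (fs x)\<^sup>2) = ennreal (36 * sqn c * (1 + 2 * \<bar>zz a b V X x\<bar>)\<^sup>2) + ennreal (2 * (fs x)\<^sup>2)"
        using sqn_nonneg[of c] by (intro ennreal_plus) auto
      also have "ennreal (36 * sqn c * (1 + 2 * \<bar>zz a b V X x\<bar>)\<^sup>2) = ennreal (36 * sqn c) * ennreal ((1 + 2 * \<bar>zz a b V X x\<bar>)\<^sup>2)"
        using sqn_nonneg[of c] by (intro ennreal_mult) auto
      also have "ennreal (2 * (fs x)\<^sup>2) = ennreal 2 * ennreal ((fs x)\<^sup>2)" by (intro ennreal_mult) auto
      finally show ?thesis using ennreal_leI[OF pw]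
        by (simp only: abs_of_nonneg zero_le_power2)
    qed
    then show "ennreal ((net_out c a b V X x - fs x)\<^sup>2) * indicator ?A x
      \<le> ennreal (36 * sqn c) * (ennreal \<bar>(1 + 2 * \<bar>zz a b V X x\<bar>)\<^sup>2\<bar> * indicator ?A x) + ennreal 2 * (ennreal \<bar>(fs x)\<^sup>2\<bar> * indicator ?A x)"
      by (cases "x \<in> ?A") auto
  qed
  also have "\<dots> = ennreal (36 * sqn c) * (\<integral>\<^sup>+x. ennreal \<bar>(1 + 2 * \<bar>zz a b V X x\<bar>)\<^sup>2\<bar> * indicator ?A x \<partial>\<nu>) + ennreal 2 * (\<integral>\<^sup>+x. ennreal \<bar>(fs x)\<^sup>2\<bar> * indicator ?A x \<partial>\<nu>)"
    using A by (subst nn_integral_add) (auto simp: nn_integral_cmult)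
  also have "\<dots> \<le> ennreal (36 * sqn c) * ennreal (10000 * K^5 * sn) + ennreal 2 * ennreal (4 * K * sn)"
    using t1 t2 by (intro add_mono mult_left_mono) auto
  also have "\<dots> = ennreal (36 * sqn c * (10000 * K^5 * sn) + 2 * (4 * K * sn))"
  proof -
    have nn: "0 \<le> 36 * sqn c" "0 \<le> 10000 * K^5 * sn" "0 \<le> (2::real)" "0 \<le> 4 * K * sn" using sn_facts ge1 sqn_nonneg[of c] by auto
    show ?thesis
      unfolding ennreal_mult[OF nn(1,2), symmetric] ennreal_mult[OF nn(3,4), symmetric]
      by (rule ennreal_plus[OF mult_nonneg_nonneg[OF nn(1,2)] mult_nonneg_nonneg[OF nn(3,4)], symmetric])
  qed
  also have "36 * sqn c * (10000 * K^5 * sn) + 2 * (4 * K * sn) = 360000 * K^5 * sn * sqn c + 8 * K * sn" by simp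
  finally show ?thesis .
qed

text \<open>The term with \<open>sqn c\<close> is exactly the ridge penalty for \<open>lam0\<close>,
  so the right side is the training objective plus a term independent of \<open>c\<close>; this is
  how the norm of the trained weights is controlled. \<open>K3\<close> makes room for the gap
  constant \<open>144 * 3000\<close> plus the tail constant \<open>360000\<close>.\<close>

lemma pop_upper:
  assumes g2: "good2 a b V X Y"
  shows "(\<integral>\<^sup>+x. ennreal ((net_out c a b V X x - fs x)\<^sup>2) \<partial>\<nu>) \<le> ennreal (Qhat c a b V X Y + K3 * sn * sqn c + K3 * F\<^sup>2 * sn)"
proof -
  note net_out_meas[OF sp, measurable]
  have Gm: "G V X \<in> sets \<nu>" using G_sets(2)[OF sp(3,4)] .
  let ?r = "\<lambda>x. ennreal ((net_out c a b V X x - fs x)\<^sup>2)"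
  have "(\<integral>\<^sup>+x. ?r x \<partial>\<nu>) = (\<integral>\<^sup>+x. ennreal ((rG c a b V X x)\<^sup>2) + ?r x * indicator (space \<nu> - G V X) x \<partial>\<nu>)"
    by (intro nn_integral_cong) (auto simp: rG_eq)
  also have "\<dots> = (\<integral>\<^sup>+x. ennreal ((rG c a b V X x)\<^sup>2) \<partial>\<nu>) + (\<integral>\<^sup>+x. ?r x * indicator (space \<nu> - G V X) x \<partial>\<nu>)"
    using Gm borel_measurable_integrable[OF rG_sq_integrable[of c]] by (intro nn_integral_add) auto
  also have "(\<integral>\<^sup>+x. ennreal ((rG c a b V X x)\<^sup>2) \<partial>\<nu>) = ennreal (QG c a b V X)"
    unfolding QG_def by (intro nn_integral_eq_integral rG_sq_integrable) auto
  also have "ennreal (QG c a b V X) + (\<integral>\<^sup>+x. ?r x * indicator (space \<nu> - G V X) x \<partial>\<nu>) \<le> ennreal (QG c a b V X) + ennreal (360000 * K^5 * sn * sqn c + 8 * K * sn)"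
    by (intro add_left_mono tail)
  also have "\<dots> = ennreal (QG c a b V X + (360000 * K^5 * sn * sqn c + 8 * K * sn))"
    using sn_facts K5 ge1 sqn_nonneg[of c] by (intro ennreal_plus[symmetric]) (auto simp: QG_def)
  also have "\<dots> \<le> ennreal (Qhat c a b V X Y + K3 * sn * sqn c + K3 * F\<^sup>2 * sn)"
  proof (rule ennreal_leI)
    have q: "QG c a b V X \<le> Qhat c a b V X Y + (144 * K2 * sn * sqn c + 12 * K2 * F\<^sup>2 * sn)" using gap[OF g2, of c] by linarith
    have 1: "144 * K2 * sn * sqn c + 360000 * K^5 * sn * sqn c \<le> K3 * sn * sqn c"
    proof -
      have "0 \<le> K^5 * sn * sqn c" using sn_facts K5 sqn_nonneg[of c] by (intro mult_nonneg_nonneg) linarith+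
      moreover have "144 * K2 * sn * sqn c + 360000 * K^5 * sn * sqn c = 792000 * (K^5 * sn * sqn c)" "K3 * sn * sqn c = 1000000 * (K^5 * sn * sqn c)"
        by (simp_all add: K2_def K3_def)
      ultimately show ?thesis by linarith
    qed
    have 2: "12 * K2 * F\<^sup>2 * sn + 8 * K * sn \<le> K3 * F\<^sup>2 * sn"
    proof -
      have "K * 1 \<le> K^5 * F\<^sup>2" using K5 ge1 by (intro mult_mono) auto
      then have "K * sn \<le> K^5 * F\<^sup>2 * sn" using sn_facts by (intro mult_right_mono) auto
      moreover have "0 \<le> K^5 * F\<^sup>2 * sn" using sn_facts ge1 by simp
      moreover have "12 * K2 * F\<^sup>2 * sn = 36000 * (K^5 * F\<^sup>2 * sn)" "K3 * F\<^sup>2 * sn = 1000000 * (K^5 * F\<^sup>2 * sn)"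
        by (simp_all add: K2_def K3_def)
      ultimately show ?thesis by linarith
    qed
    show "QG c a b V X + (360000 * K^5 * sn * sqn c + 8 * K * sn) \<le> Qhat c a b V X Y + K3 * sn * sqn c + K3 * F\<^sup>2 * sn"
      using q 1 2 by linarith
  qed
  finally show ?thesis .
qed

text \<open>The reverse comparison, to be applied to the reference weights
  \<open>astar\<close>.\<close>

lemma emp_upper:
  assumes g2: "good2 a b V X Y"
  shows "Qhat c a b V X Y \<le> QG c a b V X + K3 * sn * sqn c + K3 * F\<^sup>2 * sn"
proof -
  have 1: "144 * K2 * sn * sqn c \<le> K3 * sn * sqn c"
    using sn_facts K5 ge1 sqn_nonneg[of c] by (intro mult_right_mono) (auto simp: K2_def K3_def)
  have 2: "12 * K2 * F\<^sup>2 * sn \<le> K3 * F\<^sup>2 * sn"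
    using sn_facts K5 ge1 by (intro mult_right_mono) (auto simp: K2_def K3_def)
  show ?thesis using gap[OF g2, of c] 1 2 by linarith
qed

end

end

section \<open>Excess risk of the trained network\<close>

lemma emeasure_pair_assoc:
  assumes M1: "prob_space M1" and M2: "prob_space M2" and M3: "prob_space M3" and A: "A \<in> sets (M1 \<Otimes>\<^sub>M M2)"
  shows "{\<omega> \<in> space (M1 \<Otimes>\<^sub>M (M2 \<Otimes>\<^sub>M M3)). (fst \<omega>, fst (snd \<omega>)) \<in> A} \<in> sets (M1 \<Otimes>\<^sub>M (M2 \<Otimes>\<^sub>M M3))"
    and "emeasure (M1 \<Otimes>\<^sub>M (M2 \<Otimes>\<^sub>M M3)) {\<omega> \<in> space (M1 \<Otimes>\<^sub>M (M2 \<Otimes>\<^sub>M M3)). (fst \<omega>, fst (snd \<omega>)) \<in> A} = emeasure (M1 \<Otimes>\<^sub>M M2) A"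
proof -
  interpret M1: prob_space M1 by fact
  interpret M2: prob_space M2 by fact
  interpret M3: prob_space M3 by fact
  interpret M23: pair_prob_space M2 M3 ..
  let ?N = "M1 \<Otimes>\<^sub>M (M2 \<Otimes>\<^sub>M M3)"
  let ?A = "{\<omega> \<in> space ?N. (fst \<omega>, fst (snd \<omega>)) \<in> A}"
  have "(\<lambda>\<omega>. (fst \<omega>, fst (snd \<omega>))) \<in> measurable ?N (M1 \<Otimes>\<^sub>M M2)" by measurable
  from measurable_sets[OF this A] show m: "?A \<in> sets ?N" by (simp add: vimage_def Int_def conj_commute)
  have sub: "A \<subseteq> space M1 \<times> space M2" using sets.sets_into_space[OF A] by (simp add: space_pair_measure)
  have "emeasure ?N ?A = (\<integral>\<^sup>+x. emeasure (M2 \<Otimes>\<^sub>M M3) (Pair x -` ?A) \<partial>M1)"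
    by (rule M23.emeasure_pair_measure_alt[OF m])
  also have "\<dots> = (\<integral>\<^sup>+x. emeasure M2 (Pair x -` A) \<partial>M1)"
  proof (rule nn_integral_cong)
    fix x assume x: "x \<in> space M1"
    have "Pair x -` ?A = (Pair x -` A) \<times> space M3" using x sub by (auto simp: space_pair_measure)
    moreover have "Pair x -` A \<in> sets M2" using A by (rule sets_Pair1)
    ultimately show "emeasure (M2 \<Otimes>\<^sub>M M3) (Pair x -` ?A) = emeasure M2 (Pair x -` A)"
      by (simp add: M3.emeasure_pair_measure_Times M3.emeasure_space_1)
  qed
  also have "\<dots> = emeasure (M1 \<Otimes>\<^sub>M M2) A" by (rule M2.emeasure_pair_measure_alt[OF A, symmetric])
  finally show "emeasure ?N ?A = emeasure (M1 \<Otimes>\<^sub>M M2) A" .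
qed

locale net_target = net_weights +
  fixes q :: "real \<Rightarrow> real" and S1 S2 :: real
  assumes S12: "0 \<le> S1" "0 \<le> S2"
    and rep_eq: "\<And>y. y \<in> {-1..1} \<Longrightarrow> S2 * (\<integral>p. frep u v y p \<partial>RN) = q y"
    and rep_lip: "\<And>y z. y \<in> {-1..1} \<Longrightarrow> \<bar>S2 * (\<integral>p. frep u v z p \<partial>RN) - q y\<bar> \<le> 11 * S1 * \<bar>z - y\<bar>"
begin

text \<open>An extension of \<open>q\<close> from \<open>[-1, 1]\<close> to the line by the
  represented function. Unlike \<open>q\<close> it is measurable, and its growth outside the
  interval is controlled.\<close>

definition Gq :: "real \<Rightarrow> real" where "Gq z = S2 * (\<integral>p. frep u v z p \<partial>RN)"

lemma Gq_meas [measurable]: "Gq \<in> borel_measurable borel"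
proof -
  have "(\<lambda>x::real. x) \<in> measurable rademacher borel" by simp
  from measurable_compose[OF measurable_compose[OF measurable_snd[of "borel :: real measure" RN] measurable_fst[of rademacher std_normal]] this]
  have [measurable]: "(\<lambda>w. fst (snd w)) \<in> borel_measurable ((borel :: real measure) \<Otimes>\<^sub>M RN)" by simp
  have [measurable]: "(\<lambda>w. snd (snd w)) \<in> borel_measurable ((borel :: real measure) \<Otimes>\<^sub>M RN)" by measurable
  have "(\<lambda>w. frep u v (fst w) (snd w)) \<in> borel_measurable ((borel :: real measure) \<Otimes>\<^sub>M RN)"
    unfolding frep_def wt_def by measurable
  then have "(\<lambda>z. \<integral>p. frep u v z p \<partial>RN) \<in> borel_measurable borel"
    by (intro RN.borel_measurable_lebesgue_integral) (simp add: case_prod_beta')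
  then show ?thesis unfolding Gq_def[abs_def] by simp
qed

definition astar :: "vec \<Rightarrow> vec \<Rightarrow> vec" where "astar a b = (\<lambda>i. S2 * wt u v (a i) (b i))"

lemma sqn_astar: "sqn (astar a b) \<le> Wb\<^sup>2 * S2\<^sup>2"
proof -
  have "(\<Sum>i<m1. (astar a b i)\<^sup>2) \<le> (\<Sum>i<m1. Wb\<^sup>2 * S2\<^sup>2)"
  proof (rule sum_mono)
    fix i
    have "\<bar>wt u v (a i) (b i)\<bar>\<^sup>2 \<le> Wb\<^sup>2" using wt_bd by (intro power_mono) auto
    then show "(astar a b i)\<^sup>2 \<le> Wb\<^sup>2 * S2\<^sup>2" unfolding astar_def power_mult_distrib by (subst mult.commute) (intro mult_right_mono, auto)
  qed
  then show ?thesis using pos by (simp add: sqn_def pos_divide_le_eq mult.commute)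
qed

lemma net_out_astar: "net_out (astar a b) a b V X x = S2 * err m1 (zz a b V X x) a b + Gq (zz a b V X x)"
proof -
  have "wt u v a b * psi a b z = frep u v z (a, b)" for a b z
  proof (cases "wt u v a b = 0")
    case False
    then have "0 < b" using wt_supp by blast
    then show ?thesis by (simp add: frep_def psi_def relu_deriv_def)
  qed (simp add: frep_def)
  then have "net_out (astar a b) a b V X x = S2 * ((\<Sum>i<m1. frep u v (zz a b V X x) (a i, b i)) / m1)"
    unfolding net_out_def astar_def by (simp add: mult.assoc sum_distrib_left[symmetric])
  then show ?thesis by (simp add: err_def Gq_def algebra_simps)
qed

definition Cfin :: real where "Cfin = 200000000 * K^5 * Wb\<^sup>2"
text \<open>The inverse of a smoothness bound: \<open>1764 * n\<^sup>2\<close> is twice the feature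
  bound \<open>882 * n\<^sup>2\<close> of \<open>training\<close>, with \<open>882 = 18 * 49\<close>
  from \<open>beta_sum\<close> and \<open>zz_G\<close>, and \<open>2 * K3\<close> bounds
  \<open>lam0\<close>.\<close>

definition eta2 :: real where "eta2 = 1 / (1764 * (real n)\<^sup>2 + 2 * K3)"
text \<open>With the factor \<open>lam / 2\<close> of the objective the penalty becomes
  \<open>K3 * sn * sqn\<close>, the form in which the generalization gap appears.\<close>

definition lam0 :: real where "lam0 = 2 * K3 * sn / m1"
text \<open>The squared distance from the initial signs to \<open>astar\<close> is at most
  \<open>2 * m1 * (1 + Wb\<^sup>2 * S2\<^sup>2)\<close>; this many steps bring the optimization
  error of \<open>gd_rate\<close> below \<open>1 / n\<close>.\<close>

definition t0 :: nat where "t0 = nat \<lceil>real m1 * (1 + Wb\<^sup>2 * S2\<^sup>2) * n * (1764 * (real n)\<^sup>2 + 2 * K3)\<rceil>"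

lemma K3_pos: "0 < 1764 * (real n)\<^sup>2 + 2 * K3"
proof -
  have "0 < 1764 * (real n)\<^sup>2" using pos by simp
  moreover have "0 \<le> K3" using ge1 by (simp add: K3_def)
  ultimately show ?thesis by linarith
qed

lemma t0_bounds: "0 < t0" "real m1 * (1 + Wb\<^sup>2 * S2\<^sup>2) * n * (1764 * (real n)\<^sup>2 + 2 * K3) \<le> real t0"
  "real t0 \<le> real m1 * (1 + Wb\<^sup>2 * S2\<^sup>2) * n * (1764 * (real n)\<^sup>2 + 2 * K3) + 1"
proof -
  let ?r = "real m1 * (1 + Wb\<^sup>2 * S2\<^sup>2) * n * (1764 * (real n)\<^sup>2 + 2 * K3)"
  have "0 < 1 + Wb\<^sup>2 * S2\<^sup>2" by (simp add: add_pos_nonneg)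
  then have r: "0 < ?r" using pos K3_pos by (intro mult_pos_pos) auto
  then show "0 < t0" by (simp add: t0_def)
  show "?r \<le> real t0" unfolding t0_def using r by (simp add: of_nat_ceiling)
  have "real t0 = of_int \<lceil>?r\<rceil>" unfolding t0_def using r by (intro of_nat_nat) (simp add: less_imp_le)
  then show "real t0 \<le> ?r + 1" using of_int_ceiling_le_add_one[of ?r] by simp
qed

definition Ztot :: real where
  "Ztot = S1\<^sup>2 * \<eta>\<^sup>2 * (eps\<^sup>2 + \<iota> / m1) + S2\<^sup>2 * \<iota> / m1 + (S2\<^sup>2 + F\<^sup>2) * sn"

context
  fixes a b V X
  assumes sp: "a \<in> space MA" "b \<in> space MB" "V \<in> space MV" "X \<in> space MX"
    and ab: "good_ab a b" and g: "good V X"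
begin

lemma eta_bias: "(\<eta> * bias_out m1 a b)\<^sup>2 \<le> 144 * \<eta>\<^sup>2 * (\<iota> / m1)"
proof -
  have "\<bar>bias_out m1 a b\<bar>\<^sup>2 \<le> (12 * sqrt (\<iota> / m1))\<^sup>2" using ab by (intro power_mono) (auto simp: good_ab_def)
  then have "(bias_out m1 a b)\<^sup>2 \<le> 144 * (\<iota> / m1)" using ge1 by (simp add: power_mult_distrib)
  then have "\<eta>\<^sup>2 * (bias_out m1 a b)\<^sup>2 \<le> \<eta>\<^sup>2 * (144 * (\<iota> / m1))" by (rule mult_left_mono) simp
  also have "\<dots> = 144 * \<eta>\<^sup>2 * (\<iota> / m1)" by simp
  finally show ?thesis unfolding power_mult_distrib .
qed

text \<open>On \<open>G\<close> the residual splits into the sampling error of the representation,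
  the change of \<open>Gq\<close> caused by the feature error, and the approximation error at the
  ideal feature. The last one has no real bound and stays an extended integral.\<close>

lemma QG_astar:
  "ennreal (QG (astar a b) a b V X) \<le>
     ennreal (3 * (132 * Wb)\<^sup>2 * S2\<^sup>2 * (\<iota> / m1) * K2 + 363 * S1\<^sup>2 * (2 * \<eta>\<^sup>2 * eps\<^sup>2 + 2448 * K^5 * \<eta>\<^sup>2 * (\<iota> / m1)))
     + 3 * (\<integral>\<^sup>+x. ennreal ((q (\<eta> * Kf x) - fs x)\<^sup>2) \<partial>\<nu>)"
proof -
  note sp[measurable]
  let ?z = "zz a b V X" and ?y = "\<lambda>x. \<eta> * Kf x" and ?s = "feat d n m2 \<sigma>2 (\<lambda>_. 1) V X" and ?g = "feat d n m2 \<sigma>2 fs V X"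
  have Gm [measurable]: "G V X \<in> sets \<nu>" using G_sets(2)[OF sp(3,4)] .
  let ?A = "\<lambda>x. (1 + 2 * \<bar>?z x\<bar>)\<^sup>2 * indicator (G V X) x" and ?B = "\<lambda>x. (?z x - ?y x)\<^sup>2 * indicator (G V X) x"
    and ?C = "\<lambda>x. (Gq (?y x) - fs x)\<^sup>2 * indicator (G V X) x"
  let ?ca = "3 * (132 * Wb)\<^sup>2 * S2\<^sup>2 * (\<iota> / m1)" and ?cb = "363 * S1\<^sup>2"
  have A: "(\<integral>\<^sup>+x. ennreal (?A x) \<partial>\<nu>) \<le> ennreal K2"
  proof -
    have "(\<integral>\<^sup>+x. ennreal (?A x) \<partial>\<nu>) \<le> ennreal (1/2 + 1/2 * K2)"
    proof (rule nn_integral_le_affine[OF prob_nu _ zz_G_pow4[OF sp ab g]])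
      show "?A x \<le> 1/2 + 1/2 * ((1 + 2 * \<bar>?z x\<bar>)^4 * indicator (G V X) x)" for x
        using mult_le_half_squares[of 1 "(1 + 2 * \<bar>?z x\<bar>)\<^sup>2"] by (auto split: split_indicator)
    qed (use ge1 in \<open>auto simp: K2_def\<close>)
    also have "\<dots> \<le> ennreal K2" using K5 by (intro ennreal_leI) (simp add: K2_def)
    finally show ?thesis .
  qed
  have zy: "(?z x - ?y x)\<^sup>2 \<le> (2 * \<eta>\<^sup>2 * eps\<^sup>2 + 144 * \<eta>\<^sup>2 * (\<iota> / m1)) + 144 * \<eta>\<^sup>2 * (\<iota> / m1) * ?s x^4" if x: "x \<in> G V X" for x
  proof -
    have "?z x - ?y x = \<eta> * (?g x - Kf x) + (- ((\<eta> * bias_out m1 a b) * ?s x))" by (simp add: zz_def zval_def algebra_simps)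
    then have "(?z x - ?y x)\<^sup>2 \<le> 2 * (\<eta> * (?g x - Kf x))\<^sup>2 + 2 * ((\<eta> * bias_out m1 a b) * ?s x)\<^sup>2"
    proof -
      have "(x1 + - x2)\<^sup>2 \<le> 2 * x1\<^sup>2 + 2 * x2\<^sup>2" for x1 x2 :: real
        using mult_le_half_squares[of x1 "- x2"] by (simp add: power2_diff)
      then show ?thesis unfolding \<open>?z x - ?y x = \<eta> * (?g x - Kf x) + (- ((\<eta> * bias_out m1 a b) * ?s x))\<close> .
    qed
    also have "(\<eta> * (?g x - Kf x))\<^sup>2 \<le> \<eta>\<^sup>2 * eps\<^sup>2"
    proof -
      have "\<bar>?g x - Kf x\<bar>\<^sup>2 \<le> eps\<^sup>2" using G_facts(1)[OF g x] by (intro power_mono) auto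
      then show ?thesis by (simp add: power_mult_distrib mult_left_mono)
    qed
    also have "((\<eta> * bias_out m1 a b) * ?s x)\<^sup>2 \<le> (144 * \<eta>\<^sup>2 * (\<iota> / m1)) * ((1 + ?s x^4) / 2)"
    proof -
      have "(?s x)\<^sup>2 \<le> (1 + ?s x^4) / 2" using mult_le_half_squares[of 1 "(?s x)\<^sup>2"] by simp
      then show ?thesis unfolding power_mult_distrib[of _ "?s x"] using eta_bias ge1 by (intro mult_mono) auto
    qed
    finally have f: "(?z x - ?y x)\<^sup>2 \<le> 2 * (\<eta>\<^sup>2 * eps\<^sup>2) + 2 * ((144 * \<eta>\<^sup>2 * (\<iota> / m1)) * ((1 + ?s x^4) / 2))" by simp
    have gen: "2 * p + 2 * (w * ((1 + t) / 2)) = (2 * p + w) + w * t" for p w t :: real by (simp add: distrib_left)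
    show ?thesis using f unfolding gen by (simp only: mult.assoc)
  qed
  have B: "(\<integral>\<^sup>+x. ennreal (?B x) \<partial>\<nu>) \<le> ennreal (2 * \<eta>\<^sup>2 * eps\<^sup>2 + 2448 * K^5 * \<eta>\<^sup>2 * (\<iota> / m1))"
  proof -
    have "(\<integral>\<^sup>+x. ennreal (?B x) \<partial>\<nu>) \<le> ennreal ((2 * \<eta>\<^sup>2 * eps\<^sup>2 + 144 * \<eta>\<^sup>2 * (\<iota> / m1)) + 144 * \<eta>\<^sup>2 * (\<iota> / m1) * (16 * K^5))"
      by (rule nn_integral_le_affine[OF prob_nu _ feat_moments(1)[OF sp(3,4) g]])
         (use zy ge1 in \<open>auto split: split_indicator\<close>)
    also have "\<dots> \<le> ennreal (2 * \<eta>\<^sup>2 * eps\<^sup>2 + 2448 * K^5 * \<eta>\<^sup>2 * (\<iota> / m1))"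
    proof (rule ennreal_leI)
      have "\<eta>\<^sup>2 * (\<iota> / m1) * 1 \<le> \<eta>\<^sup>2 * (\<iota> / m1) * K^5" using K5 ge1 by (intro mult_left_mono) auto
      moreover have "144 * \<eta>\<^sup>2 * (\<iota> / m1) = 144 * (\<eta>\<^sup>2 * (\<iota> / m1))" by (rule mult.assoc)
      moreover have "144 * \<eta>\<^sup>2 * (\<iota> / m1) * (16 * K^5) = 2304 * (\<eta>\<^sup>2 * (\<iota> / m1) * K^5)" by (simp only: mult_ac) simp
      moreover have "2448 * K^5 * \<eta>\<^sup>2 * (\<iota> / m1) = 2448 * (\<eta>\<^sup>2 * (\<iota> / m1) * K^5)" by (simp only: mult_ac)
      ultimately show "(2 * \<eta>\<^sup>2 * eps\<^sup>2 + 144 * \<eta>\<^sup>2 * (\<iota> / m1)) + 144 * \<eta>\<^sup>2 * (\<iota> / m1) * (16 * K^5) \<le> 2 * \<eta>\<^sup>2 * eps\<^sup>2 + 2448 * K^5 * \<eta>\<^sup>2 * (\<iota> / m1)"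
        by linarith
    qed
    finally show ?thesis .
  qed
  have y1: "?y x \<in> {-1..1}" if "x \<in> G V X" for x using G_facts(5)[OF g that] by (auto simp: abs_le_iff)
  \<comment> \<open>\<open>?C\<close> uses \<open>Gq\<close>, which equals \<open>q\<close> at the
    values that occur on \<open>G\<close>. Outside \<open>[-1, 1]\<close> the function
    \<open>q\<close> is arbitrary, possibly not measurable, so its integral is reached by
    monotonicity alone.\<close>
  have C: "(\<integral>\<^sup>+x. ennreal (?C x) \<partial>\<nu>) \<le> (\<integral>\<^sup>+x. ennreal ((q (\<eta> * Kf x) - fs x)\<^sup>2) \<partial>\<nu>)"
    using rep_eq[OF y1] by (intro nn_integral_mono) (auto simp: Gq_def split: split_indicator)
  have pw: "(rG (astar a b) a b V X x)\<^sup>2 \<le> ?ca * ?A x + ?cb * ?B x + 3 * ?C x" for x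
  proof (cases "x \<in> G V X")
    case True
    let ?e1 = "S2 * err m1 (?z x) a b" and ?e2 = "Gq (?z x) - Gq (?y x)" and ?e3 = "Gq (?y x) - fs x"
    have r: "rG (astar a b) a b V X x = ?e1 + ?e2 + ?e3" using True by (simp add: rG_eq net_out_astar)
    have tri: "(x1 + x2 + x3)\<^sup>2 \<le> 3 * x1\<^sup>2 + 3 * x2\<^sup>2 + 3 * x3\<^sup>2" for x1 x2 x3 :: real
      using mult_le_half_squares[of x1 x2] mult_le_half_squares[of x1 x3] mult_le_half_squares[of x2 x3]
      by (simp add: power2_eq_square algebra_simps)
    have "\<bar>?e1\<bar>\<^sup>2 \<le> (S2 * (132 * Wb * sqrt (\<iota> / m1) * (1 + 2 * \<bar>?z x\<bar>)))\<^sup>2"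
      using good_ab_err[OF ab, of "?z x"] S12 by (intro power_mono) (auto simp: abs_mult intro!: mult_left_mono)
    also have "\<dots> = (132 * Wb)\<^sup>2 * S2\<^sup>2 * (\<iota> / m1) * (1 + 2 * \<bar>?z x\<bar>)\<^sup>2"
      using ge1 unfolding power_mult_distrib by simp
    finally have e1: "?e1\<^sup>2 \<le> (132 * Wb)\<^sup>2 * S2\<^sup>2 * (\<iota> / m1) * (1 + 2 * \<bar>?z x\<bar>)\<^sup>2" by simp
    have "\<bar>?e2\<bar> \<le> 11 * S1 * \<bar>?z x - ?y x\<bar>"
      using rep_lip[OF y1[OF True], of "?z x"] rep_eq[OF y1[OF True]] by (simp add: Gq_def)
    then have "\<bar>?e2\<bar>\<^sup>2 \<le> (11 * S1 * \<bar>?z x - ?y x\<bar>)\<^sup>2" by (intro power_mono) auto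
    then have e2: "?e2\<^sup>2 \<le> 121 * S1\<^sup>2 * (?z x - ?y x)\<^sup>2" by (simp add: power_mult_distrib)
    show ?thesis unfolding r using tri[of ?e1 ?e2 ?e3] e1 e2 True by simp
  qed (simp add: rG_eq)
  have nn: "0 \<le> ?ca" "0 \<le> ?cb" "0 \<le> (3::real)" using ge1 by auto
  have ABC: "0 \<le> ?A x" "0 \<le> ?B x" "0 \<le> ?C x" for x by auto
  have "ennreal (QG (astar a b) a b V X) = (\<integral>\<^sup>+x. ennreal ((rG (astar a b) a b V X x)\<^sup>2) \<partial>\<nu>)"
    unfolding QG_def by (intro nn_integral_eq_integral[symmetric] rG_sq_integrable[OF sp ab g]) auto
  also have "\<dots> \<le> (\<integral>\<^sup>+x. (ennreal ?ca * ennreal (?A x) + ennreal ?cb * ennreal (?B x)) + 3 * ennreal (?C x) \<partial>\<nu>)"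
  proof (rule nn_integral_mono)
    fix x
    have "ennreal ((rG (astar a b) a b V X x)\<^sup>2) \<le> ennreal (?ca * ?A x + ?cb * ?B x + 3 * ?C x)" by (intro ennreal_leI pw)
    also have "\<dots> = ennreal (?ca * ?A x) + ennreal (?cb * ?B x) + ennreal (3 * ?C x)"
      by (simp only: ennreal_plus[OF add_nonneg_nonneg[OF mult_nonneg_nonneg[OF nn(1) ABC(1)] mult_nonneg_nonneg[OF nn(2) ABC(2)]] mult_nonneg_nonneg[OF nn(3) ABC(3)]]
           ennreal_plus[OF mult_nonneg_nonneg[OF nn(1) ABC(1)] mult_nonneg_nonneg[OF nn(2) ABC(2)]])
    also have "\<dots> = (ennreal ?ca * ennreal (?A x) + ennreal ?cb * ennreal (?B x)) + 3 * ennreal (?C x)"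
      unfolding ennreal_mult[OF nn(1) ABC(1)] ennreal_mult[OF nn(2) ABC(2)] ennreal_mult[OF nn(3) ABC(3)] ennreal_numeral ..
    finally show "ennreal ((rG (astar a b) a b V X x)\<^sup>2) \<le> (ennreal ?ca * ennreal (?A x) + ennreal ?cb * ennreal (?B x)) + 3 * ennreal (?C x)" .
  qed
  also have "\<dots> = (ennreal ?ca * (\<integral>\<^sup>+x. ennreal (?A x) \<partial>\<nu>) + ennreal ?cb * (\<integral>\<^sup>+x. ennreal (?B x) \<partial>\<nu>)) + 3 * (\<integral>\<^sup>+x. ennreal (?C x) \<partial>\<nu>)"
    by (subst nn_integral_add, measurable, subst nn_integral_add, measurable) (simp add: nn_integral_cmult)
  also have "\<dots> \<le> (ennreal ?ca * ennreal K2 + ennreal ?cb * ennreal (2 * \<eta>\<^sup>2 * eps\<^sup>2 + 2448 * K^5 * \<eta>\<^sup>2 * (\<iota> / m1))) + 3 * (\<integral>\<^sup>+x. ennreal ((q (\<eta> * Kf x) - fs x)\<^sup>2) \<partial>\<nu>)"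
    using A B C by (intro add_mono mult_left_mono) auto
  also have "ennreal ?ca * ennreal K2 + ennreal ?cb * ennreal (2 * \<eta>\<^sup>2 * eps\<^sup>2 + 2448 * K^5 * \<eta>\<^sup>2 * (\<iota> / m1))
     = ennreal (?ca * K2 + ?cb * (2 * \<eta>\<^sup>2 * eps\<^sup>2 + 2448 * K^5 * \<eta>\<^sup>2 * (\<iota> / m1)))"
  proof -
    have k: "0 \<le> K2" "0 \<le> 2 * \<eta>\<^sup>2 * eps\<^sup>2 + 2448 * K^5 * \<eta>\<^sup>2 * (\<iota> / m1)" using ge1 by (auto simp: K2_def intro!: add_nonneg_nonneg mult_nonneg_nonneg)
    show ?thesis unfolding ennreal_mult[OF nn(1) k(1), symmetric] ennreal_mult[OF nn(2) k(2), symmetric]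
      by (rule ennreal_plus[OF mult_nonneg_nonneg[OF nn(1) k(1)] mult_nonneg_nonneg[OF nn(2) k(2)], symmetric])
  qed
  finally show ?thesis .
qed

text \<open>Comparison of the last iterate with \<open>astar\<close> by \<open>gd_rate\<close>. The
  feature bound \<open>882 * n\<^sup>2\<close> is wasteful, but it holds at every point of the
  second sample on the good event, and only the number of steps pays for it.\<close>

lemma training:
  assumes g2: "good2 a b V X Y"
    and c: "c = (ridge_step (\<lambda>k i. psi (a i) (b i) (zz a b V X (Y k)) / m1) (\<lambda>k. fs (Y k)) n m1 lam0 eta2 ^^ t0) a"
  shows "Qhat c a b V X Y + K3 * sn * sqn c \<le> Qhat (astar a b) a b V X Y + K3 * sn * sqn (astar a b) + 1 / n"
proof -
  let ?\<Phi> = "\<lambda>k i. psi (a i) (b i) (zz a b V X (Y k)) / m1"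
  have ai: "a i = 1 \<or> a i = -1" if "i < m1" for i using ab that by (auto simp: good_ab_def)
  interpret R: ridge ?\<Phi> "\<lambda>k. fs (Y k)" n m1 lam0 "882 * (real n)\<^sup>2" eta2
  proof
    show "0 \<le> lam0" using sn_facts ge1 by (simp add: lam0_def K3_def)
    show "0 < n" by (rule pos)
    show "0 < eta2" using K3_pos by (simp add: eta2_def)
    have "lam0 \<le> 2 * K3"
    proof -
      have "sn / m1 \<le> 1" using sn_facts pos by (simp add: divide_le_eq)
      then have "2 * K3 * (sn / m1) \<le> 2 * K3 * 1" using ge1 by (intro mult_left_mono) (auto simp: K3_def)
      then show ?thesis by (simp add: lam0_def)
    qed
    then show "eta2 * (2 * (882 * (real n)\<^sup>2) + lam0) \<le> 1" using K3_pos by (simp add: eta2_def divide_le_eq)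
    fix k assume k: "k < n"
    then have YG: "Y k \<in> G V X" using g2 by (auto simp: good2_def)
    have "(\<Sum>i<m1. (?\<Phi> k i)\<^sup>2) \<le> (\<Sum>i<m1. (1 + \<bar>b i\<bar>)\<^sup>2 * (7 * K * B)\<^sup>2 / (real m1)\<^sup>2)"
    proof (rule sum_mono)
      fix i assume "i \<in> {..<m1}"
      then have "psi (a i) (b i) (zz a b V X (Y k)) \<le> (1 + \<bar>b i\<bar>) * (1 + 2 * \<bar>zz a b V X (Y k)\<bar>)" using ai psi_le by auto
      also have "\<dots> \<le> (1 + \<bar>b i\<bar>) * (7 * K * B)" using zz_G(2)[OF g ab YG] by (intro mult_left_mono) auto
      finally have "(psi (a i) (b i) (zz a b V X (Y k)))\<^sup>2 \<le> ((1 + \<bar>b i\<bar>) * (7 * K * B))\<^sup>2" using psi_nonneg by (intro power_mono) auto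
      then show "(?\<Phi> k i)\<^sup>2 \<le> (1 + \<bar>b i\<bar>)\<^sup>2 * (7 * K * B)\<^sup>2 / (real m1)\<^sup>2"
        unfolding power_divide power_mult_distrib[of "1 + \<bar>b i\<bar>"] by (intro divide_right_mono) auto
    qed
    also have "\<dots> = (\<Sum>i<m1. (1 + \<bar>b i\<bar>)\<^sup>2) * ((7 * K * B)\<^sup>2 / (real m1)\<^sup>2)" by (simp add: sum_distrib_right sum_divide_distrib)
    also have "\<dots> \<le> (18 * real m1) * ((7 * K * B)\<^sup>2 / (real m1)\<^sup>2)" using beta_sum[OF ab] by (intro mult_right_mono) auto
    also have "\<dots> = 882 * (K * (K * B\<^sup>2)) / m1" using pos by (simp add: power2_eq_square)
    also have "\<dots> \<le> 882 * (K * (K * B\<^sup>2)) / 1" using pos ge1 by (intro divide_left_mono mult_nonneg_nonneg) auto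
    also have "\<dots> = 882 * (K * (K * B\<^sup>2))" by simp
    also have "\<dots> \<le> 882 * (real n * real n)" using K_le_n ge1 by (intro mult_left_mono mult_mono) auto
    finally show "(\<Sum>i<m1. (?\<Phi> k i)\<^sup>2) \<le> 882 * (real n)\<^sup>2" by (simp add: power2_eq_square)
  qed
  have obj: "R.obj c = Qhat c a b V X Y + K3 * sn * sqn c" for c
  proof -
    have "R.res c k = net_out c a b V X (Y k) - fs (Y k)" for k
      by (simp add: ridge_res_def net_out_def sum_divide_distrib)
    then show ?thesis by (simp add: ridge_obj_def Qhat_def lam0_def sqn_def)
  qed
  have "(\<Sum>i<m1. (a i - astar a b i)\<^sup>2) \<le> (\<Sum>i<m1. 2 * (1 + Wb\<^sup>2 * S2\<^sup>2))"
  proof (rule sum_mono)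
    fix i assume "i \<in> {..<m1}"
    then have a1: "(a i)\<^sup>2 = 1" using ai by (metis lessThan_iff one_power2 power2_minus)
    have "\<bar>wt u v (a i) (b i)\<bar>\<^sup>2 \<le> Wb\<^sup>2" using wt_bd by (intro power_mono) auto
    then have "(astar a b i)\<^sup>2 \<le> Wb\<^sup>2 * S2\<^sup>2" unfolding astar_def power_mult_distrib by (subst mult.commute) (intro mult_right_mono, auto)
    then show "(a i - astar a b i)\<^sup>2 \<le> 2 * (1 + Wb\<^sup>2 * S2\<^sup>2)"
      using abs_mult_le_half_squares[of "a i" "astar a b i"] a1 by (simp add: power2_diff abs_le_iff)
  qed
  then have D: "(\<Sum>i<m1. (a i - astar a b i)\<^sup>2) \<le> 2 * (real m1 * (1 + Wb\<^sup>2 * S2\<^sup>2))" by (simp add: mult.left_commute)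
  have "(\<Sum>i<m1. (a i - astar a b i)\<^sup>2) / (2 * eta2 * t0) \<le> 1 / n"
  proof -
    let ?H = "1764 * (real n)\<^sup>2 + 2 * K3"
    have "(\<Sum>i<m1. (a i - astar a b i)\<^sup>2) * (n * ?H) \<le> 2 * (real m1 * (1 + Wb\<^sup>2 * S2\<^sup>2)) * (n * ?H)"
      using D K3_pos by (intro mult_right_mono) auto
    then have "(\<Sum>i<m1. (a i - astar a b i)\<^sup>2) * n * ?H \<le> 2 * (real m1 * (1 + Wb\<^sup>2 * S2\<^sup>2) * n * ?H)"
      by (simp only: mult.assoc)
    also have "\<dots> \<le> 2 * real t0" using t0_bounds(2) by linarith
    finally have "(\<Sum>i<m1. (a i - astar a b i)\<^sup>2) * n * ?H \<le> 2 * real t0" .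
    then have "(\<Sum>i<m1. (a i - astar a b i)\<^sup>2) * n \<le> 2 * real t0 / ?H" using K3_pos by (simp add: pos_le_divide_eq)
    then have "(\<Sum>i<m1. (a i - astar a b i)\<^sup>2) * n \<le> 2 * eta2 * t0" by (simp add: eta2_def)
    moreover have "0 < 2 * eta2 * t0" using t0_bounds(1) R.\<eta> by simp
    ultimately show ?thesis using pos by (simp add: pos_divide_le_eq pos_le_divide_eq)
  qed
  then show ?thesis using R.gd_rate[OF t0_bounds(1), of a "astar a b"] unfolding c[symmetric] obj by linarith
qed

text \<open>\<open>pop_upper\<close> passes to the training objective, \<open>training\<close> to
  the objective at \<open>astar\<close>, \<open>emp_upper\<close> back to the population loss of
  \<open>astar\<close> on \<open>G\<close>, which \<open>QG_astar\<close> estimates.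
  \<open>Suc t0\<close> accounts for the step spent on \<open>W\<close>.\<close>

lemma main_bound:
  assumes g2: "good2 a b V X Y"
  shows "(\<integral>\<^sup>+x. ennreal ((net d m1 m2 \<sigma>2 (layerwise_train d n m1 m2 \<sigma>2 fs (real m1 / real m2 * \<eta>) eta2 lam0 (Suc t0) a b V X Y) x - fs x)\<^sup>2) \<partial>\<nu>)
    \<le> ennreal Cfin * (ennreal Ztot + (\<integral>\<^sup>+x. ennreal ((q (\<eta> * Kf x) - fs x)\<^sup>2) \<partial>\<nu>))"
proof -
  define c where "c = (ridge_step (\<lambda>k i. psi (a i) (b i) (zz a b V X (Y k)) / m1) (\<lambda>k. fs (Y k)) n m1 lam0 eta2 ^^ t0) a"
  let ?I = "\<integral>\<^sup>+x. ennreal ((q (\<eta> * Kf x) - fs x)\<^sup>2) \<partial>\<nu>"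
  have net: "net d m1 m2 \<sigma>2 (layerwise_train d n m1 m2 \<sigma>2 fs (real m1 / real m2 * \<eta>) eta2 lam0 (Suc t0) a b V X Y) x = net_out c a b V X x" for x
    unfolding layerwise_train_eq[OF pos(2-4) refl, of d \<sigma>2 fs \<eta> eta2 lam0 "Suc t0" a b V X Y x]
    by (simp add: net_out_def c_def zz_def)
  let ?R = "2 * K3 * Wb\<^sup>2 * S2\<^sup>2 * sn + 3 * K3 * F\<^sup>2 * sn"
  let ?X = "3 * (132 * Wb)\<^sup>2 * S2\<^sup>2 * (\<iota> / m1) * K2 + 363 * S1\<^sup>2 * (2 * \<eta>\<^sup>2 * eps\<^sup>2 + 2448 * K^5 * \<eta>\<^sup>2 * (\<iota> / m1))"
  have K3sn: "0 \<le> K3 * sn" using sn_facts ge1 by (simp add: K3_def)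
  have R0: "0 \<le> ?R" using sn_facts ge1 by (intro add_nonneg_nonneg mult_nonneg_nonneg) (auto simp: K3_def)
  have X0: "0 \<le> ?X" using ge1 by (intro add_nonneg_nonneg mult_nonneg_nonneg) (auto simp: K2_def)
  have QG0: "0 \<le> QG (astar a b) a b V X" by (simp add: QG_def)
  have "(\<integral>\<^sup>+x. ennreal ((net_out c a b V X x - fs x)\<^sup>2) \<partial>\<nu>) \<le> ennreal (Qhat c a b V X Y + K3 * sn * sqn c + K3 * F\<^sup>2 * sn)"
    by (rule pop_upper[OF sp ab g g2])
  also have "\<dots> \<le> ennreal (QG (astar a b) a b V X + ?R)"
  proof (rule ennreal_leI)
    have s: "K3 * sn * sqn (astar a b) \<le> K3 * sn * (Wb\<^sup>2 * S2\<^sup>2)" using sqn_astar K3sn by (rule mult_left_mono)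
    have "1 / n \<le> K3 * F\<^sup>2 * sn"
    proof -
      have "1 \<le> K3 * F\<^sup>2" using K5 ge1 one_le_power[of F 2] by (intro mult_ge1_I) (auto simp: K3_def)
      then have "1 * sn \<le> K3 * F\<^sup>2 * sn" using sn_facts by (intro mult_right_mono) auto
      then show ?thesis using sn_facts by linarith
    qed
    then have "Qhat c a b V X Y + K3 * sn * sqn c + K3 * F\<^sup>2 * sn
       \<le> QG (astar a b) a b V X + 2 * (K3 * sn * (Wb\<^sup>2 * S2\<^sup>2)) + 3 * (K3 * F\<^sup>2 * sn)"
      using training[OF g2 c_def] emp_upper[OF sp ab g g2, of "astar a b"] s by linarith
    also have "\<dots> = QG (astar a b) a b V X + ?R" by simp
    finally show "Qhat c a b V X Y + K3 * sn * sqn c + K3 * F\<^sup>2 * sn \<le> QG (astar a b) a b V X + ?R" .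
  qed
  also have "\<dots> = ennreal (QG (astar a b) a b V X) + ennreal ?R" using QG0 R0 by (rule ennreal_plus)
  also have "\<dots> \<le> (ennreal ?X + 3 * ?I) + ennreal ?R" by (intro add_right_mono QG_astar)
  also have "\<dots> = ennreal (?X + ?R) + 3 * ?I" unfolding ennreal_plus[OF X0 R0] by (simp add: ac_simps)
  also have "\<dots> \<le> ennreal (Cfin * Ztot) + ennreal Cfin * ?I"
  proof (intro add_mono ennreal_leI mult_right_mono)
    have W: "1 \<le> Wb\<^sup>2" using Wb_pos by simp
    have KW: "K^5 * 1 \<le> K^5 * Wb\<^sup>2" using W ge1 by (intro mult_left_mono) auto
    let ?M = "K^5 * Wb\<^sup>2"
    have M1: "1 \<le> ?M" using KW K5 by linarith
    have a1: "3 * (132 * Wb)\<^sup>2 * S2\<^sup>2 * (\<iota> / m1) * K2 = 156816000 * (?M * (S2\<^sup>2 * (\<iota> / m1)))"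
      unfolding power_mult_distrib K2_def by simp
    have a2: "363 * S1\<^sup>2 * (2 * \<eta>\<^sup>2 * eps\<^sup>2 + 2448 * K^5 * \<eta>\<^sup>2 * (\<iota> / m1)) = 726 * (S1\<^sup>2 * \<eta>\<^sup>2 * eps\<^sup>2) + 888624 * (K^5 * (S1\<^sup>2 * \<eta>\<^sup>2 * (\<iota> / m1)))"
      by (simp add: algebra_simps)
    have a3: "2 * K3 * Wb\<^sup>2 * S2\<^sup>2 * sn + 3 * K3 * F\<^sup>2 * sn = 2000000 * (?M * (S2\<^sup>2 * sn)) + 3000000 * (K^5 * (F\<^sup>2 * sn))"
      by (simp add: K3_def algebra_simps)
    have z: "Cfin * Ztot = 200000000 * (?M * (S1\<^sup>2 * \<eta>\<^sup>2 * eps\<^sup>2)) + 200000000 * (?M * (S1\<^sup>2 * \<eta>\<^sup>2 * (\<iota> / m1))) + 200000000 * (?M * (S2\<^sup>2 * (\<iota> / m1)))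
        + 200000000 * (?M * (S2\<^sup>2 * sn)) + 200000000 * (?M * (F\<^sup>2 * sn))"
      by (simp add: Cfin_def Ztot_def algebra_simps)
    have p: "0 \<le> S1\<^sup>2 * \<eta>\<^sup>2 * eps\<^sup>2" "0 \<le> S1\<^sup>2 * \<eta>\<^sup>2 * (\<iota> / m1)" "0 \<le> S2\<^sup>2 * (\<iota> / m1)" "0 \<le> S2\<^sup>2 * sn" "0 \<le> F\<^sup>2 * sn"
      using ge1 sn_facts by auto
    have b1: "1 * (S1\<^sup>2 * \<eta>\<^sup>2 * eps\<^sup>2) \<le> ?M * (S1\<^sup>2 * \<eta>\<^sup>2 * eps\<^sup>2)" using M1 p by (intro mult_right_mono) auto
    have b2: "K^5 * (S1\<^sup>2 * \<eta>\<^sup>2 * (\<iota> / m1)) \<le> ?M * (S1\<^sup>2 * \<eta>\<^sup>2 * (\<iota> / m1))" using KW p by (intro mult_right_mono) auto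
    have b3: "K^5 * (F\<^sup>2 * sn) \<le> ?M * (F\<^sup>2 * sn)" using KW p by (intro mult_right_mono) auto
    have n: "0 \<le> ?M * (S2\<^sup>2 * (\<iota> / m1))" "0 \<le> ?M * (S2\<^sup>2 * sn)" "0 \<le> ?M * (F\<^sup>2 * sn)" "0 \<le> ?M * (S1\<^sup>2 * \<eta>\<^sup>2 * eps\<^sup>2)" "0 \<le> ?M * (S1\<^sup>2 * \<eta>\<^sup>2 * (\<iota> / m1))"
      using M1 by (auto intro!: mult_nonneg_nonneg[OF _ p(1)] mult_nonneg_nonneg[OF _ p(2)] mult_nonneg_nonneg[OF _ p(3)] mult_nonneg_nonneg[OF _ p(4)] mult_nonneg_nonneg[OF _ p(5)] simp del: times_divide_eq_right)
    have gen: "156816000 * t3 + (726 * x1 + 888624 * x2) + (2000000 * t4 + 3000000 * x5)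
       \<le> 200000000 * t1 + 200000000 * t2 + 200000000 * t3 + 200000000 * t4 + 200000000 * t5"
      if "x1 \<le> t1" "x2 \<le> t2" "x5 \<le> t5" "0 \<le> t1" "0 \<le> t2" "0 \<le> t3" "0 \<le> t4" "0 \<le> t5" for t1 t2 t3 t4 t5 x1 x2 x5 :: real
    proof -
      have "726 * x1 \<le> 200000000 * t1" "888624 * x2 \<le> 200000000 * t2" "3000000 * x5 \<le> 200000000 * t5"
        "156816000 * t3 \<le> 200000000 * t3" "2000000 * t4 \<le> 200000000 * t4" using that by auto
      then show ?thesis by auto
    qed
    show "?X + ?R \<le> Cfin * Ztot" unfolding a1 a2 a3 z using b1 b2 b3 n by (intro gen) auto
    have "3 \<le> Cfin" using M1 by (simp add: Cfin_def)
    then show "3 \<le> ennreal Cfin" by (metis ennreal_leI ennreal_numeral)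
  qed auto
  also have "\<dots> = ennreal Cfin * (ennreal Ztot + ?I)"
  proof -
    have "0 \<le> Cfin" "0 \<le> Ztot" using ge1 sn_facts by (auto simp: Cfin_def Ztot_def)
    then show ?thesis by (simp add: ennreal_mult distrib_left)
  qed
  finally show ?thesis unfolding net .
qed

end

definition Egood :: "(vec \<times> vec \<times> (nat \<Rightarrow> vec) \<times> (nat \<Rightarrow> vec) \<times> (nat \<Rightarrow> vec)) set" where
  "Egood = {\<omega> \<in> space (init_data_measure d n m1 m2 \<nu>). case \<omega> of (a, b, V, X, Y) \<Rightarrow> good_ab a b \<and> good V X \<and> good2 a b V X Y}"

text \<open>\<open>29 = 7 + 8 + 14\<close>. The third failure event contains the first two good
  events as conditions, so \<open>good2_prob\<close> applies on every slice with \<open>a\<close>,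
  \<open>b\<close>, \<open>V\<close> and \<open>X\<close> frozen.\<close>

lemma Egood_prob:
  shows "Egood \<in> sets (init_data_measure d n m1 m2 \<nu>)"
    and "measure (init_data_measure d n m1 m2 \<nu>) Egood \<ge> 1 - 29 * exp (- \<iota>)"
proof -
  let ?M = "init_data_measure d n m1 m2 \<nu>"
  have M: "?M = MA \<Otimes>\<^sub>M (MB \<Otimes>\<^sub>M (MV \<Otimes>\<^sub>M (MX \<Otimes>\<^sub>M MX)))" by (simp add: init_data_measure_def)
  interpret XX: pair_prob_space MX MX ..
  interpret VXX: pair_prob_space MV "MX \<Otimes>\<^sub>M MX" ..
  interpret BVXX: pair_prob_space MB "MV \<Otimes>\<^sub>M (MX \<Otimes>\<^sub>M MX)" ..
  interpret P: pair_prob_space MA "MB \<Otimes>\<^sub>M (MV \<Otimes>\<^sub>M (MX \<Otimes>\<^sub>M MX))" ..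
  let ?P1 = "\<lambda>\<omega>::vec \<times> vec \<times> (nat \<Rightarrow> vec) \<times> (nat \<Rightarrow> vec) \<times> (nat \<Rightarrow> vec). \<not> good_ab (fst \<omega>) (fst (snd \<omega>))"
  let ?P2 = "\<lambda>\<omega>::vec \<times> vec \<times> (nat \<Rightarrow> vec) \<times> (nat \<Rightarrow> vec) \<times> (nat \<Rightarrow> vec). \<not> good (fst (snd (snd \<omega>))) (fst (snd (snd (snd \<omega>))))"
  let ?P3 = "\<lambda>\<omega>::vec \<times> vec \<times> (nat \<Rightarrow> vec) \<times> (nat \<Rightarrow> vec) \<times> (nat \<Rightarrow> vec). good_ab (fst \<omega>) (fst (snd \<omega>)) \<and> good (fst (snd (snd \<omega>))) (fst (snd (snd (snd \<omega>))))
      \<and> \<not> good2 (fst \<omega>) (fst (snd \<omega>)) (fst (snd (snd \<omega>))) (fst (snd (snd (snd \<omega>)))) (snd (snd (snd (snd \<omega>))))"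
  note a1 = emeasure_pair_assoc[OF MA.prob_space_axioms MB.prob_space_axioms VXX.prob_space_axioms good_ab_prob(1)]
  have eq1: "{\<omega> \<in> space ?M. (fst \<omega>, fst (snd \<omega>)) \<in> {p \<in> space (MA \<Otimes>\<^sub>M MB). \<not> good_ab (fst p) (snd p)}} = {\<omega> \<in> space ?M. ?P1 \<omega>}"
    by (auto simp: M space_pair_measure)
  have m1: "{\<omega> \<in> space ?M. ?P1 \<omega>} \<in> sets ?M" using a1(1) unfolding M[symmetric] eq1 .
  have e1: "emeasure ?M {\<omega> \<in> space ?M. ?P1 \<omega>} \<le> ennreal (7 * exp (- \<iota>))" using a1(2) good_ab_prob(2) unfolding M[symmetric] eq1 by simp
  let ?R = "MV \<Otimes>\<^sub>M (MX \<Otimes>\<^sub>M MX)"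
  note a2 = emeasure_pair_assoc[OF MV.prob_space_axioms MX.prob_space_axioms MX.prob_space_axioms good_prob(1)]
  let ?B = "{w \<in> space ?R. (fst w, fst (snd w)) \<in> {p \<in> space (MV \<Otimes>\<^sub>M MX). \<not> good (fst p) (snd p)}}"
  have B: "?B \<in> sets ?R" "emeasure ?R ?B \<le> ennreal (8 * exp (- \<iota>))" using a2 good_prob(2) by auto
  have "(\<lambda>\<omega>. snd (snd \<omega>)) \<in> measurable ?M ?R" unfolding M by measurable
  from measurable_sets[OF this B(1)] have "(\<lambda>\<omega>. snd (snd \<omega>)) -` ?B \<inter> space ?M \<in> sets ?M" .
  also have eq2: "(\<lambda>\<omega>. snd (snd \<omega>)) -` ?B \<inter> space ?M = {\<omega> \<in> space ?M. ?P2 \<omega>}"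
    by (auto simp: M space_pair_measure)
  finally have m2: "{\<omega> \<in> space ?M. ?P2 \<omega>} \<in> sets ?M" .
  have e2: "emeasure ?M {\<omega> \<in> space ?M. ?P2 \<omega>} \<le> ennreal (8 * exp (- \<iota>))"
    unfolding M
  proof (rule emeasure_pair_le[OF MA.prob_space_axioms BVXX.prob_space_axioms m2[unfolded M]])
    fix a assume a: "a \<in> space MA"
    let ?S = "{y \<in> space (MB \<Otimes>\<^sub>M ?R). (a, y) \<in> {\<omega> \<in> space (MA \<Otimes>\<^sub>M (MB \<Otimes>\<^sub>M ?R)). ?P2 \<omega>}}"
    have "?S = {y \<in> space (MB \<Otimes>\<^sub>M ?R). snd y \<in> ?B}" using a by (auto simp: space_pair_measure)
    moreover have "snd -` ?B \<inter> space (MB \<Otimes>\<^sub>M ?R) \<in> sets (MB \<Otimes>\<^sub>M ?R)" by (rule measurable_sets[OF measurable_snd B(1)])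
    ultimately have S: "?S = {y \<in> space (MB \<Otimes>\<^sub>M ?R). snd y \<in> ?B}" "{y \<in> space (MB \<Otimes>\<^sub>M ?R). snd y \<in> ?B} \<in> sets (MB \<Otimes>\<^sub>M ?R)"
      by (simp_all add: vimage_def Int_def conj_commute)
    show "emeasure (MB \<Otimes>\<^sub>M ?R) ?S \<le> ennreal (8 * exp (- \<iota>))"
      unfolding S(1)
    proof (rule emeasure_pair_le[OF MB.prob_space_axioms VXX.prob_space_axioms S(2)])
      fix b assume b: "b \<in> space MB"
      have "{w \<in> space ?R. (b, w) \<in> {y \<in> space (MB \<Otimes>\<^sub>M ?R). snd y \<in> ?B}} = ?B" using b by (auto simp: space_pair_measure)
      then show "emeasure ?R {w \<in> space ?R. (b, w) \<in> {y \<in> space (MB \<Otimes>\<^sub>M ?R). snd y \<in> ?B}} \<le> ennreal (8 * exp (- \<iota>))" using B(2) by simp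
    qed
  qed
  have fm: "fst \<in> measurable ?M MA" "(\<lambda>\<omega>. fst (snd \<omega>)) \<in> measurable ?M MB" "(\<lambda>\<omega>. fst (snd (snd \<omega>))) \<in> measurable ?M MV"
    "(\<lambda>\<omega>. fst (snd (snd (snd \<omega>)))) \<in> measurable ?M MX" "(\<lambda>\<omega>. snd (snd (snd (snd \<omega>)))) \<in> measurable ?M MX"
    unfolding M by measurable
  have g2m: "{\<omega> \<in> space ?M. good2 (fst \<omega>) (fst (snd \<omega>)) (fst (snd (snd \<omega>))) (fst (snd (snd (snd \<omega>)))) (snd (snd (snd (snd \<omega>))))} \<in> sets ?M"
    by (rule good2_meas[OF fm])
  have m1': "{\<omega> \<in> space ?M. \<not> ?P1 \<omega>} \<in> sets ?M" and m2': "{\<omega> \<in> space ?M. \<not> ?P2 \<omega>} \<in> sets ?M"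
    by (rule sets.sets_Collect_neg[OF m1], rule sets.sets_Collect_neg[OF m2])
  have m3: "{\<omega> \<in> space ?M. ?P3 \<omega>} \<in> sets ?M"
    using sets.sets_Collect_conj[OF m1' sets.sets_Collect_conj[OF m2' sets.sets_Collect_neg[OF g2m]]] by (simp add: conj_ac)
  have e3: "emeasure ?M {\<omega> \<in> space ?M. ?P3 \<omega>} \<le> ennreal (14 * exp (- \<iota>))"
    unfolding M
  proof (rule emeasure_pair_le[OF MA.prob_space_axioms BVXX.prob_space_axioms m3[unfolded M]])
    fix a assume a: "a \<in> space MA"
    let ?S3 = "{\<omega> \<in> space (MA \<Otimes>\<^sub>M (MB \<Otimes>\<^sub>M ?R)). ?P3 \<omega>}"
    let ?Sa = "{y \<in> space (MB \<Otimes>\<^sub>M ?R). (a, y) \<in> ?S3}"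
    have ma: "?Sa \<in> sets (MB \<Otimes>\<^sub>M ?R)"
      using measurable_sets[OF measurable_Pair1'[OF a] m3[unfolded M]] by (simp add: vimage_def Int_def conj_commute)
    show "emeasure (MB \<Otimes>\<^sub>M ?R) ?Sa \<le> ennreal (14 * exp (- \<iota>))"
    proof (rule emeasure_pair_le[OF MB.prob_space_axioms VXX.prob_space_axioms ma])
      fix b assume b: "b \<in> space MB"
      let ?Sb = "{y \<in> space ?R. (b, y) \<in> ?Sa}"
      have mb: "?Sb \<in> sets ?R" using measurable_sets[OF measurable_Pair1'[OF b] ma] by (simp add: vimage_def Int_def conj_commute)
      show "emeasure ?R ?Sb \<le> ennreal (14 * exp (- \<iota>))"
      proof (rule emeasure_pair_le[OF MV.prob_space_axioms XX.prob_space_axioms mb])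
        fix V assume V: "V \<in> space MV"
        let ?Sv = "{y \<in> space (MX \<Otimes>\<^sub>M MX). (V, y) \<in> ?Sb}"
        have mv: "?Sv \<in> sets (MX \<Otimes>\<^sub>M MX)" using measurable_sets[OF measurable_Pair1'[OF V] mb] by (simp add: vimage_def Int_def conj_commute)
        show "emeasure (MX \<Otimes>\<^sub>M MX) ?Sv \<le> ennreal (14 * exp (- \<iota>))"
        proof (rule emeasure_pair_le[OF MX.prob_space_axioms MX.prob_space_axioms mv])
          fix X assume X: "X \<in> space MX"
          have eq: "{y \<in> space MX. (X, y) \<in> ?Sv} = {Y \<in> space MX. good_ab a b \<and> good V X \<and> \<not> good2 a b V X Y}"
            using a b V X by (auto simp: space_pair_measure)
          show "emeasure MX {y \<in> space MX. (X, y) \<in> ?Sv} \<le> ennreal (14 * exp (- \<iota>))"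
          proof (cases "good_ab a b \<and> good V X")
            case True
            then show ?thesis unfolding eq using good2_prob[OF a b V X] by simp
          next
            case False
            then have e: "{Y \<in> space MX. good_ab a b \<and> good V X \<and> \<not> good2 a b V X Y} = {}" by auto
            show ?thesis unfolding eq e by simp
          qed
        qed
      qed
    qed
  qed
  have E: "Egood = {\<omega> \<in> space ?M. \<not> (?P1 \<omega> \<or> (?P2 \<omega> \<or> ?P3 \<omega>))}"
    unfolding Egood_def by (auto simp: split_beta)
  have bad: "{\<omega> \<in> space ?M. ?P1 \<omega> \<or> (?P2 \<omega> \<or> ?P3 \<omega>)} \<in> sets ?M"
    by (intro sets.sets_Collect_disj m1 m2 m3)
  have "emeasure ?M {\<omega> \<in> space ?M. ?P1 \<omega> \<or> (?P2 \<omega> \<or> ?P3 \<omega>)} \<le> ennreal (7 * exp (- \<iota>) + (8 * exp (- \<iota>) + 14 * exp (- \<iota>)))"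
    by (intro emeasure_Un_le e1 e2 e3 m1 m2 m3 sets.sets_Collect_disj) auto
  then have "measure ?M {\<omega> \<in> space ?M. ?P1 \<omega> \<or> (?P2 \<omega> \<or> ?P3 \<omega>)} \<le> 29 * exp (- \<iota>)"
    using P.emeasure_eq_measure unfolding M by (subst (asm) P.emeasure_eq_measure) simp
  moreover have Eq: "Egood = space ?M - {\<omega> \<in> space ?M. ?P1 \<omega> \<or> (?P2 \<omega> \<or> ?P3 \<omega>)}" unfolding E by auto
  ultimately show "measure ?M Egood \<ge> 1 - 29 * exp (- \<iota>)"
    using P.prob_compl[OF bad[unfolded M]] unfolding M by simp
  show "Egood \<in> sets ?M" unfolding Eq using bad by auto
qed

lemma T_bound: "real (Suc t0) \<le> real m1 * (1 + Wb\<^sup>2 * S2\<^sup>2) * n * (1764 * (real n)\<^sup>2 + 2 * K3) + 2"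
  using t0_bounds(3) by simp

end

section \<open>Subgaussian data\<close>

lemma emeasure_markov:
  assumes [measurable]: "u \<in> borel_measurable M" and le: "(\<integral>\<^sup>+x. ennreal (u x) \<partial>M) \<le> ennreal C" and c: "0 < c" and C: "0 \<le> C"
  shows "emeasure M {x \<in> space M. c \<le> u x} \<le> ennreal (C / c)"
proof -
  have "{x \<in> space M. c \<le> u x} \<subseteq> {x \<in> space M. 1 \<le> ennreal (1 / c) * ennreal (u x)}"
    using c by (auto simp flip: ennreal_mult' simp: pos_le_divide_eq)
  then have "emeasure M {x \<in> space M. c \<le> u x} \<le> emeasure M {x \<in> space M. 1 \<le> ennreal (1 / c) * ennreal (u x)}"
    by (rule emeasure_mono) measurable
  also have "\<dots> \<le> ennreal (1 / c) * (\<integral>\<^sup>+x. ennreal (u x) * indicator (space M) x \<partial>M)"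
    by (rule nn_integral_Markov_inequality) auto
  also have "\<dots> = ennreal (1 / c) * (\<integral>\<^sup>+x. ennreal (u x) \<partial>M)"
    by (intro arg_cong2[where f=times] nn_integral_cong) auto
  also have "\<dots> \<le> ennreal (1 / c) * ennreal C" using le by (intro mult_left_mono) auto
  also have "\<dots> = ennreal (C / c)" using c C by (simp flip: ennreal_mult')
  finally show ?thesis .
qed

text \<open>Moments with controlled growth in their order give exponential tails: at
  \<open>exp 1\<close> times a bound for the norm of order \<open>r\<close>, Markov's inequality
  yields \<open>exp (- r)\<close>. The order will be \<open>32 * \<iota>\<close>.\<close>

lemma emeasure_moment_tail:
  assumes [measurable]: "f \<in> borel_measurable M" and r: "0 < r" and L: "0 < L"
    and le: "(\<integral>\<^sup>+x. ennreal (\<bar>f x\<bar> powr r) \<partial>M) \<le> ennreal (L powr r)" and F: "exp 1 * L \<le> F"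
  shows "emeasure M {x \<in> space M. F < \<bar>f x\<bar>} \<le> ennreal (exp (- r))"
proof -
  have pos: "0 < exp 1 * L" using L by simp
  have "emeasure M {x \<in> space M. F < \<bar>f x\<bar>} \<le> emeasure M {x \<in> space M. (exp 1 * L) powr r \<le> \<bar>f x\<bar> powr r}"
    using pos F r by (intro emeasure_mono) (auto intro!: powr_mono2)
  also have "\<dots> \<le> ennreal (L powr r / (exp 1 * L) powr r)"
    using pos by (intro emeasure_markov le) auto
  also have "L powr r / (exp 1 * L) powr r = exp (- r)"
    using L by (simp add: powr_mult exp_minus divide_simps) (simp add: powr_def)
  finally show ?thesis .
qed

text \<open>Tangent bound for the logarithm at \<open>a + 1\<close>; taking \<open>a + 1\<close>
  instead of \<open>a\<close> includes the case \<open>a = 0\<close>.\<close>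

lemma powr_le_exp:
  fixes a z :: real
  assumes a: "0 \<le> a"
  shows "(1 + \<bar>z\<bar>) powr a \<le> exp 1 * (a + 1) powr a * exp \<bar>z\<bar>"
proof -
  let ?x = "1 + \<bar>z\<bar>"
  have x: "0 < ?x" by (simp add: add_pos_nonneg)
  have "ln (?x / (a + 1)) \<le> ?x / (a + 1) - 1" using a x by (intro ln_le_minus_one) auto
  then have "ln ?x \<le> ?x / (a + 1) + ln (a + 1)" using a x by (simp add: ln_div)
  then have "a * ln ?x \<le> a * (?x / (a + 1)) + a * ln (a + 1)" using a by (metis distrib_left mult_left_mono)
  also have "a * (?x / (a + 1)) \<le> ?x"
    using a x by (simp add: divide_simps)
  finally have "?x powr a \<le> exp (?x + a * ln (a + 1))" using x by (simp add: powr_def)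
  also have "\<dots> = exp 1 * (a + 1) powr a * exp \<bar>z\<bar>" using a by (simp add: powr_def exp_add)
  finally show ?thesis .
qed

text \<open>No integrability is required: integrate the tangent inequality for the power function at \<^term>\<open>m\<close>.\<close>

lemma powr_mean_le:
  assumes M: "prob_space M" and g [measurable]: "g \<in> borel_measurable M" and g0: "\<And>x. 0 \<le> g x"
    and r: "1 \<le> r" and m: "0 \<le> m" "ennreal m \<le> (\<integral>\<^sup>+x. ennreal (g x) \<partial>M)"
  shows "ennreal (m powr r) \<le> (\<integral>\<^sup>+x. ennreal (g x powr r) \<partial>M)"
proof (cases "m = 0")
  case False
  interpret prob_space M by fact
  have m0: "0 < m" using m False by simp
  have tangent: "r * m powr (r - 1) * y \<le> y powr r + (r - 1) * m powr r" if y: "0 \<le> y" for y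
  proof (cases "y = 0")
    case False
    then have "(y powr r) powr (1/r) * (m powr r) powr (1 - 1/r) \<le> (1/r) * y powr r + (1 - 1/r) * m powr r"
      using y m0 r by (intro Youngs_inequality_0) auto
    moreover have "(y powr r) powr (1/r) = y" using r y by (simp add: powr_powr)
    moreover have "(m powr r) powr (1 - 1/r) = m powr (r - 1)" using r by (simp add: powr_powr right_diff_distrib)
    ultimately have "r * (y * m powr (r - 1)) \<le> r * ((1/r) * y powr r + (1 - 1/r) * m powr r)" using r by (intro mult_left_mono) auto
    also have "\<dots> = y powr r + (r - 1) * m powr r" using r by (simp add: distrib_left left_diff_distrib right_diff_distrib)
    finally show ?thesis by (simp add: ac_simps)
  qed (use r in simp)
  let ?c = "ennreal ((r - 1) * m powr r)"
  have "?c + ennreal (m powr r) = ennreal (r * m powr (r - 1) * m)"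
  proof -
    have "m powr (r - 1) * m = m powr r" using powr_add[of m "r - 1" 1] m0 by simp
    then have "(r - 1) * m powr r + m powr r = r * m powr (r - 1) * m" by (simp add: algebra_simps)
    then show ?thesis using r by (simp flip: ennreal_plus)
  qed
  also have "\<dots> = ennreal (r * m powr (r - 1)) * ennreal m" using r m by (intro ennreal_mult) auto
  also have "\<dots> \<le> ennreal (r * m powr (r - 1)) * (\<integral>\<^sup>+x. ennreal (g x) \<partial>M)" using m(2) by (rule mult_left_mono) simp
  also have "\<dots> = (\<integral>\<^sup>+x. ennreal (r * m powr (r - 1)) * ennreal (g x) \<partial>M)" by (simp add: nn_integral_cmult)
  also have "\<dots> \<le> (\<integral>\<^sup>+x. ?c + ennreal (g x powr r) \<partial>M)"
  proof (rule nn_integral_mono)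
    fix x
    show "ennreal (r * m powr (r - 1)) * ennreal (g x) \<le> ?c + ennreal (g x powr r)"
      using r g0[of x] tangent[OF g0[of x]] by (simp flip: ennreal_mult ennreal_plus add: add.commute ennreal_leI)
  qed
  also have "\<dots> = ?c + (\<integral>\<^sup>+x. ennreal (g x powr r) \<partial>M)"
    by (subst nn_integral_add) (auto simp: emeasure_space_1)
  finally show ?thesis by (simp add: ennreal_add_left_cancel_le)
qed simp

text \<open>Without integrability the left side is 0 by convention, so the inequality is
  unconditional.\<close>

lemma abs_integral_le_nn_integral:
  fixes f :: "'a \<Rightarrow> real"
  shows "ennreal \<bar>\<integral>x. f x \<partial>M\<bar> \<le> (\<integral>\<^sup>+x. ennreal \<bar>f x\<bar> \<partial>M)"
proof (cases "integrable M f")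
  case True
  from integral_norm_bound_ennreal[OF this] show ?thesis by simp
qed (simp add: not_integrable_integral_eq)

locale subgaussian_data =
  fixes d :: nat and \<nu> :: "vec measure" and fs :: "vec \<Rightarrow> real" and \<sigma>2 :: "real \<Rightarrow> real" and C\<gamma> C\<sigma> \<alpha> :: real
  assumes d_pos: "0 < d" and prob_nu: "prob_space \<nu>" and sets_nu [measurable_cong]: "sets \<nu> = sets (Rd d)"
    and subg: "centered_subgaussian d \<nu> C\<gamma>" and C\<gamma>: "0 < C\<gamma>" and C\<sigma>: "0 < C\<sigma>" and \<alpha>: "0 \<le> \<alpha>"
    and fs_meas [measurable]: "fs \<in> borel_measurable (Rd d)" and fs_2: "(\<integral>\<^sup>+x. ennreal ((fs x)\<^sup>2) \<partial>\<nu>) \<le> 1"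
    and s2_meas [measurable]: "\<sigma>2 \<in> borel_measurable borel" and growth: "\<And>z. \<bar>\<sigma>2 z\<bar> \<le> C\<sigma> * (1 + \<bar>z\<bar>) powr \<alpha>"
begin

sublocale nu: prob_space \<nu> by (rule prob_nu)
sublocale tau: prob_space "sphere_unif d" by (rule prob_space_sphere_unif[OF d_pos])
sublocale TN: pair_prob_space "sphere_unif d" \<nu> ..

lemma exp_bound:
  assumes v: "dotp d v v = 1" shows "(\<integral>\<^sup>+x. ennreal (exp (t * dotp d v x)) \<partial>\<nu>) \<le> ennreal (exp (C\<gamma>\<^sup>2 * t\<^sup>2))"
proof -
  have "(\<integral>\<^sup>+x. ennreal (exp (t * dotp d x v)) \<partial>\<nu>) \<le> ennreal (exp (C\<gamma>\<^sup>2 * t\<^sup>2))"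
    using subg v unfolding centered_subgaussian_def by blast
  moreover have "dotp d v = (\<lambda>x. dotp d x v)" by (rule ext) (rule dotp_commute)
  ultimately show ?thesis by simp
qed

text \<open>Only the coordinates below \<^term>\<open>d\<close> matter, so the vectors need not be extensional.\<close>

lemma dotp_meas [measurable]: "dotp d v \<in> borel_measurable (Rd d)"
proof -
  have "(\<lambda>x. dotp d (restrict v {..<d}) x) \<in> borel_measurable (Rd d)"
    by (rule measurable_dotp) (auto simp: Rd_def space_PiM)
  moreover have "dotp d (restrict v {..<d}) = dotp d v" by (auto simp: dotp_def fun_eq_iff)
  ultimately show ?thesis by simp
qed

text \<open>The exponent is taken as 33 so that one factor \<open>exp L\<close> absorbs the 2 of the
  two-sided bound.\<close>

lemma dot_tail:
  assumes v: "dotp d v v = 1" and L: "1 \<le> L"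
  shows "emeasure \<nu> {x \<in> space \<nu>. 2 * C\<gamma> * sqrt (33 * L) < \<bar>dotp d v x\<bar>} \<le> ennreal (exp (- 32 * L))"
proof -
  have "emeasure \<nu> {x \<in> space \<nu>. 2 * sqrt (C\<gamma>\<^sup>2 * (33 * L)) < \<bar>dotp d v x\<bar>} \<le> ennreal (2 * exp (- (33 * L)))"
  proof (rule nu.chernoff_two_sided)
    show "(\<integral>\<^sup>+x. ennreal (exp (s * dotp d v x)) \<partial>\<nu>) \<le> ennreal (exp (s\<^sup>2 * C\<gamma>\<^sup>2))" for s
      using exp_bound[OF v, of s] by (simp only: mult.commute)
  qed (use L C\<gamma> in auto)
  also have "2 * sqrt (C\<gamma>\<^sup>2 * (33 * L)) = 2 * C\<gamma> * sqrt (33 * L)" using C\<gamma> by (simp add: real_sqrt_mult)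
  also have "ennreal (2 * exp (- (33 * L))) \<le> ennreal (exp (- 32 * L))"
  proof (rule ennreal_leI)
    have "2 \<le> exp L" using exp_ge_add_one_self[of L] L by linarith
    then have "2 * exp (- (33 * L)) \<le> exp L * exp (- (33 * L))" by (rule mult_right_mono) simp
    then show "2 * exp (- (33 * L)) \<le> exp (- 32 * L)" by (simp flip: exp_add)
  qed
  finally show ?thesis .
qed

definition smom :: "real \<Rightarrow> real" where
  "smom r = C\<sigma> powr r * (exp 1 * (\<alpha> * r + 1) powr (\<alpha> * r)) * (2 * exp (C\<gamma>\<^sup>2))"

lemma smom_nonneg: "0 \<le> smom r" by (simp add: smom_def)

text \<open>Polynomial growth is below a multiple of \<open>exp \<bar>z\<bar>\<close>, hence of
  \<open>exp z + exp (- z)\<close>; the subGaussian bound at parameters 1 and -1 then gives a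
  constant that is uniform in the direction.\<close>

lemma s2_moment:
  assumes v: "dotp d v v = 1" and r: "0 \<le> r"
  shows "(\<integral>\<^sup>+x. ennreal (\<bar>\<sigma>2 (dotp d v x)\<bar> powr r) \<partial>\<nu>) \<le> ennreal (smom r)"
proof -
  let ?c = "C\<sigma> powr r * (exp 1 * (\<alpha> * r + 1) powr (\<alpha> * r))"
  have "(\<integral>\<^sup>+x. ennreal (\<bar>\<sigma>2 (dotp d v x)\<bar> powr r) \<partial>\<nu>) \<le> ennreal (?c * exp (C\<gamma>\<^sup>2) + ?c * exp (C\<gamma>\<^sup>2))"
  proof (rule nn_integral_add_le)
    show "(\<integral>\<^sup>+x. ennreal (exp (dotp d v x)) \<partial>\<nu>) \<le> ennreal (exp (C\<gamma>\<^sup>2))" using exp_bound[OF v, of 1] by simp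
    show "(\<integral>\<^sup>+x. ennreal (exp (- dotp d v x)) \<partial>\<nu>) \<le> ennreal (exp (C\<gamma>\<^sup>2))" using exp_bound[OF v, of "-1"] by simp
    fix x
    let ?z = "dotp d v x"
    have "\<bar>\<sigma>2 ?z\<bar> powr r \<le> (C\<sigma> * (1 + \<bar>?z\<bar>) powr \<alpha>) powr r" using growth r by (intro powr_mono2) auto
    also have "\<dots> = C\<sigma> powr r * (1 + \<bar>?z\<bar>) powr (\<alpha> * r)" using C\<sigma> by (simp add: powr_mult powr_powr)
    also have "\<dots> \<le> C\<sigma> powr r * (exp 1 * (\<alpha> * r + 1) powr (\<alpha> * r) * exp \<bar>?z\<bar>)"
      using powr_le_exp[of "\<alpha> * r" ?z] \<alpha> r by (intro mult_left_mono) auto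
    also have "\<dots> = ?c * exp \<bar>?z\<bar>" by simp
    also have "\<dots> \<le> ?c * (exp ?z + exp (- ?z))" by (intro mult_left_mono) (auto simp: abs_if)
    finally show "\<bar>\<sigma>2 ?z\<bar> powr r \<le> ?c * exp ?z + ?c * exp (- ?z)" by (simp add: distrib_left)
  qed auto
  then show ?thesis by (simp add: smom_def mult_ac)
qed

lemma s2_fs:
  assumes v: "dotp d v v = 1"
  shows "(\<integral>\<^sup>+x. ennreal \<bar>\<sigma>2 (dotp d v x) * fs x\<bar> \<partial>\<nu>) \<le> ennreal (smom 2 / 2 + 1 / 2)"
proof -
  have "(\<integral>\<^sup>+x. ennreal \<bar>\<sigma>2 (dotp d v x) * fs x\<bar> \<partial>\<nu>) \<le> ennreal (1/2 * smom 2 + 1/2 * 1)"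
  proof (rule nn_integral_add_le[OF _ _ s2_moment[OF v, of 2]])
    show "(\<integral>\<^sup>+x. ennreal ((fs x)\<^sup>2) \<partial>\<nu>) \<le> ennreal 1" using fs_2 by simp
    show "\<bar>\<sigma>2 (dotp d v x) * fs x\<bar> \<le> 1/2 * \<bar>\<sigma>2 (dotp d v x)\<bar> powr 2 + 1/2 * (fs x)\<^sup>2" for x
      using abs_mult_le_half_squares[of "\<sigma>2 (dotp d v x)" "fs x"] by simp
  qed (auto simp: smom_nonneg)
  then show ?thesis by simp
qed

lemma kernel_meas [measurable]: "case_prod (kernel d \<sigma>2) \<in> borel_measurable (Rd d \<Otimes>\<^sub>M Rd d)"
proof -
  have "(\<lambda>p. \<integral>v. \<sigma>2 (dotp d (fst p) v) * \<sigma>2 (dotp d (snd p) v) \<partial>sphere_unif d) \<in> borel_measurable (Rd d \<Otimes>\<^sub>M Rd d)"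
    by (intro tau.borel_measurable_lebesgue_integral) measurable
  then show ?thesis by (simp add: kernel_def case_prod_beta')
qed

lemma Kop_meas [measurable]: "Kop d \<sigma>2 \<nu> fs \<in> borel_measurable (Rd d)"
proof -
  have [measurable]: "(\<lambda>p. kernel d \<sigma>2 (fst p) (snd p)) \<in> borel_measurable (Rd d \<Otimes>\<^sub>M Rd d)"
    using kernel_meas by (simp add: case_prod_beta')
  have "(\<lambda>p. kernel d \<sigma>2 (fst p) (snd p) * fs (snd p)) \<in> borel_measurable (Rd d \<Otimes>\<^sub>M \<nu>)" by measurable
  then have "(\<lambda>x. \<integral>x'. kernel d \<sigma>2 x x' * fs x' \<partial>\<nu>) \<in> borel_measurable (Rd d)"
    by (intro nu.borel_measurable_lebesgue_integral) (simp add: case_prod_beta')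
  then show ?thesis by (simp add: Kop_def[abs_def])
qed

text \<open>Working with extended reals and Tonelli's theorem, the estimate holds before any
  integrability of the kernel has been established.\<close>

lemma Kop_le:
  assumes x: "x \<in> space (Rd d)" and K: "smom 2 / 2 + 1 / 2 \<le> K"
  shows "ennreal \<bar>Kop d \<sigma>2 \<nu> fs x\<bar> \<le> ennreal K * (\<integral>\<^sup>+v. ennreal \<bar>\<sigma>2 (dotp d v x)\<bar> \<partial>sphere_unif d)"
proof -
  note x[measurable]
  let ?t = "sphere_unif d"
  have "ennreal \<bar>Kop d \<sigma>2 \<nu> fs x\<bar> \<le> (\<integral>\<^sup>+x'. ennreal \<bar>kernel d \<sigma>2 x x' * fs x'\<bar> \<partial>\<nu>)"
    unfolding Kop_def by (rule abs_integral_le_nn_integral)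
  also have "\<dots> \<le> (\<integral>\<^sup>+x'. \<integral>\<^sup>+v. ennreal \<bar>\<sigma>2 (dotp d v x)\<bar> * ennreal \<bar>\<sigma>2 (dotp d v x') * fs x'\<bar> \<partial>?t \<partial>\<nu>)"
  proof (rule nn_integral_mono)
    fix x' assume "x' \<in> space \<nu>"
    then have x'[measurable]: "x' \<in> space (Rd d)" using sets_eq_imp_space_eq[OF sets_nu] by simp
    have "ennreal \<bar>kernel d \<sigma>2 x x' * fs x'\<bar> = ennreal \<bar>kernel d \<sigma>2 x x'\<bar> * ennreal \<bar>fs x'\<bar>"
      by (simp add: abs_mult ennreal_mult)
    also have "\<dots> \<le> (\<integral>\<^sup>+v. ennreal \<bar>\<sigma>2 (dotp d x v) * \<sigma>2 (dotp d x' v)\<bar> \<partial>?t) * ennreal \<bar>fs x'\<bar>"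
      unfolding kernel_def by (intro mult_right_mono abs_integral_le_nn_integral) auto
    also have "\<dots> = (\<integral>\<^sup>+v. ennreal \<bar>\<sigma>2 (dotp d x v) * \<sigma>2 (dotp d x' v)\<bar> * ennreal \<bar>fs x'\<bar> \<partial>?t)"
      by (rule nn_integral_multc[symmetric]) measurable
    also have "\<dots> = (\<integral>\<^sup>+v. ennreal \<bar>\<sigma>2 (dotp d v x)\<bar> * ennreal \<bar>\<sigma>2 (dotp d v x') * fs x'\<bar> \<partial>?t)"
      by (simp add: abs_mult ennreal_mult dotp_commute[of d _ x] dotp_commute[of d _ x'] mult.assoc)
    finally show "ennreal \<bar>kernel d \<sigma>2 x x' * fs x'\<bar> \<le> (\<integral>\<^sup>+v. ennreal \<bar>\<sigma>2 (dotp d v x)\<bar> * ennreal \<bar>\<sigma>2 (dotp d v x') * fs x'\<bar> \<partial>?t)" .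
  qed
  also have "\<dots> = (\<integral>\<^sup>+v. \<integral>\<^sup>+x'. ennreal \<bar>\<sigma>2 (dotp d v x)\<bar> * ennreal \<bar>\<sigma>2 (dotp d v x') * fs x'\<bar> \<partial>\<nu> \<partial>?t)"
    by (rule TN.Fubini') measurable
  also have "\<dots> \<le> (\<integral>\<^sup>+v. ennreal \<bar>\<sigma>2 (dotp d v x)\<bar> * ennreal K \<partial>?t)"
  proof (rule nn_integral_mono_AE, use AE_sphere_unif_unit[OF d_pos] in eventually_elim)
    fix v assume v: "dotp d v v = 1"
    have "(\<integral>\<^sup>+x'. ennreal \<bar>\<sigma>2 (dotp d v x)\<bar> * ennreal \<bar>\<sigma>2 (dotp d v x') * fs x'\<bar> \<partial>\<nu>)
      = ennreal \<bar>\<sigma>2 (dotp d v x)\<bar> * (\<integral>\<^sup>+x'. ennreal \<bar>\<sigma>2 (dotp d v x') * fs x'\<bar> \<partial>\<nu>)"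
      by (rule nn_integral_cmult) measurable
    also have "\<dots> \<le> ennreal \<bar>\<sigma>2 (dotp d v x)\<bar> * ennreal K"
      using order_trans[OF s2_fs[OF v] ennreal_leI[OF K]] by (rule mult_left_mono) simp
    finally show "(\<integral>\<^sup>+x'. ennreal \<bar>\<sigma>2 (dotp d v x)\<bar> * ennreal \<bar>\<sigma>2 (dotp d v x') * fs x'\<bar> \<partial>\<nu>) \<le> ennreal \<bar>\<sigma>2 (dotp d v x)\<bar> * ennreal K" .
  qed
  also have "\<dots> = (\<integral>\<^sup>+v. ennreal \<bar>\<sigma>2 (dotp d v x)\<bar> \<partial>?t) * ennreal K"
    by (rule nn_integral_multc) measurable
  finally show ?thesis by (simp add: mult.commute)
qed

text \<open>Jensen's inequality for the average over directions, then Tonelli. These moments also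
  yield the integrability without which the integral in \<open>Lnorm\<close> would default to
  0.\<close>

lemma Kop_moment:
  assumes K: "smom 2 / 2 + 1 / 2 \<le> K" and r: "1 \<le> r"
  shows "(\<integral>\<^sup>+x. ennreal (\<bar>Kop d \<sigma>2 \<nu> fs x\<bar> powr r) \<partial>\<nu>) \<le> ennreal (K powr r * smom r)"
proof -
  let ?t = "sphere_unif d" and ?Kf = "Kop d \<sigma>2 \<nu> fs"
  have K0: "0 < K" using K smom_nonneg[of 2] by linarith
  have "(\<integral>\<^sup>+x. ennreal (\<bar>?Kf x\<bar> powr r) \<partial>\<nu>) \<le> (\<integral>\<^sup>+x. ennreal (K powr r) * (\<integral>\<^sup>+v. ennreal (\<bar>\<sigma>2 (dotp d v x)\<bar> powr r) \<partial>?t) \<partial>\<nu>)"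
  proof (rule nn_integral_mono)
    fix x assume "x \<in> space \<nu>"
    then have x[measurable]: "x \<in> space (Rd d)" using sets_eq_imp_space_eq[OF sets_nu] by simp
    have "ennreal (\<bar>?Kf x\<bar> / K) = ennreal (1 / K) * ennreal \<bar>?Kf x\<bar>" using K0 by (simp flip: ennreal_mult)
    also have "\<dots> \<le> ennreal (1 / K) * (ennreal K * (\<integral>\<^sup>+v. ennreal \<bar>\<sigma>2 (dotp d v x)\<bar> \<partial>?t))"
      using Kop_le[OF x K] by (rule mult_left_mono) simp
    also have "\<dots> = (\<integral>\<^sup>+v. ennreal \<bar>\<sigma>2 (dotp d v x)\<bar> \<partial>?t)"
      using K0 by (simp flip: ennreal_mult mult.assoc)
    finally have "ennreal ((\<bar>?Kf x\<bar> / K) powr r) \<le> (\<integral>\<^sup>+v. ennreal (\<bar>\<sigma>2 (dotp d v x)\<bar> powr r) \<partial>?t)"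
      using K0 r by (intro powr_mean_le[OF tau.prob_space_axioms]) auto
    from mult_left_mono[OF this, of "ennreal (K powr r)"]
    show "ennreal (\<bar>?Kf x\<bar> powr r) \<le> ennreal (K powr r) * (\<integral>\<^sup>+v. ennreal (\<bar>\<sigma>2 (dotp d v x)\<bar> powr r) \<partial>?t)"
      using K0 by (simp flip: ennreal_mult add: powr_divide)
  qed
  also have "\<dots> = ennreal (K powr r) * (\<integral>\<^sup>+x. \<integral>\<^sup>+v. ennreal (\<bar>\<sigma>2 (dotp d v x)\<bar> powr r) \<partial>?t \<partial>\<nu>)"
    by (rule nn_integral_cmult) measurable
  also have "(\<integral>\<^sup>+x. \<integral>\<^sup>+v. ennreal (\<bar>\<sigma>2 (dotp d v x)\<bar> powr r) \<partial>?t \<partial>\<nu>) = (\<integral>\<^sup>+v. \<integral>\<^sup>+x. ennreal (\<bar>\<sigma>2 (dotp d v x)\<bar> powr r) \<partial>\<nu> \<partial>?t)"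
    by (rule TN.Fubini') measurable
  also have "\<dots> \<le> (\<integral>\<^sup>+v. ennreal (smom r) \<partial>?t)"
    by (rule nn_integral_mono_AE, use AE_sphere_unif_unit[OF d_pos] in eventually_elim) (use s2_moment r in auto)
  also have "\<dots> = ennreal (smom r)" by (simp add: tau.emeasure_space_1)
  finally show ?thesis by (simp add: ennreal_mult smom_nonneg mult_left_mono)
qed

lemma Kop_powr_integrable:
  assumes r: "1 \<le> r"
  shows "integrable \<nu> (\<lambda>x. \<bar>Kop d \<sigma>2 \<nu> fs x\<bar> powr r)"
  using order.strict_trans1[OF Kop_moment[OF order_refl r] ennreal_less_top]
  by (intro integrableI_bounded) auto

text \<open>Turns the conditions on \<open>n\<close>, \<open>m1\<close> and \<open>m2\<close>, which
  are relative to the squared norm, into absolute lower bounds.\<close>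

lemma Kop_norm_le:
  assumes K: "1 \<le> K" "smom 2 \<le> K"
  shows "(Lnorm \<nu> 2 (Kop d \<sigma>2 \<nu> fs))\<^sup>2 \<le> K^3"
proof -
  let ?Kf = "Kop d \<sigma>2 \<nu> fs"
  have "ennreal (\<integral>x. \<bar>?Kf x\<bar> powr 2 \<partial>\<nu>) = (\<integral>\<^sup>+x. ennreal (\<bar>?Kf x\<bar> powr 2) \<partial>\<nu>)"
    by (rule nn_integral_eq_integral[symmetric]) (use Kop_powr_integrable[of 2] in auto)
  also have "\<dots> \<le> ennreal (K powr 2 * smom 2)" using K by (intro Kop_moment) auto
  finally have "(\<integral>x. \<bar>?Kf x\<bar> powr 2 \<partial>\<nu>) \<le> K powr 2 * smom 2"
    using smom_nonneg[of 2] by (subst (asm) ennreal_le_iff) auto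
  also have "\<dots> \<le> K\<^sup>2 * K" using K by (simp add: mult_left_mono)
  finally have "(\<integral>x. \<bar>?Kf x\<bar> powr 2 \<partial>\<nu>) \<le> K^3" by (simp add: power2_eq_square power3_eq_cube)
  moreover have "(Lnorm \<nu> 2 ?Kf)\<^sup>2 = (\<integral>x. \<bar>?Kf x\<bar> powr 2 \<partial>\<nu>)"
    by (simp add: Lnorm_def powr_half_sqrt)
  ultimately show ?thesis by simp
qed

lemma Kop_tail:
  assumes r: "1 \<le> r" and L: "0 < L" "Lnorm \<nu> r (Kop d \<sigma>2 \<nu> fs) \<le> L" and F: "exp 1 * L \<le> F"
  shows "emeasure \<nu> {x \<in> space \<nu>. F < \<bar>Kop d \<sigma>2 \<nu> fs x\<bar>} \<le> ennreal (exp (- r))"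
proof (rule emeasure_moment_tail[OF _ _ L(1) _ F])
  let ?Kf = "Kop d \<sigma>2 \<nu> fs" and ?I = "\<integral>x. \<bar>Kop d \<sigma>2 \<nu> fs x\<bar> powr r \<partial>\<nu>"
  have "?I = (?I powr (1 / r)) powr r" using r by (simp add: powr_powr)
  also have "\<dots> \<le> L powr r" using L r by (intro powr_mono2) (auto simp: Lnorm_def)
  finally have "?I \<le> L powr r" .
  moreover have "(\<integral>\<^sup>+x. ennreal (\<bar>?Kf x\<bar> powr r) \<partial>\<nu>) = ennreal ?I"
    by (rule nn_integral_eq_integral) (use Kop_powr_integrable[OF r] in auto)
  ultimately show "(\<integral>\<^sup>+x. ennreal (\<bar>?Kf x\<bar> powr r) \<partial>\<nu>) \<le> ennreal (L powr r)" by (simp add: ennreal_leI)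
qed (use r in auto)

end

section \<open>Choice of the constants\<close>

locale problem_constants =
  fixes C\<gamma> Cf ell C\<sigma> \<alpha> CK chi :: real
begin

definition Kc :: real where
  "Kc = max 1 (max (subgaussian_data.smom C\<gamma> C\<sigma> \<alpha> 2) (max (subgaussian_data.smom C\<gamma> C\<sigma> \<alpha> 4) ((Cf * 4 powr ell)^4)))"
definition Fc :: real where "Fc = max 1 (exp 1 * Cf * 32 powr ell)"
definition Bc :: real where "Bc = max 1 (C\<sigma> * (1 + 2 * C\<gamma> * sqrt 33) powr \<alpha>)"
definition Qc :: real where "Qc = Fc * Bc\<^sup>2"
text \<open>Chosen such that the step size times the tail level
  \<open>exp 1 * CK * (32 * \<iota>) powr chi * N\<close> of the kernel operator is exactly
  \<open>1 / 2\<close>.\<close>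

definition c0 :: real where "c0 = 1 / (2 * exp 1 * CK * 32 powr chi)"
text \<open>The first summand secures the absolute sizes in \<open>net_setup\<close> by way of
  \<open>N\<^sup>2 \<le> Kc^3\<close>, the second the step size conditions;
  \<open>60 = 4 * 15\<close> makes each half of \<open>eta_eps\<close> at most
  \<open>1 / 4\<close>.\<close>

definition Ac :: real where "Ac = 128 * Kc^4 * Qc\<^sup>2 + (60 * c0 * Kc * Qc)\<^sup>2"
definition C3c :: real where "C3c = 200000000 * Kc^5 * Wb\<^sup>2 * (450 * c0\<^sup>2 * Kc\<^sup>2 * Qc\<^sup>2 + c0\<^sup>2 + 1 + Fc\<^sup>2 + 1)"
definition Ctc :: real where "Ctc = (1 + Wb\<^sup>2) * (1764 + 2 * (1000000 * Kc^5)) + 2"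

lemma c_ge1: "1 \<le> Kc" "1 \<le> Fc" "1 \<le> Bc" "1 \<le> Qc"
proof -
  show *: "1 \<le> Kc" "1 \<le> Fc" "1 \<le> Bc" by (auto simp: Kc_def Fc_def Bc_def)
  show "1 \<le> Qc" unfolding Qc_def using * by (intro mult_ge1_I one_le_power) auto
qed

lemma Ac_pos: "0 < Ac"
proof -
  have "0 < 128 * Kc^4 * Qc\<^sup>2" using c_ge1 by simp
  then show ?thesis unfolding Ac_def by (simp add: add_pos_nonneg)
qed

lemma C3c_pos: "0 < C3c"
proof -
  have "0 < 450 * c0\<^sup>2 * Kc\<^sup>2 * Qc\<^sup>2 + c0\<^sup>2 + 1 + Fc\<^sup>2 + 1" by (simp add: add_pos_nonneg add_nonneg_pos)
  then show ?thesis unfolding C3c_def using c_ge1 Wb_pos by (intro mult_pos_pos) auto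
qed

lemma Ctc_ge1: "1 \<le> Ctc"
proof -
  have "0 \<le> (1 + Wb\<^sup>2) * (1764 + 2 * (1000000 * Kc^5))" using c_ge1 by (intro mult_nonneg_nonneg) auto
  then show ?thesis by (simp add: Ctc_def)
qed

end

text \<open>\<open>32 * \<iota> \<le> d\<close> admits the moment order \<open>32 * \<iota>\<close>
  in \<open>hyper\<close>, the source of the tail \<open>exp (- 32 * \<iota>)\<close> of the kernel
  operator.\<close>

locale learning_problem = problem_constants C\<gamma> Cf ell C\<sigma> \<alpha> CK chi + subgaussian_data d \<nu> fs \<sigma>2 C\<gamma> C\<sigma> \<alpha>
  for C\<gamma> Cf ell C\<sigma> \<alpha> CK chi :: real and d :: nat and \<nu> fs \<sigma>2 +
  fixes n m1 m2 :: nat and \<iota> :: real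
  assumes params: "0 < Cf" "0 \<le> ell" "0 < CK" "0 \<le> chi"
    and pos: "0 < n" "0 < m1" "0 < m2"
    and iota: "1 \<le> \<iota>" "32 * \<iota> \<le> real d" "real (d * n * m1 * m2) \<le> exp \<iota>"
    and mom: "moment_bound \<nu> fs Cf ell"
    and hyper: "\<And>r. 1 \<le> r \<Longrightarrow> r \<le> real d \<Longrightarrow> Lnorm \<nu> r (Kop d \<sigma>2 \<nu> fs) \<le> CK * r powr chi * Lnorm \<nu> 2 (Kop d \<sigma>2 \<nu> fs)"
    and N_pos: "0 < Lnorm \<nu> 2 (Kop d \<sigma>2 \<nu> fs)"
    and n_ge: "Ac * \<iota> powr (2 * ell + 2 * \<alpha> + 1) / (Lnorm \<nu> 2 (Kop d \<sigma>2 \<nu> fs))\<^sup>2 \<le> real n"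
    and m1_ge: "Ac * \<iota> / (Lnorm \<nu> 2 (Kop d \<sigma>2 \<nu> fs))\<^sup>2 \<le> real m1"
    and m2_ge: "Ac * \<iota> powr (2 * \<alpha> + 1) / (Lnorm \<nu> 2 (Kop d \<sigma>2 \<nu> fs))\<^sup>2 \<le> real m2"
begin

abbreviation "Kf \<equiv> Kop d \<sigma>2 \<nu> fs"
definition N :: real where "N = Lnorm \<nu> 2 Kf"
definition \<eta>b :: real where "\<eta>b = c0 * \<iota> powr (- chi) / N"
definition Rb :: real where "Rb = 2 * C\<gamma> * sqrt (33 * \<iota>)"
text \<open>The exponent is half of \<open>\<alpha>\<close> because the truncation radius
  \<open>Rb\<close> is of order \<open>sqrt \<iota>\<close>.\<close>

definition Bb :: real where "Bb = Bc * \<iota> powr (\<alpha> / 2)"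
definition Fb :: real where "Fb = Fc * \<iota> powr ell"

lemma K_bounds: "smom 2 \<le> Kc" "smom 4 \<le> Kc" "(Cf * 4 powr ell)^4 \<le> Kc"
  by (auto simp: Kc_def)

lemma N0: "0 < N" using N_pos by (simp add: N_def)
lemma N_le: "N\<^sup>2 \<le> Kc^3" unfolding N_def by (intro Kop_norm_le c_ge1 K_bounds)
lemma c0_pos: "0 < c0" using params by (simp add: c0_def)

lemma iota_powr_ge1: "0 \<le> t \<Longrightarrow> 1 \<le> \<iota> powr t" using iota by (intro ge_one_powr_ge_zero) auto

lemma eta_bounds: "0 < \<eta>b" "\<eta>b \<le> c0 / N" "\<eta>b\<^sup>2 \<le> c0\<^sup>2 / N\<^sup>2"
proof -
  show p: "0 < \<eta>b" using N0 c0_pos iota by (simp add: \<eta>b_def)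
  have "\<iota> powr (- chi) \<le> 1" using iota params by (simp add: powr_minus_divide divide_le_eq iota_powr_ge1)
  then have "c0 * \<iota> powr (- chi) \<le> c0 * 1" using c0_pos by (intro mult_left_mono) auto
  then show *: "\<eta>b \<le> c0 / N" unfolding \<eta>b_def using N0 by (intro divide_right_mono) auto
  have "\<eta>b\<^sup>2 \<le> (c0 / N)\<^sup>2" using p * by (intro power_mono) auto
  then show "\<eta>b\<^sup>2 \<le> c0\<^sup>2 / N\<^sup>2" by (simp add: power_divide)
qed

lemma B_powers: "Bb\<^sup>2 = Bc\<^sup>2 * \<iota> powr \<alpha>" "Bb^4 * \<iota> = Bc^4 * \<iota> powr (2 * \<alpha> + 1)"
proof -
  have i0: "0 < \<iota>" using iota by simp
  have "(\<iota> powr (\<alpha> / 2))\<^sup>2 = \<iota> powr \<alpha>" using i0 by (simp add: power2_eq_square flip: powr_add)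
  then show *: "Bb\<^sup>2 = Bc\<^sup>2 * \<iota> powr \<alpha>" by (simp add: Bb_def power_mult_distrib)
  have "Bb^4 = (Bb\<^sup>2)\<^sup>2" by simp
  also have "\<dots> = Bc^4 * \<iota> powr (2 * \<alpha>)" unfolding * using i0 by (simp add: power_mult_distrib power2_eq_square[of "\<iota> powr \<alpha>"] flip: powr_add)
  finally show "Bb^4 * \<iota> = Bc^4 * \<iota> powr (2 * \<alpha> + 1)" using i0 by (simp add: powr_add)
qed

lemma F_square: "Fb\<^sup>2 = Fc\<^sup>2 * \<iota> powr (2 * ell)"
  using iota by (simp add: Fb_def power_mult_distrib power2_eq_square[of "\<iota> powr ell"] flip: powr_add)

lemma FB_powers: "Fb\<^sup>2 * Bb^4 * \<iota> = Qc\<^sup>2 * \<iota> powr (2 * ell + 2 * \<alpha> + 1)" "Bb^4 * \<iota> \<le> Qc\<^sup>2 * \<iota> powr (2 * \<alpha> + 1)"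
proof -
  have "Fb\<^sup>2 * Bb^4 * \<iota> = (Fc\<^sup>2 * \<iota> powr (2 * ell)) * (Bc^4 * \<iota> powr (2 * \<alpha> + 1))" unfolding F_square B_powers(2)[symmetric] by simp
  also have "\<dots> = (Fc\<^sup>2 * Bc^4) * (\<iota> powr (2 * ell) * \<iota> powr (2 * \<alpha> + 1))" by (simp only: mult_ac)
  also have "\<iota> powr (2 * ell) * \<iota> powr (2 * \<alpha> + 1) = \<iota> powr (2 * ell + 2 * \<alpha> + 1)"
    unfolding powr_add[symmetric] by (simp add: add.assoc)
  finally show "Fb\<^sup>2 * Bb^4 * \<iota> = Qc\<^sup>2 * \<iota> powr (2 * ell + 2 * \<alpha> + 1)" by (simp add: Qc_def power_mult_distrib)
  have "1 * Bc^4 \<le> Fc\<^sup>2 * Bc^4" using c_ge1 by (intro mult_right_mono one_le_power) auto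
  then have "Bc^4 \<le> Qc\<^sup>2" by (simp add: Qc_def power_mult_distrib)
  then show "Bb^4 * \<iota> \<le> Qc\<^sup>2 * \<iota> powr (2 * \<alpha> + 1)" unfolding B_powers by (rule mult_right_mono) simp
qed

lemma sample_size:
  assumes "Ac * P / (Lnorm \<nu> 2 Kf)\<^sup>2 \<le> real m" and P: "0 \<le> P" and m: "0 < m"
  shows "128 * Kc * Qc\<^sup>2 * P \<le> real m" "60 * c0 * Kc * Qc * sqrt (P / m) \<le> N"
proof -
  have AP: "Ac * P \<le> real m * N\<^sup>2" using assms(1) N0 by (simp add: N_def[symmetric] pos_divide_le_eq)
  have "128 * Kc^4 * Qc\<^sup>2 * P \<le> Ac * P" using P by (intro mult_right_mono) (auto simp: Ac_def)
  also note AP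
  also have "real m * N\<^sup>2 \<le> real m * Kc^3" using N_le by (intro mult_left_mono) auto
  finally have "Kc^3 * (128 * Kc * Qc\<^sup>2 * P) \<le> Kc^3 * real m" by (simp add: power_numeral_reduce mult_ac)
  then show "128 * Kc * Qc\<^sup>2 * P \<le> real m" using c_ge1 by (subst (asm) mult_le_cancel_left_pos) auto
  have "(60 * c0 * Kc * Qc)\<^sup>2 * P \<le> Ac * P" using P c_ge1 by (intro mult_right_mono) (auto simp: Ac_def)
  with AP have "(60 * c0 * Kc * Qc)\<^sup>2 * P \<le> real m * N\<^sup>2" by simp
  then have "(60 * c0 * Kc * Qc)\<^sup>2 * (P / m) \<le> N\<^sup>2" using m by (simp add: pos_divide_le_eq mult.commute)
  moreover have "(60 * c0 * Kc * Qc * sqrt (P / m))\<^sup>2 = (60 * c0 * Kc * Qc)\<^sup>2 * (P / m)"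
    unfolding power_mult_distrib[of _ "sqrt (P / m)"] using P by (subst real_sqrt_pow2) simp_all
  ultimately have "(60 * c0 * Kc * Qc * sqrt (P / m))\<^sup>2 \<le> N\<^sup>2" by (simp only:)
  then show "60 * c0 * Kc * Qc * sqrt (P / m) \<le> N" by (rule power2_le_imp_le) (rule less_imp_le[OF N0])
qed

lemma eta_times:
  assumes "60 * c0 * Kc * Qc * s \<le> N" "0 \<le> s"
  shows "\<eta>b * (15 * Kc * (Qc * s)) \<le> 1 / 4" "\<eta>b * (12 * s) \<le> 1"
proof -
  have "\<eta>b * (15 * Kc * (Qc * s)) \<le> c0 / N * (15 * Kc * (Qc * s))" using eta_bounds c_ge1 assms by (intro mult_right_mono) auto
  also have "\<dots> = (60 * c0 * Kc * Qc * s) / N / 4" by simp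
  also have "\<dots> \<le> 1 / 4" using assms(1) N0 by (intro divide_right_mono) (simp_all only: pos_divide_le_eq mult_1 zero_le_numeral)
  finally show *: "\<eta>b * (15 * Kc * (Qc * s)) \<le> 1 / 4" .
  have "1 * s \<le> (Kc * Qc) * s" using c_ge1 assms by (intro mult_right_mono mult_ge1_I) auto
  then have "\<eta>b * s \<le> \<eta>b * (Kc * (Qc * s))" using eta_bounds by (intro mult_left_mono) (auto simp: mult.assoc)
  moreover have "\<eta>b * (15 * Kc * (Qc * s)) = 15 * (\<eta>b * (Kc * (Qc * s)))" "\<eta>b * (12 * s) = 12 * (\<eta>b * s)" by simp_all
  ultimately show "\<eta>b * (12 * s) \<le> 1" using * by linarith
qed

lemma sqrt_terms:
  "Fb * Bb\<^sup>2 * sqrt (\<iota> / n) = Qc * sqrt (\<iota> powr (2 * ell + 2 * \<alpha> + 1) / n)"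
  "Bb\<^sup>2 * sqrt (\<iota> / m2) \<le> Qc * sqrt (\<iota> powr (2 * \<alpha> + 1) / m2)"
proof -
  have b: "0 \<le> Bb" "0 \<le> Fb" using c_ge1 by (auto simp: Bb_def Fb_def)
  have "(Fb * Bb\<^sup>2 * sqrt (\<iota> / n))\<^sup>2 = Fb\<^sup>2 * Bb^4 * \<iota> / n" using iota by (simp add: power_mult_distrib)
  also have "\<dots> = (Qc * sqrt (\<iota> powr (2 * ell + 2 * \<alpha> + 1) / n))\<^sup>2" unfolding FB_powers by (simp add: power_mult_distrib)
  finally show "Fb * Bb\<^sup>2 * sqrt (\<iota> / n) = Qc * sqrt (\<iota> powr (2 * ell + 2 * \<alpha> + 1) / n)"
    using b c_ge1 iota by (subst (asm) power2_eq_iff_nonneg) auto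
  have "(Bb\<^sup>2 * sqrt (\<iota> / m2))\<^sup>2 = Bb^4 * \<iota> / m2" using iota by (simp add: power_mult_distrib)
  also have "\<dots> \<le> Qc\<^sup>2 * \<iota> powr (2 * \<alpha> + 1) / m2" using FB_powers by (intro divide_right_mono) auto
  also have "\<dots> = (Qc * sqrt (\<iota> powr (2 * \<alpha> + 1) / m2))\<^sup>2" by (simp add: power_mult_distrib)
  finally show "Bb\<^sup>2 * sqrt (\<iota> / m2) \<le> Qc * sqrt (\<iota> powr (2 * \<alpha> + 1) / m2)"
    by (rule power2_le_imp_le) (use c_ge1 in auto)
qed

lemma net_setup_holds: "net_setup d n m1 m2 \<nu> fs \<sigma>2 \<eta>b \<iota> Kc Rb Bb Fb"
proof (rule net_setup.intro)
  have i0: "0 < \<iota>" using iota by simp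
  have r1: "1 \<le> 32 * \<iota>" using iota by simp
  have P1: "1 \<le> \<iota> powr (2 * ell + 2 * \<alpha> + 1)" "1 \<le> \<iota> powr (2 * \<alpha> + 1)" using params \<alpha> by (auto intro!: iota_powr_ge1)
  note n = sample_size[OF n_ge _ pos(1)] and m1 = sample_size[OF m1_ge _ pos(2)] and m2 = sample_size[OF m2_ge _ pos(3)]
  show "0 < d" by (rule d_pos)
  show "0 < n" "0 < m1" "0 < m2" by (rule pos)+
  show "prob_space \<nu>" by (rule prob_nu)
  show "sets \<nu> = sets (Rd d)" by (rule sets_nu)
  show "fs \<in> borel_measurable (Rd d)" "\<sigma>2 \<in> borel_measurable borel" by measurable
  show "1 \<le> Kc" by (rule c_ge1)
  show "1 \<le> \<iota>" by (rule iota)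
  show "1 \<le> Bb" unfolding Bb_def using c_ge1 \<alpha> by (intro mult_ge1_I iota_powr_ge1) auto
  show "1 \<le> Fb" unfolding Fb_def using c_ge1 params by (intro mult_ge1_I iota_powr_ge1) auto
  show "\<bar>\<sigma>2 z\<bar> \<le> Bb" if z: "\<bar>z\<bar> \<le> Rb" for z
  proof -
    have "1 \<le> sqrt \<iota>" using iota by simp
    moreover have "(1 + 2 * C\<gamma> * sqrt 33) * sqrt \<iota> = sqrt \<iota> + Rb" by (simp add: Rb_def real_sqrt_mult distrib_right mult.assoc)
    ultimately have "1 + \<bar>z\<bar> \<le> (1 + 2 * C\<gamma> * sqrt 33) * sqrt \<iota>" using z by linarith
    then have "(1 + \<bar>z\<bar>) powr \<alpha> \<le> ((1 + 2 * C\<gamma> * sqrt 33) * sqrt \<iota>) powr \<alpha>" using \<alpha> by (intro powr_mono2) auto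
    also have "\<dots> = (1 + 2 * C\<gamma> * sqrt 33) powr \<alpha> * \<iota> powr (\<alpha> / 2)"
      using C\<gamma> i0 by (simp add: powr_mult powr_half_sqrt[symmetric] powr_powr)
    finally have "C\<sigma> * (1 + \<bar>z\<bar>) powr \<alpha> \<le> C\<sigma> * ((1 + 2 * C\<gamma> * sqrt 33) powr \<alpha> * \<iota> powr (\<alpha> / 2))"
      using C\<sigma> by (intro mult_left_mono) auto
    also have "\<dots> \<le> Bb" unfolding Bb_def Bc_def mult.assoc[symmetric] by (intro mult_right_mono) auto
    finally show ?thesis using growth[of z] by simp
  qed
  show "\<exists>b. \<forall>z. \<bar>z\<bar> \<le> r \<longrightarrow> \<bar>\<sigma>2 z\<bar> \<le> b" for r
  proof (intro exI allI impI)
    fix z assume z: "\<bar>z\<bar> \<le> r"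
    have "\<bar>\<sigma>2 z\<bar> \<le> C\<sigma> * (1 + \<bar>z\<bar>) powr \<alpha>" by (rule growth)
    also have "\<dots> \<le> C\<sigma> * (1 + r) powr \<alpha>" using C\<sigma> \<alpha> z by (intro mult_left_mono powr_mono2) auto
    finally show "\<bar>\<sigma>2 z\<bar> \<le> C\<sigma> * (1 + r) powr \<alpha>" .
  qed
  show "(\<integral>\<^sup>+x. ennreal ((\<sigma>2 (dotp d v x))^4) \<partial>\<nu>) \<le> ennreal Kc" if v: "dotp d v v = 1" for v
  proof -
    have "(\<integral>\<^sup>+x. ennreal ((\<sigma>2 (dotp d v x))^4) \<partial>\<nu>) = (\<integral>\<^sup>+x. ennreal (\<bar>\<sigma>2 (dotp d v x)\<bar> powr 4) \<partial>\<nu>)" by (simp add: power_even_abs)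
    also have "\<dots> \<le> ennreal (smom 4)" using v by (rule s2_moment) simp
    also have "\<dots> \<le> ennreal Kc" by (intro ennreal_leI K_bounds)
    finally show ?thesis .
  qed
  show "emeasure \<nu> {x \<in> space \<nu>. Rb < \<bar>dotp d v x\<bar>} \<le> ennreal (exp (- 32 * \<iota>))" if v: "dotp d v v = 1" for v
    unfolding Rb_def by (rule dot_tail[OF v iota(1)])
  show "(\<integral>\<^sup>+x. ennreal ((fs x)^4) \<partial>\<nu>) \<le> ennreal Kc"
  proof -
    have "(\<integral>\<^sup>+x. ennreal ((fs x)^4) \<partial>\<nu>) = (\<integral>\<^sup>+x. ennreal (\<bar>fs x\<bar> powr 4) \<partial>\<nu>)" by (simp add: power_even_abs)
    also have "\<dots> \<le> ennreal ((Cf * 4 powr ell) powr 4)" using mom unfolding moment_bound_def by (rule allE[of _ 4]) simp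
    also have "\<dots> = ennreal ((Cf * 4 powr ell)^4)" using params by simp
    also have "\<dots> \<le> ennreal Kc" by (intro ennreal_leI K_bounds)
    finally show ?thesis .
  qed
  show "(\<integral>\<^sup>+x. ennreal ((fs x)\<^sup>2) \<partial>\<nu>) \<le> 1" by (rule fs_2)
  show "emeasure \<nu> {x \<in> space \<nu>. Fb < \<bar>fs x\<bar>} \<le> ennreal (exp (- 32 * \<iota>))"
  proof -
    have "emeasure \<nu> {x \<in> space \<nu>. Fb < \<bar>fs x\<bar>} \<le> ennreal (exp (- (32 * \<iota>)))"
    proof (rule emeasure_moment_tail)
      show "(\<integral>\<^sup>+x. ennreal (\<bar>fs x\<bar> powr (32 * \<iota>)) \<partial>\<nu>) \<le> ennreal ((Cf * (32 * \<iota>) powr ell) powr (32 * \<iota>))"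
        using mom r1 unfolding moment_bound_def by blast
      have "exp 1 * (Cf * (32 * \<iota>) powr ell) = (exp 1 * Cf * 32 powr ell) * \<iota> powr ell" using i0 by (simp add: powr_mult)
      also have "\<dots> \<le> Fb" unfolding Fb_def Fc_def by (intro mult_right_mono) auto
      finally show "exp 1 * (Cf * (32 * \<iota>) powr ell) \<le> Fb" .
    qed (use params i0 in auto)
    then show ?thesis by simp
  qed
  show "emeasure \<nu> {x \<in> space \<nu>. 1 / 2 < \<bar>\<eta>b * Kf x\<bar>} \<le> ennreal (exp (- 32 * \<iota>))"
  proof -
    let ?L = "CK * (32 * \<iota>) powr chi * N"
    have "exp 1 * ?L * \<eta>b = 1 / 2"
    proof -
      have gen: "e * (C * (k * p) * N') * (c * p' / N') = (e * C * k * c) * (p * p')" if "0 < N'" for e C k p N' c p' :: real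
        using that by simp
      have "\<iota> powr chi * \<iota> powr (- chi) = 1" unfolding powr_add[symmetric] using i0 by simp
      moreover have "exp 1 * CK * 32 powr chi * c0 = 1 / 2" using params by (simp add: c0_def)
      moreover have "(32 * \<iota>) powr chi = 32 powr chi * \<iota> powr chi" using i0 by (simp add: powr_mult)
      ultimately show ?thesis unfolding \<eta>b_def by (simp only: gen[OF N0] mult_1_right)
    qed
    then have "(1 / 2 < \<bar>\<eta>b * Kf x\<bar>) = (exp 1 * ?L * \<eta>b < \<bar>Kf x\<bar> * \<eta>b)" for x
      using eta_bounds(1) by (simp only: abs_mult abs_of_pos mult.commute)
    then have "{x \<in> space \<nu>. 1 / 2 < \<bar>\<eta>b * Kf x\<bar>} = {x \<in> space \<nu>. exp 1 * ?L < \<bar>Kf x\<bar>}"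
      by (simp only: mult_less_cancel_right_pos[OF eta_bounds(1)])
    moreover have "emeasure \<nu> {x \<in> space \<nu>. exp 1 * ?L < \<bar>Kf x\<bar>} \<le> ennreal (exp (- (32 * \<iota>)))"
      using hyper[OF r1 iota(2)] params i0 N0 by (intro Kop_tail[OF r1]) (auto simp: N_def)
    ultimately show ?thesis by simp
  qed
  show "128 * Kc * Fb\<^sup>2 * Bb^4 * \<iota> \<le> real n"
  proof -
    have "128 * Kc * Fb\<^sup>2 * Bb^4 * \<iota> = 128 * Kc * (Fb\<^sup>2 * Bb^4 * \<iota>)" by simp
    also have "\<dots> \<le> real n" unfolding FB_powers using n(1) P1 by (simp add: mult.assoc)
    finally show ?thesis .
  qed
  have drop: "128 * t \<le> real m" if "128 * Kc * Qc\<^sup>2 * P \<le> real m" "t \<le> Qc\<^sup>2 * P" "0 \<le> Qc\<^sup>2 * P" for t P m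
  proof -
    have "128 * t \<le> 128 * (1 * (Qc\<^sup>2 * P))" using that by simp
    also have "\<dots> \<le> 128 * (Kc * (Qc\<^sup>2 * P))" using c_ge1 that(3) by (intro mult_left_mono mult_right_mono) auto
    also have "\<dots> \<le> real m" using that(1) by (simp only: mult.assoc)
    finally show ?thesis .
  qed
  show "128 * Bb^4 * \<iota> \<le> real m2" using drop[OF m2(1) FB_powers(2)] P1 by (simp add: mult.assoc)
  have "1 * \<iota> \<le> Qc\<^sup>2 * \<iota>" using c_ge1 i0 by (intro mult_right_mono one_le_power) auto
  then show "128 * \<iota> \<le> real m1" using drop[OF m1(1), of \<iota>] i0 by simp
  show "real n * real m1 * real m2 \<le> exp \<iota>"
  proof -
    have "1 * (real n * real m1 * real m2) \<le> real d * (real n * real m1 * real m2)" using d_pos by (intro mult_right_mono) auto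
    with iota(3) show ?thesis by (simp add: mult.assoc)
  qed
  show "0 \<le> \<eta>b" using eta_bounds by simp
  show "\<eta>b * (15 * Kc * (Fb * Bb\<^sup>2 * sqrt (\<iota> / n) + Bb\<^sup>2 * sqrt (\<iota> / m2))) \<le> 1 / 2"
  proof -
    let ?s1 = "sqrt (\<iota> powr (2 * ell + 2 * \<alpha> + 1) / n)" and ?s2 = "sqrt (\<iota> powr (2 * \<alpha> + 1) / m2)"
    have "\<eta>b * (15 * Kc * (Fb * Bb\<^sup>2 * sqrt (\<iota> / n) + Bb\<^sup>2 * sqrt (\<iota> / m2))) \<le> \<eta>b * (15 * Kc * (Qc * ?s1 + Qc * ?s2))"
      using sqrt_terms eta_bounds c_ge1 by (intro mult_left_mono add_mono) auto
    also have "\<dots> = \<eta>b * (15 * Kc * (Qc * ?s1)) + \<eta>b * (15 * Kc * (Qc * ?s2))" by (simp only: distrib_left)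
    also have "\<dots> \<le> 1 / 4 + 1 / 4" using P1 by (intro add_mono eta_times(1) n(2) m2(2)) auto
    finally show ?thesis by simp
  qed
  show "\<eta>b * (12 * sqrt (\<iota> / m1)) \<le> 1" using i0 by (intro eta_times(2) m1(2)) auto
  show "\<eta>b \<le> exp \<iota>"
  proof -
    \<comment> \<open>The sample size condition forces \<open>c0 / sqrt n \<le> N\<close>, so the
      step size is at most \<open>sqrt n\<close> and hence at most
      \<open>exp \<iota>\<close>.\<close>
    have "1 * (1 / sqrt n) \<le> 60 * Kc * Qc * sqrt (\<iota> powr (2 * ell + 2 * \<alpha> + 1) / n)"
      unfolding real_sqrt_divide using c_ge1 P1 pos
      by (simp add: divide_right_mono mult_ge1_I real_sqrt_ge_one)
    then have "c0 * (1 / sqrt n) \<le> c0 * (60 * Kc * Qc * sqrt (\<iota> powr (2 * ell + 2 * \<alpha> + 1) / n))"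
      using c0_pos by (intro mult_left_mono) auto
    also have "\<dots> \<le> N" using n(2) P1 by (simp add: mult_ac)
    finally have "c0 / N \<le> sqrt n" using N0 pos by (simp add: divide_le_eq mult.commute)
    also have "sqrt n \<le> real n" using pos by (intro real_le_lsqrt) (auto simp: power2_eq_square)
    also have "real n \<le> real (d * n * m1 * m2)" using d_pos pos by (intro of_nat_mono) simp
    finally show ?thesis using eta_bounds iota by linarith
  qed
qed

end

context learning_problem
begin

text \<open>\<open>eta_bounds\<close> drops the negative power of \<open>\<iota>\<close> in the
  squared step size, and the exponents with \<open>2 * chi\<close> are reached by monotonicity.
  \<open>S2\<^sup>2\<close> and \<open>Fb\<^sup>2\<close> times \<open>sqrt (\<iota> / n)\<close>
  fit under the common root because \<open>Fb\<^sup>2\<close> is a multiple of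
  \<open>\<iota> powr (2 * ell)\<close>.\<close>

lemma Ztot_le:
  fixes S1 S2 :: real
  assumes S: "0 \<le> S1" "0 \<le> S2"
  defines "e \<equiv> 15 * Kc * (Fb * Bb\<^sup>2 * sqrt (\<iota> / n) + Bb\<^sup>2 * sqrt (\<iota> / m2))"
  shows "S1\<^sup>2 * \<eta>b\<^sup>2 * (e\<^sup>2 + \<iota> / m1) + S2\<^sup>2 * \<iota> / m1 + (S2\<^sup>2 + Fb\<^sup>2) * sqrt (\<iota> / n)
    \<le> (450 * c0\<^sup>2 * Kc\<^sup>2 * Qc\<^sup>2 + c0\<^sup>2 + 1 + Fc\<^sup>2 + 1) *
      (S1\<^sup>2 / N\<^sup>2 * (\<iota> powr (2 * ell + 2 * \<alpha> + 2 * chi + 1) / real n + \<iota> powr (2 * \<alpha> + 2 * chi + 1) / real m2 + \<iota> / real m1)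
       + S2\<^sup>2 * \<iota> / real m1 + sqrt ((S2^4 * \<iota> + \<iota> powr (4 * ell + 1)) / real n))"
proof -
  let ?P1 = "\<iota> powr (2 * ell + 2 * \<alpha> + 1)" and ?P2 = "\<iota> powr (2 * \<alpha> + 1)"
  let ?X = "?P1 / real n + ?P2 / real m2"
  let ?Y = "\<iota> powr (2 * ell + 2 * \<alpha> + 2 * chi + 1) / real n + \<iota> powr (2 * \<alpha> + 2 * chi + 1) / real m2 + \<iota> / real m1"
  let ?H = "sqrt ((S2^4 * \<iota> + \<iota> powr (4 * ell + 1)) / real n)" and ?s = "sqrt (\<iota> / n)"
  have i0: "0 < \<iota>" using iota by simp
  have X0: "0 \<le> ?X" by (intro add_nonneg_nonneg divide_nonneg_nonneg) auto
  have XY: "?X + \<iota> / real m1 \<le> ?Y" 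
  proof -
    have "?P1 \<le> \<iota> powr (2 * ell + 2 * \<alpha> + 2 * chi + 1)" "?P2 \<le> \<iota> powr (2 * \<alpha> + 2 * chi + 1)"
      by (rule powr_mono; use iota params in simp)+
    then show ?thesis by (intro add_mono divide_right_mono) auto
  qed
  have m1_0: "0 \<le> \<iota> / real m1" using i0 by simp
  have Y0: "0 \<le> ?Y" using XY X0 m1_0 by linarith
  have e2: "e\<^sup>2 \<le> 450 * Kc\<^sup>2 * Qc\<^sup>2 * ?X"
  proof -
    have b: "0 \<le> Bb" "0 \<le> Fb" using c_ge1 by (auto simp: Bb_def Fb_def)
    have "0 \<le> e" unfolding e_def using b c_ge1 i0 by (intro mult_nonneg_nonneg add_nonneg_nonneg) auto
    moreover have "e \<le> 15 * Kc * (Qc * sqrt (?P1 / n) + Qc * sqrt (?P2 / m2))"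
      unfolding e_def using sqrt_terms c_ge1 by (intro mult_left_mono add_mono) auto
    ultimately have "e\<^sup>2 \<le> (15 * Kc * (Qc * sqrt (?P1 / n) + Qc * sqrt (?P2 / m2)))\<^sup>2" by (intro power_mono)
    also have "\<dots> = 225 * Kc\<^sup>2 * Qc\<^sup>2 * (sqrt (?P1 / n) + sqrt (?P2 / m2))\<^sup>2"
    proof -
      have "(15 * k * (w * x + w * y))\<^sup>2 = 225 * k\<^sup>2 * w\<^sup>2 * (x + y)\<^sup>2" for k w x y :: real
        by (simp add: power2_eq_square algebra_simps)
      then show ?thesis .
    qed
    also have "\<dots> \<le> 225 * Kc\<^sup>2 * Qc\<^sup>2 * (2 * ?X)"
    proof (rule mult_left_mono)
      have gen: "(x + y)\<^sup>2 \<le> 2 * (x\<^sup>2 + y\<^sup>2)" for x y :: real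
        using mult_le_half_squares[of x y] by (simp add: power2_sum)
      have sq: "(sqrt (?P1 / n))\<^sup>2 = ?P1 / n" "(sqrt (?P2 / m2))\<^sup>2 = ?P2 / m2" by (rule real_sqrt_pow2, simp)+
      show "(sqrt (?P1 / n) + sqrt (?P2 / m2))\<^sup>2 \<le> 2 * ?X"
        using gen[of "sqrt (?P1 / n)" "sqrt (?P2 / m2)"] unfolding sq .
    qed simp
    also have "\<dots> = 450 * Kc\<^sup>2 * Qc\<^sup>2 * ?X"
    proof -
      have "225 * k * w * (2 * x) = 450 * k * w * x" for k w x :: real by simp
      then show ?thesis .
    qed
    finally show ?thesis .
  qed
  have t1: "S1\<^sup>2 * \<eta>b\<^sup>2 * (e\<^sup>2 + \<iota> / m1) \<le> (450 * c0\<^sup>2 * Kc\<^sup>2 * Qc\<^sup>2 + c0\<^sup>2) * (S1\<^sup>2 / N\<^sup>2 * ?Y)"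
  proof -
    have "e\<^sup>2 + \<iota> / m1 \<le> (450 * Kc\<^sup>2 * Qc\<^sup>2 + 1) * ?Y"
    proof -
      have "450 * Kc\<^sup>2 * Qc\<^sup>2 * ?X \<le> 450 * Kc\<^sup>2 * Qc\<^sup>2 * ?Y" using XY m1_0 by (intro mult_left_mono) auto
      moreover have "\<iota> / m1 \<le> ?Y" using XY X0 by linarith
      ultimately show ?thesis using e2 by (simp only: distrib_right mult_1)
    qed
    then have "S1\<^sup>2 * \<eta>b\<^sup>2 * (e\<^sup>2 + \<iota> / m1) \<le> S1\<^sup>2 * (c0\<^sup>2 / N\<^sup>2) * ((450 * Kc\<^sup>2 * Qc\<^sup>2 + 1) * ?Y)"
      using eta_bounds(3) m1_0 by (intro mult_mono mult_nonneg_nonneg add_nonneg_nonneg) auto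
    also have "\<dots> = (450 * c0\<^sup>2 * Kc\<^sup>2 * Qc\<^sup>2 + c0\<^sup>2) * (S1\<^sup>2 / N\<^sup>2 * ?Y)"
    proof -
      have "s * (c / N') * ((450 * k * w + 1) * y) = (450 * c * k * w + c) * (s / N' * y)" for s c N' k w y :: real
        by (simp add: field_simps)
      then show ?thesis .
    qed
    finally show ?thesis .
  qed
  have H1: "S2\<^sup>2 * ?s \<le> ?H"
  proof -
    have "S2\<^sup>2 * ?s = sqrt (S2^4 * \<iota> / n)" using real_sqrt_abs[of "S2\<^sup>2"] by (simp add: real_sqrt_mult real_sqrt_divide)
    also have "\<dots> \<le> ?H" by (intro real_sqrt_le_mono divide_right_mono) auto
    finally show ?thesis .
  qed
  have H2: "Fb\<^sup>2 * ?s \<le> Fc\<^sup>2 * ?H"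
  proof -
    have "\<iota> powr (2 * ell) = sqrt (\<iota> powr (4 * ell))"
      using i0 by (simp add: powr_half_sqrt[symmetric] powr_powr)
    then have "\<iota> powr (2 * ell) * ?s = sqrt (\<iota> powr (4 * ell + 1) / n)" using i0 by (simp add: real_sqrt_mult real_sqrt_divide powr_add)
    also have "\<dots> \<le> ?H" using i0 by (intro real_sqrt_le_mono divide_right_mono) auto
    finally show ?thesis unfolding F_square mult.assoc by (intro mult_left_mono) auto
  qed
  have H0: "0 \<le> ?H" using i0 by simp
  define a1 a2 a3 where "a1 = S1\<^sup>2 / N\<^sup>2 * ?Y" and "a2 = S2\<^sup>2 * \<iota> / real m1" and "a3 = ?H"
  have nn: "0 \<le> a1" "0 \<le> a2" "0 \<le> a3"
    unfolding a1_def a2_def a3_def using Y0 i0 H0 by (auto simp del: times_divide_eq_left intro!: mult_nonneg_nonneg)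
  have fin: "x1 + x2 + x3 \<le> (p + r + 1 + f + 1) * (y1 + y2 + y3)"
    if "x1 \<le> (p + r) * y1" "x2 \<le> y2" "x3 \<le> y3 + f * y3" "0 \<le> y1" "0 \<le> y2" "0 \<le> y3" "0 \<le> p" "0 \<le> r" "0 \<le> f" for x1 x2 x3 y1 y2 y3 p r f :: real
  proof -
    have "0 \<le> (p + r) * y2" "0 \<le> (p + r) * y3" "0 \<le> f * y1" "0 \<le> f * y2" "0 \<le> f * y3" using that by (auto intro!: mult_nonneg_nonneg)
    moreover have "(p + r + 1 + f + 1) * (y1 + y2 + y3)
      = ((p + r) * y1 + f * y1 + 2 * y1) + ((p + r) * y2 + f * y2 + 2 * y2) + ((p + r) * y3 + f * y3 + 2 * y3)"
      by (simp add: algebra_simps)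
    ultimately show ?thesis using that by linarith
  qed
  show ?thesis
    unfolding a1_def[symmetric] a2_def[symmetric] a3_def[symmetric]
    by (rule fin) (use t1 H1 H2 nn in \<open>auto simp: a1_def a2_def a3_def distrib_right\<close>)
qed

lemma learning_guarantee:
  assumes q: "C2_interval q"
  shows "\<exists>T lam \<eta>2. T \<ge> 1 \<and> real T \<le> Ctc * (real (d * n * m1 * m2) * max 1 (sob_norm q 2)) ^ 3 \<and>
    (\<exists>E\<in>sets (init_data_measure d n m1 m2 \<nu>).
      E \<subseteq> {\<omega> \<in> space (init_data_measure d n m1 m2 \<nu>). (case \<omega> of (a0, b0, V0, X1, X2) \<Rightarrow>
        (\<integral>\<^sup>+x. ennreal ((net d m1 m2 \<sigma>2 (layerwise_train d n m1 m2 \<sigma>2 fs (real m1 / real m2 * \<eta>b) \<eta>2 lam T a0 b0 V0 X1 X2) x - fs x)^2) \<partial>\<nu>)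
        \<le> ennreal C3c * (ennreal ((sob_norm q 1)^2 / (Lnorm \<nu> 2 Kf)^2 *
             (\<iota> powr (2 * ell + 2 * \<alpha> + 2 * chi + 1) / real n + \<iota> powr (2 * \<alpha> + 2 * chi + 1) / real m2 + \<iota> / real m1)
             + (sob_norm q 2)^2 * \<iota> / real m1
             + sqrt (((sob_norm q 2)^4 * \<iota> + \<iota> powr (4 * ell + 1)) / real n))
           + (\<integral>\<^sup>+x. ennreal ((q (\<eta>b * Kf x) - fs x)^2) \<partial>\<nu>)))} \<and>
      measure (init_data_measure d n m1 m2 \<nu>) E \<ge> 1 - 29 * exp (- \<iota>))"
proof -
  define S1 S2 where "S1 = sob_norm q 1" and "S2 = sob_norm q 2"
  have S: "0 \<le> S1" "0 \<le> S2"
    using sob_norm_bounds(1,4)[OF q, of 0] unfolding S1_def S2_def by auto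
  from representation[OF q] obtain u v where uv: "u \<in> borel_measurable borel" "v \<in> borel_measurable borel"
    "\<And>b. \<bar>u b\<bar> \<le> Wb" "\<And>b. \<bar>v b\<bar> \<le> Wb" "\<And>b. u b \<noteq> 0 \<Longrightarrow> 0 < b \<and> b \<le> 3" "\<And>b. v b \<noteq> 0 \<Longrightarrow> 0 < b \<and> b \<le> 3"
    and rep: "\<And>y. y \<in> {-1..1} \<Longrightarrow> S2 * (((\<integral>b. u b * relu (2 * y + b) \<partial>std_normal) + (\<integral>b. v b * relu (- 2 * y + b) \<partial>std_normal)) / 2) = q y"
    "\<And>y z. y \<in> {-1..1} \<Longrightarrow>
      \<bar>S2 * (((\<integral>b. u b * relu (2 * z + b) \<partial>std_normal) + (\<integral>b. v b * relu (- 2 * z + b) \<partial>std_normal)) / 2) - q y\<bar> \<le> 11 * S1 * \<bar>z - y\<bar>"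
    unfolding S1_def S2_def by blast
  have W: "weights u v" using uv by (rule weights.intro)
  have T: "net_target d n m1 m2 \<nu> fs \<sigma>2 \<eta>b \<iota> Kc Rb Bb Fb u v q S1 S2"
    using S rep by (intro net_target.intro net_weights.intro net_setup_holds W net_target_axioms.intro)
      (simp_all only: weights.frep_expectation[OF W])
  interpret T: net_target d n m1 m2 \<nu> fs \<sigma>2 \<eta>b \<iota> Kc Rb Bb Fb u v q S1 S2 by (rule T)
  let ?M = "init_data_measure d n m1 m2 \<nu>" and ?D = "real (d * n * m1 * m2)"
  let ?RHS = "S1\<^sup>2 / N\<^sup>2 * (\<iota> powr (2 * ell + 2 * \<alpha> + 2 * chi + 1) / real n + \<iota> powr (2 * \<alpha> + 2 * chi + 1) / real m2 + \<iota> / real m1)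
             + S2\<^sup>2 * \<iota> / real m1 + sqrt ((S2^4 * \<iota> + \<iota> powr (4 * ell + 1)) / real n)"
  let ?I = "\<integral>\<^sup>+x. ennreal ((q (\<eta>b * Kf x) - fs x)\<^sup>2) \<partial>\<nu>"
  have Z: "ennreal T.Cfin * (ennreal T.Ztot + ?I) \<le> ennreal C3c * (ennreal ?RHS + ?I)"
  proof -
    define w where "w = 450 * c0\<^sup>2 * Kc\<^sup>2 * Qc\<^sup>2 + c0\<^sup>2 + 1 + Fc\<^sup>2 + 1"
    have w1: "1 \<le> w"
    proof -
      have "0 \<le> 450 * c0\<^sup>2 * Kc\<^sup>2 * Qc\<^sup>2" "0 \<le> c0\<^sup>2" "0 \<le> Fc\<^sup>2" by simp_all
      then show ?thesis unfolding w_def by linarith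
    qed
    have "T.Ztot \<le> w * ?RHS" unfolding T.Ztot_def T.eps_def T.sn_def w_def by (rule Ztot_le[OF S])
    then have "ennreal T.Ztot \<le> ennreal (w * ?RHS)" by (rule ennreal_leI)
    also have "\<dots> = ennreal w * ennreal ?RHS" using w1 by (intro ennreal_mult') simp
    finally have "ennreal T.Ztot \<le> ennreal w * ennreal ?RHS" .
    moreover have "1 \<le> ennreal w" using ennreal_leI[OF w1] by simp
    then have "1 * ?I \<le> ennreal w * ?I" by (rule mult_right_mono) simp
    ultimately have "ennreal T.Ztot + ?I \<le> ennreal w * (ennreal ?RHS + ?I)" by (simp add: distrib_left add_mono)
    then have "ennreal T.Cfin * (ennreal T.Ztot + ?I) \<le> ennreal T.Cfin * (ennreal w * (ennreal ?RHS + ?I))" by (rule mult_left_mono) simp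
    also have "\<dots> = ennreal C3c * (ennreal ?RHS + ?I)"
    proof -
      have "0 \<le> T.Cfin" using c_ge1 by (simp add: T.Cfin_def)
      moreover have "C3c = T.Cfin * w" unfolding C3c_def T.Cfin_def w_def by simp
      ultimately show ?thesis using w1 by (simp add: ennreal_mult mult.assoc)
    qed
    finally show ?thesis .
  qed
  \<comment> \<open>The number of steps is of order \<open>m1 * n^3 * max 1 (S2\<^sup>2)\<close>,
    which the cube of \<open>?D * max 1 S2\<close> covers.\<close>
  have Tb: "real (Suc T.t0) \<le> Ctc * (?D * max 1 S2) ^ 3"
  proof -
    let ?m = "max 1 S2"
    define h where "h = 1764 + 2 * T.K3"
    have K3: "0 \<le> T.K3" using c_ge1 by (simp add: T.K3_def)
    have h0: "0 \<le> h" using K3 by (simp add: h_def)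
    have n1: "1 \<le> real n" "1 \<le> real d" "1 \<le> real m1" "1 \<le> real m2" using pos d_pos by auto
    have S3: "S2\<^sup>2 \<le> ?m^3" "1 \<le> ?m^3"
    proof -
      show m3: "1 \<le> ?m^3" by (intro one_le_power) simp
      have "S2\<^sup>2 \<le> ?m\<^sup>2" using S by (intro power_mono) auto
      also have "\<dots> \<le> ?m^3" by (intro power_increasing) auto
      finally show "S2\<^sup>2 \<le> ?m^3" .
    qed
    have D: "real m1 * real n ^ 3 \<le> ?D^3" "1 \<le> ?D^3"
    proof -
      have "real m1 * real n ^ 3 \<le> real m1 ^ 3 * real n ^ 3" using n1 self_le_power[of "real m1" 3] by (intro mult_right_mono) auto
      also have "\<dots> = (1 * real n * real m1 * 1) ^ 3" by (simp add: power_mult_distrib)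
      also have "\<dots> \<le> (real d * real n * real m1 * real m2) ^ 3" using n1 by (intro power_mono mult_mono mult_nonneg_nonneg) auto
      finally show "real m1 * real n ^ 3 \<le> ?D^3" by simp
      have "1 \<le> d * n * m1 * m2" using d_pos pos by (simp add: Suc_leI)
      from of_nat_mono[OF this, where 'a = real] have "1 \<le> ?D" by (simp only: of_nat_1)
      then show "1 \<le> ?D^3" by (rule one_le_power)
    qed
    have "real m1 * (1 + Wb\<^sup>2 * S2\<^sup>2) * n * (1764 * (real n)\<^sup>2 + 2 * T.K3)
      \<le> real m1 * ((1 + Wb\<^sup>2) * ?m^3) * n * (h * (real n)\<^sup>2)"
    proof (intro mult_mono mult_nonneg_nonneg)
      have "Wb\<^sup>2 * S2\<^sup>2 \<le> Wb\<^sup>2 * ?m^3" using S3 by (intro mult_left_mono) auto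
      then show "1 + Wb\<^sup>2 * S2\<^sup>2 \<le> (1 + Wb\<^sup>2) * ?m^3"
        unfolding distrib_right mult_1 by (rule add_mono[OF S3(2)])
      have "2 * T.K3 * 1 \<le> 2 * T.K3 * (real n)\<^sup>2" using K3 n1 by (intro mult_left_mono one_le_power) auto
      then show "1764 * (real n)\<^sup>2 + 2 * T.K3 \<le> h * (real n)\<^sup>2" by (simp add: h_def distrib_right)
    qed (use K3 h0 in \<open>auto intro!: add_nonneg_nonneg\<close>)
    also have "\<dots> = ((1 + Wb\<^sup>2) * h) * ((real m1 * real n ^ 3) * ?m^3)"
      by (simp add: power2_eq_square power3_eq_cube)
    also have "\<dots> \<le> ((1 + Wb\<^sup>2) * h) * (?D^3 * ?m^3)"
      using D h0 S3 by (intro mult_left_mono mult_right_mono mult_nonneg_nonneg) auto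
    finally have "real (Suc T.t0) \<le> ((1 + Wb\<^sup>2) * h) * (?D^3 * ?m^3) + 2" using T.T_bound by linarith
    also have "2 \<le> 2 * (?D^3 * ?m^3)" using mult_mono[OF D(2) S3(2)] by simp
    also have "((1 + Wb\<^sup>2) * h) * (?D^3 * ?m^3) + 2 * (?D^3 * ?m^3) = Ctc * (?D * ?m) ^ 3"
      unfolding Ctc_def h_def T.K3_def power_mult_distrib[of ?D ?m] by (rule distrib_right[symmetric])
    finally show ?thesis by simp
  qed
  have E: "T.Egood \<subseteq> {\<omega> \<in> space ?M. (case \<omega> of (a0, b0, V0, X1, X2) \<Rightarrow>
        (\<integral>\<^sup>+x. ennreal ((net d m1 m2 \<sigma>2 (layerwise_train d n m1 m2 \<sigma>2 fs (real m1 / real m2 * \<eta>b) T.eta2 T.lam0 (Suc T.t0) a0 b0 V0 X1 X2) x - fs x)^2) \<partial>\<nu>)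
        \<le> ennreal C3c * (ennreal ?RHS + ?I))}"
  proof
    fix \<omega> assume w: "\<omega> \<in> T.Egood"
    obtain a b V X Y where \<omega>: "\<omega> = (a, b, V, X, Y)" by (cases \<omega>) auto
    have sp: "(a, b, V, X, Y) \<in> space ?M" and g: "T.good_ab a b" "T.good V X" "T.good2 a b V X Y"
      using w by (auto simp: T.Egood_def \<omega>)
    then have "a \<in> space (Pi\<^sub>M {..<m1} (\<lambda>_. rademacher))" "b \<in> space (Pi\<^sub>M {..<m1} (\<lambda>_. std_normal))"
      "V \<in> space (Pi\<^sub>M {..<m2} (\<lambda>_. sphere_unif d))" "X \<in> space (Pi\<^sub>M {..<n} (\<lambda>_. \<nu>))"
      by (auto simp: init_data_measure_def space_pair_measure)
    from order_trans[OF T.main_bound[OF this g] Z] sp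
    show "\<omega> \<in> {\<omega> \<in> space ?M. (case \<omega> of (a0, b0, V0, X1, X2) \<Rightarrow>
        (\<integral>\<^sup>+x. ennreal ((net d m1 m2 \<sigma>2 (layerwise_train d n m1 m2 \<sigma>2 fs (real m1 / real m2 * \<eta>b) T.eta2 T.lam0 (Suc T.t0) a0 b0 V0 X1 X2) x - fs x)^2) \<partial>\<nu>)
        \<le> ennreal C3c * (ennreal ?RHS + ?I))}"
      unfolding \<omega> by simp
  qed
  show ?thesis
    unfolding N_def[symmetric] S1_def[symmetric] S2_def[symmetric]
    by (intro exI[of _ "Suc T.t0"] exI[of _ T.lam0] exI[of _ T.eta2] conjI bexI[of _ T.Egood] Tb E T.Egood_prob) simp
qed

end

theorem theorem5:
  fixes C\<gamma> Cf ell C\<sigma> \<alpha>\<sigma> CK chi :: real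
  assumes "C\<gamma> > 0" "Cf > 0" "ell \<ge> 0" "C\<sigma> > 0" "\<alpha>\<sigma> \<ge> 0" "CK > 0" "chi \<ge> 0"
  shows "\<exists>Cp::real. \<exists>p::nat. \<exists>C\<iota>0>0. \<forall>C\<iota>\<ge>C\<iota>0.
    \<exists>A>0. \<exists>c1>0. \<exists>c2>0. \<exists>C3>0. \<exists>Ct>0. \<exists>pt::nat.
    \<forall>(d::nat) (n::nat) (m1::nat) (m2::nat) (\<nu>::vec measure) (fs::vec \<Rightarrow> real)
      (\<sigma>2::real \<Rightarrow> real) (q::real \<Rightarrow> real).
     (let \<iota> = iota C\<iota> d n m1 m2;
          Kf = Kop d \<sigma>2 \<nu> fs;
          N = Lnorm \<nu> 2 Kf;
          M = init_data_measure d n m1 m2 \<nu>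
      in
      (d \<ge> 1 \<and> n \<ge> 1 \<and> m1 \<ge> 1 \<and> m2 \<ge> 1 \<and> \<iota> \<le> real d / C\<iota> \<and>
       prob_space \<nu> \<and> sets \<nu> = sets (Rd d) \<and> centered_subgaussian d \<nu> C\<gamma> \<and>
       fs \<in> borel_measurable \<nu> \<and> (\<integral>\<^sup>+x. ennreal ((fs x)^2) \<partial>\<nu>) \<le> 1 \<and>
       moment_bound \<nu> fs Cf ell \<and>
       \<sigma>2 \<in> borel_measurable borel \<and> (\<forall>z. \<bar>\<sigma>2 z\<bar> \<le> C\<sigma> * (1 + \<bar>z\<bar>) powr \<alpha>\<sigma>) \<and>
       (\<forall>r. 1 \<le> r \<and> r \<le> real d \<longrightarrow> Lnorm \<nu> r Kf \<le> CK * r powr chi * N) \<and>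
       N > 0 \<and> C2_interval q \<and>
       real n \<ge> A * \<iota> powr (2*ell + 2*\<alpha>\<sigma> + 1) / N^2 \<and>
       real m1 \<ge> A * \<iota> / N^2 \<and>
       real m2 \<ge> A * \<iota> powr (2*\<alpha>\<sigma> + 1) / N^2)
      \<longrightarrow>
      (\<exists>\<eta>bar T lam \<eta>2.
         c1 * \<iota> powr (-chi) / N \<le> \<eta>bar \<and> \<eta>bar \<le> c2 * \<iota> powr (-chi) / N \<and>
         T \<ge> 1 \<and> real T \<le> Ct * (real (d * n * m1 * m2) * max 1 (sob_norm q 2)) ^ pt \<and>
         (\<exists>E\<in>sets M.
            E \<subseteq> {\<omega> \<in> space M. (case \<omega> of (a0, b0, V0, X1, X2) \<Rightarrow>
                (\<integral>\<^sup>+x. ennreal ((net d m1 m2 \<sigma>2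
                    (layerwise_train d n m1 m2 \<sigma>2 fs (real m1 / real m2 * \<eta>bar) \<eta>2 lam T
                        a0 b0 V0 X1 X2) x - fs x)^2) \<partial>\<nu>)
                \<le> ennreal C3 *
                   (ennreal ((sob_norm q 1)^2 / N^2 *
                        (\<iota> powr (2*ell + 2*\<alpha>\<sigma> + 2*chi + 1) / real n
                         + \<iota> powr (2*\<alpha>\<sigma> + 2*chi + 1) / real m2 + \<iota> / real m1)
                      + (sob_norm q 2)^2 * \<iota> / real m1
                      + sqrt (((sob_norm q 2)^4 * \<iota> + \<iota> powr (4*ell + 1)) / real n))
                    + (\<integral>\<^sup>+x. ennreal ((q (\<eta>bar * Kf x) - fs x)^2) \<partial>\<nu>)))} \<and>
            measure M E \<ge> 1 - Cp * real (d * n * m1 * m2) ^ p * exp (- \<iota>))))"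
proof -
  interpret problem_constants C\<gamma> Cf ell C\<sigma> \<alpha>\<sigma> CK chi .
  have c0: "0 < c0" using assms by (simp add: c0_def)
  have Ct: "0 < Ctc" using Ctc_ge1 by simp
  show ?thesis
  \<comment> \<open>All witnesses depend on the constants of the hypotheses only, not on
    \<open>C\<iota>\<close>. The failure probability is \<open>29 * exp (- \<iota>)\<close>, so the
    polynomial factor has exponent 0. The threshold 32 serves both
    \<open>32 * \<iota> \<le> d\<close> and \<open>1 \<le> \<iota>\<close>, the latter because
    \<open>ln 2 \<ge> 1 / 2\<close>.\<close>
  proof (rule exI[of _ 29], rule exI[of _ 0], rule exI[of _ 32], rule conjI, simp, rule allI, rule impI,
      rule exI[of _ Ac], rule conjI[OF Ac_pos], rule exI[of _ c0], rule conjI[OF c0], rule exI[of _ c0], rule conjI[OF c0],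
      rule exI[of _ C3c], rule conjI[OF C3c_pos], rule exI[of _ Ctc], rule conjI[OF Ct], rule exI[of _ 3],
      intro allI, unfold Let_def, intro impI, elim conjE)
    fix C\<iota> :: real and d n m1 m2 :: nat and \<nu> :: "vec measure" and fs :: "vec \<Rightarrow> real" and \<sigma>2 q :: "real \<Rightarrow> real"
    let ?\<iota> = "iota C\<iota> d n m1 m2" and ?D = "real (d * n * m1 * m2)"
    assume C\<iota>: "32 \<le> C\<iota>" and pos: "1 \<le> d" "1 \<le> n" "1 \<le> m1" "1 \<le> m2" and \<iota>: "?\<iota> \<le> real d / C\<iota>"
      and \<nu>: "prob_space \<nu>" "sets \<nu> = sets (Rd d)" "centered_subgaussian d \<nu> C\<gamma>"
      and fs: "fs \<in> borel_measurable \<nu>" "(\<integral>\<^sup>+x. ennreal ((fs x)\<^sup>2) \<partial>\<nu>) \<le> 1" "moment_bound \<nu> fs Cf ell"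
      and s2: "\<sigma>2 \<in> borel_measurable borel" "\<forall>z. \<bar>\<sigma>2 z\<bar> \<le> C\<sigma> * (1 + \<bar>z\<bar>) powr \<alpha>\<sigma>"
      and hyper: "\<forall>r. 1 \<le> r \<and> r \<le> real d \<longrightarrow> Lnorm \<nu> r (Kop d \<sigma>2 \<nu> fs) \<le> CK * r powr chi * Lnorm \<nu> 2 (Kop d \<sigma>2 \<nu> fs)"
      and N: "0 < Lnorm \<nu> 2 (Kop d \<sigma>2 \<nu> fs)" and q: "C2_interval q"
      and large: "Ac * ?\<iota> powr (2 * ell + 2 * \<alpha>\<sigma> + 1) / (Lnorm \<nu> 2 (Kop d \<sigma>2 \<nu> fs))\<^sup>2 \<le> real n"
        "Ac * ?\<iota> / (Lnorm \<nu> 2 (Kop d \<sigma>2 \<nu> fs))\<^sup>2 \<le> real m1"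
        "Ac * ?\<iota> powr (2 * \<alpha>\<sigma> + 1) / (Lnorm \<nu> 2 (Kop d \<sigma>2 \<nu> fs))\<^sup>2 \<le> real m2"
    have D1: "1 \<le> d * n * m1 * m2" using pos by (simp add: Suc_leI)
    show "\<exists>\<eta>bar T lam \<eta>2.
         c0 * ?\<iota> powr (-chi) / Lnorm \<nu> 2 (Kop d \<sigma>2 \<nu> fs) \<le> \<eta>bar \<and> \<eta>bar \<le> c0 * ?\<iota> powr (-chi) / Lnorm \<nu> 2 (Kop d \<sigma>2 \<nu> fs) \<and>
         T \<ge> 1 \<and> real T \<le> Ctc * (?D * max 1 (sob_norm q 2)) ^ 3 \<and>
         (\<exists>E\<in>sets (init_data_measure d n m1 m2 \<nu>).
            E \<subseteq> {\<omega> \<in> space (init_data_measure d n m1 m2 \<nu>). (case \<omega> of (a0, b0, V0, X1, X2) \<Rightarrow>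
                (\<integral>\<^sup>+x. ennreal ((net d m1 m2 \<sigma>2
                    (layerwise_train d n m1 m2 \<sigma>2 fs (real m1 / real m2 * \<eta>bar) \<eta>2 lam T
                        a0 b0 V0 X1 X2) x - fs x)^2) \<partial>\<nu>)
                \<le> ennreal C3c *
                   (ennreal ((sob_norm q 1)^2 / (Lnorm \<nu> 2 (Kop d \<sigma>2 \<nu> fs))^2 *
                        (?\<iota> powr (2*ell + 2*\<alpha>\<sigma> + 2*chi + 1) / real n
                         + ?\<iota> powr (2*\<alpha>\<sigma> + 2*chi + 1) / real m2 + ?\<iota> / real m1)
                      + (sob_norm q 2)^2 * ?\<iota> / real m1
                      + sqrt (((sob_norm q 2)^4 * ?\<iota> + ?\<iota> powr (4*ell + 1)) / real n))
                    + (\<integral>\<^sup>+x. ennreal ((q (\<eta>bar * Kop d \<sigma>2 \<nu> fs x) - fs x)^2) \<partial>\<nu>)))} \<and>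
            measure (init_data_measure d n m1 m2 \<nu>) E \<ge> 1 - 29 * ?D ^ 0 * exp (- ?\<iota>))"
    proof (cases "d * n * m1 * m2 = 1")
      case True
      \<comment> \<open>If all sizes are 1, then \<open>\<iota> = 0\<close> and the required
        probability is negative, so the empty event suffices.\<close>
      then have i0: "?\<iota> = 0" and D: "?D = 1" by (simp_all only: iota_def of_nat_1 ln_one mult_zero_right)
      have "1 * 1 \<le> Ctc * (?D * max 1 (sob_norm q 2)) ^ 3" unfolding D by (intro mult_mono one_le_power) (use Ctc_ge1 in auto)
      then show ?thesis
        by (intro exI[of _ "c0 * ?\<iota> powr (-chi) / Lnorm \<nu> 2 (Kop d \<sigma>2 \<nu> fs)"] exI[of _ 1] exI[of _ 0] conjI bexI[of _ "{}"])
          (simp_all add: i0)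
    next
      case False
      with D1 have D2: "2 \<le> d * n * m1 * m2" by linarith
      from of_nat_mono[OF this, where 'a = real] have D2': "2 \<le> ?D" by (simp only: of_nat_numeral)
      have l0: "1/2 \<le> ln ?D"
      proof -
        have "1 / 2 \<le> ln (2::real)" using ln_le_minus_one[of "1 / 2 :: real"] by (simp add: ln_div)
        also have "\<dots> \<le> ln ?D" using D2' by (intro ln_mono) auto
        finally show ?thesis .
      qed
      have li: "ln ?D \<le> ?\<iota>" unfolding iota_def using mult_right_mono[of 1 C\<iota> "ln ?D"] C\<iota> l0 by simp
      have "exp (ln ?D) \<le> exp ?\<iota>" using li by (simp only: exp_le_cancel_iff)
      then have De: "?D \<le> exp ?\<iota>" using D2' by (simp only: exp_ln)
      have i1: "1 \<le> ?\<iota>" unfolding iota_def using mult_mono[of 32 C\<iota> "1/2" "ln ?D"] C\<iota> l0 by simp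
      have "?\<iota> * C\<iota> \<le> real d" using \<iota> C\<iota> by (simp add: pos_le_divide_eq)
      moreover have "?\<iota> * 32 \<le> ?\<iota> * C\<iota>" using C\<iota> i1 by (intro mult_left_mono) auto
      ultimately have id: "32 * ?\<iota> \<le> real d" by linarith
      have fs': "fs \<in> borel_measurable (Rd d)" using fs(1) \<nu>(2) measurable_cong_sets by blast
      have "learning_problem C\<gamma> Cf ell C\<sigma> \<alpha>\<sigma> CK chi d \<nu> fs \<sigma>2 n m1 m2 ?\<iota>"
      proof (intro learning_problem.intro subgaussian_data.intro learning_problem_axioms.intro)
        show "Lnorm \<nu> r (Kop d \<sigma>2 \<nu> fs) \<le> CK * r powr chi * Lnorm \<nu> 2 (Kop d \<sigma>2 \<nu> fs)" if "1 \<le> r" "r \<le> real d" for r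
          using hyper that by blast
      qed (use assms pos \<nu> fs fs' s2 N large i1 id De in auto)
      then interpret P: learning_problem C\<gamma> Cf ell C\<sigma> \<alpha>\<sigma> CK chi d \<nu> fs \<sigma>2 n m1 m2 ?\<iota> .
      have e: "P.\<eta>b = c0 * ?\<iota> powr (-chi) / Lnorm \<nu> 2 (Kop d \<sigma>2 \<nu> fs)" unfolding P.\<eta>b_def P.N_def ..
      show ?thesis
        using P.learning_guarantee[OF q] e unfolding power_0 mult_1_right by (intro exI[of _ P.\<eta>b]) simp
    qed
  qed
qed

end
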